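(* (Stroock's formula) Every random variable $F\in L^2(\Omega,\sigma(Z),P)$ can be expressed as $$F=\sum_{p=0}^\infty\sum_{q=0}^\infty I_{p,q}(f_{p,q})\qquad(\text{convergence in }L^2(\Omega)),$$ where $f_{p,q}\in \mathfrak{H}^{\odot p}\otimes \mathfrak{H}^{\odot q}$. If moreover $F\in \mathbb{D}^{m,2}\cap \bar{\mathbb{D}}^{n,2}$ for some integers $m,n\ge 0$, then $$f_{p,q}=\frac{1}{p!\,q!}\,E[D^p\bar{D}^q F],\qquad \forall\, p\le m,\ q\le n.$$
   Context: Hilbert space and Gaussian process. $\mathfrak{H}=\mathfrak{H}_{\mathbb{R}}+\mathrm{i}\,\mathfrak{H}_{\mathbb{R}}$ is a complex separable Hilbert space (complexification of a real Hilbert space, so that conjugation $h\mapsto\bar h$ is defined), with inner product linear in the first argument. $Z=\{Z(h):h\in\mathfrak{H}\}$ is a complex Gaussian isonormal process on $(\Omega,\mathcal{F},P)$: a centered symmetric complex Gaussian family, linear in $h$, with $E[Z(h)^2]=0$ and $E[Z(g)\overline{Z(h)}]=\langle g,h\rangle_{\mathfrak{H}}$ for all $g,h\in\mathfrak{H}$. Complex Hermite polynomials: $J_{m,n}(z,\rho)=\sum_{r=0}^{m\wedge n}(-1)^r r!\binom{m}{r}\binom{n}{r}z^{m-r}\bar z^{\,n-r}\rho^r$. Complex multiple Wiener-Itô integral. $\mathfrak{H}^{\odot m}$ is the $m$-fold symmetric tensor product of $\mathfrak H$, and $\hat\otimes$ is the symmetrized tensor product. For an orthonormal basis $\{e_k\}$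 of $\mathfrak{H}$ and sequences $(m_k),(n_k)$ of nonnegative integers with $\sum m_k=m$, $\sum n_k=n$, put $$I_{m,n}\big((\hat\otimes_k e_k^{\otimes m_k})\otimes(\hat\otimes_k \bar e_k^{\otimes n_k})\big)=\prod_k 2^{-(m_k+n_k)/2}J_{m_k,n_k}(\sqrt2 Z(e_k),2).$$ This extends linearly to an isometry $I_{m,n}$ from $\mathfrak{H}^{\odot m}\otimes\mathfrak{H}^{\odot n}$ with norm $\sqrt{m!n!}\,\|\cdot\|_{\mathfrak{H}^{\otimes(m+n)}}$ into $L^2(\Omega)$; $I_{0,0}$ is the identity on constants. Complex Malliavin derivatives. $\mathcal{S}$ is the set of random variables $F=f(Z(\varphi_1),\dots,Z(\varphi_k))$ with $k\ge1$, $\varphi_i\in\mathfrak{H}$, and $f\in C^\infty(\mathbb{C}^k)$ such that $f$ and all its partial derivatives have polynomial growth. For such $F$, $$DF=\sum_i \partial_i f(Z(\varphi_1),\dots,Z(\varphi_k))\,\varphi_i,\qquad \bar DF=\sum_i\bar\partial_i f(Z(\varphi_1),\dots,Z(\varphi_k))\,\bar\varphi_i,$$ where $\partial_i=\partial/\partial z_i$ and $\bar\partial_i=\partial/\partial\bar z_i$ are Wirtinger derivatives. Iterating gives $D^p\bar D^qF$ with values in $\mathfrak{H}^{\odot p}\otimes\mathfrak{H}^{\odot q}$. These operators are closable, and their closures are denoted by the same symbols. $\mathbb{D}^{m,2}\cap\bar{\mathbb{D}}^{n,2}$ denotes the closure of $\mathcal{S}$ with respect to the Sobolev seminorm $\|F\|_{m,n,2}=\big(\sum_{i=0}^{m}\sum_{j=0}^{n}E\|D^i\bar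 D^jF\|^2_{\mathfrak{H}^{\otimes(i+j)}}\big)^{1/2}$. *)

theory Defs
  imports "HOL-Probability.Probability" "HOL-Combinatorics.Combinatorics"
begin

section \<open>Complexification of a real Hilbert space\<close>

text \<open>A pair (x, y) stands for x + i y. The product norm of the library is the norm of the
  complexified inner product, see \<open>cinner_self\<close> below.\<close>

type_synonym 'h cplx = "'h \<times> 'h"

definition cscale :: "complex \<Rightarrow> 'h::real_vector cplx \<Rightarrow> 'h cplx" (infixr "*\<^sub>C" 75)
  where "c *\<^sub>C h = (Re c *\<^sub>R fst h - Im c *\<^sub>R snd h, Re c *\<^sub>R snd h + Im c *\<^sub>R fst h)"

definition cconj :: "'h::real_vector cplx \<Rightarrow> 'h cplx"
  where "cconj h = (fst h, - snd h)"

definition cinner :: "'h::real_inner cplx \<Rightarrow> 'h cplx \<Rightarrow> complex"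
  where "cinner g h =
    Complex (fst g \<bullet> fst h + snd g \<bullet> snd h) (snd g \<bullet> fst h - fst g \<bullet> snd h)"

lemma cinner_add_left: "cinner (x + y) z = cinner x z + cinner y z"
  and cinner_add_right: "cinner x (y + z) = cinner x y + cinner x z"
  and cinner_diff_left: "cinner (x - y) z = cinner x z - cinner y z"
  and cinner_diff_right: "cinner x (y - z) = cinner x y - cinner x z"
  and cinner_scale_left: "cinner (c *\<^sub>C x) z = c * cinner x z"
  and cinner_scale_right: "cinner x (c *\<^sub>C z) = cnj c * cinner x z"
  and cinner_commute: "cinner x y = cnj (cinner y x)"
  and cinner_zero_left [simp]: "cinner 0 x = 0"
  by (simp_all add: cinner_def cscale_def complex_eq_iff inner_add_left inner_add_right
      inner_diff_left inner_diff_right inner_commute algebra_simps)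

lemma cinner_self: "cinner x x = of_real ((norm x)\<^sup>2)"
  by (simp add: cinner_def complex_eq_iff inner_commute norm_prod_def power2_norm_eq_inner[symmetric])

lemma cinner_sum_left: "cinner (sum f A) z = (\<Sum>a\<in>A. cinner (f a) z)"
  by (induction A rule: infinite_finite_induct) (auto simp: cinner_add_left)

lemma cscale_simps:
  "1 *\<^sub>C x = x" "0 *\<^sub>C x = 0" "c *\<^sub>C 0 = 0" "c *\<^sub>C d *\<^sub>C x = (c * d) *\<^sub>C x"
  by (simp_all add: cscale_def zero_prod_def algebra_simps prod_eq_iff)

definition corthonormal :: "'h::real_inner cplx set \<Rightarrow> bool"
  where "corthonormal B \<longleftrightarrow> (\<forall>x\<in>B. \<forall>y\<in>B. cinner x y = (if x = y then 1 else 0))"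

definition reproduced :: "'h::real_inner cplx set \<Rightarrow> 'h cplx \<Rightarrow> bool"
  where "reproduced B x \<longleftrightarrow> x = (\<Sum>b\<in>B. cinner x b *\<^sub>C b)"

lemma corthonormal_subset: "corthonormal B \<Longrightarrow> A \<subseteq> B \<Longrightarrow> corthonormal A"
  unfolding corthonormal_def by blast

lemma corthonormalD:
  assumes "corthonormal B" "x \<in> B"
  shows "cinner x x = 1" and "y \<in> B \<Longrightarrow> x \<noteq> y \<Longrightarrow> cinner x y = 0"
  using assms unfolding corthonormal_def by simp_all

lemma cinner_expansion:
  assumes "finite B" "corthonormal B" "b \<in> B"
  shows "cinner (\<Sum>a\<in>B. u a *\<^sub>C a) b = u b"
proof -
  have "cinner (\<Sum>a\<in>B. u a *\<^sub>C a) b = (\<Sum>a\<in>B. if a = b then u a else 0)"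
    unfolding cinner_sum_left using assms
    by (intro sum.cong) (auto simp: cinner_scale_left corthonormal_def)
  then show ?thesis using assms by simp
qed

lemma reproduced_mono:
  assumes "finite B'" "corthonormal B'" "B \<subseteq> B'" "reproduced B x"
  shows "reproduced B' x"
proof -
  have fB: "finite B" using assms finite_subset by blast
  have x: "x = (\<Sum>b\<in>B. cinner x b *\<^sub>C b)" using assms(4) by (simp add: reproduced_def)
  have "cinner x b = 0" if "b \<in> B' - B" for b
  proof -
    have "cinner x b = (\<Sum>a\<in>B. cinner x a * cinner a b)"
      by (subst x) (simp add: cinner_sum_left cinner_scale_left)
    also have "\<dots> = 0" proof (intro sum.neutral ballI)
      fix a assume "a \<in> B"
      then have "cinner a b = 0" using that assms(2,3) corthonormalD(2)[of B' a b] by blast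
      then show "cinner x a * cinner a b = 0" by simp
    qed
    finally show ?thesis .
  qed
  then have "(\<Sum>b\<in>B'. cinner x b *\<^sub>C b) = (\<Sum>b\<in>B. cinner x b *\<^sub>C b)"
    using assms by (intro sum.mono_neutral_right) (auto simp: cscale_simps)
  then show ?thesis using x by (simp add: reproduced_def)
qed

lemma reproduced_member:
  assumes "finite B" "corthonormal B" "x \<in> B"
  shows "reproduced B x"
proof -
  have "(\<Sum>b\<in>B. cinner x b *\<^sub>C b) = (\<Sum>b\<in>B. if b = x then x else 0)"
    using assms by (intro sum.cong) (auto simp: corthonormal_def cscale_simps)
  then show ?thesis using assms by (simp add: reproduced_def)
qed

lemma gram_schmidt_step:
  assumes "finite B" "corthonormal (B :: 'h::real_inner cplx set)"
  shows "\<exists>B'. finite B' \<and> corthonormal B' \<and> B \<subseteq> B' \<and> reproduced B' x"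
proof (cases "reproduced B x")
  case True
  then show ?thesis using assms by blast
next
  case False
  define y where "y = x - (\<Sum>b\<in>B. cinner x b *\<^sub>C b)"
  have y0: "y \<noteq> 0" using False by (simp add: y_def reproduced_def)
  have yb: "cinner y b = 0" if "b \<in> B" for b
    using cinner_expansion[OF assms that] by (simp add: y_def cinner_diff_left)
  define e where "e = of_real (1 / norm y) *\<^sub>C y"
  have eb: "cinner e b = 0" "cinner b e = 0" if "b \<in> B" for b
    using yb[OF that] cinner_commute[of b y]
    by (auto simp: e_def cinner_scale_left cinner_scale_right)
  have ee: "cinner e e = 1"
  proof -
    have "cinner e e = of_real (1 / norm y) * (cnj (of_real (1 / norm y)) * of_real ((norm y)\<^sup>2))"
      unfolding e_def cinner_scale_left cinner_scale_right cinner_self[of y]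
      by (simp only: mult_ac)
    then show ?thesis using y0 by (simp add: power2_eq_square)
  qed
  have enB: "e \<notin> B" using eb ee by fastforce
  have orth: "corthonormal (insert e B)"
    using assms(2) eb ee enB by (auto simp: corthonormal_def)
  have "cinner x e = cinner y e"
    using eb by (simp add: y_def cinner_diff_left cinner_sum_left cinner_scale_left)
  also have "\<dots> = of_real (norm y)"
    using y0 by (simp add: e_def cinner_scale_right cinner_self power2_eq_square)
  finally have "cinner x e *\<^sub>C e = y"
    using y0 by (simp add: e_def cscale_simps flip: of_real_mult)
  then have "reproduced (insert e B) x"
    using enB assms by (simp add: reproduced_def y_def)
  then show ?thesis using orth assms by (intro exI[of _ "insert e B"]) auto
qed

lemma gram_schmidt:
  assumes "finite X" "finite B" "corthonormal (B :: 'h::real_inner cplx set)"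
  shows "\<exists>B'. finite B' \<and> corthonormal B' \<and> B \<subseteq> B' \<and> (\<forall>x\<in>X. reproduced B' x)"
  using assms
proof (induction X)
  case (insert x X)
  then obtain B1 where 1: "finite B1" "corthonormal B1" "B \<subseteq> B1" "\<forall>x\<in>X. reproduced B1 x"
    by blast
  obtain B2 where 2: "finite B2" "corthonormal B2" "B1 \<subseteq> B2" "reproduced B2 x"
    using gram_schmidt_step[OF 1(1,2)] by blast
  then show ?case using 1 reproduced_mono[OF 2(1,2,3)] by (intro exI[of _ B2]) auto
qed auto

lemma bessel:
  assumes "finite B" "corthonormal (B :: 'h::real_inner cplx set)"
  shows "(\<Sum>b\<in>B. (cmod (cinner x b))\<^sup>2) \<le> (norm x)\<^sup>2"
    and "reproduced B x \<Longrightarrow> (norm x)\<^sup>2 = (\<Sum>b\<in>B. (cmod (cinner x b))\<^sup>2)"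
proof -
  define p where "p = (\<Sum>b\<in>B. cinner x b *\<^sub>C b)"
  define y where "y = x - p"
  have pb: "cinner p b = cinner x b" if "b \<in> B" for b
    using cinner_expansion[OF assms that] by (simp add: p_def)
  have pz: "cinner p z = (\<Sum>b\<in>B. cinner x b * cinner b z)" for z
    by (simp add: p_def cinner_sum_left cinner_scale_left)
  have bx: "cinner x b * cinner b x = of_real ((cmod (cinner x b))\<^sup>2)" for b
    using cinner_commute[of b x] complex_norm_square[of "cinner x b"] by simp
  have px: "cinner p x = of_real (\<Sum>b\<in>B. (cmod (cinner x b))\<^sup>2)"
    by (simp add: pz bx)
  have "cinner p p = (\<Sum>b\<in>B. cinner x b * cinner b x)"
    unfolding pz[of p] using pb cinner_commute[of _ p] cinner_commute[of _ x]
    by (intro sum.cong) auto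
  then have pp: "cinner p p = of_real (\<Sum>b\<in>B. (cmod (cinner x b))\<^sup>2)"
    by (simp add: bx)
  have xp: "cinner x p = of_real (\<Sum>b\<in>B. (cmod (cinner x b))\<^sup>2)"
    using px cinner_commute[of x p] by simp
  have "cinner y y = cinner x x - cinner x p - cinner p x + cinner p p"
    by (simp add: y_def cinner_diff_left cinner_diff_right)
  also have "\<dots> = of_real ((norm x)\<^sup>2 - (\<Sum>b\<in>B. (cmod (cinner x b))\<^sup>2))"
    unfolding px pp xp cinner_self[of x] by (simp del: of_real_sum)
  finally have "(norm y)\<^sup>2 = (norm x)\<^sup>2 - (\<Sum>b\<in>B. (cmod (cinner x b))\<^sup>2)"
    unfolding cinner_self of_real_eq_iff .
  then show "(\<Sum>b\<in>B. (cmod (cinner x b))\<^sup>2) \<le> (norm x)\<^sup>2"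
    using zero_le_power2[of "norm y"] by linarith
  show "reproduced B x \<Longrightarrow> (norm x)\<^sup>2 = (\<Sum>b\<in>B. (cmod (cinner x b))\<^sup>2)"
  proof -
    assume "reproduced B x"
    then have "x = p" by (simp add: reproduced_def p_def)
    moreover have "(norm p)\<^sup>2 = (\<Sum>b\<in>B. (cmod (cinner x b))\<^sup>2)"
      using pp by (simp only: cinner_self of_real_eq_iff)
    ultimately show "(norm x)\<^sup>2 = (\<Sum>b\<in>B. (cmod (cinner x b))\<^sup>2)" by metis
  qed
qed

section \<open>Hilbert space tensor powers\<close>

text \<open>
  An element T of the k-fold Hilbert space tensor power of a complex Hilbert space H is represented
  by the functional sending (h1, ..., hk) to the inner product of T with the elementary tensor of
  h1, ..., hk. These functionals are exactly the Hilbert-Schmidt ones: they are conjugate linear in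
  each argument, and the sum of the squares of their values over the tuples from an orthonormal
  basis is finite. That sum is the squared norm of T; it is written below as a supremum over finite
  orthonormal sets, which avoids the choice of a basis.

  All powers live in one type, the full Fock space (the Hilbert space direct sum of all the tensor
  powers), whose elements are functionals on lists of arbitrary length. The k-th power consists of
  the functionals that vanish on lists of length other than k.
\<close>

definition slot_antilinear :: "('h::real_inner cplx list \<Rightarrow> complex) \<Rightarrow> bool"
  where "slot_antilinear T \<longleftrightarrow> (\<forall>xs ys a b x y.
    T (xs @ (a *\<^sub>C x + b *\<^sub>C y) # ys) = cnj a * T (xs @ x # ys) + cnj b * T (xs @ y # ys))"

definition words_upto :: "'a set \<Rightarrow> nat \<Rightarrow> 'a list set"
  where "words_upto B K = {xs. set xs \<subseteq> B \<and> length xs \<le> K}"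

definition words :: "'a set \<Rightarrow> nat \<Rightarrow> 'a list set"
  where "words B k = {xs. set xs \<subseteq> B \<and> length xs = k}"

definition hs_norm :: "('h::real_inner cplx list \<Rightarrow> complex) \<Rightarrow> 'h cplx set \<Rightarrow> nat \<Rightarrow> real"
  where "hs_norm T B K = L2_set (\<lambda>xs. cmod (T xs)) (words_upto B K)"

lemma finite_words [simp]: "finite B \<Longrightarrow> finite (words B k)" "finite B \<Longrightarrow> finite (words_upto B k)"
  by (simp_all add: words_def words_upto_def finite_lists_length_eq finite_lists_length_le)

lemma words_0 [simp]: "words B 0 = {[]}"
  by (auto simp: words_def)

lemma sum_words_Suc:
  "(\<Sum>zs\<in>words B (Suc k). f zs) = (\<Sum>x\<in>B. \<Sum>xs\<in>words B k. f (x # xs))"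
proof -
  have "bij_betw (\<lambda>(x, xs). x # xs) (B \<times> words B k) (words B (Suc k))"
    unfolding bij_betw_def
    by (auto simp: inj_on_def words_def image_iff length_Suc_conv)
  then show ?thesis
    by (simp add: sum.cartesian_product flip: sum.reindex_bij_betw) (simp add: case_prod_unfold)
qed

lemma sum_words_upto:
  assumes "finite B"
  shows "(\<Sum>zs\<in>words_upto B K. f zs) = (\<Sum>k\<le>K. \<Sum>xs\<in>words B k. f xs)"
proof -
  have "words_upto B K = (\<Union>k\<in>{..K}. words B k)"
    by (auto simp: words_upto_def words_def)
  moreover have "sum f (\<Union>k\<in>{..K}. words B k) = (\<Sum>k\<le>K. sum f (words B k))"
    using assms by (intro sum.UNION_disjoint) (auto simp: words_def intro: finite_lists_length_eq)
  ultimately show ?thesis by simp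
qed

lemma hs_norm_power2:
  "finite B \<Longrightarrow> (hs_norm T B K)\<^sup>2 = (\<Sum>k\<le>K. \<Sum>xs\<in>words B k. (cmod (T xs))\<^sup>2)"
  by (simp add: hs_norm_def L2_set_def sum_words_upto sum_nonneg)

lemma hs_norm_nonneg [simp]: "0 \<le> hs_norm T B K"
  by (simp add: hs_norm_def)

lemma slot_antilinear_add:
  "slot_antilinear T \<Longrightarrow> T (xs @ (x + y) # ys) = T (xs @ x # ys) + T (xs @ y # ys)"
  unfolding slot_antilinear_def by (metis cscale_simps(1) complex_cnj_one mult_1)

lemma slot_antilinear_0:
  assumes "slot_antilinear T"
  shows "T (xs @ 0 # ys) = 0"
  using slot_antilinear_add[OF assms, of xs 0 0 ys] by simp

lemma slot_antilinear_scale: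
  "slot_antilinear T \<Longrightarrow> T (xs @ (c *\<^sub>C x) # ys) = cnj c * T (xs @ x # ys)"
  using slot_antilinear_0[of T xs ys]
  unfolding slot_antilinear_def by (metis cscale_simps(2) complex_cnj_zero mult_zero_left add.right_neutral)

lemma slot_antilinear_sum:
  assumes "slot_antilinear T"
  shows "T (xs @ (\<Sum>b\<in>B. u b *\<^sub>C b) # ys) = (\<Sum>b\<in>B. cnj (u b) * T (xs @ b # ys))"
  by (induction B rule: infinite_finite_induct)
    (simp_all add: slot_antilinear_0 slot_antilinear_add slot_antilinear_scale assms)

lemma slot_expand:
  assumes "slot_antilinear T" "reproduced B z"
  shows "T (xs @ z # ys) = (\<Sum>b\<in>B. cnj (cinner z b) * T (xs @ b # ys))"
proof -
  have "T (xs @ z # ys) = T (xs @ (\<Sum>b\<in>B. cinner z b *\<^sub>C b) # ys)"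
    using assms(2) unfolding reproduced_def by metis
  then show ?thesis using slot_antilinear_sum[OF assms(1)] by simp
qed

lemma cauchy_schwarz_sum:
  fixes f g :: "'a \<Rightarrow> complex"
  shows "(cmod (\<Sum>a\<in>A. f a * g a))\<^sup>2 \<le> (\<Sum>a\<in>A. (cmod (f a))\<^sup>2) * (\<Sum>a\<in>A. (cmod (g a))\<^sup>2)"
proof -
  have "cmod (\<Sum>a\<in>A. f a * g a) \<le> (\<Sum>a\<in>A. \<bar>cmod (f a)\<bar> * \<bar>cmod (g a)\<bar>)"
    by (rule order_trans[OF norm_sum]) (simp add: norm_mult)
  also have "\<dots> \<le> L2_set (\<lambda>a. cmod (f a)) A * L2_set (\<lambda>a. cmod (g a)) A"
    by (rule L2_set_mult_ineq)
  finally have "(cmod (\<Sum>a\<in>A. f a * g a))\<^sup>2 \<le> (L2_set (\<lambda>a. cmod (f a)) A * L2_set (\<lambda>a. cmod (g a)) A)\<^sup>2"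
    by (intro power_mono) auto
  then show ?thesis by (simp add: power_mult_distrib L2_set_def sum_nonneg)
qed

lemma slot_mono:
  assumes T: "slot_antilinear T" and B: "finite B" "corthonormal B"
    and B': "finite B'" "corthonormal B'" and r: "\<And>b. b \<in> B \<Longrightarrow> reproduced B' b"
  shows "(\<Sum>b\<in>B. (cmod (T (xs @ b # ys)))\<^sup>2) \<le> (\<Sum>b\<in>B'. (cmod (T (xs @ b # ys)))\<^sup>2)"
proof -
  define v where "v = (\<Sum>c\<in>B'. T (xs @ c # ys) *\<^sub>C c)"
  have vc: "cinner v c = T (xs @ c # ys)" if "c \<in> B'" for c
    using cinner_expansion[OF B' that] by (simp add: v_def)
  have vb: "cinner v b = T (xs @ b # ys)" if "b \<in> B" for b
  proof -
    have "T (xs @ b # ys) = (\<Sum>c\<in>B'. cnj (cinner b c) * T (xs @ c # ys))"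
      by (rule slot_expand[OF T r[OF that]])
    also have "\<dots> = (\<Sum>c\<in>B'. T (xs @ c # ys) * cinner c b)"
      by (intro sum.cong refl) (subst cinner_commute, simp add: mult.commute)
    also have "\<dots> = cinner v b"
      by (simp add: v_def cinner_sum_left cinner_scale_left)
    finally show ?thesis by simp
  qed
  have "reproduced B' v"
    unfolding reproduced_def using vc by (simp add: v_def)
  then have "(norm v)\<^sup>2 = (\<Sum>c\<in>B'. (cmod (cinner v c))\<^sup>2)"
    using bessel(2)[OF B'] by blast
  moreover have "(\<Sum>b\<in>B. (cmod (cinner v b))\<^sup>2) \<le> (norm v)\<^sup>2"
    by (rule bessel(1)[OF B])
  ultimately show ?thesis using vb vc by simp
qed

lemma words_mono:
  assumes T: "slot_antilinear T" and B: "finite B" "corthonormal B"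
    and B': "finite B'" "corthonormal B'" and r: "\<And>b. b \<in> B \<Longrightarrow> reproduced B' b"
  shows "(\<Sum>xs\<in>words B k. (cmod (T (pre @ xs)))\<^sup>2) \<le> (\<Sum>xs\<in>words B' k. (cmod (T (pre @ xs)))\<^sup>2)"
proof (induction k arbitrary: pre)
  case (Suc k)
  have "(\<Sum>xs\<in>words B (Suc k). (cmod (T (pre @ xs)))\<^sup>2)
      = (\<Sum>x\<in>B. \<Sum>xs\<in>words B k. (cmod (T ((pre @ [x]) @ xs)))\<^sup>2)"
    by (simp add: sum_words_Suc)
  also have "\<dots> \<le> (\<Sum>x\<in>B. \<Sum>xs\<in>words B' k. (cmod (T ((pre @ [x]) @ xs)))\<^sup>2)"
    by (intro sum_mono Suc.IH)
  also have "\<dots> = (\<Sum>xs\<in>words B' k. \<Sum>x\<in>B. (cmod (T (pre @ x # xs)))\<^sup>2)"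
    by (subst sum.swap) simp
  also have "\<dots> \<le> (\<Sum>xs\<in>words B' k. \<Sum>x\<in>B'. (cmod (T (pre @ x # xs)))\<^sup>2)"
    by (intro sum_mono slot_mono assms)
  also have "\<dots> = (\<Sum>xs\<in>words B' (Suc k). (cmod (T (pre @ xs)))\<^sup>2)"
    by (subst sum.swap) (simp add: sum_words_Suc)
  finally show ?case .
qed simp

lemma words_eval_bound:
  assumes T: "slot_antilinear T" and B: "finite B" "corthonormal B"
    and r: "\<And>z. z \<in> set zs \<Longrightarrow> reproduced B z"
  shows "(cmod (T (pre @ zs)))\<^sup>2 \<le>
    (\<Prod>z\<leftarrow>zs. (norm z)\<^sup>2) * (\<Sum>xs\<in>words B (length zs). (cmod (T (pre @ xs)))\<^sup>2)"
  using r
proof (induction zs arbitrary: pre)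
  case (Cons z zs)
  have rz: "reproduced B z" using Cons.prems by simp
  have "T (pre @ z # zs) = (\<Sum>b\<in>B. cnj (cinner z b) * T (pre @ b # zs))"
    by (rule slot_expand[OF T rz])
  then have "(cmod (T (pre @ z # zs)))\<^sup>2
      \<le> (\<Sum>b\<in>B. (cmod (cinner z b))\<^sup>2) * (\<Sum>b\<in>B. (cmod (T (pre @ b # zs)))\<^sup>2)"
    using cauchy_schwarz_sum[of "\<lambda>b. cnj (cinner z b)" "\<lambda>b. T (pre @ b # zs)" B] by simp
  also have "\<dots> = (norm z)\<^sup>2 * (\<Sum>b\<in>B. (cmod (T ((pre @ [b]) @ zs)))\<^sup>2)"
    using bessel(2)[OF B rz] by simp
  also have "\<dots> \<le> (norm z)\<^sup>2 * (\<Sum>b\<in>B. (\<Prod>z\<leftarrow>zs. (norm z)\<^sup>2) *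
      (\<Sum>xs\<in>words B (length zs). (cmod (T ((pre @ [b]) @ xs)))\<^sup>2))"
    using Cons.prems by (intro mult_left_mono sum_mono Cons.IH) auto
  also have "\<dots> = (\<Prod>z\<leftarrow>z # zs. (norm z)\<^sup>2) *
      (\<Sum>xs\<in>words B (length (z # zs)). (cmod (T (pre @ xs)))\<^sup>2)"
    by (simp add: sum_words_Suc sum_distrib_left mult.assoc)
  finally show ?case .
qed simp

text \<open>The functional of the elementary tensor of a list of vectors.\<close>

fun eltensor :: "'h::real_inner cplx list \<Rightarrow> 'h cplx list \<Rightarrow> complex"
  where
    "eltensor [] [] = 1"
  | "eltensor (g # gs) (x # xs) = cinner g x * eltensor gs xs"
  | "eltensor _ _ = 0"

lemma eltensor_length: "length gs \<noteq> length xs \<Longrightarrow> eltensor gs xs = 0"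
  by (induction gs xs rule: eltensor.induct) auto

lemma eltensor_antilinear: "slot_antilinear (eltensor gs)"
proof -
  have "eltensor gs (xs @ (a *\<^sub>C x + b *\<^sub>C y) # ys)
      = cnj a * eltensor gs (xs @ x # ys) + cnj b * eltensor gs (xs @ y # ys)" for xs ys a b x y
  proof (induction xs arbitrary: gs)
    case Nil
    then show ?case
      by (cases gs) (simp_all add: cinner_add_right cinner_scale_right algebra_simps)
  next
    case (Cons z zs)
    then show ?case by (cases gs) (simp_all add: algebra_simps)
  qed
  then show ?thesis by (simp add: slot_antilinear_def)
qed

lemma eltensor_linear:
  "eltensor (gs @ (a *\<^sub>C x + b *\<^sub>C y) # hs) xs
    = a * eltensor (gs @ x # hs) xs + b * eltensor (gs @ y # hs) xs"
proof (induction gs arbitrary: xs)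
  case Nil
  then show ?case
    by (cases xs) (simp_all add: cinner_add_left cinner_scale_left algebra_simps)
next
  case (Cons z zs)
  then show ?case by (cases xs) (simp_all add: algebra_simps)
qed

lemma eltensor_words:
  assumes "finite B" "corthonormal B"
  shows "(\<Sum>xs\<in>words B (length gs). (cmod (eltensor gs xs))\<^sup>2) \<le> (\<Prod>g\<leftarrow>gs. (norm g)\<^sup>2)"
proof (induction gs)
  case (Cons g gs)
  have "(\<Sum>xs\<in>words B (length (g # gs)). (cmod (eltensor (g # gs) xs))\<^sup>2)
      = (\<Sum>x\<in>B. (cmod (cinner g x))\<^sup>2) * (\<Sum>xs\<in>words B (length gs). (cmod (eltensor gs xs))\<^sup>2)"
    by (simp add: sum_words_Suc norm_mult power_mult_distrib sum_product)
  also have "\<dots> \<le> (norm g)\<^sup>2 * (\<Prod>g\<leftarrow>gs. (norm g)\<^sup>2)"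
    using Cons bessel(1)[OF assms] by (intro mult_mono) (auto intro: sum_nonneg)
  finally show ?case by simp
qed simp

lemma eltensor_hs_norm:
  assumes "finite B" "corthonormal B"
  shows "hs_norm (eltensor gs) B K \<le> (\<Prod>g\<leftarrow>gs. norm g)"
proof -
  have "(\<Sum>xs\<in>words B k. (cmod (eltensor gs xs))\<^sup>2) = 0" if "k \<noteq> length gs" for k
    using that eltensor_length[of gs] by (intro sum.neutral) (auto simp: words_def)
  then have "(hs_norm (eltensor gs) B K)\<^sup>2 =
      (\<Sum>k\<le>K. if k = length gs then \<Sum>xs\<in>words B (length gs). (cmod (eltensor gs xs))\<^sup>2 else 0)"
    unfolding hs_norm_power2[OF assms(1)] by (intro sum.cong) auto
  also have "\<dots> \<le> (\<Sum>xs\<in>words B (length gs). (cmod (eltensor gs xs))\<^sup>2)"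
    by (simp add: sum_nonneg)
  also have "\<dots> \<le> (\<Prod>g\<leftarrow>gs. (norm g)\<^sup>2)" by (rule eltensor_words[OF assms])
  also have "\<dots> = (\<Prod>g\<leftarrow>gs. norm g)\<^sup>2"
    by (induction gs) (auto simp: power_mult_distrib)
  finally show ?thesis
    by (rule power2_le_imp_le) (induction gs, auto)
qed

typedef (overloaded) 'h fock =
  "{T :: 'h::real_inner cplx list \<Rightarrow> complex. slot_antilinear T \<and>
     (\<exists>C. \<forall>B K. finite B \<longrightarrow> corthonormal B \<longrightarrow> hs_norm T B K \<le> C)}"
  morphisms fock_eval Abs_fock
proof
  show "(\<lambda>_. 0) \<in> {T :: 'h cplx list \<Rightarrow> complex. slot_antilinear T \<and>
     (\<exists>C. \<forall>B K. finite B \<longrightarrow> corthonormal B \<longrightarrow> hs_norm T B K \<le> C)}"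
    by (auto simp: slot_antilinear_def hs_norm_def L2_set_def)
qed

setup_lifting type_definition_fock

lemma fock_eqI: "(\<And>xs. fock_eval S xs = fock_eval T xs) \<Longrightarrow> S = T"
  by (simp add: fock_eval_inject[symmetric] fun_eq_iff)

lemma hs_norm_triangle: "hs_norm (\<lambda>xs. S xs + T xs) B K \<le> hs_norm S B K + hs_norm T B K"
proof -
  have "hs_norm (\<lambda>xs. S xs + T xs) B K \<le> L2_set (\<lambda>xs. cmod (S xs) + cmod (T xs)) (words_upto B K)"
    unfolding hs_norm_def by (intro L2_set_mono norm_triangle_ineq) auto
  also have "\<dots> \<le> hs_norm S B K + hs_norm T B K"
    unfolding hs_norm_def by (rule L2_set_triangle_ineq)
  finally show ?thesis .
qed

lemma hs_norm_scale: "hs_norm (\<lambda>xs. c * T xs) B K = cmod c * hs_norm T B K"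
  unfolding hs_norm_def norm_mult by (simp add: L2_set_right_distrib)

lift_definition fock_scale :: "complex \<Rightarrow> 'h::real_inner fock \<Rightarrow> 'h fock" (infixr "*\<^sub>F" 75)
  is "\<lambda>c T xs. c * T xs"
proof (intro conjI)
  fix c :: complex and T :: "'h cplx list \<Rightarrow> complex"
  assume *: "slot_antilinear T \<and> (\<exists>C. \<forall>B K. finite B \<longrightarrow> corthonormal B \<longrightarrow> hs_norm T B K \<le> C)"
  then show "slot_antilinear (\<lambda>xs. c * T xs)"
    by (simp add: slot_antilinear_def algebra_simps)
  from * obtain C where C: "\<And>B K. finite B \<Longrightarrow> corthonormal B \<Longrightarrow> hs_norm T B K \<le> C" by blast
  then have "hs_norm (\<lambda>xs. c * T xs) B K \<le> cmod c * C" if "finite B" "corthonormal B" for B K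
    unfolding hs_norm_scale using that by (intro mult_left_mono) auto
  then show "\<exists>C. \<forall>B K. finite B \<longrightarrow> corthonormal B \<longrightarrow> hs_norm (\<lambda>xs. c * T xs) B K \<le> C" by blast
qed

instantiation fock :: (real_inner) real_vector
begin

lift_definition zero_fock :: "'a fock" is "\<lambda>_. 0"
  by (auto simp: slot_antilinear_def hs_norm_def L2_set_def)

lift_definition plus_fock :: "'a fock \<Rightarrow> 'a fock \<Rightarrow> 'a fock" is "\<lambda>S T xs. S xs + T xs"
proof (intro conjI)
  fix S T :: "'a cplx list \<Rightarrow> complex"
  assume S: "slot_antilinear S \<and> (\<exists>C. \<forall>B K. finite B \<longrightarrow> corthonormal B \<longrightarrow> hs_norm S B K \<le> C)"
    and T: "slot_antilinear T \<and> (\<exists>C. \<forall>B K. finite B \<longrightarrow> corthonormal B \<longrightarrow> hs_norm T B K \<le> C)"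
  then show "slot_antilinear (\<lambda>xs. S xs + T xs)"
    by (simp add: slot_antilinear_def algebra_simps)
  from S obtain C where C: "\<And>B K. finite B \<Longrightarrow> corthonormal B \<Longrightarrow> hs_norm S B K \<le> C" by blast
  from T obtain D where D: "\<And>B K. finite B \<Longrightarrow> corthonormal B \<Longrightarrow> hs_norm T B K \<le> D" by blast
  have "hs_norm (\<lambda>xs. S xs + T xs) B K \<le> C + D" if "finite B" "corthonormal B" for B K
    using hs_norm_triangle[of S T B K] C[OF that, of K] D[OF that, of K] by linarith
  then show "\<exists>C. \<forall>B K. finite B \<longrightarrow> corthonormal B \<longrightarrow> hs_norm (\<lambda>xs. S xs + T xs) B K \<le> C" by blast
qed

definition scaleR_fock :: "real \<Rightarrow> 'a fock \<Rightarrow> 'a fock" where "r *\<^sub>R T = of_real r *\<^sub>F T"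
definition uminus_fock :: "'a fock \<Rightarrow> 'a fock" where "- T = (- 1) *\<^sub>F T"
definition minus_fock :: "'a fock \<Rightarrow> 'a fock \<Rightarrow> 'a fock" where "S - T = S + (- 1) *\<^sub>F T"

instance
  by standard
    (auto simp: scaleR_fock_def uminus_fock_def minus_fock_def fock_scale.rep_eq plus_fock.rep_eq
      zero_fock.rep_eq algebra_simps intro!: fock_eqI)

end

lemma fock_eval_simps [simp]:
  "fock_eval 0 xs = 0"
  "fock_eval (S + T) xs = fock_eval S xs + fock_eval T xs"
  "fock_eval (- T) xs = - fock_eval T xs"
  "fock_eval (S - T) xs = fock_eval S xs - fock_eval T xs"
  "fock_eval (r *\<^sub>R T) xs = of_real r * fock_eval T xs"
  "fock_eval (c *\<^sub>F T) xs = c * fock_eval T xs"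
  by (simp_all add: scaleR_fock_def uminus_fock_def minus_fock_def fock_scale.rep_eq plus_fock.rep_eq
      zero_fock.rep_eq)

lemma fock_eval_sum [simp]: "fock_eval (\<Sum>i\<in>A. f i) xs = (\<Sum>i\<in>A. fock_eval (f i) xs)"
  by (induction A rule: infinite_finite_induct) auto

instantiation fock :: (real_inner) real_normed_vector
begin

definition norm_fock :: "'a fock \<Rightarrow> real"
  where "norm T = (SUP (B, K)\<in>{B. finite B \<and> corthonormal B} \<times> UNIV. hs_norm (fock_eval T) B K)"
definition dist_fock :: "'a fock \<Rightarrow> 'a fock \<Rightarrow> real" where "dist_fock S T = norm (S - T)"
definition sgn_fock :: "'a fock \<Rightarrow> 'a fock" where "sgn_fock T = T /\<^sub>R norm T"
definition uniformity_fock :: "('a fock \<times> 'a fock) filter"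
  where "uniformity_fock = (INF e\<in>{0<..}. principal {(S, T). dist S T < e})"
definition open_fock :: "'a fock set \<Rightarrow> bool"
  where "open_fock U \<longleftrightarrow> (\<forall>S\<in>U. \<forall>\<^sub>F (S', T) in uniformity. S' = S \<longrightarrow> T \<in> U)"

lemma fock_eval_antilinear: "slot_antilinear (fock_eval T)" for T :: "'a fock"
  using fock_eval[of T] by simp

lemma hs_norm_le_norm:
  fixes T :: "'a fock"
  assumes "finite B" "corthonormal B"
  shows "hs_norm (fock_eval T) B K \<le> norm T"
proof -
  obtain C where "\<And>B K. finite B \<Longrightarrow> corthonormal B \<Longrightarrow> hs_norm (fock_eval T) B K \<le> C"
    using fock_eval[of T] by blast
  then have "bdd_above ((\<lambda>(B, K). hs_norm (fock_eval T) B K) ` ({B. finite B \<and> corthonormal B} \<times> UNIV))"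
    by (intro bdd_aboveI[of _ C]) auto
  from cSUP_upper[OF _ this, of "(B, K)"] assms show ?thesis by (simp add: norm_fock_def)
qed

lemma fock_norm_leI:
  fixes T :: "'a fock"
  assumes "\<And>B K. finite B \<Longrightarrow> corthonormal B \<Longrightarrow> hs_norm (fock_eval T) B K \<le> C"
  shows "norm T \<le> C"
proof -
  have "({}, 0) \<in> {B :: 'a cplx set. finite B \<and> corthonormal B} \<times> UNIV"
    by (simp add: corthonormal_def)
  then have "{B :: 'a cplx set. finite B \<and> corthonormal B} \<times> (UNIV :: nat set) \<noteq> {}" by blast
  then show ?thesis unfolding norm_fock_def using assms by (intro cSUP_least) auto
qed

lemma fock_norm_nonneg: "0 \<le> norm T" for T :: "'a fock"
  by (rule order_trans[OF hs_norm_nonneg hs_norm_le_norm[of "{}" T 0]]) (simp_all add: corthonormal_def)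

lemma fock_eval_bound:
  fixes T :: "'a fock"
  shows "cmod (fock_eval T zs) \<le> (\<Prod>z\<leftarrow>zs. norm z) * norm T"
proof -
  obtain B where B: "finite B" "corthonormal B" "\<And>z. z \<in> set zs \<Longrightarrow> reproduced B z"
    using gram_schmidt[of "set zs" "{}"] by (auto simp: corthonormal_def)
  have "(cmod (fock_eval T ([] @ zs)))\<^sup>2 \<le> (\<Prod>z\<leftarrow>zs. (norm z)\<^sup>2) *
      (\<Sum>xs\<in>words B (length zs). (cmod (fock_eval T ([] @ xs)))\<^sup>2)"
    by (rule words_eval_bound[OF fock_eval_antilinear B])
  also have "\<dots> \<le> (\<Prod>z\<leftarrow>zs. (norm z)\<^sup>2) * (hs_norm (fock_eval T) B (length zs))\<^sup>2"
  proof (intro mult_left_mono)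
    show "(\<Sum>xs\<in>words B (length zs). (cmod (fock_eval T ([] @ xs)))\<^sup>2)
        \<le> (hs_norm (fock_eval T) B (length zs))\<^sup>2"
      unfolding hs_norm_power2[OF B(1)] append_Nil
      by (rule member_le_sum) (auto intro: sum_nonneg)
  qed (induction zs, auto)
  also have "\<dots> \<le> (\<Prod>z\<leftarrow>zs. (norm z)\<^sup>2) * (norm T)\<^sup>2"
  proof (intro mult_left_mono power_mono hs_norm_le_norm[OF B(1,2)])
    show "0 \<le> (\<Prod>z\<leftarrow>zs. (norm z)\<^sup>2)" by (induction zs) auto
  qed simp
  also have "(\<Prod>z\<leftarrow>zs. (norm z)\<^sup>2) = (\<Prod>z\<leftarrow>zs. norm z)\<^sup>2"
    by (induction zs) (auto simp: power_mult_distrib)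
  finally have "(cmod (fock_eval T zs))\<^sup>2 \<le> ((\<Prod>z\<leftarrow>zs. norm z) * norm T)\<^sup>2"
    by (simp add: power_mult_distrib)
  then show ?thesis
  proof (rule power2_le_imp_le)
    have "0 \<le> (\<Prod>z\<leftarrow>zs. norm z)" by (induction zs) auto
    then show "0 \<le> (\<Prod>z\<leftarrow>zs. norm z) * norm T" using fock_norm_nonneg[of T] by simp
  qed
qed

lemma fock_norm_triangle: "norm (S + T) \<le> norm S + norm T" for S T :: "'a fock"
proof (rule fock_norm_leI)
  fix B :: "'a cplx set" and K assume B: "finite B" "corthonormal B"
  have "hs_norm (fock_eval (S + T)) B K = hs_norm (\<lambda>xs. fock_eval S xs + fock_eval T xs) B K"
    by (simp add: hs_norm_def)
  also have "\<dots> \<le> norm S + norm T"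
    by (rule order_trans[OF hs_norm_triangle add_mono[OF hs_norm_le_norm[OF B] hs_norm_le_norm[OF B]]])
  finally show "hs_norm (fock_eval (S + T)) B K \<le> norm S + norm T" .
qed

lemma fock_norm_scale: "norm (c *\<^sub>F T) = cmod c * norm T" for T :: "'a fock"
proof -
  have le: "norm (c *\<^sub>F T) \<le> cmod c * norm T" for c and T :: "'a fock"
  proof (rule fock_norm_leI)
    fix B :: "'a cplx set" and K assume B: "finite B" "corthonormal B"
    have "hs_norm (fock_eval (c *\<^sub>F T)) B K = cmod c * hs_norm (fock_eval T) B K"
      unfolding hs_norm_scale[symmetric] by (simp add: hs_norm_def)
    then show "hs_norm (fock_eval (c *\<^sub>F T)) B K \<le> cmod c * norm T"
      using hs_norm_le_norm[OF B] by (simp add: mult_left_mono)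
  qed
  show ?thesis
  proof (cases "c = 0")
    case True
    then show ?thesis using le[of c T] fock_norm_nonneg[of "c *\<^sub>F T"] by simp
  next
    case False
    have "T = (1 / c) *\<^sub>F (c *\<^sub>F T)" using False by (intro fock_eqI) simp
    then have "norm T \<le> cmod (1 / c) * norm (c *\<^sub>F T)" using le by metis
    then have "cmod c * norm T \<le> norm (c *\<^sub>F T)"
      using False by (simp add: norm_divide field_simps)
    then show ?thesis using le[of c T] by simp
  qed
qed

instance
proof
  fix S T :: "'a fock" and r :: real and U :: "'a fock set"
  show "norm T = 0 \<longleftrightarrow> T = 0"
  proof
    assume "norm T = 0"
    then show "T = 0" using fock_eval_bound[of T] by (intro fock_eqI) simp
  next
    assume "T = 0"
    then have "norm T \<le> 0" by (intro fock_norm_leI) (simp add: hs_norm_def L2_set_def)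
    then show "norm T = 0" using fock_norm_nonneg[of T] by simp
  qed
  show "norm (S + T) \<le> norm S + norm T" by (rule fock_norm_triangle)
  show "norm (r *\<^sub>R T) = \<bar>r\<bar> * norm T" by (simp add: scaleR_fock_def fock_norm_scale)
qed (rule dist_fock_def sgn_fock_def uniformity_fock_def open_fock_def)+

end

instance fock :: (real_inner) banach
proof
  fix X :: "nat \<Rightarrow> 'a fock" assume X: "Cauchy X"
  have ev: "Cauchy (\<lambda>n. fock_eval (X n) xs)" for xs
  proof (rule CauchyI)
    fix e :: real assume e: "e > 0"
    define c where "c = (\<Prod>z\<leftarrow>xs. norm z) + 1"
    have c: "c > 0" unfolding c_def by (rule add_nonneg_pos) (induction xs, auto)
    obtain N where N: "\<And>m n. m \<ge> N \<Longrightarrow> n \<ge> N \<Longrightarrow> norm (X m - X n) < e / c"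
      using CauchyD[OF X, of "e / c"] e c by auto
    have "norm (fock_eval (X m) xs - fock_eval (X n) xs) < e" if "m \<ge> N" "n \<ge> N" for m n
    proof -
      have "norm (fock_eval (X m) xs - fock_eval (X n) xs) \<le> (\<Prod>z\<leftarrow>xs. norm z) * norm (X m - X n)"
        using fock_eval_bound[of "X m - X n" xs] by simp
      also have "\<dots> \<le> c * norm (X m - X n)" by (intro mult_right_mono) (auto simp: c_def)
      also have "\<dots> < e" using N[OF that] c by (simp add: field_simps)
      finally show ?thesis .
    qed
    then show "\<exists>M. \<forall>m\<ge>M. \<forall>n\<ge>M. norm (fock_eval (X m) xs - fock_eval (X n) xs) < e" by blast
  qed
  define L where "L = (\<lambda>xs. lim (\<lambda>n. fock_eval (X n) xs))"
  have lim: "(\<lambda>n. fock_eval (X n) xs) \<longlonglongrightarrow> L xs" for xs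
    using ev[of xs] by (simp add: L_def convergent_LIMSEQ_iff Cauchy_convergent_iff)
  have anti: "slot_antilinear L"
    unfolding slot_antilinear_def
  proof (intro allI)
    fix xs ys a b and x y :: "'a cplx"
    have eq: "fock_eval T (xs @ (a *\<^sub>C x + b *\<^sub>C y) # ys)
        = cnj a * fock_eval T (xs @ x # ys) + cnj b * fock_eval T (xs @ y # ys)" for T
      using fock_eval_antilinear[of T] unfolding slot_antilinear_def by blast
    have "(\<lambda>n. fock_eval (X n) (xs @ (a *\<^sub>C x + b *\<^sub>C y) # ys))
      \<longlonglongrightarrow> cnj a * L (xs @ x # ys) + cnj b * L (xs @ y # ys)"
      unfolding eq by (intro tendsto_intros lim)
    with lim show "L (xs @ (a *\<^sub>C x + b *\<^sub>C y) # ys) = cnj a * L (xs @ x # ys) + cnj b * L (xs @ y # ys)"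
      using LIMSEQ_unique by blast
  qed
  have unif: "\<exists>N. \<forall>n\<ge>N. \<forall>B K. finite B \<longrightarrow> corthonormal B \<longrightarrow>
      hs_norm (\<lambda>xs. fock_eval (X n) xs - L xs) B K \<le> e" if e: "e > 0" for e
  proof -
    obtain N where N: "\<And>m n. m \<ge> N \<Longrightarrow> n \<ge> N \<Longrightarrow> norm (X m - X n) < e"
      using CauchyD[OF X e] by auto
    have "hs_norm (\<lambda>xs. fock_eval (X n) xs - L xs) B K \<le> e"
      if n: "n \<ge> N" and B: "finite B" "corthonormal B" for n B K
    proof (rule LIMSEQ_le_const2)
      show "(\<lambda>m. hs_norm (fock_eval (X n - X m)) B K)
          \<longlonglongrightarrow> hs_norm (\<lambda>xs. fock_eval (X n) xs - L xs) B K"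
        unfolding hs_norm_def L2_set_def fock_eval_simps by (intro tendsto_intros lim)
      show "\<exists>M. \<forall>m\<ge>M. hs_norm (fock_eval (X n - X m)) B K \<le> e"
        using N[OF n] hs_norm_le_norm[OF B] by (meson less_imp_le order_trans)
    qed
    then show ?thesis by blast
  qed
  obtain N where N: "\<And>B K. finite B \<Longrightarrow> corthonormal B \<Longrightarrow>
      hs_norm (\<lambda>xs. fock_eval (X N) xs - L xs) B K \<le> 1"
    using unif[of 1] by auto
  have "hs_norm L B K \<le> norm (X N) + 1" if B: "finite B" "corthonormal B" for B K
  proof -
    have "hs_norm L B K = hs_norm (\<lambda>xs. fock_eval (X N) xs + (- 1) * (fock_eval (X N) xs - L xs)) B K"
      by simp
    also have "\<dots> \<le> hs_norm (fock_eval (X N)) B K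
        + hs_norm (\<lambda>xs. (- 1) * (fock_eval (X N) xs - L xs)) B K"
      by (rule hs_norm_triangle)
    also have "\<dots> \<le> norm (X N) + 1"
      unfolding hs_norm_scale using N[OF B, of K] hs_norm_le_norm[OF B, of "X N" K] by simp
    finally show ?thesis .
  qed
  then have mem: "fock_eval (Abs_fock L) = L"
    using anti by (intro Abs_fock_inverse) auto
  have "X \<longlonglongrightarrow> Abs_fock L"
  proof (rule LIMSEQ_I)
    fix e :: real assume e: "e > 0"
    obtain N where N: "\<And>n B K. n \<ge> N \<Longrightarrow> finite B \<Longrightarrow> corthonormal B \<Longrightarrow>
        hs_norm (\<lambda>xs. fock_eval (X n) xs - L xs) B K \<le> e / 2"
      using unif[of "e / 2"] e by auto
    have "norm (X n - Abs_fock L) \<le> e / 2" if "n \<ge> N" for n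
    proof (rule fock_norm_leI)
      fix B :: "'a cplx set" and K assume B: "finite B" "corthonormal B"
      have "fock_eval (X n - Abs_fock L) = (\<lambda>xs. fock_eval (X n) xs - L xs)"
        by (simp add: fun_eq_iff mem)
      then show "hs_norm (fock_eval (X n - Abs_fock L)) B K \<le> e / 2" using N[OF that B] by simp
    qed
    then show "\<exists>N. \<forall>n\<ge>N. norm (X n - Abs_fock L) < e"
      using e by (intro exI[of _ N]) fastforce
  qed
  then show "convergent X" by (rule convergentI)
qed

lift_definition pure_tensor :: "'h::real_inner cplx list \<Rightarrow> 'h fock" is eltensor
  using eltensor_antilinear eltensor_hs_norm by blast

lemma pure_tensor_norm_le: "norm (pure_tensor gs) \<le> (\<Prod>g\<leftarrow>gs. norm g)"
  by (rule fock_norm_leI) (simp add: pure_tensor.rep_eq eltensor_hs_norm)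

lemma pure_tensor_diff: "pure_tensor (gs @ x # hs) - pure_tensor (gs @ y # hs) = pure_tensor (gs @ (x - y) # hs)"
proof (rule fock_eqI)
  fix xs
  have "x - y = 1 *\<^sub>C x + (- 1) *\<^sub>C y" by (simp add: cscale_def prod_eq_iff)
  then show "fock_eval (pure_tensor (gs @ x # hs) - pure_tensor (gs @ y # hs)) xs = fock_eval (pure_tensor (gs @ (x - y) # hs)) xs"
    using eltensor_linear[of gs 1 x "-1" y hs xs] by (simp add: pure_tensor.rep_eq)
qed

lemma tendsto_pure_tensor:
  assumes "X \<longlonglongrightarrow> x"
  shows "(\<lambda>n. pure_tensor (gs @ X n # hs)) \<longlonglongrightarrow> pure_tensor (gs @ x # hs)"
proof -
  define c where "c = (\<Prod>g\<leftarrow>gs. norm g) * (\<Prod>g\<leftarrow>hs. norm g)"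
  have le: "norm (pure_tensor (gs @ X n # hs) - pure_tensor (gs @ x # hs)) \<le> c * norm (X n - x)" for n
    using pure_tensor_norm_le[of "gs @ (X n - x) # hs"] by (simp add: pure_tensor_diff c_def mult_ac)
  have "(\<lambda>n. c * norm (X n - x)) \<longlonglongrightarrow> c * norm (x - x)"
    by (intro tendsto_intros assms)
  then have "(\<lambda>n. c * norm (X n - x)) \<longlonglongrightarrow> 0" by simp
  then have "(\<lambda>n. pure_tensor (gs @ X n # hs) - pure_tensor (gs @ x # hs)) \<longlonglongrightarrow> 0"
    by (rule tendsto_norm_zero_cancel[OF tendsto_sandwich[OF _ _ tendsto_const], rotated 2])
      (use le in auto)
  then show ?thesis by (simp add: LIM_zero_iff)
qed

lemma tendsto_fock_scale:
  assumes "(f \<longlongrightarrow> c) F"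
  shows "((\<lambda>n. f n *\<^sub>F T) \<longlongrightarrow> c *\<^sub>F T) F"
proof -
  have "bounded_linear (\<lambda>c. c *\<^sub>F T)"
    by (rule bounded_linear_intro[of _ "norm T"])
      (simp_all add: fock_eqI fock_norm_scale distrib_left distrib_right scaleR_conv_of_real mult_ac)
  then show ?thesis using assms by (rule bounded_linear.tendsto)
qed

lemma tendsto_fock_scale_right:
  assumes "(f \<longlongrightarrow> T) F"
  shows "((\<lambda>n. c *\<^sub>F f n) \<longlongrightarrow> c *\<^sub>F T) F"
proof -
  have "bounded_linear (\<lambda>T. c *\<^sub>F T)"
    by (rule bounded_linear_intro[of _ "cmod c"])
      (simp_all add: fock_eqI fock_norm_scale distrib_left distrib_right scaleR_conv_of_real mult_ac)
  then show ?thesis using assms by (rule bounded_linear.tendsto)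
qed

lemma eltensor_orthonormal:
  assumes "corthonormal B" "set xs \<subseteq> B" "set ys \<subseteq> B"
  shows "eltensor xs ys = (if xs = ys then 1 else 0)"
  using assms(2,3)
proof (induction xs ys rule: eltensor.induct)
  case (2 g gs x xs)
  then show ?case using corthonormalD[OF assms(1), of g] by (cases "g = x") auto
qed auto

lemma fock_truncation:
  fixes T :: "'h::real_inner fock"
  assumes B: "finite B" "corthonormal B"
  shows "(norm (T - (\<Sum>xs\<in>words_upto B K. fock_eval T xs *\<^sub>F pure_tensor xs)))\<^sup>2
    \<le> (norm T)\<^sup>2 - (hs_norm (fock_eval T) B K)\<^sup>2"
proof -
  define P where "P = (\<Sum>xs\<in>words_upto B K. fock_eval T xs *\<^sub>F pure_tensor xs)"
  have sq: "(hs_norm S A J)\<^sup>2 = (\<Sum>xs\<in>words_upto A J. (cmod (S xs))\<^sup>2)" for S :: "'h cplx list \<Rightarrow> complex" and A J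
    by (simp add: hs_norm_def L2_set_def sum_nonneg)
  have le: "(hs_norm (fock_eval (T - P)) B1 K1)\<^sup>2 \<le> (norm T)\<^sup>2 - (hs_norm (fock_eval T) B K)\<^sup>2"
    if B1: "finite B1" "corthonormal B1" for B1 K1
  proof -
    obtain B2 where B2: "finite B2" "corthonormal B2" "B \<subseteq> B2" "\<forall>x\<in>B1. reproduced B2 x"
      using gram_schmidt[OF B1(1) B] by blast
    define K2 where "K2 = max K K1"
    have sub: "words_upto B K \<subseteq> words_upto B2 K2"
      using B2(3) by (auto simp: words_upto_def K2_def)
    have P: "fock_eval P ys = (if ys \<in> words_upto B K then fock_eval T ys else 0)"
      if "ys \<in> words_upto B2 K2" for ys
    proof -
      have "fock_eval P ys = (\<Sum>xs\<in>words_upto B K. if xs = ys then fock_eval T xs else 0)"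
        unfolding P_def fock_eval_sum
      proof (rule sum.cong[OF refl])
        fix xs assume "xs \<in> words_upto B K"
        then have "set xs \<subseteq> B2" using sub by (auto simp: words_upto_def)
        moreover have "set ys \<subseteq> B2" using that by (auto simp: words_upto_def)
        ultimately show "fock_eval (fock_eval T xs *\<^sub>F pure_tensor xs) ys = (if xs = ys then fock_eval T xs else 0)"
          using eltensor_orthonormal[OF B2(2)] by (simp add: pure_tensor.rep_eq)
      qed
      then show ?thesis using B by simp
    qed
    have "(hs_norm (fock_eval (T - P)) B1 K1)\<^sup>2 \<le> (hs_norm (fock_eval (T - P)) B2 K1)\<^sup>2"
      unfolding hs_norm_power2[OF B1(1)] hs_norm_power2[OF B2(1)]
      using words_mono[OF fock_eval_antilinear B1 B2(1,2), of "T - P" "[]"] B2(4)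
      by (intro sum_mono) simp
    also have "\<dots> \<le> (hs_norm (fock_eval (T - P)) B2 K2)\<^sup>2"
      unfolding sq using B2(1) by (intro sum_mono2) (auto simp: words_upto_def K2_def finite_lists_length_le)
    also have "\<dots> = (\<Sum>xs\<in>words_upto B2 K2 - words_upto B K. (cmod (fock_eval T xs))\<^sup>2)"
      unfolding sq using P B2(1) by (intro sum.mono_neutral_cong_right) auto
    also have "\<dots> = (hs_norm (fock_eval T) B2 K2)\<^sup>2 - (hs_norm (fock_eval T) B K)\<^sup>2"
      unfolding sq using sub B2(1) by (intro sum_diff) auto
    also have "\<dots> \<le> (norm T)\<^sup>2 - (hs_norm (fock_eval T) B K)\<^sup>2"
      using hs_norm_le_norm[OF B2(1,2)] by (intro diff_right_mono power_mono) auto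
    finally show ?thesis .
  qed
  have nn: "0 \<le> (norm T)\<^sup>2 - (hs_norm (fock_eval T) B K)\<^sup>2"
    using hs_norm_le_norm[OF B, of T K] by (simp add: power_mono)
  have "norm (T - P) \<le> sqrt ((norm T)\<^sup>2 - (hs_norm (fock_eval T) B K)\<^sup>2)"
    using le by (intro fock_norm_leI real_le_rsqrt) auto
  then have "(norm (T - P))\<^sup>2 \<le> (sqrt ((norm T)\<^sup>2 - (hs_norm (fock_eval T) B K)\<^sup>2))\<^sup>2"
    by (intro power_mono) auto
  then show ?thesis using nn by (simp add: P_def)
qed

lemma fock_approx:
  fixes T :: "'h::real_inner fock"
  assumes "e > 0"
  shows "\<exists>B K. finite B \<and> corthonormal B \<and>
    norm (T - (\<Sum>xs\<in>words_upto B K. fock_eval T xs *\<^sub>F pure_tensor xs)) < e"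
proof -
  define d where "d = (norm T)\<^sup>2 - e\<^sup>2 / 2"
  have d: "d < (norm T)\<^sup>2" using assms by (simp add: d_def)
  have "\<exists>B K. finite B \<and> corthonormal B \<and> d < (hs_norm (fock_eval T) B K)\<^sup>2"
  proof (rule ccontr)
    assume neg: "\<not> ?thesis"
    have *: "(hs_norm (fock_eval T) B K)\<^sup>2 \<le> d" if "finite B" "corthonormal B" for B K
    proof (rule leI, rule notI)
      assume "d < (hs_norm (fock_eval T) B K)\<^sup>2"
      then have "\<exists>B K. finite B \<and> corthonormal B \<and> d < (hs_norm (fock_eval T) B K)\<^sup>2"
        by (intro exI[of _ B] exI[of _ K] conjI that)
      with neg show False by (rule notE)
    qed
    have d0: "0 \<le> d" by (rule order_trans[OF zero_le_power2 *[of "{}" 0]]) (simp_all add: corthonormal_def)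
    have "norm T \<le> sqrt d"
    proof (rule fock_norm_leI)
      fix B :: "'h cplx set" and K assume "finite B" "corthonormal B"
      then show "hs_norm (fock_eval T) B K \<le> sqrt d" by (intro real_le_rsqrt *)
    qed
    then have "(norm T)\<^sup>2 \<le> (sqrt d)\<^sup>2" by (intro power_mono) auto
    moreover have "(sqrt d)\<^sup>2 = d" using d0 by simp
    ultimately show False using d by linarith
  qed
  then obtain B K where B: "finite B" "corthonormal B" "d < (hs_norm (fock_eval T) B K)\<^sup>2" by blast
  have "(norm (T - (\<Sum>xs\<in>words_upto B K. fock_eval T xs *\<^sub>F pure_tensor xs)))\<^sup>2 < e\<^sup>2"
    using fock_truncation[OF B(1,2), of T K] B(3) zero_less_power[OF assms, of 2]
    unfolding d_def by linarith
  then have "norm (T - (\<Sum>xs\<in>words_upto B K. fock_eval T xs *\<^sub>F pure_tensor xs)) < e"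
    using assms by (rule power2_less_imp_less[OF _ less_imp_le])
  then show ?thesis using B by (intro exI[of _ B] exI[of _ K] conjI)
qed

lemma second_countable_if_countable_dense:
  fixes D :: "'a::metric_space set"
  assumes "countable D" "closure D = UNIV"
  shows "\<exists>B::'a set set. countable B \<and> open = generate_topology B"
proof (intro exI conjI)
  define Bs where "Bs = (\<lambda>(d, n). ball d (1 / real (Suc n))) ` (D \<times> UNIV)"
  show "countable Bs" using assms(1) by (simp add: Bs_def)
  have "topological_basis Bs"
  proof (rule topological_basisI)
    show "open b" if "b \<in> Bs" for b using that by (auto simp: Bs_def)
    fix U :: "'a set" and x assume U: "open U" "x \<in> U"
    then obtain e where e: "e > 0" "ball x e \<subseteq> U" by (meson openE)
    obtain n where n: "1 / real (Suc n) < e / 2"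
      using nat_approx_posE[of "e / 2"] e by auto
    have "x \<in> closure D" using assms(2) by simp
    moreover have "0 < 1 / real (Suc n)" by simp
    ultimately obtain d where d: "d \<in> D" "dist d x < 1 / real (Suc n)"
      unfolding closure_approachable by blast
    have "ball d (1 / real (Suc n)) \<subseteq> ball x e"
    proof
      fix y assume "y \<in> ball d (1 / real (Suc n))"
      then have "dist x y < 1 / real (Suc n) + 1 / real (Suc n)"
        using d(2) dist_triangle[of x y d] by (simp add: dist_commute)
      then have "dist x y < e" using n by linarith
      then show "y \<in> ball x e" by simp
    qed
    then show "\<exists>b\<in>Bs. x \<in> b \<and> b \<subseteq> U"
      using d e by (intro bexI[of _ "ball d (1 / real (Suc n))"]) (auto simp: Bs_def)
  qed
  then show "open = generate_topology Bs"
    by (rule topological_basis_imp_subbasis)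
qed

instance fock :: ("{real_inner, second_countable_topology}") second_countable_topology
proof
  obtain D :: "'a cplx set" where D: "countable D" "\<And>X. open X \<Longrightarrow> X \<noteq> {} \<Longrightarrow> \<exists>d\<in>D. d \<in> X"
    using countable_dense_exists by blast
  obtain Q :: "complex set" where Q: "countable Q" "\<And>X. open X \<Longrightarrow> X \<noteq> {} \<Longrightarrow> \<exists>d\<in>Q. d \<in> X"
    using countable_dense_exists by blast
  have seq: "\<exists>X. (\<forall>n. X n \<in> A) \<and> X \<longlonglongrightarrow> x"
    if A: "\<And>X. open X \<Longrightarrow> X \<noteq> {} \<Longrightarrow> \<exists>d\<in>A. d \<in> X" for A :: "'z::metric_space set" and x
  proof -
    have "x \<in> closure A"
      unfolding closure_approachable
    proof (intro allI impI)
      fix e :: real assume "e > 0"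
      then have "\<exists>d\<in>A. d \<in> ball x e" by (intro A) auto
      then show "\<exists>y\<in>A. dist y x < e" by (auto simp: dist_commute)
    qed
    then show ?thesis unfolding closure_sequential by blast
  qed
  define E where "E = (\<lambda>(c, gs). c *\<^sub>F pure_tensor gs) ` (Q \<times> lists D)"
  have E: "countable E" using Q(1) D(1) by (simp add: E_def)
  define S where "S = sum_list ` lists E"
  have S: "countable S" using E by (simp add: S_def)
  have add: "x + y \<in> closure S" if xy: "x \<in> closure S" "y \<in> closure S" for x y
  proof -
    obtain X Y where X: "\<forall>n. X n \<in> S" "X \<longlonglongrightarrow> x" and Y: "\<forall>n. Y n \<in> S" "Y \<longlonglongrightarrow> y"
      using xy unfolding closure_sequential by blast
    have "u + v \<in> S" if uv: "u \<in> S" "v \<in> S" for u v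
    proof -
      obtain us vs where "us \<in> lists E" "u = sum_list us" "vs \<in> lists E" "v = sum_list vs"
        using uv by (auto simp: S_def)
      then show ?thesis unfolding S_def by (intro image_eqI[of _ _ "us @ vs"]) auto
    qed
    then have "\<forall>n. X n + Y n \<in> S" using X Y by blast
    moreover have "(\<lambda>n. X n + Y n) \<longlonglongrightarrow> x + y" using X Y by (intro tendsto_intros)
    ultimately show ?thesis
      unfolding closure_sequential by (intro exI[of _ "\<lambda>n. X n + Y n"]) simp
  qed
  have zero: "0 \<in> closure S"
    by (rule subsetD[OF closure_subset]) (auto simp: S_def intro: image_eqI[of _ _ "[]"])
  have E_S: "E \<subseteq> closure S"
  proof
    fix x assume "x \<in> E"
    then have "x \<in> S" unfolding S_def by (intro image_eqI[of _ _ "[x]"]) auto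
    then show "x \<in> closure S" using closure_subset by blast
  qed
  have lim: "x \<in> closure S" if "\<And>n. X n \<in> closure S" "X \<longlonglongrightarrow> x" for X x
    using closed_sequentially[OF closed_closure] that by blast
  have ten_c: "c *\<^sub>F pure_tensor (gs @ hs) \<in> closure S" if "hs \<in> lists D" "c \<in> Q" for c gs hs
    using that(1)
  proof (induction gs arbitrary: hs rule: rev_induct)
    case Nil
    then show ?case using E_S that(2) by (auto simp: E_def)
  next
    case (snoc x xs)
    obtain X where X: "\<forall>n. X n \<in> D" "X \<longlonglongrightarrow> x" using seq[of D x] D(2) by blast
    have "c *\<^sub>F pure_tensor (xs @ X n # hs) \<in> closure S" for n
      using snoc.IH[of "X n # hs"] snoc.prems X(1) by simp
    moreover have "(\<lambda>n. c *\<^sub>F pure_tensor (xs @ X n # hs)) \<longlonglongrightarrow> c *\<^sub>F pure_tensor (xs @ x # hs)"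
      using X(2) by (intro tendsto_fock_scale_right tendsto_pure_tensor)
    ultimately have "c *\<^sub>F pure_tensor (xs @ x # hs) \<in> closure S" by (rule lim)
    then show ?case by simp
  qed
  have ten_S: "c *\<^sub>F pure_tensor gs \<in> closure S" for c gs
  proof -
    obtain C where C: "\<forall>n. C n \<in> Q" "C \<longlonglongrightarrow> c" using seq[of Q c] Q(2) by blast
    have "C n *\<^sub>F pure_tensor gs \<in> closure S" for n using ten_c[of "[]" "C n" gs] C(1) by simp
    then show ?thesis using lim[OF _ tendsto_fock_scale[OF C(2)]] by blast
  qed
  have sum_S: "(\<Sum>i\<in>I. c i *\<^sub>F pure_tensor (g i)) \<in> closure S" for I :: "'a cplx list set" and c g
    by (induction I rule: infinite_finite_induct) (auto simp: zero add ten_S)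
  have "T \<in> closure (closure S)" for T
    unfolding closure_approachable
  proof (intro allI impI)
    fix e :: real assume "e > 0"
    then obtain B K where "norm (T - (\<Sum>xs\<in>words_upto B K. fock_eval T xs *\<^sub>F pure_tensor xs)) < e"
      using fock_approx by blast
    then show "\<exists>y\<in>closure S. dist y T < e"
      using sum_S by (intro bexI) (auto simp: dist_norm norm_minus_commute)
  qed
  then have "closure S = UNIV" by auto
  then show "\<exists>B::'a fock set set. countable B \<and> open = generate_topology B"
    using second_countable_if_countable_dense S by blast
qed

section \<open>Complex isonormal Gaussian processes\<close>

definition centered_gaussian :: "'w measure \<Rightarrow> ('w \<Rightarrow> real) \<Rightarrow> bool"
  where "centered_gaussian M X \<longleftrightarrow> (\<exists>\<sigma>\<ge>0.
    if \<sigma> = 0 then X \<in> borel_measurable M \<and> (AE \<omega> in M. X \<omega> = 0)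
    else distributed M lborel X (normal_density 0 \<sigma>))"

text \<open>Z is a linear map into classes of random variables, so linearity holds almost surely.\<close>

locale complex_isonormal = prob_space M
  for M :: "'w measure" and Z :: "'h::real_inner cplx \<Rightarrow> 'w \<Rightarrow> complex" +
  assumes measurable: "\<And>h. random_variable borel (Z h)"
    and linear: "\<And>a b g h. AE \<omega> in M. Z (a *\<^sub>C g + b *\<^sub>C h) \<omega> = a * Z g \<omega> + b * Z h \<omega>"
    and jointly_gaussian: "\<And>A u v. finite A \<Longrightarrow>
      centered_gaussian M (\<lambda>\<omega>. \<Sum>h\<in>A. u h * Re (Z h \<omega>) + v h * Im (Z h \<omega>))"
    and symmetric: "\<And>c h. cmod c = 1 \<Longrightarrow> distr M borel (\<lambda>\<omega>. c * Z h \<omega>) = distr M borel (Z h)"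
    and pseudo_variance: "\<And>h. expectation (\<lambda>\<omega>. (Z h \<omega>)\<^sup>2) = 0"
    and covariance: "\<And>g h. expectation (\<lambda>\<omega>. Z g \<omega> * cnj (Z h \<omega>)) = cinner g h"

definition process_sigma :: "'w measure \<Rightarrow> ('h \<Rightarrow> 'w \<Rightarrow> complex) \<Rightarrow> 'w measure"
  where "process_sigma M Z = sigma (space M) (\<Union>h. {Z h -` A \<inter> space M |A. A \<in> sets borel})"

definition L2_space :: "'w measure \<Rightarrow> ('w \<Rightarrow> 'b::{banach, second_countable_topology}) set"
  where "L2_space M = {X \<in> borel_measurable M. integrable M (\<lambda>\<omega>. (norm (X \<omega>))\<^sup>2)}"

definition L2_tendsto ::
  "'w measure \<Rightarrow> ('i \<Rightarrow> 'w \<Rightarrow> 'b::real_normed_vector) \<Rightarrow> ('w \<Rightarrow> 'b) \<Rightarrow> 'i filter \<Rightarrow> bool"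
  where "L2_tendsto M X Y F \<longleftrightarrow>
    ((\<lambda>i. \<integral>\<^sup>+\<omega>. ennreal ((norm (X i \<omega> - Y \<omega>))\<^sup>2) \<partial>M) \<longlongrightarrow> 0) F"

section \<open>Complex multiple Wiener-Ito integrals\<close>

definition complex_hermite :: "nat \<Rightarrow> nat \<Rightarrow> complex \<Rightarrow> real \<Rightarrow> complex"
  where "complex_hermite m n z \<rho> = (\<Sum>r\<le>min m n. (- 1) ^ r * fact r *
    of_nat (m choose r) * of_nat (n choose r) * z ^ (m - r) * cnj z ^ (n - r) * of_real \<rho> ^ r)"

definition orthonormal_basis :: "'h::real_inner cplx set \<Rightarrow> bool"
  where "orthonormal_basis B \<longleftrightarrow>
    corthonormal B \<and> closure (span (B \<union> (\<lambda>b. \<i> *\<^sub>C b) ` B)) = UNIV"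

text \<open>The Hilbert space tensor product of the p-th and the q-th symmetric tensor power.\<close>

definition bisymmetric :: "nat \<Rightarrow> nat \<Rightarrow> 'h::real_inner fock set"
  where "bisymmetric p q = {T.
    (\<forall>xs. length xs \<noteq> p + q \<longrightarrow> fock_eval T xs = 0) \<and>
    (\<forall>xs ys \<sigma> \<tau>. length xs = p \<longrightarrow> length ys = q \<longrightarrow> \<sigma> permutes {..<p} \<longrightarrow> \<tau> permutes {..<q} \<longrightarrow>
      fock_eval T (permute_list \<sigma> xs @ permute_list \<tau> ys) = fock_eval T (xs @ ys))}"

text \<open>A pair of multiplicity sequences is encoded by lists xs, ys of basis vectors in which e occurs
  with the respective multiplicity. The tensor below is the symmetrization of xs tensored with the
  symmetrization of the conjugates of ys, and both definitions depend on the multiplicities only.\<close>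

definition basis_tensor :: "'h::real_inner cplx list \<Rightarrow> 'h cplx list \<Rightarrow> 'h fock"
  where "basis_tensor xs ys = (1 / (fact (length xs) * fact (length ys))) *\<^sub>R
    (\<Sum>\<sigma> | \<sigma> permutes {..<length xs}. \<Sum>\<tau> | \<tau> permutes {..<length ys}.
      pure_tensor (permute_list \<sigma> xs @ map cconj (permute_list \<tau> ys)))"

definition hermite_product ::
  "('h cplx \<Rightarrow> 'w \<Rightarrow> complex) \<Rightarrow> 'h cplx list \<Rightarrow> 'h cplx list \<Rightarrow> 'w \<Rightarrow> complex"
  where "hermite_product Z xs ys \<omega> = (\<Prod>e\<in>set xs \<union> set ys.
    let m = count_list xs e; n = count_list ys e in
      of_real (2 powr (- real (m + n) / 2)) * complex_hermite m n (of_real (sqrt 2) * Z e \<omega>) 2)"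

text \<open>The closure of the graph of the linear extension, and the resulting integral. The integral is
  determined up to almost sure equality only, hence the choice of a version.\<close>

definition wiener_ito_graph :: "'w measure \<Rightarrow> ('h::real_inner cplx \<Rightarrow> 'w \<Rightarrow> complex) \<Rightarrow> 'h cplx set \<Rightarrow>
    nat \<Rightarrow> nat \<Rightarrow> 'h fock \<Rightarrow> ('w \<Rightarrow> complex) \<Rightarrow> bool"
  where "wiener_ito_graph M Z B m n f X \<longleftrightarrow> X \<in> L2_space M \<and>
    (\<exists>(A :: nat \<Rightarrow> ('h cplx list \<times> 'h cplx list) set) c.
      (\<forall>l. finite (A l) \<and> A l \<subseteq> words B m \<times> words B n) \<and>
      (\<lambda>l. \<Sum>(xs, ys)\<in>A l. c l xs ys *\<^sub>F basis_tensor xs ys) \<longlonglongrightarrow> f \<and>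
      L2_tendsto M (\<lambda>l \<omega>. \<Sum>(xs, ys)\<in>A l. c l xs ys * hermite_product Z xs ys \<omega>) X sequentially)"

definition wiener_ito :: "'w measure \<Rightarrow> ('h::real_inner cplx \<Rightarrow> 'w \<Rightarrow> complex) \<Rightarrow> 'h cplx set \<Rightarrow>
    nat \<Rightarrow> nat \<Rightarrow> 'h fock \<Rightarrow> 'w \<Rightarrow> complex"
  where "wiener_ito M Z B m n f = (SOME X. wiener_ito_graph M Z B m n f X)"

text \<open>The double series converges unconditionally in mean square. Its terms are mutually orthogonal,
  so this is the same as convergence in any particular order of summation.\<close>

definition chaos_expansion :: "'w measure \<Rightarrow> ('h::real_inner cplx \<Rightarrow> 'w \<Rightarrow> complex) \<Rightarrow> 'h cplx set \<Rightarrow>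
    ('w \<Rightarrow> complex) \<Rightarrow> (nat \<Rightarrow> nat \<Rightarrow> 'h fock) \<Rightarrow> bool"
  where "chaos_expansion M Z B F f \<longleftrightarrow> (\<forall>p q. f p q \<in> bisymmetric p q) \<and>
    L2_tendsto M (\<lambda>A \<omega>. \<Sum>(p, q)\<in>A. wiener_ito M Z B p q (f p q) \<omega>) F (finite_subsets_at_top UNIV)"

section \<open>Complex Malliavin derivatives\<close>

text \<open>A function on k-dimensional complex space is represented by a function of a sequence that
  depends on the first k entries only. \<open>partial_deriv i 1\<close> and \<open>partial_deriv i \<i>\<close> are the partial
  derivatives with respect to the real and the imaginary part of the i-th variable.\<close>

definition partial_deriv ::
  "nat \<Rightarrow> complex \<Rightarrow> ((nat \<Rightarrow> complex) \<Rightarrow> complex) \<Rightarrow> (nat \<Rightarrow> complex) \<Rightarrow> complex"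
  where "partial_deriv i c f z =
    vector_derivative (\<lambda>t::real. f (z(i := z i + of_real t * c))) (at 0)"

definition iter_partial ::
  "(nat \<times> complex) list \<Rightarrow> ((nat \<Rightarrow> complex) \<Rightarrow> complex) \<Rightarrow> (nat \<Rightarrow> complex) \<Rightarrow> complex"
  where "iter_partial ds f = foldr (\<lambda>(i, c). partial_deriv i c) ds f"

definition polynomial_growth :: "nat \<Rightarrow> ((nat \<Rightarrow> complex) \<Rightarrow> complex) \<Rightarrow> bool"
  where "polynomial_growth k f \<longleftrightarrow>
    (\<exists>C N. \<forall>z. cmod (f z) \<le> C * (1 + (\<Sum>i<k. cmod (z i))) ^ N)"

definition smooth_poly_growth :: "nat \<Rightarrow> ((nat \<Rightarrow> complex) \<Rightarrow> complex) \<Rightarrow> bool"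
  where "smooth_poly_growth k f \<longleftrightarrow>
    (\<forall>z w. (\<forall>i<k. z i = w i) \<longrightarrow> f z = f w) \<and>
    (\<forall>ds \<in> lists ({..<k} \<times> {1, \<i>}).
      continuous_on UNIV (iter_partial ds f) \<and>
      polynomial_growth k (iter_partial ds f) \<and>
      (\<forall>(i, c) \<in> {..<k} \<times> {1, \<i>}. \<forall>z.
        (\<lambda>t::real. iter_partial ds f (z(i := z i + of_real t * c))) differentiable (at 0)))"

definition wirtinger ::
  "nat \<Rightarrow> ((nat \<Rightarrow> complex) \<Rightarrow> complex) \<Rightarrow> (nat \<Rightarrow> complex) \<Rightarrow> complex"
  where "wirtinger i f z = (partial_deriv i 1 f z - \<i> * partial_deriv i \<i> f z) / 2"

definition wirtinger_bar ::
  "nat \<Rightarrow> ((nat \<Rightarrow> complex) \<Rightarrow> complex) \<Rightarrow> (nat \<Rightarrow> complex) \<Rightarrow> complex"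
  where "wirtinger_bar i f z = (partial_deriv i 1 f z + \<i> * partial_deriv i \<i> f z) / 2"

definition cylinder_deriv :: "('h::real_inner cplx \<Rightarrow> 'w \<Rightarrow> complex) \<Rightarrow> nat \<Rightarrow> (nat \<Rightarrow> 'h cplx) \<Rightarrow>
    ((nat \<Rightarrow> complex) \<Rightarrow> complex) \<Rightarrow> nat \<Rightarrow> nat \<Rightarrow> 'w \<Rightarrow> 'h fock"
  where "cylinder_deriv Z k \<phi> f p q \<omega> = (\<Sum>is\<in>words {..<k} p. \<Sum>js\<in>words {..<k} q.
    foldr wirtinger is (foldr wirtinger_bar js f) (\<lambda>i. Z (\<phi> i) \<omega>) *\<^sub>F
      pure_tensor (map \<phi> is @ map (\<lambda>j. cconj (\<phi> j)) js))"

text \<open>\<open>smooth_functional Z F T\<close>: the random variable F is smooth, and \<open>T p q\<close> is the derivative of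
  F obtained by applying q times the conjugate derivative and then p times the derivative.\<close>

definition smooth_functional :: "('h::real_inner cplx \<Rightarrow> 'w \<Rightarrow> complex) \<Rightarrow> ('w \<Rightarrow> complex) \<Rightarrow>
    (nat \<Rightarrow> nat \<Rightarrow> 'w \<Rightarrow> 'h fock) \<Rightarrow> bool"
  where "smooth_functional Z F T \<longleftrightarrow> (\<exists>k \<phi> f. k \<ge> 1 \<and> smooth_poly_growth k f \<and>
    F = (\<lambda>\<omega>. f (\<lambda>i. Z (\<phi> i) \<omega>)) \<and> T = cylinder_deriv Z k \<phi> f)"

text \<open>The graph of the closure of the derivative of order (p, q), and the derivative itself. As with the integral
  above, only its class modulo almost sure equality is determined.\<close>

definition malliavin_graph :: "'w measure \<Rightarrow>
    ('h::{real_inner, second_countable_topology} cplx \<Rightarrow> 'w \<Rightarrow> complex) \<Rightarrow>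
    nat \<Rightarrow> nat \<Rightarrow> ('w \<Rightarrow> complex) \<Rightarrow> ('w \<Rightarrow> 'h fock) \<Rightarrow> bool"
  where "malliavin_graph M Z p q F G \<longleftrightarrow> F \<in> L2_space M \<and> G \<in> L2_space M \<and>
    (\<exists>(S :: nat \<Rightarrow> 'w \<Rightarrow> complex) T. (\<forall>l. smooth_functional Z (S l) (T l)) \<and>
      L2_tendsto M S F sequentially \<and> L2_tendsto M (\<lambda>l. T l p q) G sequentially)"

definition malliavin :: "'w measure \<Rightarrow>
    ('h::{real_inner, second_countable_topology} cplx \<Rightarrow> 'w \<Rightarrow> complex) \<Rightarrow>
    nat \<Rightarrow> nat \<Rightarrow> ('w \<Rightarrow> complex) \<Rightarrow> 'w \<Rightarrow> 'h fock"
  where "malliavin M Z p q F = (SOME G. malliavin_graph M Z p q F G)"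

definition sobolev_norm :: "'w measure \<Rightarrow> nat \<Rightarrow> nat \<Rightarrow>
    (nat \<Rightarrow> nat \<Rightarrow> 'w \<Rightarrow> 'h::{real_inner, second_countable_topology} fock) \<Rightarrow> real"
  where "sobolev_norm M m n T = sqrt (\<Sum>i\<le>m. \<Sum>j\<le>n. \<integral>\<omega>. (norm (T i j \<omega>))\<^sup>2 \<partial>M)"

text \<open>The closure of the smooth random variables in the Sobolev seminorm: G collects the limits of
  the derivatives up to order (m, n), which by closability are the derivatives of F.\<close>

definition sobolev_space :: "'w measure \<Rightarrow>
    ('h::{real_inner, second_countable_topology} cplx \<Rightarrow> 'w \<Rightarrow> complex) \<Rightarrow>
    nat \<Rightarrow> nat \<Rightarrow> ('w \<Rightarrow> complex) set"
  where "sobolev_space M Z m n = {F \<in> L2_space M.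
    \<exists>(S :: nat \<Rightarrow> 'w \<Rightarrow> complex) T G. (\<forall>l. smooth_functional Z (S l) (T l)) \<and>
      (\<forall>i\<le>m. \<forall>j\<le>n. G i j \<in> L2_space M) \<and> L2_tendsto M S F sequentially \<and>
      (\<lambda>l. sobolev_norm M m n (\<lambda>i j \<omega>. T l i j \<omega> - G i j \<omega>)) \<longlonglongrightarrow> 0}"

end

theory Submission
  imports Defs
begin

text \<open>Tensors are compared only through numbers. A tensor of degree p + q is determined by its
  values on lists \<open>xs @ map cconj ys\<close> with entries of \<open>xs\<close> and
  \<open>ys\<close> in the basis, and both the kernel and the mean of the derivative are tied to the
  same number \<open>L2_inner M F (HP xs ys)\<close>: the mean equals it, the kernel equals it up to
  the factor p! q!, whence the constant of the formula. That factor arises because the pairing of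
  two Hermite products counts the pairs of permutations matching their lists, while
  \<open>basis_tensor\<close> averages over such pairs. Two features of the setting shape the
  details. The process is linear only almost surely, with a null set depending on the vectors, so
  each use of linearity is an almost everywhere argument for finitely or countably many vectors.
  Integral and derivative are chosen versions; all facts about them are derived from the graph
  relations, once these are known to have a solution. Integration by parts is real: Z is replaced by
  its real part, a real Gaussian process over the space regarded as a real Hilbert space, and the
  directions x and -i x are recombined at the end.\<close>

text \<open>
  For a vector x of the basis, Gaussian integration by parts shows that multiplication by Z x minus the
  conjugate derivative along x is adjoint to the derivative along x. Starting from the constant 1, this
  operator and its conjugate counterpart build the Hermite products, which are the integrals of the
  basis tensors. Hence the mean of the (p, q)-th derivative of a smooth F, evaluated at a basis tensor,
  is the inner product of F with the corresponding Hermite product. Both sides are continuous along an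
  approximating sequence, and the inner product with F also reads off the kernels of the chaos expansion.
  The expansion exists because the Hermite products are total: a random variable orthogonal to them is
  orthogonal to all characters of the Gaussian process, and so to all cylinder events.
\<close>

section \<open>Square integrable random variables\<close>

definition L2_sq :: "'w measure \<Rightarrow> ('w \<Rightarrow> 'b::real_normed_vector) \<Rightarrow> real"
  where "L2_sq M X = (\<integral>\<omega>. (norm (X \<omega>))\<^sup>2 \<partial>M)"

definition L2_inner :: "'w measure \<Rightarrow> ('w \<Rightarrow> complex) \<Rightarrow> ('w \<Rightarrow> complex) \<Rightarrow> complex"
  where "L2_inner M X Y = (\<integral>\<omega>. X \<omega> * cnj (Y \<omega>) \<partial>M)"

lemma L2_spaceD:
  assumes "X \<in> L2_space M"
  shows "X \<in> borel_measurable M" "integrable M (\<lambda>\<omega>. (norm (X \<omega>))\<^sup>2)"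
  using assms by (auto simp: L2_space_def)

lemma L2_spaceI:
  "X \<in> borel_measurable M \<Longrightarrow> integrable M (\<lambda>\<omega>. (norm (X \<omega>))\<^sup>2) \<Longrightarrow> X \<in> L2_space M"
  by (auto simp: L2_space_def)

lemma L2_sq_nonneg [simp]: "0 \<le> L2_sq M X"
  by (simp add: L2_sq_def)

lemma norm_add_power2_le: "(norm (x + y))\<^sup>2 \<le> 2 * (norm x)\<^sup>2 + 2 * (norm (y :: 'b::real_normed_vector))\<^sup>2"
proof -
  have "(norm (x + y))\<^sup>2 \<le> (norm x + norm y)\<^sup>2" by (intro power_mono norm_triangle_ineq) auto
  also have "\<dots> \<le> 2 * (norm x)\<^sup>2 + 2 * (norm y)\<^sup>2"
    using sum_squares_bound[of "norm x" "norm y"] by (simp add: power2_sum)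
  finally show ?thesis .
qed

lemma L2_zero [simp]: "(\<lambda>\<omega>. 0) \<in> L2_space M"
  by (simp add: L2_space_def)

lemma L2_add:
  assumes "X \<in> L2_space M" "Y \<in> L2_space M"
  shows "(\<lambda>\<omega>. X \<omega> + Y \<omega>) \<in> L2_space M"
proof (rule L2_spaceI)
  note [measurable] = L2_spaceD(1)[OF assms(1)] L2_spaceD(1)[OF assms(2)]
  show "(\<lambda>\<omega>. X \<omega> + Y \<omega>) \<in> borel_measurable M" by measurable
  show "integrable M (\<lambda>\<omega>. (norm (X \<omega> + Y \<omega>))\<^sup>2)"
    by (rule Bochner_Integration.integrable_bound[of _ "\<lambda>\<omega>. 2 * (norm (X \<omega>))\<^sup>2 + 2 * (norm (Y \<omega>))\<^sup>2"])
      (use assms in \<open>auto simp: norm_add_power2_le intro!: L2_spaceD(2)\<close>)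
qed

lemma L2_bounded_linear:
  fixes X :: "'w \<Rightarrow> 'b::{banach, second_countable_topology}"
  assumes "bounded_linear (f :: 'b \<Rightarrow> 'c::{banach, second_countable_topology})" "X \<in> L2_space M"
  shows "(\<lambda>\<omega>. f (X \<omega>)) \<in> L2_space M"
proof (rule L2_spaceI)
  interpret bounded_linear f by fact
  note [measurable] = L2_spaceD(1)[OF assms(2)] borel_measurable_continuous_onI[OF linear_continuous_on[OF assms(1)]]
  show "(\<lambda>\<omega>. f (X \<omega>)) \<in> borel_measurable M"
    by measurable
  obtain K where K: "\<And>x. norm (f x) \<le> norm x * K" using bounded by blast
  show "integrable M (\<lambda>\<omega>. (norm (f (X \<omega>)))\<^sup>2)"
  proof (rule Bochner_Integration.integrable_bound[of _ "\<lambda>\<omega>. K\<^sup>2 * (norm (X \<omega>))\<^sup>2"])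
    show "AE \<omega> in M. norm ((norm (f (X \<omega>)))\<^sup>2) \<le> norm (K\<^sup>2 * (norm (X \<omega>))\<^sup>2)"
      using K by (intro AE_I2) (auto simp: power_mult_distrib[symmetric] mult.commute intro!: power_mono)
  qed (use assms in \<open>auto dest: L2_spaceD(2)\<close>)
qed

lemma L2_cmult: "X \<in> L2_space M \<Longrightarrow> (\<lambda>\<omega>. c * X \<omega> :: complex) \<in> L2_space M"
  by (rule L2_bounded_linear[OF bounded_linear_mult_right])

lemma L2_uminus: "X \<in> L2_space M \<Longrightarrow> (\<lambda>\<omega>. - X \<omega>) \<in> L2_space M"
  by (rule L2_bounded_linear[OF bounded_linear_minus[OF bounded_linear_ident]])

lemma L2_diff: "X \<in> L2_space M \<Longrightarrow> Y \<in> L2_space M \<Longrightarrow> (\<lambda>\<omega>. X \<omega> - Y \<omega>) \<in> L2_space M"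
  using L2_add[OF _ L2_uminus, of X M Y] by simp

lemma L2_sum: "(\<And>i. i \<in> A \<Longrightarrow> X i \<in> L2_space M) \<Longrightarrow> (\<lambda>\<omega>. \<Sum>i\<in>A. X i \<omega>) \<in> L2_space M"
  by (induction A rule: infinite_finite_induct) (auto intro: L2_add)

lemma L2_cnj: "X \<in> L2_space M \<Longrightarrow> (\<lambda>\<omega>. cnj (X \<omega>)) \<in> L2_space M"
  by (rule L2_bounded_linear[OF bounded_linear_cnj])

lemma L2_integrable_mult:
  fixes X Y :: "'w \<Rightarrow> complex"
  assumes "X \<in> L2_space M" "Y \<in> L2_space M"
  shows "integrable M (\<lambda>\<omega>. X \<omega> * Y \<omega>)"
proof (rule Bochner_Integration.integrable_bound[of _ "\<lambda>\<omega>. (norm (X \<omega>))\<^sup>2 + (norm (Y \<omega>))\<^sup>2"])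
  show "AE \<omega> in M. norm (X \<omega> * Y \<omega>) \<le> norm ((norm (X \<omega>))\<^sup>2 + (norm (Y \<omega>))\<^sup>2)"
  proof (rule AE_I2)
    fix \<omega>
    show "norm (X \<omega> * Y \<omega>) \<le> norm ((norm (X \<omega>))\<^sup>2 + (norm (Y \<omega>))\<^sup>2)"
      using sum_squares_bound[of "norm (X \<omega>)" "norm (Y \<omega>)"] mult_nonneg_nonneg[of "norm (X \<omega>)" "norm (Y \<omega>)"]
      unfolding norm_mult real_norm_def by linarith
  qed
qed (use L2_spaceD[OF assms(1)] L2_spaceD[OF assms(2)] in \<open>auto intro: borel_measurable_times\<close>)

lemma L2_integrable_mult_cnj:
  "X \<in> L2_space M \<Longrightarrow> Y \<in> L2_space M \<Longrightarrow> integrable M (\<lambda>\<omega>. X \<omega> * cnj (Y \<omega>))"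
  by (rule L2_integrable_mult[OF _ L2_cnj])

lemma L2_inner_add_left:
  "X \<in> L2_space M \<Longrightarrow> Y \<in> L2_space M \<Longrightarrow> U \<in> L2_space M \<Longrightarrow>
    L2_inner M (\<lambda>\<omega>. X \<omega> + Y \<omega>) U = L2_inner M X U + L2_inner M Y U"
  by (simp add: L2_inner_def distrib_right L2_integrable_mult_cnj)

lemma L2_inner_diff_left:
  "X \<in> L2_space M \<Longrightarrow> Y \<in> L2_space M \<Longrightarrow> U \<in> L2_space M \<Longrightarrow>
    L2_inner M (\<lambda>\<omega>. X \<omega> - Y \<omega>) U = L2_inner M X U - L2_inner M Y U"
  by (simp add: L2_inner_def left_diff_distrib L2_integrable_mult_cnj)

lemma L2_inner_cmult_left: "L2_inner M (\<lambda>\<omega>. c * X \<omega>) U = c * L2_inner M X U"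
  by (simp add: L2_inner_def mult.assoc)

lemma L2_inner_commute: "L2_inner M Y X = cnj (L2_inner M X Y)"
proof -
  have "cnj (L2_inner M X Y) = (\<integral>\<omega>. cnj (X \<omega> * cnj (Y \<omega>)) \<partial>M)"
    unfolding L2_inner_def by (rule Bochner_Integration.integral_cnj[symmetric])
  then show ?thesis by (simp add: L2_inner_def mult.commute)
qed

lemma L2_inner_cmult_right: "L2_inner M U (\<lambda>\<omega>. c * X \<omega>) = cnj c * L2_inner M U X"
  by (subst (1 2) L2_inner_commute) (simp add: L2_inner_cmult_left)

lemma L2_inner_add_right:
  "X \<in> L2_space M \<Longrightarrow> Y \<in> L2_space M \<Longrightarrow> U \<in> L2_space M \<Longrightarrow>
    L2_inner M U (\<lambda>\<omega>. X \<omega> + Y \<omega>) = L2_inner M U X + L2_inner M U Y"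
  by (subst (1 2 3) L2_inner_commute) (simp add: L2_inner_add_left)

lemma L2_inner_diff_right:
  "X \<in> L2_space M \<Longrightarrow> Y \<in> L2_space M \<Longrightarrow> U \<in> L2_space M \<Longrightarrow>
    L2_inner M U (\<lambda>\<omega>. X \<omega> - Y \<omega>) = L2_inner M U X - L2_inner M U Y"
  by (subst (1 2 3) L2_inner_commute) (simp add: L2_inner_diff_left)

lemma L2_inner_zero [simp]: "L2_inner M (\<lambda>\<omega>. 0) U = 0" "L2_inner M U (\<lambda>\<omega>. 0) = 0"
  by (simp_all add: L2_inner_def)

lemma L2_inner_sum_left:
  "(\<And>i. i \<in> A \<Longrightarrow> X i \<in> L2_space M) \<Longrightarrow> U \<in> L2_space M \<Longrightarrow>
    L2_inner M (\<lambda>\<omega>. \<Sum>i\<in>A. X i \<omega>) U = (\<Sum>i\<in>A. L2_inner M (X i) U)"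
  by (induction A rule: infinite_finite_induct) (auto simp: L2_inner_add_left L2_sum)

lemma L2_inner_sum_right:
  "(\<And>i. i \<in> A \<Longrightarrow> X i \<in> L2_space M) \<Longrightarrow> U \<in> L2_space M \<Longrightarrow>
    L2_inner M U (\<lambda>\<omega>. \<Sum>i\<in>A. X i \<omega>) = (\<Sum>i\<in>A. L2_inner M U (X i))"
  by (induction A rule: infinite_finite_induct) (auto simp: L2_inner_add_right L2_sum)

lemma L2_inner_self: "L2_inner M X X = of_real (L2_sq M X)"
  by (simp add: L2_inner_def L2_sq_def complex_norm_square[symmetric] del: of_real_power)

lemma L2_sq_commute: "L2_sq M (\<lambda>\<omega>. X \<omega> - Y \<omega>) = L2_sq M (\<lambda>\<omega>. Y \<omega> - X \<omega>)"
  by (simp add: L2_sq_def norm_minus_commute)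

lemma L2_sq_diff:
  fixes X Y :: "'w \<Rightarrow> complex"
  assumes "X \<in> L2_space M" "Y \<in> L2_space M"
  shows "L2_sq M (\<lambda>\<omega>. X \<omega> - Y \<omega>) = L2_sq M X - 2 * Re (L2_inner M X Y) + L2_sq M Y"
proof -
  have "of_real (L2_sq M (\<lambda>\<omega>. X \<omega> - Y \<omega>)) =
      of_real (L2_sq M X) - L2_inner M X Y - cnj (L2_inner M X Y) + of_real (L2_sq M Y)"
    using assms by (simp flip: L2_inner_self L2_inner_commute[of M Y X]
        add: L2_inner_diff_left L2_inner_diff_right L2_diff)
  from arg_cong[OF this, of Re] show ?thesis by simp
qed

text \<open>Cauchy-Schwarz from a nonnegative quadratic in t: Y is scaled by t times the inner
  product c itself, which makes the cross term real. If Y has positive norm, the minimizer t = 1 /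
  \<open>L2_sq M Y\<close> gives the claim.\<close>

lemma L2_inner_bound:
  assumes "X \<in> L2_space M" "Y \<in> L2_space M"
  shows "(cmod (L2_inner M X Y))\<^sup>2 \<le> L2_sq M X * L2_sq M Y"
proof -
  define c where "c = L2_inner M X Y"
  have *: "0 \<le> L2_sq M X - 2 * t * (cmod c)\<^sup>2 + t\<^sup>2 * (cmod c)\<^sup>2 * L2_sq M Y" for t :: real
  proof -
    have "0 \<le> L2_sq M (\<lambda>\<omega>. X \<omega> - (of_real t * c) * Y \<omega>)" by simp
    also have "\<dots> = L2_sq M X - 2 * Re (cnj (of_real t * c) * c) + L2_sq M (\<lambda>\<omega>. (of_real t * c) * Y \<omega>)"
      unfolding L2_sq_diff[OF assms(1) L2_cmult[OF assms(2)]] L2_inner_cmult_right c_def ..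
    also have "L2_sq M (\<lambda>\<omega>. (of_real t * c) * Y \<omega>) = t\<^sup>2 * (cmod c)\<^sup>2 * L2_sq M Y"
      by (simp add: L2_sq_def norm_mult power_mult_distrib)
    also have "Re (cnj (of_real t * c) * c) = t * (cmod c)\<^sup>2"
      by (simp add: cmod_def power2_eq_square algebra_simps)
    finally show ?thesis by simp
  qed
  show ?thesis
  proof (cases "L2_sq M Y = 0")
    case True
    have "(cmod c)\<^sup>2 = 0"
    proof (rule ccontr)
      assume "(cmod c)\<^sup>2 \<noteq> 0"
      then have p: "(cmod c)\<^sup>2 > 0" by simp
      \<comment> \<open>The quadratic is affine here, and this t gives it the value -1.\<close>
      show False using *[of "(L2_sq M X + 1) / (2 * (cmod c)\<^sup>2)"] p by (simp add: True field_simps)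
    qed
    then show ?thesis by (simp add: True c_def)
  next
    case False
    then have p: "L2_sq M Y > 0" using L2_sq_nonneg[of M Y] by linarith
    show ?thesis using *[of "1 / L2_sq M Y"] p
      by (simp add: c_def[symmetric] field_simps power2_eq_square)
  qed
qed

lemma L2_inner_bound_sqrt:
  assumes "X \<in> L2_space M" "Y \<in> L2_space M"
  shows "cmod (L2_inner M X Y) \<le> sqrt (L2_sq M X) * sqrt (L2_sq M Y)"
  using L2_inner_bound[OF assms] by (simp add: real_le_rsqrt flip: real_sqrt_mult)

text \<open>\<open>L2_tendsto\<close> uses an extended nonnegative integral, because a Bochner
  integral would assign 0 to differences that are not square integrable. Within L2 the two
  agree.\<close>

lemma L2_tendsto_iff:
  assumes "\<forall>\<^sub>F i in F. X i \<in> L2_space M" "Y \<in> L2_space M"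
  shows "L2_tendsto M X Y F \<longleftrightarrow> ((\<lambda>i. L2_sq M (\<lambda>\<omega>. X i \<omega> - Y \<omega>)) \<longlongrightarrow> 0) F"
proof -
  have "\<forall>\<^sub>F i in F. (\<integral>\<^sup>+\<omega>. ennreal ((norm (X i \<omega> - Y \<omega>))\<^sup>2) \<partial>M) = ennreal (L2_sq M (\<lambda>\<omega>. X i \<omega> - Y \<omega>))"
    using assms(1)
  proof eventually_elim
    case (elim i)
    then show ?case unfolding L2_sq_def
      using L2_diff[OF elim assms(2)] by (intro nn_integral_eq_integral) (auto dest: L2_spaceD(2))
  qed
  then have "L2_tendsto M X Y F \<longleftrightarrow> ((\<lambda>i. ennreal (L2_sq M (\<lambda>\<omega>. X i \<omega> - Y \<omega>))) \<longlongrightarrow> ennreal 0) F"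
    unfolding L2_tendsto_def ennreal_0 by (rule tendsto_cong)
  also have "\<dots> \<longleftrightarrow> ((\<lambda>i. L2_sq M (\<lambda>\<omega>. X i \<omega> - Y \<omega>)) \<longlongrightarrow> 0) F"
    by (rule tendsto_ennreal_iff) auto
  finally show ?thesis .
qed

lemma L2_inner_tendsto:
  assumes X: "\<forall>\<^sub>F i in F. X i \<in> L2_space M" and Y: "Y \<in> L2_space M" and U: "U \<in> L2_space M"
    and lim: "L2_tendsto M X Y F"
  shows "((\<lambda>i. L2_inner M (X i) U) \<longlongrightarrow> L2_inner M Y U) F"
proof -
  define d where "d i = L2_sq M (\<lambda>\<omega>. X i \<omega> - Y \<omega>)" for i
  have "(d \<longlongrightarrow> 0) F"
    using lim L2_tendsto_iff[OF X Y] unfolding d_def[abs_def] by simp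
  then have "((\<lambda>i. sqrt (d i) * sqrt (L2_sq M U)) \<longlongrightarrow> sqrt 0 * sqrt (L2_sq M U)) F"
    by (intro tendsto_mult tendsto_real_sqrt tendsto_const)
  then have 1: "((\<lambda>i. sqrt (d i) * sqrt (L2_sq M U)) \<longlongrightarrow> 0) F" by simp
  have 2: "\<forall>\<^sub>F i in F. norm (L2_inner M (X i) U - L2_inner M Y U) \<le> sqrt (d i) * sqrt (L2_sq M U)"
    using X
  proof eventually_elim
    case (elim i)
    have "L2_inner M (X i) U - L2_inner M Y U = L2_inner M (\<lambda>\<omega>. X i \<omega> - Y \<omega>) U"
      by (rule L2_inner_diff_left[OF elim Y U, symmetric])
    then show ?case
      using L2_inner_bound_sqrt[OF L2_diff[OF elim Y] U] by (simp add: d_def)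
  qed
  show ?thesis by (rule LIM_zero_cancel[OF Lim_null_comparison[OF 2 1]])
qed

text \<open>The expansion of the squared distance is solved for the squared norm of X i; every other
  term has a known limit.\<close>

lemma L2_sq_tendsto:
  fixes Y :: "'w \<Rightarrow> complex"
  assumes "\<And>i. X i \<in> L2_space M" "Y \<in> L2_space M" "L2_tendsto M X Y F"
  shows "((\<lambda>i. L2_sq M (X i)) \<longlongrightarrow> L2_sq M Y) F"
proof -
  have "((\<lambda>i. L2_sq M (\<lambda>\<omega>. X i \<omega> - Y \<omega>) + 2 * Re (L2_inner M (X i) Y) - L2_sq M Y)
      \<longlongrightarrow> 0 + 2 * Re (L2_inner M Y Y) - L2_sq M Y) F"
    using assms(3) L2_tendsto_iff[of X M F Y] assms(1,2)
    by (intro tendsto_diff tendsto_add tendsto_mult tendsto_const tendsto_Re L2_inner_tendsto) auto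
  then show ?thesis using assms(1,2) by (simp add: L2_sq_diff L2_inner_self)
qed

lemma (in prob_space) L2_integrable:
  assumes "X \<in> L2_space M"
  shows "integrable M X"
proof (rule Bochner_Integration.integrable_bound[of _ "\<lambda>\<omega>. (norm (X \<omega>))\<^sup>2 + 1"])
  have "x \<le> x\<^sup>2 + 1" for x :: real
    using zero_le_power2[of "x - 1/2"] by (simp add: power2_diff power2_eq_square field_simps)
  then show "AE \<omega> in M. norm (X \<omega>) \<le> norm ((norm (X \<omega>))\<^sup>2 + 1)" by simp
qed (use assms in \<open>auto dest: L2_spaceD\<close>)

text \<open>This is the nonnegativity of the variance of the norm of X.\<close>

lemma (in prob_space) integral_power2_le:
  fixes X :: "'a \<Rightarrow> 'b::{banach, second_countable_topology}"
  assumes "X \<in> L2_space M"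
  shows "(\<integral>\<omega>. norm (X \<omega>) \<partial>M) \<le> sqrt (L2_sq M X)"
proof (rule real_le_rsqrt)
  have "integrable M (\<lambda>\<omega>. norm (X \<omega>))" using L2_integrable[OF assms] by simp
  then have "0 \<le> expectation (\<lambda>\<omega>. (norm (X \<omega>) - expectation (\<lambda>\<omega>. norm (X \<omega>)))\<^sup>2)" by simp
  also have "\<dots> = expectation (\<lambda>\<omega>. (norm (X \<omega>))\<^sup>2) - (expectation (\<lambda>\<omega>. norm (X \<omega>)))\<^sup>2"
    using L2_integrable[OF assms] assms by (intro variance_eq) (auto dest: L2_spaceD)
  finally show "(\<integral>\<omega>. norm (X \<omega>) \<partial>M)\<^sup>2 \<le> L2_sq M X" by (simp add: L2_sq_def)
qed

text \<open>Riesz-Fischer: on a probability space the sequence is also Cauchy in L1, so some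
  subsequence converges almost surely. Its limit is the candidate, and Fatou's lemma turns the
  Cauchy bound into a bound on the distance to it.\<close>

lemma (in prob_space) L2_complete:
  fixes X :: "nat \<Rightarrow> 'a \<Rightarrow> complex"
  assumes X: "\<And>n. X n \<in> L2_space M"
    and Cauchy: "\<And>e. e > 0 \<Longrightarrow> \<exists>N. \<forall>m\<ge>N. \<forall>n\<ge>N. L2_sq M (\<lambda>\<omega>. X m \<omega> - X n \<omega>) < e"
  shows "\<exists>Y\<in>L2_space M. L2_tendsto M X Y sequentially"
proof -
  note [measurable] = L2_spaceD(1)[OF X]
  have "\<exists>N. \<forall>i\<ge>N. \<forall>j\<ge>N. (\<integral>\<omega>. norm (X i \<omega> - X j \<omega>) \<partial>M) < e" if "e > 0" for e
  proof -
    obtain N where N: "\<And>m n. m \<ge> N \<Longrightarrow> n \<ge> N \<Longrightarrow> L2_sq M (\<lambda>\<omega>. X m \<omega> - X n \<omega>) < e\<^sup>2"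
      using Cauchy[OF zero_less_power[OF \<open>e > 0\<close>, of 2]] by blast
    have "(\<integral>\<omega>. norm (X i \<omega> - X j \<omega>) \<partial>M) < e" if "i \<ge> N" "j \<ge> N" for i j
    proof (rule le_less_trans[OF integral_power2_le[OF L2_diff[OF X X]]])
      show "sqrt (L2_sq M (\<lambda>\<omega>. X i \<omega> - X j \<omega>)) < e"
        using N[OF that] \<open>e > 0\<close> by (intro real_less_lsqrt) auto
    qed
    then show ?thesis by blast
  qed
  then obtain r where r: "strict_mono r" and ae: "AE \<omega> in M. Cauchy (\<lambda>i. X (r i) \<omega>)"
    using cauchy_L1_AE_cauchy_subseq[of M X] L2_integrable[OF X] by blast
  define Y where "Y \<omega> = lim (\<lambda>i. X (r i) \<omega>)" for \<omega>
  have [measurable]: "Y \<in> borel_measurable M" unfolding Y_def by measurable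
  have conv: "AE \<omega> in M. (\<lambda>i. X (r i) \<omega>) \<longlonglongrightarrow> Y \<omega>"
    using ae by eventually_elim (simp add: Y_def Cauchy_convergent_iff convergent_LIMSEQ_iff)
  \<comment> \<open>Only the second index runs along the subsequence, so the bound holds for every n
    beyond N and the whole sequence converges.\<close>
  have fatou: "(\<integral>\<^sup>+\<omega>. ennreal ((norm (X n \<omega> - Y \<omega>))\<^sup>2) \<partial>M) \<le> ennreal e"
    if e: "e > 0" and N: "\<And>m n. m \<ge> N \<Longrightarrow> n \<ge> N \<Longrightarrow> L2_sq M (\<lambda>\<omega>. X m \<omega> - X n \<omega>) < e" and n: "n \<ge> N"
    for n N e
  proof -
    have "(\<integral>\<^sup>+\<omega>. ennreal ((norm (X n \<omega> - Y \<omega>))\<^sup>2) \<partial>M)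
        = (\<integral>\<^sup>+\<omega>. liminf (\<lambda>i. ennreal ((norm (X n \<omega> - X (r i) \<omega>))\<^sup>2)) \<partial>M)"
    proof (rule nn_integral_cong_AE)
      show "AE \<omega> in M. ennreal ((norm (X n \<omega> - Y \<omega>))\<^sup>2) = liminf (\<lambda>i. ennreal ((norm (X n \<omega> - X (r i) \<omega>))\<^sup>2))"
        using conv
      proof eventually_elim
        case (elim \<omega>)
        have "(\<lambda>i. ennreal ((norm (X n \<omega> - X (r i) \<omega>))\<^sup>2)) \<longlonglongrightarrow> ennreal ((norm (X n \<omega> - Y \<omega>))\<^sup>2)"
          by (intro tendsto_intros tendsto_ennrealI elim)
        then show ?case by (rule lim_imp_Liminf[OF sequentially_bot, symmetric])
      qed
    qed
    also have "\<dots> \<le> liminf (\<lambda>i. \<integral>\<^sup>+\<omega>. ennreal ((norm (X n \<omega> - X (r i) \<omega>))\<^sup>2) \<partial>M)"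
      by (rule nn_integral_liminf) measurable
    also have "\<dots> \<le> liminf (\<lambda>i. ennreal e)"
    proof (rule Liminf_mono)
      show "\<forall>\<^sub>F i in sequentially. (\<integral>\<^sup>+\<omega>. ennreal ((norm (X n \<omega> - X (r i) \<omega>))\<^sup>2) \<partial>M) \<le> ennreal e"
        using eventually_ge_at_top[of N]
      proof eventually_elim
        case (elim i)
        then have "r i \<ge> N" using seq_suble[OF r, of i] by linarith
        have "(\<integral>\<^sup>+\<omega>. ennreal ((norm (X n \<omega> - X (r i) \<omega>))\<^sup>2) \<partial>M) = ennreal (L2_sq M (\<lambda>\<omega>. X n \<omega> - X (r i) \<omega>))"
          unfolding L2_sq_def using L2_spaceD(2)[OF L2_diff[OF X X]] by (intro nn_integral_eq_integral) auto
        then show ?case using N[OF n \<open>r i \<ge> N\<close>] by (simp add: ennreal_leI)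
      qed
    qed
    also have "\<dots> = ennreal e" by (simp add: Liminf_const)
    finally show ?thesis .
  qed
  have "Y \<in> L2_space M"
  proof -
    obtain N where N: "\<And>m n. m \<ge> N \<Longrightarrow> n \<ge> N \<Longrightarrow> L2_sq M (\<lambda>\<omega>. X m \<omega> - X n \<omega>) < 1"
      using Cauchy[of 1] by auto
    have "(\<integral>\<^sup>+\<omega>. ennreal ((norm (X N \<omega> - Y \<omega>))\<^sup>2) \<partial>M) \<le> 1"
      using fatou[of 1 N N] N by simp
    then have "integrable M (\<lambda>\<omega>. (norm (X N \<omega> - Y \<omega>))\<^sup>2)"
      by (intro integrableI_bounded) (auto simp: top.extremum_strict le_less_trans)
    then have "(\<lambda>\<omega>. X N \<omega> - Y \<omega>) \<in> L2_space M" by (intro L2_spaceI) auto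
    from L2_diff[OF X[of N] this] show ?thesis by simp
  qed
  moreover have "L2_tendsto M X Y sequentially"
    unfolding L2_tendsto_def
  proof (rule tendsto_zero_ennreal)
    fix e :: real assume e: "e > 0"
    obtain N where N: "\<And>m n. m \<ge> N \<Longrightarrow> n \<ge> N \<Longrightarrow> L2_sq M (\<lambda>\<omega>. X m \<omega> - X n \<omega>) < e / 2"
      using Cauchy[of "e / 2"] e by auto
    show "\<forall>\<^sub>F n in sequentially. (\<integral>\<^sup>+\<omega>. ennreal ((norm (X n \<omega> - Y \<omega>))\<^sup>2) \<partial>M) < ennreal e"
      using eventually_ge_at_top[of N]
    proof eventually_elim
      case (elim n)
      have "(\<integral>\<^sup>+\<omega>. ennreal ((norm (X n \<omega> - Y \<omega>))\<^sup>2) \<partial>M) \<le> ennreal (e / 2)"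
        using fatou[of "e / 2" N n] N e elim by simp
      also have "\<dots> < ennreal e" using e by (simp add: ennreal_less_iff)
      finally show ?case .
    qed
  qed
  ultimately show ?thesis by blast
qed

section \<open>Uniqueness of Fourier transforms\<close>

lemma borel_measurable_cnj [measurable]: "cnj \<in> borel_measurable borel"
  by (intro borel_measurable_continuous_onI continuous_intros)

text \<open>Weighting M by the positive and by the negative part of f gives two laws of X, which
  after normalization have the same characteristic function. Levy's uniqueness theorem identifies
  them.\<close>

lemma (in prob_space) fourier_unique_real:
  fixes f X :: "'a \<Rightarrow> real"
  assumes f: "integrable M f" and [measurable]: "X \<in> borel_measurable M"
    and zero: "\<And>t. (\<integral>\<omega>. f \<omega> *\<^sub>R iexp (t * X \<omega>) \<partial>M) = 0" and [measurable]: "A \<in> sets borel"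
  shows "(\<integral>\<omega>. indicator A (X \<omega>) * f \<omega> \<partial>M) = 0"
proof -
  have [measurable]: "f \<in> borel_measurable M" using f by simp
  define p n where "p \<omega> = max (f \<omega>) 0" and "n \<omega> = max (- f \<omega>) 0" for \<omega>
  have [measurable]: "p \<in> borel_measurable M" "n \<in> borel_measurable M"
    unfolding p_def[abs_def] n_def[abs_def] by measurable
  have int: "integrable M p" "integrable M n" unfolding p_def[abs_def] n_def[abs_def] using f by auto
  have nn: "0 \<le> p \<omega>" "0 \<le> n \<omega>" for \<omega> by (auto simp: p_def n_def)
  have fpn: "f \<omega> = p \<omega> - n \<omega>" for \<omega> by (auto simp: p_def n_def)
  have inte: "integrable M (\<lambda>\<omega>. g \<omega> *\<^sub>R iexp (t * X \<omega>))" if "integrable M g" for g t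
    by (rule Bochner_Integration.integrable_bound[OF that]) (use that in auto)
  have inti: "integrable M (\<lambda>\<omega>. indicator A (X \<omega>) * g \<omega>)" if "integrable M g" for g :: "'a \<Rightarrow> real"
    by (rule Bochner_Integration.integrable_bound[OF that]) (use that in \<open>auto split: split_indicator\<close>)
  have eq: "(\<integral>\<omega>. p \<omega> *\<^sub>R iexp (t * X \<omega>) \<partial>M) = (\<integral>\<omega>. n \<omega> *\<^sub>R iexp (t * X \<omega>) \<partial>M)" for t
    using zero[of t] inte[OF int(1), of t] inte[OF int(2), of t]
    by (simp add: fpn scaleR_diff_left)
  define m where "m = (\<integral>\<omega>. p \<omega> \<partial>M)"
  \<comment> \<open>The frequency t = 0 shows that both parts have the same mass m, so one constant
    normalizes both. If m = 0, then f vanishes almost surely.\<close>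
  have "complex_of_real (\<integral>\<omega>. p \<omega> \<partial>M) = complex_of_real (\<integral>\<omega>. n \<omega> \<partial>M)"
    using eq[of 0] by (simp add: scaleR_conv_of_real)
  then have m: "(\<integral>\<omega>. p \<omega> \<partial>M) = m" "(\<integral>\<omega>. n \<omega> \<partial>M) = m" by (simp_all add: m_def)
  show ?thesis
  proof (cases "m = 0")
    case True
    have "AE \<omega> in M. p \<omega> = 0" "AE \<omega> in M. n \<omega> = 0"
      using m True integral_nonneg_eq_0_iff_AE[OF int(1)] integral_nonneg_eq_0_iff_AE[OF int(2)] nn by auto
    then have "AE \<omega> in M. indicator A (X \<omega>) * f \<omega> = 0" by eventually_elim (simp add: fpn)
    then show ?thesis by (rule integral_eq_zero_AE)
  next
    case False
    then have m0: "m > 0" using m(1) nn Bochner_Integration.integral_nonneg[of M p] by fastforce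
    define D where "D g = distr (density M (\<lambda>\<omega>. ennreal (g \<omega> / m))) borel X" for g :: "'a \<Rightarrow> real"
    have D_int: "(\<integral>x. h x \<partial>D g) = (\<integral>\<omega>. (g \<omega> / m) *\<^sub>R h (X \<omega>) \<partial>M)"
      if [measurable]: "g \<in> borel_measurable M" "h \<in> borel_measurable borel" and "\<And>\<omega>. 0 \<le> g \<omega>"
      for g and h :: "real \<Rightarrow> 'z::{banach, second_countable_topology}"
      unfolding D_def using m0 that by (subst integral_distr) (auto simp: integral_density)
    have rd: "real_distribution (D g)"
      if [measurable]: "g \<in> borel_measurable M" and g: "integrable M g" "(\<integral>\<omega>. g \<omega> \<partial>M) = m" "\<And>\<omega>. 0 \<le> g \<omega>" for g
    proof -
      have "prob_space (density M (\<lambda>\<omega>. ennreal (g \<omega> / m)))"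
      proof (rule prob_spaceI)
        have "emeasure (density M (\<lambda>\<omega>. ennreal (g \<omega> / m))) (space M) = (\<integral>\<^sup>+\<omega>. ennreal (g \<omega> / m) \<partial>M)"
          by (simp add: emeasure_density nn_integral_set_ennreal)
        also have "\<dots> = ennreal (\<integral>\<omega>. g \<omega> / m \<partial>M)"
          using g m0 by (intro nn_integral_eq_integral) auto
        also have "\<dots> = 1" using g m0 by simp
        finally show "emeasure (density M (\<lambda>\<omega>. ennreal (g \<omega> / m))) (space (density M (\<lambda>\<omega>. ennreal (g \<omega> / m)))) = 1"
          by simp
      qed
      then show ?thesis
        unfolding D_def by (intro prob_space.real_distribution_distr) auto
    qed
    have "char (D p) = char (D n)"
    proof
      fix t
      have "char (D g) t = (\<integral>\<omega>. g \<omega> *\<^sub>R iexp (t * X \<omega>) \<partial>M) / of_real m"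
        if [measurable]: "g \<in> borel_measurable M" and "\<And>\<omega>. 0 \<le> g \<omega>" for g
      proof -
        have "char (D g) t = (\<integral>\<omega>. (g \<omega> / m) *\<^sub>R iexp (t * X \<omega>) \<partial>M)"
          unfolding char_def using that by (subst D_int) auto
        also have "\<dots> = (\<integral>\<omega>. (g \<omega> *\<^sub>R iexp (t * X \<omega>)) / of_real m \<partial>M)"
          by (intro Bochner_Integration.integral_cong) (simp_all add: scaleR_conv_of_real)
        finally show ?thesis by simp
      qed
      then show "char (D p) t = char (D n) t" using nn eq by simp
    qed
    then have "D p = D n" using nn int m by (intro Levy_uniqueness rd) auto
    then have "(\<integral>x. indicat_real A x \<partial>D p) = (\<integral>x. indicat_real A x \<partial>D n)" by simp
    then have "(\<integral>\<omega>. p \<omega> / m * indicator A (X \<omega>) \<partial>M) = (\<integral>\<omega>. n \<omega> / m * indicator A (X \<omega>) \<partial>M)"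
      using nn D_int[of p "indicat_real A"] D_int[of n "indicat_real A"] by simp
    then have "(\<integral>\<omega>. indicator A (X \<omega>) * p \<omega> \<partial>M) = (\<integral>\<omega>. indicator A (X \<omega>) * n \<omega> \<partial>M)"
      using m0 by (simp add: mult.commute)
    then show ?thesis
      using inti[OF int(1)] inti[OF int(2)] by (simp add: fpn right_diff_distrib)
  qed
qed

text \<open>Conjugation together with t replaced by -t transfers the hypothesis to
  \<open>cnj R\<close>, hence to the real and imaginary parts of R separately, which the real case
  settles.\<close>

lemma (in prob_space) fourier_unique:
  fixes R :: "'a \<Rightarrow> complex" and X :: "'a \<Rightarrow> real"
  assumes R: "integrable M R" and X[measurable]: "X \<in> borel_measurable M"
    and zero: "\<And>t. (\<integral>\<omega>. R \<omega> * iexp (t * X \<omega>) \<partial>M) = 0" and A[measurable]: "A \<in> sets borel"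
  shows "(\<integral>\<omega>. R \<omega> * indicator A (X \<omega>) \<partial>M) = 0"
proof -
  have [measurable]: "R \<in> borel_measurable M" using R by simp
  have int: "integrable M (\<lambda>\<omega>. R \<omega> * iexp (t * X \<omega>))" for t
    by (rule Bochner_Integration.integrable_bound[OF R]) (auto simp: norm_mult)
  have int_cnj: "integrable M (\<lambda>\<omega>. cnj (R \<omega>) * iexp (t * X \<omega>))" for t
    by (rule Bochner_Integration.integrable_bound[OF R]) (auto simp: norm_mult)
  have cnj0: "(\<integral>\<omega>. cnj (R \<omega>) * iexp (t * X \<omega>) \<partial>M) = 0" for t
  proof -
    have "(\<integral>\<omega>. cnj (R \<omega>) * iexp (t * X \<omega>) \<partial>M) = (\<integral>\<omega>. cnj (R \<omega> * iexp (- t * X \<omega>)) \<partial>M)"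
      by (intro Bochner_Integration.integral_cong) (simp_all add: exp_cnj)
    also have "\<dots> = 0" unfolding Bochner_Integration.integral_cnj zero by simp
    finally show ?thesis .
  qed
  have Re0: "(\<integral>\<omega>. Re (R \<omega>) *\<^sub>R iexp (t * X \<omega>) \<partial>M) = 0" for t
  proof -
    have "(\<integral>\<omega>. Re (R \<omega>) *\<^sub>R iexp (t * X \<omega>) \<partial>M)
        = (\<integral>\<omega>. (R \<omega> * iexp (t * X \<omega>) + cnj (R \<omega>) * iexp (t * X \<omega>)) / 2 \<partial>M)"
      by (intro Bochner_Integration.integral_cong refl)
        (simp add: scaleR_conv_of_real complex_eq_iff algebra_simps)
    also have "\<dots> = 0" using int[of t] int_cnj[of t] zero[of t] cnj0[of t] by simp
    finally show ?thesis .
  qed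
  have Im0: "(\<integral>\<omega>. Im (R \<omega>) *\<^sub>R iexp (t * X \<omega>) \<partial>M) = 0" for t
  proof -
    have "(\<integral>\<omega>. Im (R \<omega>) *\<^sub>R iexp (t * X \<omega>) \<partial>M)
        = (\<integral>\<omega>. (R \<omega> * iexp (t * X \<omega>) - cnj (R \<omega>) * iexp (t * X \<omega>)) / (2 * \<i>) \<partial>M)"
      by (intro Bochner_Integration.integral_cong refl)
        (simp add: scaleR_conv_of_real complex_eq_iff algebra_simps Re_divide Im_divide power2_eq_square)
    also have "\<dots> = 0" using int[of t] int_cnj[of t] zero[of t] cnj0[of t] by simp
    finally show ?thesis .
  qed
  have intA: "integrable M (\<lambda>\<omega>. R \<omega> * indicator A (X \<omega>))"
    by (rule Bochner_Integration.integrable_bound[OF R]) (auto simp: norm_mult split: split_indicator)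
  have "Re (\<integral>\<omega>. R \<omega> * indicator A (X \<omega>) \<partial>M) = (\<integral>\<omega>. Re (R \<omega> * indicator A (X \<omega>)) \<partial>M)"
    by (rule integral_Re[OF intA, symmetric])
  also have "\<dots> = (\<integral>\<omega>. indicator A (X \<omega>) * Re (R \<omega>) \<partial>M)"
    by (intro Bochner_Integration.integral_cong refl) (simp split: split_indicator)
  also have "\<dots> = 0" using R Re0 by (intro fourier_unique_real) auto
  finally have 1: "Re (\<integral>\<omega>. R \<omega> * indicator A (X \<omega>) \<partial>M) = 0" .
  have "Im (\<integral>\<omega>. R \<omega> * indicator A (X \<omega>) \<partial>M) = (\<integral>\<omega>. Im (R \<omega> * indicator A (X \<omega>)) \<partial>M)"
    by (rule integral_Im[OF intA, symmetric])
  also have "\<dots> = (\<integral>\<omega>. indicator A (X \<omega>) * Im (R \<omega>) \<partial>M)"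
    by (intro Bochner_Integration.integral_cong refl) (simp split: split_indicator)
  also have "\<dots> = 0" using R Im0 by (intro fourier_unique_real) auto
  finally show ?thesis using 1 by (simp add: complex_eq_iff)
qed

section \<open>Finite-dimensional cylinders and the sigma algebra they generate\<close>

definition cylinder :: "'w measure \<Rightarrow> ('i \<Rightarrow> 'w \<Rightarrow> real) \<Rightarrow> ('i \<times> real set) list \<Rightarrow> 'w set"
  where "cylinder M W xs = {\<omega> \<in> space M. \<forall>(h, A)\<in>set xs. W h \<omega> \<in> A}"

definition cylinders :: "'w measure \<Rightarrow> ('i \<Rightarrow> 'w \<Rightarrow> real) \<Rightarrow> 'i set \<Rightarrow> 'w set set"
  where "cylinders M W L = cylinder M W ` lists (L \<times> sets borel)"

text \<open>Constraints are kept as lists, so intersecting two cylinders means appending their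
  lists.\<close>

lemma Int_stable_cylinders: "Int_stable (cylinders M W L)"
proof (rule Int_stableI)
  fix a b assume "a \<in> cylinders M W L" "b \<in> cylinders M W L"
  then obtain xs ys where "xs \<in> lists (L \<times> sets borel)" "ys \<in> lists (L \<times> sets borel)"
    "a = cylinder M W xs" "b = cylinder M W ys" by (auto simp: cylinders_def)
  then show "a \<inter> b \<in> cylinders M W L"
    unfolding cylinders_def by (intro image_eqI[of _ _ "xs @ ys"]) (auto simp: cylinder_def)
qed

lemma cylinders_measurable:
  assumes "\<And>h. h \<in> L \<Longrightarrow> W h \<in> borel_measurable M"
  shows "cylinders M W L \<subseteq> sets M"
proof -
  have "cylinder M W xs \<in> sets M" if "set xs \<subseteq> L \<times> sets borel" for xs
    using that
  proof (induction xs)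
    case (Cons x xs)
    obtain h A where x: "x = (h, A)" by force
    have "cylinder M W (x # xs) = (W h -` A \<inter> space M) \<inter> cylinder M W xs"
      by (auto simp: cylinder_def x)
    moreover have "W h -` A \<inter> space M \<in> sets M"
      using assms Cons.prems by (auto simp: x intro: measurable_sets)
    ultimately show ?case using Cons by auto
  qed (simp add: cylinder_def)
  then show ?thesis by (auto simp: cylinders_def)
qed

lemma cylinders_generator_measurable:
  assumes "h \<in> L"
  shows "W h \<in> borel_measurable (sigma (space M) (cylinders M W L))"
proof (rule measurableI)
  have sub: "cylinders M W L \<subseteq> Pow (space M)" by (auto simp: cylinders_def cylinder_def)
  fix A :: "real set" assume "A \<in> sets borel"
  then have "cylinder M W [(h, A)] \<in> cylinders M W L" using assms by (auto simp: cylinders_def)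
  moreover have "W h -` A \<inter> space (sigma (space M) (cylinders M W L)) = cylinder M W [(h, A)]"
    using sub by (auto simp: cylinder_def space_measure_of)
  ultimately show "W h -` A \<inter> space (sigma (space M) (cylinders M W L)) \<in> sets (sigma (space M) (cylinders M W L))"
    using sub by (simp add: sets_measure_of sigma_sets.Basic)
qed simp

text \<open>The one-dimensional statement is iterated over the variables defining a cylinder: the characters
  in the variables not yet used survive multiplication by an indicator.\<close>

lemma (in prob_space) fourier_unique_sigma:
  fixes R :: "'a \<Rightarrow> complex" and W :: "'i::real_vector \<Rightarrow> 'a \<Rightarrow> real" and Y :: "'j \<Rightarrow> 'a \<Rightarrow> real"
  assumes R: "integrable M R" and W: "\<And>h. W h \<in> borel_measurable M"
    and lin: "\<And>g h s. AE \<omega> in M. W (g + s *\<^sub>R h) \<omega> = W g \<omega> + s * W h \<omega>"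
    and L: "subspace L" and zero: "\<And>h. h \<in> L \<Longrightarrow> (\<integral>\<omega>. R \<omega> * iexp (W h \<omega>) \<partial>M) = 0"
    and Y: "\<And>j. Y j \<in> borel_measurable M" and YW: "\<And>j. j \<in> J \<Longrightarrow> \<exists>h\<in>L. AE \<omega> in M. Y j \<omega> = W h \<omega>"
    and E: "E \<in> sigma_sets (space M) (cylinders M Y J)"
  shows "(\<integral>\<omega>. R \<omega> * indicator E \<omega> \<partial>M) = 0"
proof -
  note [measurable] = W Y
  have sub: "cylinders M Y J \<subseteq> sets M" by (rule cylinders_measurable) (rule Y)
  have sigma: "E \<in> sets M" if "E \<in> sigma_sets (space M) (cylinders M Y J)" for E
    using that sets.sigma_sets_subset[OF sub] by blast
  have intE: "integrable M (\<lambda>\<omega>. R \<omega> * indicator E \<omega>)" if [measurable]: "E \<in> sets M" for E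
    by (rule Bochner_Integration.integrable_bound[OF R])
      (use R in \<open>auto simp: norm_mult split: split_indicator\<close>)
  have iexp_add: "iexp (a + b) = iexp a * iexp b" for a b
    by (simp add: distrib_left exp_add)
  have cyl: "(\<integral>\<omega>. R \<omega> * indicator (cylinder M Y xs) \<omega> * iexp (W h \<omega>) \<partial>M) = 0"
    if "set xs \<subseteq> J \<times> sets borel" "h \<in> L" for xs h
    using that
  proof (induction xs arbitrary: h)
    case Nil
    have "(\<integral>\<omega>. R \<omega> * indicator (cylinder M Y []) \<omega> * iexp (W h \<omega>) \<partial>M) = (\<integral>\<omega>. R \<omega> * iexp (W h \<omega>) \<partial>M)"
      by (intro Bochner_Integration.integral_cong) (auto simp: cylinder_def)
    then show ?case using zero Nil by simp
  next
    case (Cons x xs)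
    obtain g A where x: "x = (g, A)" by force
    have A: "A \<in> sets borel" and gJ: "g \<in> J" using Cons.prems by (auto simp: x)
    obtain g' where g': "g' \<in> L" "AE \<omega> in M. Y g \<omega> = W g' \<omega>" using YW[OF gJ] by blast
    have [measurable]: "cylinder M Y xs \<in> sets M"
      using sub Cons.prems by (auto simp: cylinders_def)
    define R' where "R' \<omega> = R \<omega> * indicator (cylinder M Y xs) \<omega> * iexp (W h \<omega>)" for \<omega>
    have [measurable]: "R' \<in> borel_measurable M" unfolding R'_def[abs_def] using R by measurable
    have "integrable M R'"
      by (rule Bochner_Integration.integrable_bound[OF R])
        (auto simp: R'_def norm_mult split: split_indicator)
    \<comment> \<open>The character in \<open>Y g\<close> is absorbed into the one in
      \<open>W h\<close>: L is a subspace, so \<open>h + t *\<^sub>R g'\<close> is again an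
      admissible direction for the induction hypothesis.\<close>
    moreover have "(\<integral>\<omega>. R' \<omega> * iexp (t * Y g \<omega>) \<partial>M) = 0" for t
    proof -
      have "(\<integral>\<omega>. R' \<omega> * iexp (t * Y g \<omega>) \<partial>M)
          = (\<integral>\<omega>. R \<omega> * indicator (cylinder M Y xs) \<omega> * iexp (W (h + t *\<^sub>R g') \<omega>) \<partial>M)"
      proof (rule integral_cong_AE)
        show "AE \<omega> in M. R' \<omega> * iexp (t * Y g \<omega>)
            = R \<omega> * indicator (cylinder M Y xs) \<omega> * iexp (W (h + t *\<^sub>R g') \<omega>)"
          using lin[of h t g'] g'(2)
        proof eventually_elim
          case (elim \<omega>)
          show ?case unfolding elim R'_def iexp_add by (simp only: mult.assoc)
        qed
      qed (use R in measurable)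
      also have "\<dots> = 0"
        using Cons g'(1) L by (intro Cons.IH) (auto intro: subspace_add subspace_scale)
      finally show ?thesis .
    qed
    ultimately have "(\<integral>\<omega>. R' \<omega> * indicator A (Y g \<omega>) \<partial>M) = 0"
      by (intro fourier_unique A) auto
    moreover have "(\<integral>\<omega>. R' \<omega> * indicator A (Y g \<omega>) \<partial>M)
        = (\<integral>\<omega>. R \<omega> * indicator (cylinder M Y (x # xs)) \<omega> * iexp (W h \<omega>) \<partial>M)"
      by (intro Bochner_Integration.integral_cong) (auto simp: R'_def x cylinder_def split: split_indicator)
    ultimately show ?case by simp
  qed
  \<comment> \<open>The auxiliary character is removed at the end by choosing h = 0, where it is
    almost surely 1.\<close>
  have W0: "AE \<omega> in M. W 0 \<omega> = 0"
    using lin[of 0 1 0] by simp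
  have cyl0: "(\<integral>\<omega>. R \<omega> * indicator (cylinder M Y xs) \<omega> \<partial>M) = 0"
    if "set xs \<subseteq> J \<times> sets borel" for xs
  proof -
    have [measurable]: "cylinder M Y xs \<in> sets M" using sub that by (auto simp: cylinders_def)
    have "(\<integral>\<omega>. R \<omega> * indicator (cylinder M Y xs) \<omega> \<partial>M)
        = (\<integral>\<omega>. R \<omega> * indicator (cylinder M Y xs) \<omega> * iexp (W 0 \<omega>) \<partial>M)"
      by (rule integral_cong_AE) (use R W0 in \<open>auto elim: eventually_mono\<close>)
    then show ?thesis using cyl[OF that subspace_0[OF L]] by simp
  qed
  have "space M \<in> cylinders M Y J"
    unfolding cylinders_def by (intro image_eqI[of _ _ "[]"]) (auto simp: cylinder_def)
  have "cylinders M Y J \<subseteq> Pow (space M)" using sub sets.sets_into_space by blast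
  \<comment> \<open>Dynkin argument: the sets with vanishing integral are closed under complements
    and disjoint countable unions, and they contain the intersection-stable cylinders.\<close>
  from Int_stable_cylinders this E show ?thesis
  proof (induction rule: sigma_sets_induct_disjoint)
    case (basic A)
    then show ?case using cyl0 by (auto simp: cylinders_def)
  next
    case empty
    then show ?case by simp
  next
    case (compl A)
    have [measurable]: "A \<in> sets M" by (rule sigma[OF compl(1)])
    have "(\<integral>\<omega>. R \<omega> * indicator (space M - A) \<omega> \<partial>M) = (\<integral>\<omega>. R \<omega> - R \<omega> * indicator A \<omega> \<partial>M)"
      by (intro Bochner_Integration.integral_cong) (auto split: split_indicator)
    also have "\<dots> = (\<integral>\<omega>. R \<omega> \<partial>M)" using R intE compl(2) by simp
    \<comment> \<open>The total integral is the case of no constraints.\<close>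
    also have "\<dots> = (\<integral>\<omega>. R \<omega> * indicator (cylinder M Y []) \<omega> \<partial>M)"
      by (intro Bochner_Integration.integral_cong) (auto simp: cylinder_def)
    also have "\<dots> = 0" by (rule cyl0) simp
    finally show ?case .
  next
    case (union A)
    have [measurable]: "A i \<in> sets M" for i using union(2) sigma by blast
    have "(\<integral>\<omega>. R \<omega> * indicator (\<Union>i. A i) \<omega> \<partial>M) = (LINT \<omega>:(\<Union>i. A i)|M. R \<omega>)"
      unfolding set_lebesgue_integral_def
      by (intro Bochner_Integration.integral_cong) (auto split: split_indicator)
    also have "\<dots> = (\<Sum>i. LINT \<omega>:A i|M. R \<omega>)"
      using union(1) R
      by (intro lebesgue_integral_countable_add)
        (auto simp: disjoint_family_on_def set_integrable_def intro: integrable_mult_indicator)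
    also have "\<dots> = (\<Sum>i. \<integral>\<omega>. R \<omega> * indicator (A i) \<omega> \<partial>M)"
      unfolding set_lebesgue_integral_def
      by (intro suminf_cong Bochner_Integration.integral_cong) (auto split: split_indicator)
    also have "(\<Sum>i. \<integral>\<omega>. R \<omega> * indicator (A i) \<omega> \<partial>M) = 0" using union(3) by simp
    finally show ?case .
  qed
qed

section \<open>Gaussian integration by parts\<close>

lemma add_power_le: "0 \<le> a \<Longrightarrow> 0 \<le> b \<Longrightarrow> (a + b) ^ N \<le> 2 ^ N * (a ^ N + b ^ N :: real)"
proof -
  assume ab: "0 \<le> a" "0 \<le> b"
  have "(a + b) ^ N \<le> (2 * max a b) ^ N" using ab by (intro power_mono) auto
  also have "\<dots> = 2 ^ N * max a b ^ N" by (simp add: power_mult_distrib)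
  also have "max a b ^ N \<le> a ^ N + b ^ N" using ab by (auto simp: max_def)
  finally show ?thesis by simp
qed

lemma normal_density_tendsto_0:
  assumes "\<sigma> > 0"
  shows "(normal_density \<mu> \<sigma> \<longlongrightarrow> 0) at_top" "(normal_density \<mu> \<sigma> \<longlongrightarrow> 0) at_bot"
proof -
  have *: "(normal_density \<mu> \<sigma> \<longlongrightarrow> 0) F" if "filterlim (\<lambda>x. (x - \<mu>)\<^sup>2) at_top F" for F
  proof -
    have "filterlim (\<lambda>x. (1 / (2 * \<sigma>\<^sup>2)) * (x - \<mu>)\<^sup>2) at_top F"
      by (rule filterlim_tendsto_pos_mult_at_top[OF tendsto_const _ that]) (use assms in auto)
    then have "filterlim (\<lambda>x. - (x - \<mu>)\<^sup>2 / (2 * \<sigma>\<^sup>2)) at_bot F"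
      by (simp add: filterlim_uminus_at_bot)
    then have "((\<lambda>x. exp (- (x - \<mu>)\<^sup>2 / (2 * \<sigma>\<^sup>2))) \<longlongrightarrow> 0) F"
      by (rule filterlim_compose[OF exp_at_bot])
    from tendsto_mult[OF tendsto_const this, of "1 / sqrt (2 * pi * \<sigma>\<^sup>2)"] show ?thesis
      by (simp add: normal_density_def[abs_def])
  qed
  have "filterlim (\<lambda>x. x - \<mu>) at_top at_top"
    using filterlim_tendsto_add_at_top[OF tendsto_const[of "- \<mu>"] filterlim_ident] by simp
  then show "(normal_density \<mu> \<sigma> \<longlongrightarrow> 0) at_top" by (intro * filterlim_pow_at_top) auto
  have "filterlim (\<lambda>x. x - \<mu>) at_bot at_bot"
    using filterlim_tendsto_add_at_top[OF tendsto_const[of \<mu>] filterlim_uminus_at_top_at_bot]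
    by (simp add: filterlim_uminus_at_bot)
  then show "(normal_density \<mu> \<sigma> \<longlongrightarrow> 0) at_bot" by (intro * filterlim_pow_at_bot_even) auto
qed

text \<open>Completing the square: exponential tilting moves the mean of a Gaussian by t \<sigma>^2
  and keeps its variance.\<close>

lemma exp_times_normal_density:
  assumes "\<sigma> > 0"
  shows "exp (t * x) * normal_density 0 \<sigma> x = exp (t\<^sup>2 * \<sigma>\<^sup>2 / 2) * normal_density (t * \<sigma>\<^sup>2) \<sigma> x"
proof -
  have "t * x + (- (x - 0)\<^sup>2 / (2 * \<sigma>\<^sup>2)) = t\<^sup>2 * \<sigma>\<^sup>2 / 2 + (- (x - t * \<sigma>\<^sup>2)\<^sup>2 / (2 * \<sigma>\<^sup>2))"
    using assms by (simp add: field_simps power2_eq_square)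
  then have "exp (t * x) * exp (- (x - 0)\<^sup>2 / (2 * \<sigma>\<^sup>2)) = exp (t\<^sup>2 * \<sigma>\<^sup>2 / 2) * exp (- (x - t * \<sigma>\<^sup>2)\<^sup>2 / (2 * \<sigma>\<^sup>2))"
    by (simp only: exp_add[symmetric])
  then show ?thesis by (simp add: normal_density_def mult.left_commute)
qed

text \<open>The left side is, up to the factorial, a single term of the exponential series at 1 +
  x.\<close>

lemma one_plus_power_le_exp:
  assumes "0 \<le> (x::real)"
  shows "(1 + x) ^ N \<le> fact N * exp (1 + x)"
proof -
  have "(1 + x) ^ N /\<^sub>R fact N \<le> exp (1 + x)"
    unfolding exp_def using assms sum_le_suminf[OF summable_exp_generic[of "1 + x"], of "{N}"] by auto
  then show ?thesis by (simp add: field_simps)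
qed

text \<open>Polynomial growth is dominated by exp u + exp (- u), and each exponential merely shifts
  the Gaussian. Integrability and decay of polynomially growing functions against the density thus
  reduce to those of normal densities.\<close>

lemma gaussian_growth_bound:
  assumes "\<sigma> > 0"
  shows "(1 + \<bar>u\<bar>) ^ N * normal_density 0 \<sigma> u
    \<le> fact N * exp (1 + \<sigma>\<^sup>2 / 2) * (normal_density (\<sigma>\<^sup>2) \<sigma> u + normal_density (- \<sigma>\<^sup>2) \<sigma> u)"
proof -
  have "(1 + \<bar>u\<bar>) ^ N \<le> fact N * exp (1 + \<bar>u\<bar>)" by (rule one_plus_power_le_exp) simp
  also have "\<dots> \<le> fact N * exp 1 * (exp (1 * u) + exp (- 1 * u))"
  proof -
    have "exp \<bar>u\<bar> \<le> exp u + exp (- u)" by (cases "u \<ge> 0") auto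
    then show ?thesis by (simp add: exp_add mult.assoc)
  qed
  finally have "(1 + \<bar>u\<bar>) ^ N * normal_density 0 \<sigma> u
      \<le> fact N * exp 1 * (exp (1 * u) + exp (- 1 * u)) * normal_density 0 \<sigma> u"
    by (rule mult_right_mono) simp
  also have "\<dots> = fact N * exp 1 * (exp (1 * u) * normal_density 0 \<sigma> u + exp (- 1 * u) * normal_density 0 \<sigma> u)"
    by (simp only: mult.assoc distrib_right)
  also have "\<dots> = fact N * exp (1 + \<sigma>\<^sup>2 / 2) * (normal_density (\<sigma>\<^sup>2) \<sigma> u + normal_density (- \<sigma>\<^sup>2) \<sigma> u)"
    unfolding exp_times_normal_density[OF assms] by (simp add: exp_add algebra_simps)
  finally show ?thesis .
qed

lemma gaussian_growth_integrable:
  fixes h :: "real \<Rightarrow> complex"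
  assumes "\<sigma> > 0" and h: "\<And>u. cmod (h u) \<le> C * (1 + \<bar>u\<bar>) ^ N" and [measurable]: "h \<in> borel_measurable borel"
  shows "integrable lborel (\<lambda>u. normal_density 0 \<sigma> u *\<^sub>R h u)"
proof (rule Bochner_Integration.integrable_bound)
  show "integrable lborel (\<lambda>u. \<bar>C\<bar> * (fact N * exp (1 + \<sigma>\<^sup>2 / 2) *
      (normal_density (\<sigma>\<^sup>2) \<sigma> u + normal_density (- \<sigma>\<^sup>2) \<sigma> u)))"
    using assms(1) by simp
  show "AE u in lborel. norm (normal_density 0 \<sigma> u *\<^sub>R h u) \<le> norm (\<bar>C\<bar> * (fact N * exp (1 + \<sigma>\<^sup>2 / 2) *
      (normal_density (\<sigma>\<^sup>2) \<sigma> u + normal_density (- \<sigma>\<^sup>2) \<sigma> u)))"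
  proof (rule AE_I2)
    fix u
    have "norm (normal_density 0 \<sigma> u *\<^sub>R h u) \<le> (C * (1 + \<bar>u\<bar>) ^ N) * normal_density 0 \<sigma> u"
      using mult_right_mono[OF h[of u], of "normal_density 0 \<sigma> u"] by (simp add: mult.commute)
    also have "\<dots> \<le> \<bar>C\<bar> * ((1 + \<bar>u\<bar>) ^ N * normal_density 0 \<sigma> u)"
      unfolding mult.assoc by (intro mult_right_mono) auto
    also have "\<dots> \<le> \<bar>C\<bar> * (fact N * exp (1 + \<sigma>\<^sup>2 / 2) *
        (normal_density (\<sigma>\<^sup>2) \<sigma> u + normal_density (- \<sigma>\<^sup>2) \<sigma> u))"
      by (intro mult_left_mono gaussian_growth_bound assms) auto
    finally show "norm (normal_density 0 \<sigma> u *\<^sub>R h u) \<le> norm (\<bar>C\<bar> * (fact N * exp (1 + \<sigma>\<^sup>2 / 2) *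
        (normal_density (\<sigma>\<^sup>2) \<sigma> u + normal_density (- \<sigma>\<^sup>2) \<sigma> u)))" by simp
  qed
qed measurable

text \<open>Stein's identity: F, the density times h, vanishes at both ends of the line, and its
  derivative f is the difference of the two integrands up to the factor 1 / \<sigma>^2. The
  fundamental theorem of calculus gives f integral 0.\<close>

lemma gaussian_ibp:
  fixes h h' :: "real \<Rightarrow> complex"
  assumes \<sigma>: "\<sigma> > 0"
    and deriv: "\<And>u. (h has_vector_derivative h' u) (at u)" and cont: "continuous_on UNIV h'"
    and h: "\<And>u. cmod (h u) \<le> C * (1 + \<bar>u\<bar>) ^ N" and h': "\<And>u. cmod (h' u) \<le> C * (1 + \<bar>u\<bar>) ^ N"
  shows "(\<integral>u. normal_density 0 \<sigma> u *\<^sub>R (of_real u * h u) \<partial>lborel)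
    = of_real (\<sigma>\<^sup>2) * (\<integral>u. normal_density 0 \<sigma> u *\<^sub>R h' u \<partial>lborel)"
proof -
  have conth: "continuous_on UNIV h"
    using deriv by (auto simp: continuous_on_eq_continuous_at intro: has_vector_derivative_continuous)
  have [measurable]: "h \<in> borel_measurable borel" "h' \<in> borel_measurable borel"
    using cont conth by (auto intro: borel_measurable_continuous_onI)
  have int_h': "integrable lborel (\<lambda>u. normal_density 0 \<sigma> u *\<^sub>R h' u)"
    by (rule gaussian_growth_integrable[OF \<sigma> h']) measurable
  have int_h: "integrable lborel (\<lambda>u. normal_density 0 \<sigma> u *\<^sub>R (of_real u * h u))"
  proof (rule gaussian_growth_integrable[OF \<sigma>])
    show "cmod (of_real u * h u) \<le> C * (1 + \<bar>u\<bar>) ^ Suc N" for u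
    proof -
      have "cmod (of_real u * h u) \<le> (1 + \<bar>u\<bar>) * (C * (1 + \<bar>u\<bar>) ^ N)"
        unfolding norm_mult by (intro mult_mono h) auto
      then show ?thesis by (simp add: mult_ac)
    qed
  qed measurable
  define F where "F u = normal_density 0 \<sigma> u *\<^sub>R h u" for u
  define f where "f u = normal_density 0 \<sigma> u *\<^sub>R h' u - (1 / \<sigma>\<^sup>2) *\<^sub>R (normal_density 0 \<sigma> u *\<^sub>R (of_real u * h u))" for u
  have dn: "(normal_density 0 \<sigma> has_real_derivative - (u / \<sigma>\<^sup>2) * normal_density 0 \<sigma> u) (at u)" for u
    unfolding normal_density_def[abs_def]
    using \<sigma> by (auto intro!: derivative_eq_intros simp: field_simps power2_eq_square)
  have dF: "(F has_vector_derivative f u) (at u)" for u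
    unfolding F_def[abs_def] f_def
    by (rule has_vector_derivative_eq_rhs[OF has_vector_derivative_scaleR[OF dn deriv]])
      (simp add: scaleR_conv_of_real field_simps)
  have contf: "isCont f u" for u
  proof -
    have "continuous_on UNIV f"
      unfolding f_def[abs_def] normal_density_def[abs_def] using cont conth \<sigma>
      by (intro continuous_intros) auto
    then show ?thesis by (simp add: continuous_on_eq_continuous_at)
  qed
  have intf: "integrable lborel f"
    unfolding f_def[abs_def] using int_h int_h' by (intro Bochner_Integration.integrable_diff integrable_scaleR_right) auto
  \<comment> \<open>The filter is left open so that one argument covers both ends of the
    line.\<close>
  have lim: "(F \<longlongrightarrow> 0) G" if G: "\<And>\<mu>. (normal_density \<mu> \<sigma> \<longlongrightarrow> 0) G" for G
  proof (rule Lim_null_comparison)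
    define K where "K = \<bar>C\<bar> * (fact N * exp (1 + \<sigma>\<^sup>2 / 2))"
    show "\<forall>\<^sub>F u in G. norm (F u) \<le> K * (normal_density (\<sigma>\<^sup>2) \<sigma> u + normal_density (- \<sigma>\<^sup>2) \<sigma> u)"
    proof (rule always_eventually, rule allI)
      fix u
      have "norm (F u) \<le> (C * (1 + \<bar>u\<bar>) ^ N) * normal_density 0 \<sigma> u"
        using mult_right_mono[OF h[of u], of "normal_density 0 \<sigma> u"] by (simp add: F_def mult.commute)
      also have "\<dots> \<le> \<bar>C\<bar> * ((1 + \<bar>u\<bar>) ^ N * normal_density 0 \<sigma> u)"
        unfolding mult.assoc by (intro mult_right_mono) auto
      also have "\<dots> \<le> \<bar>C\<bar> * (fact N * exp (1 + \<sigma>\<^sup>2 / 2) *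
          (normal_density (\<sigma>\<^sup>2) \<sigma> u + normal_density (- \<sigma>\<^sup>2) \<sigma> u))"
        by (intro mult_left_mono gaussian_growth_bound \<sigma>) auto
      finally show "norm (F u) \<le> K * (normal_density (\<sigma>\<^sup>2) \<sigma> u + normal_density (- \<sigma>\<^sup>2) \<sigma> u)"
        by (simp add: K_def mult.assoc)
    qed
    have "((\<lambda>u. K * (normal_density (\<sigma>\<^sup>2) \<sigma> u + normal_density (- \<sigma>\<^sup>2) \<sigma> u)) \<longlongrightarrow> K * (0 + 0)) G"
      by (intro tendsto_mult tendsto_add tendsto_const G)
    then show "((\<lambda>u. K * (normal_density (\<sigma>\<^sup>2) \<sigma> u + normal_density (- \<sigma>\<^sup>2) \<sigma> u)) \<longlongrightarrow> 0) G" by simp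
  qed
  have "(LBINT u=-\<infinity>..\<infinity>. f u) = 0 - 0"
  proof (rule interval_integral_FTC_integrable)
    show "((F \<circ> real_of_ereal) \<longlongrightarrow> 0) (at_right (- \<infinity>))" "((F \<circ> real_of_ereal) \<longlongrightarrow> 0) (at_left \<infinity>)"
      unfolding ereal_tendsto_simps1 using normal_density_tendsto_0[OF \<sigma>] by (auto intro: lim)
    show "set_integrable lborel (einterval (- \<infinity>) \<infinity>) f"
      using intf by (simp add: set_integrable_def)
  qed (use dF contf in auto)
  then have "(\<integral>u. f u \<partial>lborel) = 0"
    by (simp add: interval_lebesgue_integral_def set_lebesgue_integral_def)
  moreover have "(\<integral>u. f u \<partial>lborel) = (\<integral>u. normal_density 0 \<sigma> u *\<^sub>R h' u \<partial>lborel)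
      - (1 / \<sigma>\<^sup>2) *\<^sub>R (\<integral>u. normal_density 0 \<sigma> u *\<^sub>R (of_real u * h u) \<partial>lborel)"
    unfolding f_def[abs_def] integral_scaleR_right[symmetric]
    by (intro Bochner_Integration.integral_diff integrable_scaleR_right int_h int_h')
  ultimately show ?thesis using \<sigma> by (simp add: scaleR_conv_of_real)
qed

section \<open>The underlying real Gaussian process\<close>

lemma cscale_of_real: "of_real r *\<^sub>C h = r *\<^sub>R h"
  by (simp add: cscale_def prod_eq_iff)

lemma Re_cinner: "Re (cinner g h) = g \<bullet> h"
  by (simp add: cinner_def inner_prod_def)

lemma Im_cinner: "Im (cinner g h) = (- \<i>) *\<^sub>C g \<bullet> h"
  by (simp flip: Re_cinner add: cinner_scale_left)

lemma norm_cscale: "norm (c *\<^sub>C h) = cmod c * norm (h :: 'h::real_inner cplx)"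
proof -
  have "complex_of_real ((norm (c *\<^sub>C h))\<^sup>2) = c * cnj c * of_real ((norm h)\<^sup>2)"
    unfolding cinner_self[symmetric] cinner_scale_left cinner_scale_right by (simp only: mult_ac)
  also have "\<dots> = of_real ((cmod c * norm h)\<^sup>2)"
    by (simp add: complex_norm_square[symmetric] power_mult_distrib)
  finally have "(norm (c *\<^sub>C h))\<^sup>2 = (cmod c * norm h)\<^sup>2" unfolding of_real_eq_iff .
  then show ?thesis by simp
qed

context complex_isonormal
begin

text \<open>This real process carries all of Z, since the imaginary part of Z h is almost surely W
  (-i h). It is isonormal over the space regarded as a real Hilbert space, up to the variance factor
  1/2.\<close>

definition W :: "'h cplx \<Rightarrow> 'w \<Rightarrow> real" where "W h \<omega> = Re (Z h \<omega>)"

lemma Z_measurable [measurable]: "Z h \<in> borel_measurable M"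
  by (rule measurable)

lemma W_measurable [measurable]: "W h \<in> borel_measurable M"
  unfolding W_def[abs_def] by measurable

lemma Z_scale: "AE \<omega> in M. Z (c *\<^sub>C h) \<omega> = c * Z h \<omega>"
  using linear[of c h 0 0] by (simp add: cscale_simps)

lemma Z_zero: "AE \<omega> in M. Z 0 \<omega> = 0"
  using Z_scale[of 0 0] by (simp add: cscale_simps)

lemma W_linear: "AE \<omega> in M. W (g + s *\<^sub>R h) \<omega> = W g \<omega> + s * W h \<omega>"
  using linear[of 1 g "of_real s" h]
  by eventually_elim (simp add: W_def cscale_of_real cscale_simps)

lemma Im_Z: "AE \<omega> in M. Im (Z h \<omega>) = W ((- \<i>) *\<^sub>C h) \<omega>"
  using Z_scale[of "- \<i>" h] by eventually_elim (simp add: W_def)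

lemma Z_eq_W: "AE \<omega> in M. Z h \<omega> = Complex (W h \<omega>) (W ((- \<i>) *\<^sub>C h) \<omega>)"
  using Im_Z[of h] by eventually_elim (simp add: W_def complex_eq_iff)

lemma centered_gaussian_W: "centered_gaussian M (W h)"
  using jointly_gaussian[of "{h}" "\<lambda>_. 1" "\<lambda>_. 0"] by (simp add: W_def[abs_def])

lemma W_power_integrable: "integrable M (\<lambda>\<omega>. \<bar>W h \<omega>\<bar> ^ N)"
proof -
  obtain \<sigma> where \<sigma>: "\<sigma> \<ge> 0" "if \<sigma> = 0 then W h \<in> borel_measurable M \<and> (AE \<omega> in M. W h \<omega> = 0)
      else distributed M lborel (W h) (normal_density 0 \<sigma>)"
    using centered_gaussian_W[of h] unfolding centered_gaussian_def by blast
  show ?thesis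
  proof (cases "\<sigma> = 0")
    case True
    \<comment> \<open>The form \<open>0 ^ N\<close> includes N = 0, where the constant is 1.\<close>
    then have "AE \<omega> in M. \<bar>W h \<omega>\<bar> ^ N = 0 ^ N" using \<sigma> by (auto elim: eventually_mono)
    then show ?thesis by (subst integrable_cong_AE[where g = "\<lambda>_. 0 ^ N"]) auto
  next
    case False
    then have "distributed M lborel (W h) (normal_density 0 \<sigma>)" using \<sigma> by simp
    from distributed_integrable[OF this, of "\<lambda>x. \<bar>x\<bar> ^ N"] show ?thesis
      using integrable_normal_moment_abs[of \<sigma> 0 N] \<sigma> False by simp
  qed
qed

text \<open>The real part of the pseudo-variance condition says that real and imaginary part of Z h
  have equal second moments; the covariance condition gives their sum. Each therefore has half of
  the squared norm of h.\<close>

lemma W_square: "expectation (\<lambda>\<omega>. (W h \<omega>)\<^sup>2) = (norm h)\<^sup>2 / 2"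
proof -
  have int: "integrable M (\<lambda>\<omega>. (W h \<omega>)\<^sup>2)" for h using W_power_integrable[of h 2] by simp
  define A B where "A = expectation (\<lambda>\<omega>. (W h \<omega>)\<^sup>2)" and "B = expectation (\<lambda>\<omega>. (W ((- \<i>) *\<^sub>C h) \<omega>)\<^sup>2)"
  have "integrable M (\<lambda>\<omega>. (cmod (Z h \<omega>))\<^sup>2)"
  proof (subst integrable_cong_AE[where g = "\<lambda>\<omega>. (W h \<omega>)\<^sup>2 + (W ((- \<i>) *\<^sub>C h) \<omega>)\<^sup>2"])
    show "AE \<omega> in M. (cmod (Z h \<omega>))\<^sup>2 = (W h \<omega>)\<^sup>2 + (W ((- \<i>) *\<^sub>C h) \<omega>)\<^sup>2"
      using Im_Z[of h] by eventually_elim (simp add: W_def cmod_power2)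
  qed (use int in auto)
  then have intZ: "integrable M (\<lambda>\<omega>. (Z h \<omega>)\<^sup>2)" "integrable M (\<lambda>\<omega>. Z h \<omega> * cnj (Z h \<omega>))"
    by (auto intro: Bochner_Integration.integrable_bound simp: norm_mult norm_power power2_eq_square)
  have "A - B = expectation (\<lambda>\<omega>. (W h \<omega>)\<^sup>2 - (W ((- \<i>) *\<^sub>C h) \<omega>)\<^sup>2)"
    unfolding A_def B_def using int by (intro Bochner_Integration.integral_diff[symmetric]) auto
  also have "\<dots> = expectation (\<lambda>\<omega>. Re ((Z h \<omega>)\<^sup>2))"
  proof (rule integral_cong_AE)
    show "AE \<omega> in M. (W h \<omega>)\<^sup>2 - (W ((- \<i>) *\<^sub>C h) \<omega>)\<^sup>2 = Re ((Z h \<omega>)\<^sup>2)"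
      using Im_Z[of h] by eventually_elim (simp add: W_def power2_eq_square)
  qed measurable
  also have "\<dots> = 0" unfolding integral_Re[OF intZ(1)] pseudo_variance by simp
  finally have 1: "A = B" by simp
  have "A + B = expectation (\<lambda>\<omega>. (W h \<omega>)\<^sup>2 + (W ((- \<i>) *\<^sub>C h) \<omega>)\<^sup>2)"
    unfolding A_def B_def using int by (intro Bochner_Integration.integral_add[symmetric]) auto
  also have "\<dots> = expectation (\<lambda>\<omega>. Re (Z h \<omega> * cnj (Z h \<omega>)))"
  proof (rule integral_cong_AE)
    show "AE \<omega> in M. (W h \<omega>)\<^sup>2 + (W ((- \<i>) *\<^sub>C h) \<omega>)\<^sup>2 = Re (Z h \<omega> * cnj (Z h \<omega>))"
      using Im_Z[of h] by eventually_elim (simp add: W_def power2_eq_square)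
  qed measurable
  also have "\<dots> = (norm h)\<^sup>2" unfolding integral_Re[OF intZ(2)] covariance cinner_self by simp
  finally show ?thesis using 1 by (simp add: A_def)
qed

lemma W_normal:
  assumes "h \<noteq> 0"
  shows "distributed M lborel (W h) (normal_density 0 (norm h / sqrt 2))"
proof -
  obtain \<sigma> where \<sigma>: "\<sigma> \<ge> 0" "if \<sigma> = 0 then W h \<in> borel_measurable M \<and> (AE \<omega> in M. W h \<omega> = 0)
      else distributed M lborel (W h) (normal_density 0 \<sigma>)"
    using centered_gaussian_W[of h] unfolding centered_gaussian_def by blast
  have pos: "expectation (\<lambda>\<omega>. (W h \<omega>)\<^sup>2) > 0" using assms by (simp add: W_square)
  have "\<sigma> \<noteq> 0"
  proof
    assume "\<sigma> = 0"
    then have "AE \<omega> in M. (W h \<omega>)\<^sup>2 = 0" using \<sigma> by auto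
    then have "expectation (\<lambda>\<omega>. (W h \<omega>)\<^sup>2) = 0" by (rule integral_eq_zero_AE)
    with pos show False by simp
  qed
  then have d: "\<sigma> > 0" "distributed M lborel (W h) (normal_density 0 \<sigma>)" using \<sigma> by auto
  have "\<sigma>\<^sup>2 = (norm h)\<^sup>2 / 2"
    using normal_distributed_variance[OF d] normal_distributed_expectation[OF d] W_square[of h] by simp
  then have "\<sigma> = sqrt ((norm h)\<^sup>2 / 2)" using d(1) by (metis real_sqrt_unique less_imp_le)
  then have "\<sigma> = norm h / sqrt 2" by (simp add: real_sqrt_divide)
  then show ?thesis using d by simp
qed

lemma W_zero: "AE \<omega> in M. W 0 \<omega> = 0"
  using Z_zero by eventually_elim (simp add: W_def)

text \<open>The variance is half of the squared norm of h, so the exponent of the Gaussian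
  characteristic function has the constant 1/4.\<close>

lemma W_char: "expectation (\<lambda>\<omega>. iexp (W h \<omega>)) = of_real (exp (- (norm h)\<^sup>2 / 4))"
proof (cases "h = 0")
  case True
  have "expectation (\<lambda>\<omega>. iexp (W h \<omega>)) = expectation (\<lambda>\<omega>. 1)"
    by (rule integral_cong_AE) (use W_zero True in \<open>auto elim: eventually_mono\<close>)
  then show ?thesis using True by (simp add: prob_space)
next
  case False
  define \<sigma> where "\<sigma> = norm h / sqrt 2"
  have \<sigma>: "\<sigma> > 0" using False by (simp add: \<sigma>_def)
  have D: "distributed M lborel (\<lambda>\<omega>. W h \<omega> / \<sigma>) std_normal_density"
    using W_normal[OF False] normal_standard_normal_convert[OF \<sigma>, of "W h" 0] by (simp add: \<sigma>_def)
  have "distr M borel (\<lambda>\<omega>. W h \<omega> / \<sigma>) = std_normal_distribution"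
    using distributed_distr_eq_density[OF D] by (simp add: distr_cong[of M M lborel borel])
  moreover have "char (distr M borel (\<lambda>\<omega>. W h \<omega> / \<sigma>)) \<sigma> = expectation (\<lambda>\<omega>. iexp (\<sigma> * (W h \<omega> / \<sigma>)))"
    unfolding char_def by (rule integral_distr) measurable
  ultimately have "char std_normal_distribution \<sigma> = expectation (\<lambda>\<omega>. iexp (\<sigma> * (W h \<omega> / \<sigma>)))"
    by (rule subst)
  then show ?thesis
    using \<sigma> False by (simp add: char_std_normal_distribution \<sigma>_def power_divide)
qed

lemma W_exp_integrable: "integrable M (\<lambda>\<omega>. exp (t * W h \<omega>))"
proof (cases "h = 0")
  case True
  have "AE \<omega> in M. exp (t * W h \<omega>) = 1" using W_zero True by (auto elim: eventually_mono)
  then show ?thesis by (subst integrable_cong_AE[where g = "\<lambda>_. 1"]) auto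
next
  case False
  define \<sigma> where "\<sigma> = norm h / sqrt 2"
  have \<sigma>: "\<sigma> > 0" using False by (simp add: \<sigma>_def)
  have eq: "normal_density 0 \<sigma> x * exp (t * x) = exp (t\<^sup>2 * \<sigma>\<^sup>2 / 2) * normal_density (t * \<sigma>\<^sup>2) \<sigma> x" for x
    using exp_times_normal_density[OF \<sigma>, of t x] by (simp add: mult.commute)
  have "integrable lborel (\<lambda>x. normal_density 0 \<sigma> x * exp (t * x))"
    unfolding eq using \<sigma> by simp
  with distributed_integrable[OF W_normal[OF False], of "\<lambda>x. exp (t * x)"] show ?thesis
    by (simp add: \<sigma>_def)
qed

text \<open>With t = 2 this makes exp of the absolute value of W h square integrable; it dominates
  the exponential series in \<open>orth_iexp_span\<close>.\<close>

lemma W_exp_abs_integrable: "integrable M (\<lambda>\<omega>. exp (t * \<bar>W h \<omega>\<bar>))"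
proof (rule Bochner_Integration.integrable_bound)
  show "integrable M (\<lambda>\<omega>. exp (t * W h \<omega>) + exp (- t * W h \<omega>))"
    by (intro Bochner_Integration.integrable_add W_exp_integrable)
  show "AE \<omega> in M. norm (exp (t * \<bar>W h \<omega>\<bar>)) \<le> norm (exp (t * W h \<omega>) + exp (- t * W h \<omega>))"
  proof (rule AE_I2)
    fix \<omega>
    have "exp (t * \<bar>W h \<omega>\<bar>) \<le> exp (t * W h \<omega>) + exp (- t * W h \<omega>)"
      by (cases "W h \<omega> \<ge> 0") simp_all
    also have "\<dots> \<le> norm (exp (t * W h \<omega>) + exp (- t * W h \<omega>))"
      unfolding real_norm_def by (rule abs_ge_self)
    finally show "norm (exp (t * \<bar>W h \<omega>\<bar>)) \<le> norm (exp (t * W h \<omega>) + exp (- t * W h \<omega>))"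
      by simp
  qed
qed measurable

lemma Z_power_integrable: "integrable M (\<lambda>\<omega>. cmod (Z h \<omega>) ^ N)"
proof (rule Bochner_Integration.integrable_bound)
  show "integrable M (\<lambda>\<omega>. 2 ^ N * (\<bar>W h \<omega>\<bar> ^ N + \<bar>W ((- \<i>) *\<^sub>C h) \<omega>\<bar> ^ N))"
    by (intro integrable_mult_right Bochner_Integration.integrable_add W_power_integrable)
  show "AE \<omega> in M. norm (cmod (Z h \<omega>) ^ N) \<le> norm (2 ^ N * (\<bar>W h \<omega>\<bar> ^ N + \<bar>W ((- \<i>) *\<^sub>C h) \<omega>\<bar> ^ N))"
    using Im_Z[of h]
  proof eventually_elim
    case (elim \<omega>)
    have "cmod (Z h \<omega>) ^ N \<le> (\<bar>W h \<omega>\<bar> + \<bar>W ((- \<i>) *\<^sub>C h) \<omega>\<bar>) ^ N"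
      using cmod_le[of "Z h \<omega>"] by (intro power_mono) (auto simp: W_def elim)
    also have "\<dots> \<le> 2 ^ N * (\<bar>W h \<omega>\<bar> ^ N + \<bar>W ((- \<i>) *\<^sub>C h) \<omega>\<bar> ^ N)"
      by (rule add_power_le) auto
    finally show ?case by simp
  qed
qed measurable

lemma growth_integrable:
  fixes k :: nat
  shows "integrable M (\<lambda>\<omega>. (1 + (\<Sum>i<k. cmod (Z (\<phi> i) \<omega>))) ^ N)"
proof (induction k)
  case (Suc k)
  show ?case
  proof (rule Bochner_Integration.integrable_bound)
    show "integrable M (\<lambda>\<omega>. 2 ^ N * ((1 + (\<Sum>i<k. cmod (Z (\<phi> i) \<omega>))) ^ N + cmod (Z (\<phi> k) \<omega>) ^ N))"
      by (intro integrable_mult_right Bochner_Integration.integrable_add Suc Z_power_integrable)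
    show "AE \<omega> in M. norm ((1 + (\<Sum>i<Suc k. cmod (Z (\<phi> i) \<omega>))) ^ N)
        \<le> norm (2 ^ N * ((1 + (\<Sum>i<k. cmod (Z (\<phi> i) \<omega>))) ^ N + cmod (Z (\<phi> k) \<omega>) ^ N))"
    proof (rule AE_I2)
      fix \<omega>
      define s where "s = 1 + (\<Sum>i<k. cmod (Z (\<phi> i) \<omega>))"
      have "0 \<le> s" by (simp add: s_def sum_nonneg)
      then have "(s + cmod (Z (\<phi> k) \<omega>)) ^ N \<le> 2 ^ N * (s ^ N + cmod (Z (\<phi> k) \<omega>) ^ N)" "0 \<le> s + cmod (Z (\<phi> k) \<omega>)"
        by (auto intro: add_power_le)
      moreover have "1 + (\<Sum>i<Suc k. cmod (Z (\<phi> i) \<omega>)) = s + cmod (Z (\<phi> k) \<omega>)"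
        by (simp add: s_def)
      ultimately show "norm ((1 + (\<Sum>i<Suc k. cmod (Z (\<phi> i) \<omega>))) ^ N)
          \<le> norm (2 ^ N * ((1 + (\<Sum>i<k. cmod (Z (\<phi> i) \<omega>))) ^ N + cmod (Z (\<phi> k) \<omega>) ^ N))"
        unfolding s_def[symmetric] by (smt (verit) real_norm_def zero_le_power)
    qed
  qed measurable
qed simp

lemma Z_seq_measurable [measurable]:
  fixes \<phi> :: "nat \<Rightarrow> 'h cplx"
  shows "(\<lambda>\<omega> i. Z (\<phi> i) \<omega>) \<in> borel_measurable M"
  by (rule measurable_coordinatewise_then_product) simp

lemma cylinder_functional_integrable:
  assumes g: "continuous_on UNIV g" and growth: "polynomial_growth k g"
  shows "integrable M (\<lambda>\<omega>. g (\<lambda>i. Z (\<phi> i) \<omega>))"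
proof -
  have [measurable]: "g \<in> borel_measurable borel" by (rule borel_measurable_continuous_onI[OF g])
  obtain C N where CN: "\<And>z. cmod (g z) \<le> C * (1 + (\<Sum>i<k. cmod (z i))) ^ N"
    using growth unfolding polynomial_growth_def by blast
  show ?thesis
  proof (rule Bochner_Integration.integrable_bound)
    show "integrable M (\<lambda>\<omega>. C * (1 + (\<Sum>i<k. cmod (Z (\<phi> i) \<omega>))) ^ N)"
      by (intro integrable_mult_right growth_integrable)
    show "AE \<omega> in M. norm (g (\<lambda>i. Z (\<phi> i) \<omega>)) \<le> norm (C * (1 + (\<Sum>i<k. cmod (Z (\<phi> i) \<omega>))) ^ N)"
      by (intro AE_I2 order_trans[OF CN]) simp
  qed measurable
qed

lemma cylinder_functional_L2:
  assumes g: "continuous_on UNIV g" and growth: "polynomial_growth k g"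
  shows "(\<lambda>\<omega>. g (\<lambda>i. Z (\<phi> i) \<omega>)) \<in> L2_space M"
proof (rule L2_spaceI)
  have [measurable]: "g \<in> borel_measurable borel" by (rule borel_measurable_continuous_onI[OF g])
  show "(\<lambda>\<omega>. g (\<lambda>i. Z (\<phi> i) \<omega>)) \<in> borel_measurable M" by measurable
  obtain C N where CN: "\<And>z. cmod (g z) \<le> C * (1 + (\<Sum>i<k. cmod (z i))) ^ N"
    using growth unfolding polynomial_growth_def by blast
  show "integrable M (\<lambda>\<omega>. (cmod (g (\<lambda>i. Z (\<phi> i) \<omega>)))\<^sup>2)"
  proof (rule Bochner_Integration.integrable_bound)
    show "integrable M (\<lambda>\<omega>. C\<^sup>2 * (1 + (\<Sum>i<k. cmod (Z (\<phi> i) \<omega>))) ^ (N * 2))"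
      by (intro integrable_mult_right growth_integrable)
    show "AE \<omega> in M. norm ((cmod (g (\<lambda>i. Z (\<phi> i) \<omega>)))\<^sup>2) \<le> norm (C\<^sup>2 * (1 + (\<Sum>i<k. cmod (Z (\<phi> i) \<omega>))) ^ (N * 2))"
    proof (rule AE_I2)
      fix \<omega>
      have "(cmod (g (\<lambda>i. Z (\<phi> i) \<omega>)))\<^sup>2 \<le> (C * (1 + (\<Sum>i<k. cmod (Z (\<phi> i) \<omega>))) ^ N)\<^sup>2"
        by (intro power_mono CN) simp
      then show "norm ((cmod (g (\<lambda>i. Z (\<phi> i) \<omega>)))\<^sup>2) \<le> norm (C\<^sup>2 * (1 + (\<Sum>i<k. cmod (Z (\<phi> i) \<omega>))) ^ (N * 2))"
        unfolding power_mult_distrib power_mult by simp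
    qed
  qed measurable
qed

end

section \<open>Independence of a direction from its orthogonal complement\<close>

context complex_isonormal
begin

text \<open>For h perpendicular to x in the real inner product, the squared norm of h + s x splits,
  so the joint characteristic function factors. Fourier uniqueness is applied twice: it replaces the
  characters in the complement by the event E, then those in W x by the event A.\<close>

lemma prob_Int_perp:
  assumes x: "norm x = 1" and E: "E \<in> sigma_sets (space M) (cylinders M W {h. h \<bullet> x = 0})"
    and A[measurable]: "A \<in> sets borel"
  shows "prob (W x -` A \<inter> space M \<inter> E) = prob (W x -` A \<inter> space M) * prob E"
proof -
  have sub: "cylinders M W {h. h \<bullet> x = 0} \<subseteq> sets M"
    by (rule cylinders_measurable) simp
  have E'[measurable]: "E \<in> sets M" using E sets.sigma_sets_subset[OF sub] by blast
  have L: "subspace {h. h \<bullet> x = 0}" by (auto simp: subspace_def inner_add_left)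
  define c where "c s = complex_of_real (exp (- s\<^sup>2 / 4))" for s :: real
  have W_smult: "AE \<omega> in M. W (s *\<^sub>R x) \<omega> = s * W x \<omega>" for s
    using W_linear[of 0 s x] W_zero by eventually_elim simp
  have char: "expectation (\<lambda>\<omega>. iexp (s * W x \<omega>)) = c s" for s
  proof -
    have "expectation (\<lambda>\<omega>. iexp (s * W x \<omega>)) = expectation (\<lambda>\<omega>. iexp (W (s *\<^sub>R x) \<omega>))"
      by (rule integral_cong_AE) (use W_smult[of s] in \<open>auto elim: eventually_mono\<close>)
    then show ?thesis using x by (simp add: W_char c_def)
  qed
  have int: "integrable M (\<lambda>\<omega>. iexp (s * W x \<omega>) - c s)" for s
    by (intro Bochner_Integration.integrable_diff integrable_iexp) auto
  have intE: "integrable M (\<lambda>\<omega>. indicator E \<omega> :: complex)"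
    by (rule integrable_const_bound[of _ 1]) (auto split: split_indicator)
  have intiE: "integrable M (\<lambda>\<omega>. iexp (s * W x \<omega>) * indicator E \<omega>)" for s
    by (rule integrable_const_bound[of _ 1]) (auto simp: norm_mult split: split_indicator)
  \<comment> \<open>The constant \<open>c s\<close> is the mean of the character, so the
    factorization says that the centred character is orthogonal to all characters of the
    complement.\<close>
  have 1: "(\<integral>\<omega>. (iexp (s * W x \<omega>) - c s) * indicator E \<omega> \<partial>M) = 0" for s
  proof (rule fourier_unique_sigma[OF int W_measurable W_linear L _ W_measurable _ E])
    fix h assume "h \<in> {h. h \<bullet> x = 0}"
    then have h: "h \<bullet> x = 0" by simp
    have n: "(norm (h + s *\<^sub>R x))\<^sup>2 = (norm h)\<^sup>2 + s\<^sup>2"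
      using h x by (simp add: power2_norm_eq_inner inner_add_left inner_add_right inner_commute)
        (simp add: power2_eq_square flip: power2_norm_eq_inner)
    have i: "integrable M (\<lambda>\<omega>. iexp (W h \<omega>))" for h by (rule integrable_iexp) auto
    have "(\<integral>\<omega>. (iexp (s * W x \<omega>) - c s) * iexp (W h \<omega>) \<partial>M)
        = (\<integral>\<omega>. iexp (W (h + s *\<^sub>R x) \<omega>) - c s * iexp (W h \<omega>) \<partial>M)"
    proof (rule integral_cong_AE)
      show "AE \<omega> in M. (iexp (s * W x \<omega>) - c s) * iexp (W h \<omega>)
          = iexp (W (h + s *\<^sub>R x) \<omega>) - c s * iexp (W h \<omega>)"
        using W_linear[of h s x]
      proof eventually_elim
        case (elim \<omega>)
        have "iexp (W (h + s *\<^sub>R x) \<omega>) = iexp (s * W x \<omega>) * iexp (W h \<omega>)"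
          unfolding elim by (simp add: exp_add[symmetric] algebra_simps)
        then show ?case by (simp add: algebra_simps)
      qed
    qed measurable
    also have "\<dots> = (\<integral>\<omega>. iexp (W (h + s *\<^sub>R x) \<omega>) \<partial>M) - c s * (\<integral>\<omega>. iexp (W h \<omega>) \<partial>M)"
      using i by simp
    also have "\<dots> = 0"
      unfolding W_char n c_def of_real_mult[symmetric] exp_add[symmetric] by (simp add: add_divide_distrib)
    finally show "(\<integral>\<omega>. (iexp (s * W x \<omega>) - c s) * iexp (W h \<omega>) \<partial>M) = 0" .
  qed auto
  \<comment> \<open>The roles are exchanged: the centred indicator of E is now orthogonal to all
    characters of W x.\<close>
  define R where "R \<omega> = indicator E \<omega> - complex_of_real (prob E)" for \<omega>
  have intR: "integrable M R"
    unfolding R_def[abs_def] using intE by (intro Bochner_Integration.integrable_diff) auto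
  have expE: "(\<integral>\<omega>. indicator E \<omega> \<partial>M) = complex_of_real (prob E)"
  proof -
    have "(\<integral>\<omega>. indicator E \<omega> \<partial>M) = (\<integral>\<omega>. complex_of_real (indicator E \<omega>) \<partial>M)"
      by (intro Bochner_Integration.integral_cong) (auto split: split_indicator)
    then show ?thesis by (simp add: Int_absorb2 sets.sets_into_space)
  qed
  have "(\<integral>\<omega>. R \<omega> * indicator A (W x \<omega>) \<partial>M) = 0"
  proof (rule fourier_unique[OF intR W_measurable _ A])
    fix s
    have "(\<integral>\<omega>. R \<omega> * iexp (s * W x \<omega>) \<partial>M)
        = (\<integral>\<omega>. ((iexp (s * W x \<omega>) - c s) * indicator E \<omega> + c s * indicator E \<omega>) - of_real (prob E) * iexp (s * W x \<omega>) \<partial>M)"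
      by (intro Bochner_Integration.integral_cong refl) (simp add: R_def algebra_simps)
    also have "\<dots> = (\<integral>\<omega>. (iexp (s * W x \<omega>) - c s) * indicator E \<omega> \<partial>M)
        + c s * (\<integral>\<omega>. indicator E \<omega> \<partial>M) - of_real (prob E) * (\<integral>\<omega>. iexp (s * W x \<omega>) \<partial>M)"
      using intE intiE[of s] integrable_iexp[of "\<lambda>\<omega>. s * W x \<omega>"]
      by (simp add: left_diff_distrib)
    also have "\<dots> = 0" by (simp only: 1 expE char) simp
    finally show "(\<integral>\<omega>. R \<omega> * iexp (s * W x \<omega>) \<partial>M) = 0" .
  qed
  then have "(\<integral>\<omega>. complex_of_real (indicator (W x -` A \<inter> space M \<inter> E) \<omega> - prob E * indicator (W x -` A \<inter> space M) \<omega>) \<partial>M) = 0"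
    by (subst Bochner_Integration.integral_cong[OF refl, of M _ "\<lambda>\<omega>. R \<omega> * indicator A (W x \<omega>)"])
      (auto simp: R_def split: split_indicator)
  then have "(\<integral>\<omega>. indicator (W x -` A \<inter> space M \<inter> E) \<omega> - prob E * indicator (W x -` A \<inter> space M) \<omega> \<partial>M) = 0"
    unfolding integral_complex_of_real by simp
  moreover have "integrable M (indicat_real F)" if "F \<in> events" for F
    using that by (intro integrable_real_indicator) (auto simp: emeasure_eq_measure)
  ultimately show ?thesis
    by (subst (asm) Bochner_Integration.integral_diff)
      (auto simp: mult.commute Int_absorb2 intro!: integrable_mult_right)
qed

text \<open>Independence as a product law, the form in which Fubini is applied. The codomain of T is
  general because T will be a sequence of complex variables.\<close>

lemma distr_perp:
  assumes x: "norm x = 1" and T: "T \<in> borel_measurable (sigma (space M) (cylinders M W {h. h \<bullet> x = 0}))"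
  shows "distr M borel (W x) \<Otimes>\<^sub>M distr M borel (T :: 'w \<Rightarrow> 'z::topological_space)
    = distr M (borel \<Otimes>\<^sub>M borel) (\<lambda>\<omega>. (W x \<omega>, T \<omega>))"
proof -
  define N where "N = sigma (space M) (cylinders M W {h. h \<bullet> x = 0})"
  have sub: "cylinders M W {h. h \<bullet> x = 0} \<subseteq> sets M"
    by (rule cylinders_measurable) simp
  have subN: "cylinders M W {h. h \<bullet> x = 0} \<subseteq> Pow (space M)"
    using sub sets.sets_into_space by blast
  have N: "sets N = sigma_sets (space M) (cylinders M W {h. h \<bullet> x = 0})" "space N = space M"
    using subN by (simp_all add: N_def sets_measure_of space_measure_of)
  have NM: "sets N \<subseteq> sets M" unfolding N using sets.sigma_sets_subset[OF sub] .
  have TM: "T \<in> borel_measurable M"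
    using T NM N(2) unfolding N_def[symmetric] measurable_def by auto
  have TE: "T -` B \<inter> space M \<in> sigma_sets (space M) (cylinders M W {h. h \<bullet> x = 0})" if "B \<in> sets borel" for B
    using measurable_sets[OF T that] unfolding N_def[symmetric] N .
  note [measurable] = TM
  interpret P: prob_space "distr M borel (W x)" by (rule prob_space_distr) simp
  interpret Q: prob_space "distr M borel T" by (rule prob_space_distr) simp
  show ?thesis
  proof (rule pair_measure_eqI)
    fix A :: "real set" and C :: "'z set"
    assume "A \<in> sets (distr M borel (W x))" "C \<in> sets (distr M borel T)"
    then have [measurable]: "A \<in> sets borel" "C \<in> sets borel" by auto
    have "(\<lambda>\<omega>. (W x \<omega>, T \<omega>)) -` (A \<times> C) \<inter> space M = W x -` A \<inter> space M \<inter> (T -` C \<inter> space M)" by auto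
    then show "emeasure (distr M borel (W x)) A * emeasure (distr M borel T) C
        = emeasure (distr M (borel \<Otimes>\<^sub>M borel) (\<lambda>\<omega>. (W x \<omega>, T \<omega>))) (A \<times> C)"
      using prob_Int_perp[OF x TE[of C], of A]
      by (simp add: emeasure_distr emeasure_eq_measure ennreal_mult[symmetric])
  qed (auto intro: P.sigma_finite_measure_axioms Q.sigma_finite_measure_axioms)
qed

text \<open>Splitting off the direction x leaves a vector of variables that is independent of W x, so that
  one-dimensional integration by parts applies conditionally.\<close>

lemma ibp_W:
  fixes \<phi> :: "nat \<Rightarrow> 'h cplx" and g g' :: "(nat \<Rightarrow> complex) \<Rightarrow> complex"
  assumes x: "norm x = 1"
    and g: "continuous_on UNIV g" "polynomial_growth k g"
    and g': "continuous_on UNIV g'" "polynomial_growth k g'"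
    and deriv: "\<And>z. ((\<lambda>t. g (\<lambda>i. z i + of_real t * cinner (\<phi> i) x)) has_vector_derivative g' z) (at 0)"
  shows "expectation (\<lambda>\<omega>. g (\<lambda>i. Z (\<phi> i) \<omega>) * of_real (W x \<omega>)) = expectation (\<lambda>\<omega>. g' (\<lambda>i. Z (\<phi> i) \<omega>)) / 2"
proof -
  define a where "a i = cinner (\<phi> i) x" for i
  \<comment> \<open>The standard deviation of W x for a unit vector x; its square is the factor 1/2
    of the conclusion.\<close>
  define \<sigma> :: real where "\<sigma> = 1 / sqrt 2"
  have \<sigma>: "\<sigma> > 0" "\<sigma>\<^sup>2 = 1 / 2" by (simp_all add: \<sigma>_def power_divide)
  \<comment> \<open>The real and imaginary parts of \<open>a i\<close> are the real inner products
    of \<phi> i and -i \<phi> i with x. Subtracting these components leaves vectors perpendicular to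
    x, so T is measurable with respect to the complement.\<close>
  define T where "T \<omega> i = Complex (W (\<phi> i - Re (a i) *\<^sub>R x) \<omega>) (W ((- \<i>) *\<^sub>C \<phi> i - Im (a i) *\<^sub>R x) \<omega>)" for \<omega> i
  have xx: "x \<bullet> x = 1" using x by (simp flip: power2_norm_eq_inner)
  have [measurable]: "g \<in> borel_measurable borel" "g' \<in> borel_measurable borel"
    using g g' by (auto intro: borel_measurable_continuous_onI)
  have Complex_meas: "(\<lambda>\<omega>. Complex (u \<omega>) (v \<omega>)) \<in> borel_measurable N"
    if [measurable]: "u \<in> borel_measurable N" "v \<in> borel_measurable N" for u v and N :: "'w measure"
  proof -
    have "(\<lambda>\<omega>. complex_of_real (u \<omega>) + \<i> * complex_of_real (v \<omega>)) \<in> borel_measurable N" by measurable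
    then show ?thesis by (simp add: Complex_eq)
  qed
  have T_meas: "T \<in> borel_measurable (sigma (space M) (cylinders M W {h. h \<bullet> x = 0}))"
  proof (rule measurable_coordinatewise_then_product)
    fix i
    have "\<phi> i - Re (a i) *\<^sub>R x \<in> {h. h \<bullet> x = 0}" "(- \<i>) *\<^sub>C \<phi> i - Im (a i) *\<^sub>R x \<in> {h. h \<bullet> x = 0}"
      using xx by (simp_all add: a_def Re_cinner Im_cinner inner_diff_left)
    then show "(\<lambda>\<omega>. T \<omega> i) \<in> borel_measurable (sigma (space M) (cylinders M W {h. h \<bullet> x = 0}))"
      unfolding T_def by (intro Complex_meas cylinders_generator_measurable)
  qed
  have [measurable]: "T \<in> borel_measurable M"
    by (rule measurable_coordinatewise_then_product) (simp add: T_def Complex_meas)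
  have ZT: "AE \<omega> in M. (\<lambda>i. Z (\<phi> i) \<omega>) = (\<lambda>i. T \<omega> i + a i * of_real (W x \<omega>))"
  proof -
    have "AE \<omega> in M. Z (\<phi> i) \<omega> = T \<omega> i + a i * of_real (W x \<omega>)" for i
      using Z_eq_W[of "\<phi> i"] W_linear[of "\<phi> i" "- Re (a i)" x] W_linear[of "(- \<i>) *\<^sub>C \<phi> i" "- Im (a i)" x]
      by eventually_elim (simp add: T_def complex_eq_iff)
    then have "AE \<omega> in M. \<forall>i. Z (\<phi> i) \<omega> = T \<omega> i + a i * of_real (W x \<omega>)"
      by (simp add: AE_all_countable)
    then show ?thesis by eventually_elim (simp add: fun_eq_iff)
  qed
  define \<Phi> where "\<Phi> f = (\<lambda>(u, \<tau>). f (\<lambda>i. \<tau> i + a i * complex_of_real u))" for f :: "(nat \<Rightarrow> complex) \<Rightarrow> complex"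
  have shift: "(\<lambda>p :: real \<times> (nat \<Rightarrow> complex). (\<lambda>i. snd p i + a i * of_real (fst p))) \<in> borel \<Otimes>\<^sub>M borel \<rightarrow>\<^sub>M borel"
  proof (rule measurable_coordinatewise_then_product)
    fix i
    have [measurable]: "(\<lambda>p :: real \<times> (nat \<Rightarrow> complex). snd p i) \<in> borel_measurable (borel \<Otimes>\<^sub>M borel)"
      by (rule measurable_product_then_coordinatewise[OF measurable_snd])
    show "(\<lambda>p :: real \<times> (nat \<Rightarrow> complex). snd p i + a i * of_real (fst p)) \<in> borel_measurable (borel \<Otimes>\<^sub>M borel)"
      by measurable
  qed
  have \<Phi>_meas[measurable]: "\<Phi> f \<in> borel_measurable (borel \<Otimes>\<^sub>M borel)" if [measurable]: "f \<in> borel_measurable borel" for f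
    using measurable_compose[OF shift that] by (simp add: \<Phi>_def case_prod_unfold)
  define P Q where "P = distr M borel (W x)" and "Q = distr M borel T"
  have PQ: "P \<Otimes>\<^sub>M Q = distr M (borel \<Otimes>\<^sub>M borel) (\<lambda>\<omega>. (W x \<omega>, T \<omega>))"
    unfolding P_def Q_def by (rule distr_perp[OF x T_meas])
  interpret P: prob_space P unfolding P_def by (rule prob_space_distr) simp
  interpret Q: prob_space Q unfolding Q_def by (rule prob_space_distr) simp
  interpret PQ: pair_prob_space P Q ..
  have dens: "P = density lborel (normal_density 0 \<sigma>)"
  proof -
    have "P = distr M lborel (W x)" unfolding P_def by (rule distr_cong) auto
    moreover have "x \<noteq> 0" using x by auto
    ultimately show ?thesis
      using distributed_distr_eq_density[OF W_normal[of x]] x by (simp add: \<sigma>_def)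
  qed
  have P_int: "(\<integral>u. h u \<partial>P) = (\<integral>u. normal_density 0 \<sigma> u *\<^sub>R h u \<partial>lborel)"
    if "h \<in> borel_measurable borel" for h :: "real \<Rightarrow> complex"
    unfolding dens using that by (intro integral_density) auto
  \<comment> \<open>The hypothesis gives derivatives at parameter 0 from every base point;
    translating the base point gives the derivative at every u.\<close>
  have line: "((\<lambda>u. g (\<lambda>i. \<tau> i + a i * of_real u)) has_vector_derivative g' (\<lambda>i. \<tau> i + a i * of_real u)) (at u)" for \<tau> u
  proof -
    have "((\<lambda>s. g (\<lambda>i. \<tau> i + a i * of_real u + of_real s * a i)) \<circ> (\<lambda>v. v - u) has_vector_derivative
        1 *\<^sub>R g' (\<lambda>i. \<tau> i + a i * of_real u)) (at u)"
    proof (rule vector_diff_chain_at)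
      show "((\<lambda>v. v - u) has_vector_derivative 1) (at u)" by (auto intro!: derivative_eq_intros)
      show "((\<lambda>s. g (\<lambda>i. \<tau> i + a i * of_real u + of_real s * a i)) has_vector_derivative
          g' (\<lambda>i. \<tau> i + a i * of_real u)) (at (u - u))"
        using deriv[of "\<lambda>i. \<tau> i + a i * of_real u"] by (simp add: a_def)
    qed
    then show ?thesis by (simp add: comp_def algebra_simps)
  qed
  \<comment> \<open>The constant may depend on \<tau>, because the one-dimensional identity is
    applied with \<tau> fixed. Joint integrability is obtained separately from the L2
    bounds.\<close>
  have growth: "\<exists>C N. \<forall>u. cmod (f (\<lambda>i. \<tau> i + a i * of_real u)) \<le> C * (1 + \<bar>u\<bar>) ^ N"
    if pg: "polynomial_growth k f" for f \<tau>
  proof -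
    obtain C N where CN: "\<And>z. cmod (f z) \<le> C * (1 + (\<Sum>i<k. cmod (z i))) ^ N"
      using pg unfolding polynomial_growth_def by blast
    define S where "S = 1 + (\<Sum>i<k. cmod (\<tau> i) + cmod (a i))"
    have S: "S \<ge> 1" by (simp add: S_def sum_nonneg)
    have "cmod (f (\<lambda>i. \<tau> i + a i * of_real u)) \<le> (\<bar>C\<bar> * S ^ N) * (1 + \<bar>u\<bar>) ^ N" for u
    proof -
      have "(\<Sum>i<k. cmod (\<tau> i + a i * of_real u)) \<le> (\<Sum>i<k. (cmod (\<tau> i) + cmod (a i)) * (1 + \<bar>u\<bar>))"
      proof (rule sum_mono)
        fix i
        have "cmod (\<tau> i + a i * of_real u) \<le> cmod (\<tau> i) + cmod (a i) * \<bar>u\<bar>"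
          using norm_triangle_ineq[of "\<tau> i" "a i * of_real u"] by (simp add: norm_mult)
        also have "\<dots> \<le> (cmod (\<tau> i) + cmod (a i)) * (1 + \<bar>u\<bar>)" by (simp add: algebra_simps)
        finally show "cmod (\<tau> i + a i * of_real u) \<le> (cmod (\<tau> i) + cmod (a i)) * (1 + \<bar>u\<bar>)" .
      qed
      then have "1 + (\<Sum>i<k. cmod (\<tau> i + a i * of_real u)) \<le> S * (1 + \<bar>u\<bar>)"
        by (simp add: S_def distrib_right sum_distrib_right)
      then have le: "(1 + (\<Sum>i<k. cmod (\<tau> i + a i * of_real u))) ^ N \<le> (S * (1 + \<bar>u\<bar>)) ^ N"
        by (intro power_mono) (auto simp: add_nonneg_nonneg sum_nonneg)
      have "cmod (f (\<lambda>i. \<tau> i + a i * of_real u)) \<le> C * (1 + (\<Sum>i<k. cmod (\<tau> i + a i * of_real u))) ^ N" by (rule CN)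
      also have "\<dots> \<le> \<bar>C\<bar> * (1 + (\<Sum>i<k. cmod (\<tau> i + a i * of_real u))) ^ N"
        by (intro mult_right_mono) (auto simp: add_nonneg_nonneg sum_nonneg)
      also have "\<dots> \<le> \<bar>C\<bar> * (S * (1 + \<bar>u\<bar>)) ^ N" by (intro mult_left_mono le) auto
      finally show ?thesis by (simp add: power_mult_distrib mult.assoc)
    qed
    then show ?thesis by blast
  qed
  have inner: "(\<integral>u. \<Phi> g (u, \<tau>) * of_real u \<partial>P) = (\<integral>u. \<Phi> g' (u, \<tau>) \<partial>P) / 2" for \<tau>
  proof -
    obtain C1 N1 where 1: "\<And>u. cmod (g (\<lambda>i. \<tau> i + a i * of_real u)) \<le> C1 * (1 + \<bar>u\<bar>) ^ N1"
      using growth[OF g(2)] by blast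
    obtain C2 N2 where 2: "\<And>u. cmod (g' (\<lambda>i. \<tau> i + a i * of_real u)) \<le> C2 * (1 + \<bar>u\<bar>) ^ N2"
      using growth[OF g'(2)] by blast
    define C N where "C = \<bar>C1\<bar> + \<bar>C2\<bar>" and "N = max N1 N2"
    have le: "c * (1 + \<bar>u\<bar>) ^ n \<le> C * (1 + \<bar>u\<bar>) ^ N" if "c \<le> C" "n \<le> N" for c n and u :: real
      using that by (intro mult_mono power_increasing) (auto simp: C_def)
    have contl: "continuous_on UNIV (\<lambda>u. f (\<lambda>i. \<tau> i + a i * of_real u))" if "continuous_on UNIV f"
      for f :: "(nat \<Rightarrow> complex) \<Rightarrow> complex"
      by (rule continuous_on_compose2[OF that])
        (auto intro!: continuous_on_coordinatewise_then_product continuous_intros)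
    have [measurable]: "(\<lambda>u. g (\<lambda>i. \<tau> i + a i * of_real u)) \<in> borel_measurable borel"
      "(\<lambda>u. g' (\<lambda>i. \<tau> i + a i * of_real u)) \<in> borel_measurable borel"
      using contl g g' by (auto intro: borel_measurable_continuous_onI)
    have "(\<integral>u. \<Phi> g (u, \<tau>) * of_real u \<partial>P)
        = (\<integral>u. normal_density 0 \<sigma> u *\<^sub>R (of_real u * g (\<lambda>i. \<tau> i + a i * of_real u)) \<partial>lborel)"
      by (subst P_int) (measurable, simp add: \<Phi>_def mult.commute)
    also have "\<dots> = of_real (\<sigma>\<^sup>2) * (\<integral>u. normal_density 0 \<sigma> u *\<^sub>R g' (\<lambda>i. \<tau> i + a i * of_real u) \<partial>lborel)"
    proof (rule gaussian_ibp[OF \<sigma>(1) line contl[OF g'(1)]])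
      show "cmod (g (\<lambda>i. \<tau> i + a i * of_real u)) \<le> C * (1 + \<bar>u\<bar>) ^ N" for u
        by (rule order_trans[OF 1 le]) (auto simp: C_def N_def)
      show "cmod (g' (\<lambda>i. \<tau> i + a i * of_real u)) \<le> C * (1 + \<bar>u\<bar>) ^ N" for u
        by (rule order_trans[OF 2 le]) (auto simp: C_def N_def)
    qed
    also have "(\<integral>u. normal_density 0 \<sigma> u *\<^sub>R g' (\<lambda>i. \<tau> i + a i * of_real u) \<partial>lborel) = (\<integral>u. \<Phi> g' (u, \<tau>) \<partial>P)"
      by (subst P_int) (measurable, simp add: \<Phi>_def)
    finally show ?thesis by (simp add: \<sigma>(2))
  qed
  have joint: "(\<integral>p. f p \<partial>(P \<Otimes>\<^sub>M Q)) = (\<integral>\<omega>. f (W x \<omega>, T \<omega>) \<partial>M)"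
    and joint_int: "integrable (P \<Otimes>\<^sub>M Q) f \<longleftrightarrow> integrable M (\<lambda>\<omega>. f (W x \<omega>, T \<omega>))"
    if [measurable]: "f \<in> borel_measurable (borel \<Otimes>\<^sub>M borel)" for f :: "real \<times> (nat \<Rightarrow> complex) \<Rightarrow> complex"
    unfolding PQ by (auto intro!: integral_distr integrable_distr_eq)
  have Z\<Phi>: "AE \<omega> in M. f (\<lambda>i. Z (\<phi> i) \<omega>) = \<Phi> f (W x \<omega>, T \<omega>)" for f
    using ZT by eventually_elim (simp add: \<Phi>_def)
  have L2W: "(\<lambda>\<omega>. complex_of_real (W x \<omega>)) \<in> L2_space M"
    using W_power_integrable[of x 2] by (intro L2_spaceI) auto
  have int1: "integrable M (\<lambda>\<omega>. \<Phi> g (W x \<omega>, T \<omega>) * of_real (W x \<omega>))"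
  proof (subst integrable_cong_AE[where g = "\<lambda>\<omega>. g (\<lambda>i. Z (\<phi> i) \<omega>) * of_real (W x \<omega>)"])
    show "AE \<omega> in M. \<Phi> g (W x \<omega>, T \<omega>) * of_real (W x \<omega>) = g (\<lambda>i. Z (\<phi> i) \<omega>) * of_real (W x \<omega>)"
      using Z\<Phi>[of g] by eventually_elim simp
    show "integrable M (\<lambda>\<omega>. g (\<lambda>i. Z (\<phi> i) \<omega>) * of_real (W x \<omega>))"
      by (rule L2_integrable_mult[OF cylinder_functional_L2[OF g] L2W])
  qed measurable
  have int2: "integrable M (\<lambda>\<omega>. \<Phi> g' (W x \<omega>, T \<omega>))"
  proof (subst integrable_cong_AE[where g = "\<lambda>\<omega>. g' (\<lambda>i. Z (\<phi> i) \<omega>)"])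
    show "AE \<omega> in M. \<Phi> g' (W x \<omega>, T \<omega>) = g' (\<lambda>i. Z (\<phi> i) \<omega>)"
      using Z\<Phi>[of g'] by eventually_elim simp
  qed (use cylinder_functional_integrable[OF g'] in measurable)
  have "expectation (\<lambda>\<omega>. g (\<lambda>i. Z (\<phi> i) \<omega>) * of_real (W x \<omega>)) = expectation (\<lambda>\<omega>. \<Phi> g (W x \<omega>, T \<omega>) * of_real (W x \<omega>))"
  proof (rule integral_cong_AE)
    show "AE \<omega> in M. g (\<lambda>i. Z (\<phi> i) \<omega>) * of_real (W x \<omega>) = \<Phi> g (W x \<omega>, T \<omega>) * of_real (W x \<omega>)"
      using Z\<Phi>[of g] by eventually_elim simp
  qed measurable
  also have "\<dots> = (\<integral>p. (\<lambda>(u, \<tau>). \<Phi> g (u, \<tau>) * of_real u) p \<partial>(P \<Otimes>\<^sub>M Q))"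
    by (subst joint) auto
  also have "\<dots> = (\<integral>\<tau>. (\<integral>u. \<Phi> g (u, \<tau>) * of_real u \<partial>P) \<partial>Q)"
    by (subst PQ.integral_snd) (use int1 in \<open>auto simp: joint_int\<close>)
  also have "\<dots> = (\<integral>\<tau>. (\<integral>u. \<Phi> g' (u, \<tau>) \<partial>P) \<partial>Q) / 2"
    unfolding inner by simp
  also have "(\<integral>\<tau>. (\<integral>u. \<Phi> g' (u, \<tau>) \<partial>P) \<partial>Q) = (\<integral>p. (\<lambda>(u, \<tau>). \<Phi> g' (u, \<tau>)) p \<partial>(P \<Otimes>\<^sub>M Q))"
    by (subst PQ.integral_snd) (use int2 in \<open>auto simp: joint_int\<close>)
  also have "\<dots> = expectation (\<lambda>\<omega>. \<Phi> g' (W x \<omega>, T \<omega>))"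
    by (subst joint) auto
  also have "\<dots> = expectation (\<lambda>\<omega>. g' (\<lambda>i. Z (\<phi> i) \<omega>))"
  proof (rule integral_cong_AE)
    show "AE \<omega> in M. \<Phi> g' (W x \<omega>, T \<omega>) = g' (\<lambda>i. Z (\<phi> i) \<omega>)"
      using Z\<Phi>[of g'] by eventually_elim simp
  qed measurable
  finally show ?thesis .
qed

end

section \<open>Functionals differentiable in one direction\<close>

definition moderate :: "nat \<Rightarrow> ((nat \<Rightarrow> complex) \<Rightarrow> complex) \<Rightarrow> bool"
  where "moderate k g \<longleftrightarrow> continuous_on UNIV g \<and> polynomial_growth k g"

lemma moderateE:
  assumes "moderate k g"
  obtains C N where "0 \<le> C" "\<And>z. cmod (g z) \<le> C * (1 + (\<Sum>i<k. cmod (z i))) ^ N"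
proof -
  obtain C N where "\<And>z. cmod (g z) \<le> C * (1 + (\<Sum>i<k. cmod (z i))) ^ N"
    using assms unfolding moderate_def polynomial_growth_def by blast
  then have "cmod (g z) \<le> \<bar>C\<bar> * (1 + (\<Sum>i<k. cmod (z i))) ^ N" for z
    by (rule order_trans) (intro mult_right_mono, auto simp: sum_nonneg add_nonneg_nonneg)
  then show ?thesis using that[of "\<bar>C\<bar>" N] by simp
qed

lemma moderateI:
  assumes "continuous_on UNIV g" "\<And>z. cmod (g z) \<le> C * (1 + (\<Sum>i<k. cmod (z i))) ^ N"
  shows "moderate k g"
  using assms unfolding moderate_def polynomial_growth_def by blast

lemma moderate_cont: "moderate k g \<Longrightarrow> continuous_on UNIV g"
  by (simp add: moderate_def)

lemma moderate_const [simp]: "moderate k (\<lambda>z. c)"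
  by (rule moderateI[of _ "cmod c" k 0]) auto

lemma moderate_coord:
  assumes "j < k"
  shows "moderate k (\<lambda>z. z j)"
proof (rule moderateI[of _ 1 k 1])
  show "continuous_on UNIV (\<lambda>z. z j :: complex)" by simp
  show "cmod (z j) \<le> 1 * (1 + (\<Sum>i<k. cmod (z i))) ^ 1" for z
    using member_le_sum[of j "{..<k}" "\<lambda>i. cmod (z i)"] assms by simp
qed

lemma moderate_cnj:
  assumes "moderate k g"
  shows "moderate k (\<lambda>z. cnj (g z))"
proof -
  obtain C N where "\<And>z. cmod (g z) \<le> C * (1 + (\<Sum>i<k. cmod (z i))) ^ N"
    using moderateE[OF assms] by blast
  then show ?thesis
    using moderate_cont[OF assms] by (intro moderateI[of _ C k N]) (auto intro: continuous_on_cnj)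
qed

lemma moderate_mult:
  assumes "moderate k f" "moderate k g"
  shows "moderate k (\<lambda>z. f z * g z)"
proof -
  obtain C N where f: "0 \<le> C" "\<And>z. cmod (f z) \<le> C * (1 + (\<Sum>i<k. cmod (z i))) ^ N"
    using moderateE[OF assms(1)] by blast
  obtain D L where g: "0 \<le> D" "\<And>z. cmod (g z) \<le> D * (1 + (\<Sum>i<k. cmod (z i))) ^ L"
    using moderateE[OF assms(2)] by blast
  show ?thesis
  proof (rule moderateI)
    show "cmod (f z * g z) \<le> (C * D) * (1 + (\<Sum>i<k. cmod (z i))) ^ (N + L)" for z
    proof -
      have "cmod (f z * g z) \<le> (C * (1 + (\<Sum>i<k. cmod (z i))) ^ N) * (D * (1 + (\<Sum>i<k. cmod (z i))) ^ L)"
        unfolding norm_mult using f g by (intro mult_mono) (auto simp: sum_nonneg add_nonneg_nonneg)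
      then show ?thesis by (simp add: power_add mult_ac)
    qed
  qed (rule continuous_on_mult[OF moderate_cont[OF assms(1)] moderate_cont[OF assms(2)]])
qed

lemma moderate_add:
  assumes "moderate k f" "moderate k g"
  shows "moderate k (\<lambda>z. f z + g z)"
proof -
  obtain C N where f: "0 \<le> C" "\<And>z. cmod (f z) \<le> C * (1 + (\<Sum>i<k. cmod (z i))) ^ N"
    using moderateE[OF assms(1)] by blast
  obtain D L where g: "0 \<le> D" "\<And>z. cmod (g z) \<le> D * (1 + (\<Sum>i<k. cmod (z i))) ^ L"
    using moderateE[OF assms(2)] by blast
  show ?thesis
  proof (rule moderateI)
    show "cmod (f z + g z) \<le> (C + D) * (1 + (\<Sum>i<k. cmod (z i))) ^ (max N L)" for z
    proof -
      have s: "1 \<le> 1 + (\<Sum>i<k. cmod (z i))" by (simp add: sum_nonneg)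
      have "cmod (f z + g z) \<le> C * (1 + (\<Sum>i<k. cmod (z i))) ^ N + D * (1 + (\<Sum>i<k. cmod (z i))) ^ L"
        using f(2)[of z] g(2)[of z] norm_triangle_ineq[of "f z" "g z"] by linarith
      also have "\<dots> \<le> C * (1 + (\<Sum>i<k. cmod (z i))) ^ max N L + D * (1 + (\<Sum>i<k. cmod (z i))) ^ max N L"
        using f(1) g(1) by (intro add_mono mult_left_mono power_increasing s) auto
      finally show ?thesis by (simp add: distrib_right)
    qed
  qed (rule continuous_on_add[OF moderate_cont[OF assms(1)] moderate_cont[OF assms(2)]])
qed

text \<open>Injectivity ensures that each modulus in the reindexed growth bound occurs at most once
  in the bound for k' variables.\<close>

lemma moderate_reindex:
  assumes "moderate k g" "inj r" "\<And>i. i < k \<Longrightarrow> r i < k'"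
  shows "moderate k' (\<lambda>z. g (\<lambda>i. z (r i)))"
proof -
  obtain C N where g: "0 \<le> C" "\<And>z. cmod (g z) \<le> C * (1 + (\<Sum>i<k. cmod (z i))) ^ N"
    using moderateE[OF assms(1)] by blast
  show ?thesis
  proof (rule moderateI)
    show "continuous_on UNIV (\<lambda>z. g (\<lambda>i. z (r i)))"
      by (rule continuous_on_compose2[OF moderate_cont[OF assms(1)]])
        (auto intro!: continuous_on_coordinatewise_then_product)
    show "cmod (g (\<lambda>i. z (r i))) \<le> C * (1 + (\<Sum>i<k'. cmod (z i))) ^ N" for z
    proof -
      have "(\<Sum>i<k. cmod (z (r i))) = (\<Sum>j\<in>r ` {..<k}. cmod (z j))"
        using assms(2) by (subst sum.reindex) (auto simp: inj_on_def)
      also have "\<dots> \<le> (\<Sum>i<k'. cmod (z i))" using assms(3) by (intro sum_mono2) auto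
      finally have "(1 + (\<Sum>i<k. cmod (z (r i)))) ^ N \<le> (1 + (\<Sum>i<k'. cmod (z i))) ^ N"
        by (intro power_mono) (auto simp: sum_nonneg add_nonneg_nonneg)
      then show ?thesis using g(1) by (intro order_trans[OF g(2)] mult_left_mono) auto
    qed
  qed
qed

section \<open>Random variables with a pair of directional derivatives\<close>

context complex_isonormal
begin

text \<open>The derivative of G in the direction c x is c A + cnj c B: A and B are the pairings of the
  two Malliavin derivatives of G with x.\<close>

definition wdiff :: "'h cplx \<Rightarrow> ('w \<Rightarrow> complex) \<Rightarrow> ('w \<Rightarrow> complex) \<Rightarrow> ('w \<Rightarrow> complex) \<Rightarrow> bool"
  where "wdiff x G A B \<longleftrightarrow> (\<exists>k \<phi> g gA gB. moderate k g \<and> moderate k gA \<and> moderate k gB \<and>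
    G = (\<lambda>\<omega>. g (\<lambda>i. Z (\<phi> i) \<omega>)) \<and> A = (\<lambda>\<omega>. gA (\<lambda>i. Z (\<phi> i) \<omega>)) \<and> B = (\<lambda>\<omega>. gB (\<lambda>i. Z (\<phi> i) \<omega>)) \<and>
    (\<forall>z. \<forall>c\<in>{1, \<i>}. ((\<lambda>t::real. g (\<lambda>i. z i + of_real t * (c * cinner (\<phi> i) x)))
      has_vector_derivative c * gA z + cnj c * gB z) (at 0)))"

lemma wdiffI:
  assumes "moderate k g" "moderate k gA" "moderate k gB"
    "\<And>z c. c \<in> {1, \<i>} \<Longrightarrow> ((\<lambda>t::real. g (\<lambda>i. z i + of_real t * (c * cinner (\<phi> i) x)))
      has_vector_derivative c * gA z + cnj c * gB z) (at 0)"
  shows "wdiff x (\<lambda>\<omega>. g (\<lambda>i. Z (\<phi> i) \<omega>)) (\<lambda>\<omega>. gA (\<lambda>i. Z (\<phi> i) \<omega>)) (\<lambda>\<omega>. gB (\<lambda>i. Z (\<phi> i) \<omega>))"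
  unfolding wdiff_def using assms by (intro exI[of _ k] exI[of _ \<phi>] exI[of _ g] exI[of _ gA] exI[of _ gB]) auto

lemma wdiff_L2:
  assumes "wdiff x G A B"
  shows "G \<in> L2_space M" "A \<in> L2_space M" "B \<in> L2_space M"
  using assms unfolding wdiff_def moderate_def by (auto intro: cylinder_functional_L2)

text \<open>Two functionals may be written over different sequences of vectors. Rewriting both over
  one sequence makes the sum and product rules statements about functions of the same
  argument.\<close>

lemma wdiff_common:
  assumes "wdiff x G A B" "wdiff x G' A' B'"
  obtains k \<phi> g gA gB h hA hB where
    "moderate k g" "moderate k gA" "moderate k gB" "moderate k h" "moderate k hA" "moderate k hB"
    "G = (\<lambda>\<omega>. g (\<lambda>i. Z (\<phi> i) \<omega>))" "A = (\<lambda>\<omega>. gA (\<lambda>i. Z (\<phi> i) \<omega>))" "B = (\<lambda>\<omega>. gB (\<lambda>i. Z (\<phi> i) \<omega>))"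
    "G' = (\<lambda>\<omega>. h (\<lambda>i. Z (\<phi> i) \<omega>))" "A' = (\<lambda>\<omega>. hA (\<lambda>i. Z (\<phi> i) \<omega>))" "B' = (\<lambda>\<omega>. hB (\<lambda>i. Z (\<phi> i) \<omega>))"
    "\<And>z c. c \<in> {1, \<i>} \<Longrightarrow> ((\<lambda>t::real. g (\<lambda>i. z i + of_real t * (c * cinner (\<phi> i) x)))
      has_vector_derivative c * gA z + cnj c * gB z) (at 0)"
    "\<And>z c. c \<in> {1, \<i>} \<Longrightarrow> ((\<lambda>t::real. h (\<lambda>i. z i + of_real t * (c * cinner (\<phi> i) x)))
      has_vector_derivative c * hA z + cnj c * hB z) (at 0)"
proof -
  obtain k1 \<phi>1 g gA gB where 1: "moderate k1 g" "moderate k1 gA" "moderate k1 gB"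
    "G = (\<lambda>\<omega>. g (\<lambda>i. Z (\<phi>1 i) \<omega>))" "A = (\<lambda>\<omega>. gA (\<lambda>i. Z (\<phi>1 i) \<omega>))" "B = (\<lambda>\<omega>. gB (\<lambda>i. Z (\<phi>1 i) \<omega>))"
    "\<And>z c. c \<in> {1, \<i>} \<Longrightarrow> ((\<lambda>t::real. g (\<lambda>i. z i + of_real t * (c * cinner (\<phi>1 i) x)))
      has_vector_derivative c * gA z + cnj c * gB z) (at 0)"
    using assms(1) unfolding wdiff_def by blast
  obtain k2 \<phi>2 h hA hB where 2: "moderate k2 h" "moderate k2 hA" "moderate k2 hB"
    "G' = (\<lambda>\<omega>. h (\<lambda>i. Z (\<phi>2 i) \<omega>))" "A' = (\<lambda>\<omega>. hA (\<lambda>i. Z (\<phi>2 i) \<omega>))" "B' = (\<lambda>\<omega>. hB (\<lambda>i. Z (\<phi>2 i) \<omega>))"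
    "\<And>z c. c \<in> {1, \<i>} \<Longrightarrow> ((\<lambda>t::real. h (\<lambda>i. z i + of_real t * (c * cinner (\<phi>2 i) x)))
      has_vector_derivative c * hA z + cnj c * hB z) (at 0)"
    using assms(2) unfolding wdiff_def by blast
  \<comment> \<open>The sequences are interleaved at even and odd indices; the bound k is large
    enough for both.\<close>
  define \<phi> where "\<phi> i = (if even i then \<phi>1 (i div 2) else \<phi>2 (i div 2))" for i :: nat
  define k where "k = 2 * k1 + 2 * k2"
  have \<phi>: "\<phi> (2 * i) = \<phi>1 i" "\<phi> (2 * i + 1) = \<phi>2 i" for i by (simp_all add: \<phi>_def)
  have m1: "moderate k (\<lambda>z. f (\<lambda>i. z (2 * i)))" if "moderate k1 f" for f
    by (rule moderate_reindex[OF that]) (auto simp: inj_def k_def)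
  have m2: "moderate k (\<lambda>z. f (\<lambda>i. z (2 * i + 1)))" if "moderate k2 f" for f
    by (rule moderate_reindex[OF that]) (auto simp: inj_def k_def)
  show ?thesis
  proof (rule that[of k "\<lambda>z. g (\<lambda>i. z (2 * i))" "\<lambda>z. gA (\<lambda>i. z (2 * i))" "\<lambda>z. gB (\<lambda>i. z (2 * i))"
        "\<lambda>z. h (\<lambda>i. z (2 * i + 1))" "\<lambda>z. hA (\<lambda>i. z (2 * i + 1))" "\<lambda>z. hB (\<lambda>i. z (2 * i + 1))" \<phi>])
  qed (use 1(1-3) 2(1-3) 1(7) 2(7) in \<open>simp_all only: m1 m2 1(4-6) 2(4-6) \<phi>\<close>)
qed

lemma wdiff_const: "wdiff x (\<lambda>\<omega>. c) (\<lambda>\<omega>. 0) (\<lambda>\<omega>. 0)"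
  using wdiffI[of 0 "\<lambda>z. c" "\<lambda>z. 0" "\<lambda>z. 0" "\<lambda>i. 0" x] by simp

lemma wdiff_Z: "wdiff x (Z h) (\<lambda>\<omega>. cinner h x) (\<lambda>\<omega>. 0)"
proof -
  have "((\<lambda>t::real. z 0 + of_real t * (c * cinner h x)) has_vector_derivative c * cinner h x + cnj c * 0) (at 0)"
    for z :: "nat \<Rightarrow> complex" and c
    by (auto intro!: derivative_eq_intros)
  then show ?thesis
    using wdiffI[of 1 "\<lambda>z. z 0" "\<lambda>z. cinner h x" "\<lambda>z. 0" "\<lambda>i. h" x] by (simp add: moderate_coord)
qed

lemma wdiff_cnj:
  assumes "wdiff x G A B"
  shows "wdiff x (\<lambda>\<omega>. cnj (G \<omega>)) (\<lambda>\<omega>. cnj (B \<omega>)) (\<lambda>\<omega>. cnj (A \<omega>))"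
proof -
  obtain k \<phi> g gA gB where 1: "moderate k g" "moderate k gA" "moderate k gB"
    "G = (\<lambda>\<omega>. g (\<lambda>i. Z (\<phi> i) \<omega>))" "A = (\<lambda>\<omega>. gA (\<lambda>i. Z (\<phi> i) \<omega>))" "B = (\<lambda>\<omega>. gB (\<lambda>i. Z (\<phi> i) \<omega>))"
    "\<And>z c. c \<in> {1, \<i>} \<Longrightarrow> ((\<lambda>t::real. g (\<lambda>i. z i + of_real t * (c * cinner (\<phi> i) x)))
      has_vector_derivative c * gA z + cnj c * gB z) (at 0)"
    using assms(1) unfolding wdiff_def by blast
  have "((\<lambda>t::real. cnj (g (\<lambda>i. z i + of_real t * (c * cinner (\<phi> i) x))))
      has_vector_derivative c * cnj (gB z) + cnj c * cnj (gA z)) (at 0)" if "c \<in> {1, \<i>}" for z c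
    using has_vector_derivative_cnj[OF 1(7)[OF that, of z]] by (simp add: add.commute)
  then show ?thesis unfolding 1(4-6) using 1(1-3) by (intro wdiffI moderate_cnj)
qed

lemma wdiff_add:
  assumes "wdiff x G A B" "wdiff x G' A' B'"
  shows "wdiff x (\<lambda>\<omega>. G \<omega> + G' \<omega>) (\<lambda>\<omega>. A \<omega> + A' \<omega>) (\<lambda>\<omega>. B \<omega> + B' \<omega>)"
  using assms
proof (rule wdiff_common)
  fix k \<phi> g gA gB h hA hB
  assume *: "moderate k g" "moderate k gA" "moderate k gB" "moderate k h" "moderate k hA" "moderate k hB"
    "G = (\<lambda>\<omega>. g (\<lambda>i. Z (\<phi> i) \<omega>))" "A = (\<lambda>\<omega>. gA (\<lambda>i. Z (\<phi> i) \<omega>))" "B = (\<lambda>\<omega>. gB (\<lambda>i. Z (\<phi> i) \<omega>))"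
    "G' = (\<lambda>\<omega>. h (\<lambda>i. Z (\<phi> i) \<omega>))" "A' = (\<lambda>\<omega>. hA (\<lambda>i. Z (\<phi> i) \<omega>))" "B' = (\<lambda>\<omega>. hB (\<lambda>i. Z (\<phi> i) \<omega>))"
  assume g: "\<And>z c. c \<in> {1, \<i>} \<Longrightarrow> ((\<lambda>t::real. g (\<lambda>i. z i + of_real t * (c * cinner (\<phi> i) x)))
      has_vector_derivative c * gA z + cnj c * gB z) (at 0)"
    and h: "\<And>z c. c \<in> {1, \<i>} \<Longrightarrow> ((\<lambda>t::real. h (\<lambda>i. z i + of_real t * (c * cinner (\<phi> i) x)))
      has_vector_derivative c * hA z + cnj c * hB z) (at 0)"
  show ?thesis
    unfolding *(7-12)
  proof (rule wdiffI[of k])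
    fix z c assume c: "c \<in> {1, \<i>}"
    show "((\<lambda>t::real. g (\<lambda>i. z i + of_real t * (c * cinner (\<phi> i) x)) + h (\<lambda>i. z i + of_real t * (c * cinner (\<phi> i) x)))
      has_vector_derivative c * (gA z + hA z) + cnj c * (gB z + hB z)) (at 0)"
      by (rule has_vector_derivative_eq_rhs[OF has_vector_derivative_add[OF g[OF c] h[OF c]]])
        (simp add: algebra_simps)
  qed (use *(1-6) in \<open>auto intro: moderate_add\<close>)
qed

lemma wdiff_mult:
  assumes "wdiff x G A B" "wdiff x G' A' B'"
  shows "wdiff x (\<lambda>\<omega>. G \<omega> * G' \<omega>) (\<lambda>\<omega>. A \<omega> * G' \<omega> + G \<omega> * A' \<omega>) (\<lambda>\<omega>. B \<omega> * G' \<omega> + G \<omega> * B' \<omega>)"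
  using assms
proof (rule wdiff_common)
  fix k \<phi> g gA gB h hA hB
  assume *: "moderate k g" "moderate k gA" "moderate k gB" "moderate k h" "moderate k hA" "moderate k hB"
    "G = (\<lambda>\<omega>. g (\<lambda>i. Z (\<phi> i) \<omega>))" "A = (\<lambda>\<omega>. gA (\<lambda>i. Z (\<phi> i) \<omega>))" "B = (\<lambda>\<omega>. gB (\<lambda>i. Z (\<phi> i) \<omega>))"
    "G' = (\<lambda>\<omega>. h (\<lambda>i. Z (\<phi> i) \<omega>))" "A' = (\<lambda>\<omega>. hA (\<lambda>i. Z (\<phi> i) \<omega>))" "B' = (\<lambda>\<omega>. hB (\<lambda>i. Z (\<phi> i) \<omega>))"
  assume g: "\<And>z c. c \<in> {1, \<i>} \<Longrightarrow> ((\<lambda>t::real. g (\<lambda>i. z i + of_real t * (c * cinner (\<phi> i) x)))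
      has_vector_derivative c * gA z + cnj c * gB z) (at 0)"
    and h: "\<And>z c. c \<in> {1, \<i>} \<Longrightarrow> ((\<lambda>t::real. h (\<lambda>i. z i + of_real t * (c * cinner (\<phi> i) x)))
      has_vector_derivative c * hA z + cnj c * hB z) (at 0)"
  show ?thesis
    unfolding *(7-12)
  proof (rule wdiffI[of k])
    fix z c assume c: "c \<in> {1, \<i>}"
    show "((\<lambda>t::real. g (\<lambda>i. z i + of_real t * (c * cinner (\<phi> i) x)) * h (\<lambda>i. z i + of_real t * (c * cinner (\<phi> i) x)))
      has_vector_derivative c * (gA z * h z + g z * hA z) + cnj c * (gB z * h z + g z * hB z)) (at 0)"
      by (rule has_vector_derivative_eq_rhs[OF has_vector_derivative_mult[OF g[OF c] h[OF c]]])
        (simp add: algebra_simps)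
  qed (use *(1-6) in \<open>auto intro!: moderate_add moderate_mult\<close>)
qed

lemma wdiff_cmult:
  "wdiff x G A B \<Longrightarrow> wdiff x (\<lambda>\<omega>. c * G \<omega>) (\<lambda>\<omega>. c * A \<omega>) (\<lambda>\<omega>. c * B \<omega>)"
  using wdiff_mult[OF wdiff_const[of x c], of G A B] by simp

lemma wdiff_diff:
  assumes "wdiff x G A B" "wdiff x G' A' B'"
  shows "wdiff x (\<lambda>\<omega>. G \<omega> - G' \<omega>) (\<lambda>\<omega>. A \<omega> - A' \<omega>) (\<lambda>\<omega>. B \<omega> - B' \<omega>)"
  using wdiff_add[OF assms(1) wdiff_cmult[OF assms(2), of "-1"]] by simp

text \<open>Real integration by parts along x and along y = -i x gives (A + B) / 2 and i (A - B) / 2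
  in mean. As Z x is W x + i W y, pairing with \<open>cnj (Z x)\<close> leaves A and pairing with
  \<open>Z x\<close> leaves B.\<close>

lemma wdiff_ibp:
  assumes x: "norm x = 1" and wd: "wdiff x G A B"
  shows "expectation (\<lambda>\<omega>. G \<omega> * cnj (Z x \<omega>)) = expectation A"
    and "expectation (\<lambda>\<omega>. G \<omega> * Z x \<omega>) = expectation B"
proof -
  obtain k \<phi> g gA gB where 1: "moderate k g" "moderate k gA" "moderate k gB"
    "G = (\<lambda>\<omega>. g (\<lambda>i. Z (\<phi> i) \<omega>))" "A = (\<lambda>\<omega>. gA (\<lambda>i. Z (\<phi> i) \<omega>))" "B = (\<lambda>\<omega>. gB (\<lambda>i. Z (\<phi> i) \<omega>))"
    and deriv: "\<And>z c. c \<in> {1, \<i>} \<Longrightarrow> ((\<lambda>t::real. g (\<lambda>i. z i + of_real t * (c * cinner (\<phi> i) x)))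
      has_vector_derivative c * gA z + cnj c * gB z) (at 0)"
    using wd unfolding wdiff_def by blast
  have G: "G \<in> L2_space M" and AB: "integrable M A" "integrable M B"
    using wdiff_L2[OF wd] by (auto intro: L2_integrable)
  note [measurable] = L2_spaceD(1)[OF G]
  have W: "(\<lambda>\<omega>. complex_of_real (W h \<omega>)) \<in> L2_space M" for h
    using W_power_integrable[of h 2] by (intro L2_spaceI) auto
  have GW: "integrable M (\<lambda>\<omega>. G \<omega> * of_real (W h \<omega>))" for h
    by (rule L2_integrable_mult[OF G W])
  define y where "y = (- \<i>) *\<^sub>C x"
  have y: "norm y = 1" using x by (simp add: y_def norm_cscale)
  have ZW: "AE \<omega> in M. Z x \<omega> = of_real (W x \<omega>) + \<i> * of_real (W y \<omega>)"
    using Z_eq_W[of x] by eventually_elim (simp add: y_def complex_eq_iff)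
  have Re: "expectation (\<lambda>\<omega>. G \<omega> * of_real (W x \<omega>)) = (expectation A + expectation B) / 2"
  proof -
    have "expectation (\<lambda>\<omega>. G \<omega> * of_real (W x \<omega>)) = expectation (\<lambda>\<omega>. A \<omega> + B \<omega>) / 2"
      unfolding 1(4-6)
    proof (rule ibp_W[OF x])
      show "((\<lambda>t. g (\<lambda>i. z i + of_real t * cinner (\<phi> i) x)) has_vector_derivative gA z + gB z) (at 0)" for z
        using deriv[of 1 z] by simp
    qed (use 1(1) moderate_add[OF 1(2,3)] in \<open>auto simp: moderate_def\<close>)
    then show ?thesis using AB by simp
  qed
  \<comment> \<open>\<open>cinner\<close> is conjugate linear on the right, so the direction y = -i
    x corresponds to c = i.\<close>
  have Im: "expectation (\<lambda>\<omega>. G \<omega> * of_real (W y \<omega>)) = \<i> * (expectation A - expectation B) / 2"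
  proof -
    have "expectation (\<lambda>\<omega>. G \<omega> * of_real (W y \<omega>)) = expectation (\<lambda>\<omega>. \<i> * A \<omega> + (- \<i>) * B \<omega>) / 2"
      unfolding 1(4-6)
    proof (rule ibp_W[OF y])
      show "((\<lambda>t. g (\<lambda>i. z i + of_real t * cinner (\<phi> i) y)) has_vector_derivative \<i> * gA z + (- \<i>) * gB z) (at 0)" for z
        using deriv[of \<i> z] by (simp add: y_def cinner_scale_right)
    qed (use 1(1) moderate_add[OF moderate_mult[OF moderate_const[of k "\<i>"] 1(2)] moderate_mult[OF moderate_const[of k "- \<i>"] 1(3)]] in \<open>auto simp: moderate_def\<close>)
    also have "expectation (\<lambda>\<omega>. \<i> * A \<omega> + (- \<i>) * B \<omega>) = \<i> * expectation A + (- \<i>) * expectation B"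
      using AB by (subst Bochner_Integration.integral_add) auto
    finally show ?thesis by (simp add: algebra_simps)
  qed
  have "expectation (\<lambda>\<omega>. G \<omega> * cnj (Z x \<omega>)) = expectation (\<lambda>\<omega>. G \<omega> * of_real (W x \<omega>) - \<i> * (G \<omega> * of_real (W y \<omega>)))"
  proof (rule integral_cong_AE)
    show "AE \<omega> in M. G \<omega> * cnj (Z x \<omega>) = G \<omega> * of_real (W x \<omega>) - \<i> * (G \<omega> * of_real (W y \<omega>))"
      using ZW by eventually_elim (simp add: algebra_simps)
  qed measurable
  also have "\<dots> = expectation (\<lambda>\<omega>. G \<omega> * of_real (W x \<omega>)) - \<i> * expectation (\<lambda>\<omega>. G \<omega> * of_real (W y \<omega>))"
    using GW by (subst Bochner_Integration.integral_diff) auto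
  also have "\<dots> = expectation A" unfolding Re Im by (simp add: field_simps)
  finally show "expectation (\<lambda>\<omega>. G \<omega> * cnj (Z x \<omega>)) = expectation A" .
  have "expectation (\<lambda>\<omega>. G \<omega> * Z x \<omega>) = expectation (\<lambda>\<omega>. G \<omega> * of_real (W x \<omega>) + \<i> * (G \<omega> * of_real (W y \<omega>)))"
  proof (rule integral_cong_AE)
    show "AE \<omega> in M. G \<omega> * Z x \<omega> = G \<omega> * of_real (W x \<omega>) + \<i> * (G \<omega> * of_real (W y \<omega>))"
      using ZW by eventually_elim (simp add: algebra_simps)
  qed measurable
  also have "\<dots> = expectation (\<lambda>\<omega>. G \<omega> * of_real (W x \<omega>)) + \<i> * expectation (\<lambda>\<omega>. G \<omega> * of_real (W y \<omega>))"
    using GW by (subst Bochner_Integration.integral_add) auto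
  also have "\<dots> = expectation B" unfolding Re Im by (simp add: field_simps)
  finally show "expectation (\<lambda>\<omega>. G \<omega> * Z x \<omega>) = expectation B" .
qed

end

section \<open>Smooth cylinder functionals\<close>

lemma has_vector_derivative_line_scale:
  fixes f :: "(nat \<Rightarrow> complex) \<Rightarrow> complex"
  assumes "((\<lambda>t::real. f (\<lambda>j. z j + of_real t * u j)) has_vector_derivative D) (at 0)"
  shows "((\<lambda>t::real. f (\<lambda>j. z j + of_real t * (of_real r * u j))) has_vector_derivative r *\<^sub>R D) (at 0)"
proof -
  have "((\<lambda>t::real. f (\<lambda>j. z j + of_real t * u j)) \<circ> (\<lambda>t. t * r) has_vector_derivative r *\<^sub>R D) (at 0)"
  proof (rule vector_diff_chain_at)
    show "((\<lambda>t. t * r) has_vector_derivative r) (at 0)" by (auto intro!: derivative_eq_intros)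
    show "((\<lambda>t. f (\<lambda>j. z j + of_real t * u j)) has_vector_derivative D) (at (0 * r))"
      using assms by simp
  qed
  then show ?thesis by (simp add: comp_def mult.assoc)
qed

text \<open>Directional derivatives need not add without continuity. On the plane through z spanned
  by u and v, continuity of the v-derivative makes f totally differentiable at z, and the sum is the
  derivative along the diagonal.\<close>

lemma has_vector_derivative_line_add:
  fixes f :: "(nat \<Rightarrow> complex) \<Rightarrow> complex"
  assumes u: "\<And>z. ((\<lambda>t::real. f (\<lambda>j. z j + of_real t * u j)) has_vector_derivative Du z) (at 0)"
    and v: "\<And>z. ((\<lambda>t::real. f (\<lambda>j. z j + of_real t * v j)) has_vector_derivative Dv z) (at 0)"
    and cont: "continuous_on UNIV Dv"
  shows "((\<lambda>t::real. f (\<lambda>j. z j + of_real t * (u j + v j))) has_vector_derivative Du z + Dv z) (at 0)"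
proof -
  define P where "P s t = (\<lambda>j. z j + of_real s * u j + of_real t * v j)" for s t :: real
  have fy: "((\<lambda>t. f (P s t)) has_derivative blinfun_scaleR_left (Dv (P s t))) (at t)" for s t
  proof -
    have "((\<lambda>h. f (\<lambda>j. P s t j + of_real h * v j)) \<circ> (\<lambda>h. h - t) has_vector_derivative 1 *\<^sub>R Dv (P s t)) (at t)"
    proof (rule vector_diff_chain_at)
      show "((\<lambda>h. h - t) has_vector_derivative 1) (at t)" by (auto intro!: derivative_eq_intros)
      show "((\<lambda>h. f (\<lambda>j. P s t j + of_real h * v j)) has_vector_derivative Dv (P s t)) (at (t - t))"
        using v by simp
    qed
    moreover have "P s t j + of_real (h - t) * v j = P s h j" for j h
      by (simp add: P_def algebra_simps)
    ultimately show ?thesis by (simp add: comp_def has_vector_derivative_def)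
  qed
  have fx: "((\<lambda>s. f (P s 0)) has_derivative (\<lambda>h. h *\<^sub>R Du z)) (at 0)"
    using u[of z] by (simp add: P_def has_vector_derivative_def)
  have "continuous_on UNIV (\<lambda>p. Dv (P (fst p) (snd p)))"
    by (rule continuous_on_compose2[OF cont])
      (auto simp: P_def intro!: continuous_on_coordinatewise_then_product continuous_intros)
  then have "isCont (\<lambda>p. Dv (P (fst p) (snd p))) (0, 0)"
    by (simp add: continuous_on_eq_continuous_at)
  then have fyc: "continuous (at (0, 0) within UNIV \<times> UNIV) (\<lambda>(s, t). blinfun_scaleR_left (Dv (P s t)))"
    by (simp add: case_prod_unfold bounded_linear.continuous[OF bounded_linear_blinfun_scaleR_left])
  have D: "((\<lambda>(s, t). f (P s t)) has_derivative (\<lambda>(hs, ht). hs *\<^sub>R Du z + blinfun_scaleR_left (Dv (P 0 0)) ht))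
      (at (0, 0) within UNIV \<times> UNIV)"
    using fx fy by (intro has_derivative_partialsI[OF _ _ fyc]) auto
  have pair: "((\<lambda>t. (t, t)) has_derivative (\<lambda>h. (h, h))) (at (0::real))"
    by (auto intro!: derivative_eq_intros)
  have "((\<lambda>t. f (P t t)) has_derivative (\<lambda>h. h *\<^sub>R Du z + h *\<^sub>R Dv (P 0 0))) (at 0)"
    using has_derivative_compose[OF pair D[unfolded UNIV_Times_UNIV]] by simp
  moreover have "P t t = (\<lambda>j. z j + of_real t * (u j + v j))" "P 0 0 = z" for t
    by (auto simp: P_def algebra_simps)
  ultimately show ?thesis by (simp add: has_vector_derivative_def algebra_simps)
qed

text \<open>The fold applies the last entry first, so differentiating f before the others amounts to
  appending an entry. Derivatives of smooth functions are therefore smooth by the same condition on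
  longer lists.\<close>

lemma iter_partial_snoc: "iter_partial (ds @ [(i, c)]) f = iter_partial ds (partial_deriv i c f)"
  by (simp add: iter_partial_def)

lemma iter_partial_Cons: "iter_partial ((i, c) # ds) f = partial_deriv i c (iter_partial ds f)"
  by (simp add: iter_partial_def)

lemma iter_partial_Nil [simp]: "iter_partial [] f = f"
  by (simp add: iter_partial_def)

context
  fixes k :: nat and f :: "(nat \<Rightarrow> complex) \<Rightarrow> complex"
  assumes f: "smooth_poly_growth k f"
begin

lemma smooth_dep: "(\<And>i. i < k \<Longrightarrow> z i = w i) \<Longrightarrow> f z = f w"
  using f unfolding smooth_poly_growth_def by blast

lemma smooth_iter_moderate:
  assumes "ds \<in> lists ({..<k} \<times> {1, \<i>})"
  shows "moderate k (iter_partial ds f)"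
  using f assms unfolding smooth_poly_growth_def moderate_def by blast

lemma smooth_iter_deriv:
  assumes "ds \<in> lists ({..<k} \<times> {1, \<i>})" "i < k" "c \<in> {1, \<i>}"
  shows "((\<lambda>t::real. iter_partial ds f (z(i := z i + of_real t * c)))
    has_vector_derivative partial_deriv i c (iter_partial ds f) z) (at 0)"
proof -
  have "(\<lambda>t::real. iter_partial ds f (z(i := z i + of_real t * c))) differentiable (at 0)"
    using f assms unfolding smooth_poly_growth_def by blast
  then show ?thesis unfolding partial_deriv_def by (simp only: vector_derivative_works)
qed

lemma smooth_moderate: "moderate k f"
  using smooth_iter_moderate[of "[]"] by simp

lemma smooth_deriv:
  "i < k \<Longrightarrow> c \<in> {1, \<i>} \<Longrightarrow>
    ((\<lambda>t::real. f (z(i := z i + of_real t * c))) has_vector_derivative partial_deriv i c f z) (at 0)"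
  using smooth_iter_deriv[of "[]"] by simp

lemma smooth_partial_deriv:
  assumes "i < k" "c \<in> {1, \<i>}"
  shows "smooth_poly_growth k (partial_deriv i c f)"
  unfolding smooth_poly_growth_def iter_partial_snoc[symmetric]
proof (intro conjI ballI allI impI)
  fix z w :: "nat \<Rightarrow> complex" assume zw: "\<forall>i<k. z i = w i"
  have "f (z(i := z i + of_real t * c)) = f (w(i := w i + of_real t * c))" for t
    using zw assms by (intro smooth_dep) auto
  then show "partial_deriv i c f z = partial_deriv i c f w" by (simp add: partial_deriv_def)
next
  fix ds assume "ds \<in> lists ({..<k} \<times> {1, \<i>})"
  then have ds: "ds @ [(i, c)] \<in> lists ({..<k} \<times> {1, \<i>})" using assms by auto
  show "continuous_on UNIV (iter_partial (ds @ [(i, c)]) f)" "polynomial_growth k (iter_partial (ds @ [(i, c)]) f)"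
    using smooth_iter_moderate[OF ds] by (auto simp: moderate_def)
  fix p assume "p \<in> {..<k} \<times> {1::complex, \<i>}"
  then obtain j d where p: "p = (j, d)" "j < k" "d \<in> {1, \<i>}" by blast
  show "case p of (j, d) \<Rightarrow> \<forall>z. (\<lambda>t::real. iter_partial (ds @ [(i, c)]) f (z(j := z j + of_real t * d))) differentiable at 0"
    unfolding p(1) using differentiableI_vector[OF smooth_iter_deriv[OF ds p(2,3)]] by simp
qed

text \<open>Smoothness is given through single real and imaginary coordinate directions. The
  direction b is built up coordinate by coordinate, each contributing a real and an imaginary
  step.\<close>

lemma smooth_line:
  assumes "finite I" "I \<subseteq> {..<k}"
  shows "((\<lambda>t::real. f (\<lambda>j. z j + of_real t * (if j \<in> I then b j else 0))) has_vector_derivative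
    (\<Sum>i\<in>I. Re (b i) *\<^sub>R partial_deriv i 1 f z + Im (b i) *\<^sub>R partial_deriv i \<i> f z)) (at 0)"
  using assms
proof (induction I arbitrary: z)
  case (insert i I)
  have cont: "continuous_on UNIV (partial_deriv i c f)" if "c \<in> {1, \<i>}" for c
    using smooth_iter_moderate[of "[(i, c)]"] insert.prems that
    by (auto simp: iter_partial_Cons moderate_def)
  have e: "((\<lambda>t::real. f (\<lambda>j. z j + of_real t * (of_real r * (if j = i then c else 0)))) has_vector_derivative
      r *\<^sub>R partial_deriv i c f z) (at 0)" if "c \<in> {1, \<i>}" for c r z
  proof (rule has_vector_derivative_line_scale)
    have "z(i := z i + of_real t * c) = (\<lambda>j. z j + of_real t * (if j = i then c else 0))" for t :: real
      by auto
    then show "((\<lambda>t::real. f (\<lambda>j. z j + of_real t * (if j = i then c else 0))) has_vector_derivative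
        partial_deriv i c f z) (at 0)"
      using smooth_deriv[of i c z] insert.prems that by simp
  qed
  have "((\<lambda>t::real. f (\<lambda>j. z j + of_real t * ((if j \<in> I then b j else 0)
        + (of_real (Re (b i)) * (if j = i then 1 else 0) + of_real (Im (b i)) * (if j = i then \<i> else 0))))) has_vector_derivative
      (\<Sum>i\<in>I. Re (b i) *\<^sub>R partial_deriv i 1 f z + Im (b i) *\<^sub>R partial_deriv i \<i> f z)
        + (Re (b i) *\<^sub>R partial_deriv i 1 f z + Im (b i) *\<^sub>R partial_deriv i \<i> f z)) (at 0)"
    using insert.IH insert.prems cont
    by (intro has_vector_derivative_line_add e) (auto intro!: continuous_intros)
  moreover have "(if j \<in> I then b j else 0)
        + (of_real (Re (b i)) * (if j = i then 1 else 0) + of_real (Im (b i)) * (if j = i then \<i> else 0))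
      = (if j \<in> insert i I then b j else 0)" for j
    using insert.hyps by (auto simp: complex_eq_iff)
  ultimately show ?case using insert.hyps by (simp add: add.commute)
qed simp

end

text \<open>A Wirtinger derivative is a complex combination of two partial derivatives, so this
  keeps it in the smooth class.\<close>

lemma smooth_lincomb:
  assumes f: "smooth_poly_growth k f" and g: "smooth_poly_growth k g"
  shows "smooth_poly_growth k (\<lambda>z. a * f z + b * g z)"
proof -
  have iter: "iter_partial ds (\<lambda>z. a * f z + b * g z) = (\<lambda>z. a * iter_partial ds f z + b * iter_partial ds g z)"
    if "ds \<in> lists ({..<k} \<times> {1, \<i>})" for ds
    using that
  proof (induction ds)
    case (Cons d ds)
    obtain i c where d: "d = (i, c)" by force
    have ic: "i < k" "c \<in> {1, \<i>}" "ds \<in> lists ({..<k} \<times> {1, \<i>})" using Cons by (auto simp: d)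
    have "partial_deriv i c (\<lambda>z. a * iter_partial ds f z + b * iter_partial ds g z) z
        = a * partial_deriv i c (iter_partial ds f) z + b * partial_deriv i c (iter_partial ds g) z" for z
      unfolding partial_deriv_def[of i c "\<lambda>z. a * iter_partial ds f z + b * iter_partial ds g z"]
      by (intro vector_derivative_at has_vector_derivative_add has_vector_derivative_mult_right
          smooth_iter_deriv[OF f] smooth_iter_deriv[OF g] ic)
    then show ?case using Cons by (simp add: d iter_partial_Cons)
  qed simp
  show ?thesis
    unfolding smooth_poly_growth_def
  proof (intro conjI ballI allI impI)
    fix z w :: "nat \<Rightarrow> complex" assume "\<forall>i<k. z i = w i"
    then show "a * f z + b * g z = a * f w + b * g w"
      using smooth_dep[OF f, of z w] smooth_dep[OF g, of z w] by simp
  next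
    fix ds assume ds: "ds \<in> lists ({..<k} \<times> {1::complex, \<i>})"
    have "moderate k (iter_partial ds (\<lambda>z. a * f z + b * g z))"
      unfolding iter[OF ds] using smooth_iter_moderate[OF f ds] smooth_iter_moderate[OF g ds]
      by (intro moderate_add moderate_mult moderate_const)
    then show "continuous_on UNIV (iter_partial ds (\<lambda>z. a * f z + b * g z))"
      "polynomial_growth k (iter_partial ds (\<lambda>z. a * f z + b * g z))" by (auto simp: moderate_def)
    fix p assume p: "p \<in> {..<k} \<times> {1::complex, \<i>}"
    obtain j d where pj: "p = (j, d)" by force
    have "((\<lambda>t::real. a * iter_partial ds f (z(j := z j + of_real t * d)) + b * iter_partial ds g (z(j := z j + of_real t * d)))
        has_vector_derivative a * partial_deriv j d (iter_partial ds f) z + b * partial_deriv j d (iter_partial ds g) z) (at 0)" for z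
      using p by (intro has_vector_derivative_add has_vector_derivative_mult_right
          smooth_iter_deriv[OF f] smooth_iter_deriv[OF g] ds) (auto simp: pj)
    then show "case p of (j, d) \<Rightarrow> \<forall>z. (\<lambda>t::real. iter_partial ds (\<lambda>z. a * f z + b * g z) (z(j := z j + of_real t * d))) differentiable at 0"
      unfolding iter[OF ds] pj by (auto intro: differentiableI_vector)
  qed
qed

lemma smooth_zero: "smooth_poly_growth k (\<lambda>z. 0)"
proof -
  have "iter_partial ds (\<lambda>z. 0) = (\<lambda>z. 0)" for ds
    by (induction ds) (auto simp: iter_partial_Cons partial_deriv_def)
  then show ?thesis
    by (auto simp: smooth_poly_growth_def polynomial_growth_def intro!: exI[of _ 0])
qed

lemma smooth_sum:
  "(\<And>i. i \<in> I \<Longrightarrow> smooth_poly_growth k (f i)) \<Longrightarrow> smooth_poly_growth k (\<lambda>z. \<Sum>i\<in>I. a i * f i z)"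
proof (induction I rule: infinite_finite_induct)
  case (insert i I)
  then show ?case using smooth_lincomb[of k "f i" "\<lambda>z. \<Sum>i\<in>I. a i * f i z" "a i" 1] by simp
qed (simp_all add: smooth_zero)

section \<open>Iterated Wirtinger derivatives and their tensor values\<close>

lemma smooth_wirtinger:
  assumes "smooth_poly_growth k f" "i < k"
  shows "smooth_poly_growth k (wirtinger i f)" "smooth_poly_growth k (wirtinger_bar i f)"
  using smooth_lincomb[OF smooth_partial_deriv[OF assms, of 1] smooth_partial_deriv[OF assms, of \<i>], of "1/2" "- \<i> / 2"]
    smooth_lincomb[OF smooth_partial_deriv[OF assms, of 1] smooth_partial_deriv[OF assms, of \<i>], of "1/2" "\<i> / 2"]
  by (simp_all add: wirtinger_def[abs_def] wirtinger_bar_def[abs_def] diff_divide_distrib add_divide_distrib)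

lemma partial_deriv_sum:
  assumes "\<And>j. j \<in> J \<Longrightarrow> smooth_poly_growth k (f j)" "i < k" "c \<in> {1, \<i>}"
  shows "partial_deriv i c (\<lambda>z. \<Sum>j\<in>J. a j * f j z) z = (\<Sum>j\<in>J. a j * partial_deriv i c (f j) z)"
  unfolding partial_deriv_def[of i c "\<lambda>z. \<Sum>j\<in>J. a j * f j z"] using assms
  by (intro vector_derivative_at has_vector_derivative_sum has_vector_derivative_mult_right smooth_deriv)

lemma wirtinger_sum:
  assumes "\<And>j. j \<in> J \<Longrightarrow> smooth_poly_growth k (f j)" "i < k"
  shows "wirtinger i (\<lambda>z. \<Sum>j\<in>J. a j * f j z) = (\<lambda>z. \<Sum>j\<in>J. a j * wirtinger i (f j) z)"
    and "wirtinger_bar i (\<lambda>z. \<Sum>j\<in>J. a j * f j z) = (\<lambda>z. \<Sum>j\<in>J. a j * wirtinger_bar i (f j) z)"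
proof -
  have p: "partial_deriv i c (\<lambda>z. \<Sum>j\<in>J. a j * f j z) z = (\<Sum>j\<in>J. a j * partial_deriv i c (f j) z)"
    if "c \<in> {1, \<i>}" for c z using partial_deriv_sum[OF assms that] .
  show "wirtinger i (\<lambda>z. \<Sum>j\<in>J. a j * f j z) = (\<lambda>z. \<Sum>j\<in>J. a j * wirtinger i (f j) z)"
    unfolding wirtinger_def p[of 1, simplified] p[of \<i>, simplified] sum_distrib_left sum_subtractf[symmetric] sum_divide_distrib
    by (intro ext sum.cong refl) (simp add: algebra_simps)
  show "wirtinger_bar i (\<lambda>z. \<Sum>j\<in>J. a j * f j z) = (\<lambda>z. \<Sum>j\<in>J. a j * wirtinger_bar i (f j) z)"
    unfolding wirtinger_bar_def p[of 1, simplified] p[of \<i>, simplified] sum_distrib_left sum.distrib[symmetric] sum_divide_distrib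
    by (intro ext sum.cong refl) (simp add: algebra_simps)
qed

lemma smooth_foldr_wirtinger:
  assumes "smooth_poly_growth k f" "set is \<subseteq> {..<k}"
  shows "smooth_poly_growth k (foldr wirtinger is f)" "smooth_poly_growth k (foldr wirtinger_bar is f)"
  using assms(2) by (induction "is") (auto intro: smooth_wirtinger assms(1))

lemma foldr_wirtinger_sum:
  assumes "\<And>j. j \<in> J \<Longrightarrow> smooth_poly_growth k (f j)" "set is \<subseteq> {..<k}"
  shows "foldr wirtinger is (\<lambda>z. \<Sum>j\<in>J. a j * f j z) = (\<lambda>z. \<Sum>j\<in>J. a j * foldr wirtinger is (f j) z)"
  using assms(2)
proof (induction "is")
  case (Cons i "is")
  then show ?case using assms(1) by (simp add: wirtinger_sum(1)[of J k] smooth_foldr_wirtinger)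
qed simp

text \<open>If F is f applied to Z (\<phi> 0), Z (\<phi> 1), and so on, these are the inner products of DF with x and of the conjugate
  derivative of F with the conjugate of x.\<close>

definition deriv_along :: "(nat \<Rightarrow> 'h::real_inner cplx) \<Rightarrow> nat \<Rightarrow> 'h cplx \<Rightarrow>
    ((nat \<Rightarrow> complex) \<Rightarrow> complex) \<Rightarrow> (nat \<Rightarrow> complex) \<Rightarrow> complex"
  where "deriv_along \<phi> k x f z = (\<Sum>i<k. cinner (\<phi> i) x * wirtinger i f z)"

definition deriv_bar_along :: "(nat \<Rightarrow> 'h::real_inner cplx) \<Rightarrow> nat \<Rightarrow> 'h cplx \<Rightarrow>
    ((nat \<Rightarrow> complex) \<Rightarrow> complex) \<Rightarrow> (nat \<Rightarrow> complex) \<Rightarrow> complex"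
  where "deriv_bar_along \<phi> k x f z = (\<Sum>i<k. cnj (cinner (\<phi> i) x) * wirtinger_bar i f z)"

lemma smooth_deriv_along:
  assumes "smooth_poly_growth k f"
  shows "smooth_poly_growth k (deriv_along \<phi> k x f)" "smooth_poly_growth k (deriv_bar_along \<phi> k x f)"
  unfolding deriv_along_def[abs_def] deriv_bar_along_def[abs_def]
  using assms by (auto intro!: smooth_sum smooth_wirtinger)

lemma smooth_foldr_deriv_along:
  assumes "smooth_poly_growth k f"
  shows "smooth_poly_growth k (foldr (deriv_along \<phi> k) xs f)" "smooth_poly_growth k (foldr (deriv_bar_along \<phi> k) xs f)"
  by (induction xs) (auto intro: smooth_deriv_along assms)

text \<open>Every derivative along a vector sums over the coordinates, so iteration produces a sum
  over index words. The coefficients multiply to the value at \<open>xs\<close> of the elementary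
  tensor of the vectors selected by the word.\<close>

lemma foldr_deriv_along:
  assumes f: "smooth_poly_growth k f"
  shows "foldr (deriv_along \<phi> k) xs f = (\<lambda>z. \<Sum>is\<in>words {..<k} (length xs).
      eltensor (map \<phi> is) xs * foldr wirtinger is f z)" (is "_ = ?L xs")
    and "foldr (deriv_bar_along \<phi> k) xs f = (\<lambda>z. \<Sum>is\<in>words {..<k} (length xs).
      cnj (eltensor (map \<phi> is) xs) * foldr wirtinger_bar is f z)" (is "_ = ?R xs")
proof -
  show "foldr (deriv_along \<phi> k) xs f = ?L xs"
  proof (induction xs)
    case (Cons x xs)
    have "foldr (deriv_along \<phi> k) (x # xs) f z = ?L (x # xs) z" for z
    proof -
      have "foldr (deriv_along \<phi> k) (x # xs) f z = (\<Sum>i<k. cinner (\<phi> i) x *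
          wirtinger i (\<lambda>z. \<Sum>is\<in>words {..<k} (length xs). eltensor (map \<phi> is) xs * foldr wirtinger is f z) z)"
        by (simp add: Cons deriv_along_def)
      also have "\<dots> = (\<Sum>i<k. cinner (\<phi> i) x *
          (\<Sum>is\<in>words {..<k} (length xs). eltensor (map \<phi> is) xs * wirtinger i (foldr wirtinger is f) z))"
      proof (intro sum.cong refl)
        fix i assume "i \<in> {..<k}"
        then show "cinner (\<phi> i) x * wirtinger i (\<lambda>z. \<Sum>is\<in>words {..<k} (length xs). eltensor (map \<phi> is) xs * foldr wirtinger is f z) z
            = cinner (\<phi> i) x * (\<Sum>is\<in>words {..<k} (length xs). eltensor (map \<phi> is) xs * wirtinger i (foldr wirtinger is f) z)"
          by (subst wirtinger_sum(1)[of _ k]) (auto simp: words_def intro: smooth_foldr_wirtinger f)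
      qed
      finally show ?thesis by (simp add: sum_words_Suc sum_distrib_left mult.assoc)
    qed
    then show ?case by blast
  qed simp
  show "foldr (deriv_bar_along \<phi> k) xs f = ?R xs"
  proof (induction xs)
    case (Cons x xs)
    have "foldr (deriv_bar_along \<phi> k) (x # xs) f z = ?R (x # xs) z" for z
    proof -
      have "foldr (deriv_bar_along \<phi> k) (x # xs) f z = (\<Sum>i<k. cnj (cinner (\<phi> i) x) *
          wirtinger_bar i (\<lambda>z. \<Sum>is\<in>words {..<k} (length xs). cnj (eltensor (map \<phi> is) xs) * foldr wirtinger_bar is f z) z)"
        by (simp add: Cons deriv_bar_along_def)
      also have "\<dots> = (\<Sum>i<k. cnj (cinner (\<phi> i) x) *
          (\<Sum>is\<in>words {..<k} (length xs). cnj (eltensor (map \<phi> is) xs) * wirtinger_bar i (foldr wirtinger_bar is f) z))"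
      proof (intro sum.cong refl)
        fix i assume "i \<in> {..<k}"
        then show "cnj (cinner (\<phi> i) x) * wirtinger_bar i (\<lambda>z. \<Sum>is\<in>words {..<k} (length xs). cnj (eltensor (map \<phi> is) xs) * foldr wirtinger_bar is f z) z
            = cnj (cinner (\<phi> i) x) * (\<Sum>is\<in>words {..<k} (length xs). cnj (eltensor (map \<phi> is) xs) * wirtinger_bar i (foldr wirtinger_bar is f) z)"
          by (subst wirtinger_sum(2)[of _ k]) (auto simp: words_def intro: smooth_foldr_wirtinger f)
      qed
      finally show ?thesis by (simp add: sum_words_Suc sum_distrib_left mult.assoc)
    qed
    then show ?case by blast
  qed simp
qed

lemma cinner_cconj: "cinner (cconj g) (cconj h) = cnj (cinner g h)"
  by (simp add: cinner_def cconj_def complex_eq_iff)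

lemma eltensor_append:
  "length gs = length xs \<Longrightarrow> eltensor (gs @ hs) (xs @ ys) = eltensor gs xs * eltensor hs ys"
  by (induction gs xs rule: list_induct2) auto

lemma eltensor_map_cconj: "eltensor (map cconj gs) (map cconj xs) = cnj (eltensor gs xs)"
  by (induction gs xs rule: eltensor.induct) (auto simp: cinner_cconj)

text \<open>Evaluating the tensor-valued derivative is the same as differentiating along the
  vectors. In the last q slots both tensor and argument are conjugated, which conjugates the inner
  product, as in \<open>deriv_bar_along\<close>.\<close>

lemma eval_cylinder_deriv:
  assumes f: "smooth_poly_growth k f" and "length xs = p" "length ys = q"
  shows "fock_eval (cylinder_deriv Z k \<phi> f p q \<omega>) (xs @ map cconj ys)
    = foldr (deriv_along \<phi> k) xs (foldr (deriv_bar_along \<phi> k) ys f) (\<lambda>i. Z (\<phi> i) \<omega>)"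
proof -
  define z where "z i = Z (\<phi> i) \<omega>" for i
  have "foldr (deriv_along \<phi> k) xs (foldr (deriv_bar_along \<phi> k) ys f) z
      = (\<Sum>is\<in>words {..<k} p. eltensor (map \<phi> is) xs *
          foldr wirtinger is (\<lambda>z. \<Sum>js\<in>words {..<k} q. cnj (eltensor (map \<phi> js) ys) * foldr wirtinger_bar js f z) z)"
    by (subst foldr_deriv_along(1)[OF smooth_foldr_deriv_along(2)[OF f]], subst foldr_deriv_along(2)[OF f])
      (simp add: assms)
  also have "\<dots> = (\<Sum>is\<in>words {..<k} p. \<Sum>js\<in>words {..<k} q. eltensor (map \<phi> is) xs *
      cnj (eltensor (map \<phi> js) ys) * foldr wirtinger is (foldr wirtinger_bar js f) z)"
    by (intro sum.cong refl, subst foldr_wirtinger_sum[of _ k])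
      (auto simp: sum_distrib_left mult.assoc words_def intro!: smooth_foldr_wirtinger f)
  also have "\<dots> = fock_eval (cylinder_deriv Z k \<phi> f p q \<omega>) (xs @ map cconj ys)"
    unfolding cylinder_deriv_def fock_eval_sum fock_eval_simps pure_tensor.rep_eq
  proof (intro sum.cong refl)
    fix "is" js assume "is \<in> words {..<k} p" "js \<in> words {..<k} q"
    then have l: "length (map \<phi> is) = length xs" using assms by (simp add: words_def)
    have "eltensor (map \<phi> is @ map (\<lambda>j. cconj (\<phi> j)) js) (xs @ map cconj ys)
        = eltensor (map \<phi> is) xs * cnj (eltensor (map \<phi> js) ys)"
      using eltensor_append[OF l, of "map cconj (map \<phi> js)" "map cconj ys"] eltensor_map_cconj[of "map \<phi> js" ys]
      by (simp add: comp_def)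
    then show "eltensor (map \<phi> is) xs * cnj (eltensor (map \<phi> js) ys) * foldr wirtinger is (foldr wirtinger_bar js f) z
        = foldr wirtinger is (foldr wirtinger_bar js f) (\<lambda>i. Z (\<phi> i) \<omega>) *
          eltensor (map \<phi> is @ map (\<lambda>j. cconj (\<phi> j)) js) (xs @ map cconj ys)"
      by (simp add: z_def[abs_def])
  qed
  finally show ?thesis by (simp add: z_def[abs_def])
qed

context complex_isonormal
begin

text \<open>The chain rule in Wirtinger form: the direction with coordinates b i = c
  \<open>cinner (\<phi> i) x\<close> pairs with the two Wirtinger derivatives through b i and its
  conjugate, and c and \<open>cnj c\<close> factor out.\<close>

lemma wdiff_smooth:
  assumes f: "smooth_poly_growth k f"
  shows "wdiff x (\<lambda>\<omega>. f (\<lambda>i. Z (\<phi> i) \<omega>)) (\<lambda>\<omega>. deriv_along \<phi> k x f (\<lambda>i. Z (\<phi> i) \<omega>))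
    (\<lambda>\<omega>. deriv_bar_along \<phi> k x f (\<lambda>i. Z (\<phi> i) \<omega>))"
proof (rule wdiffI)
  show "moderate k f" "moderate k (deriv_along \<phi> k x f)" "moderate k (deriv_bar_along \<phi> k x f)"
    using f by (auto intro: smooth_moderate smooth_deriv_along)
  fix z :: "nat \<Rightarrow> complex" and c :: complex
  define b where "b i = c * cinner (\<phi> i) x" for i
  have "(\<Sum>i<k. Re (b i) *\<^sub>R partial_deriv i 1 f z + Im (b i) *\<^sub>R partial_deriv i \<i> f z)
      = (\<Sum>i<k. b i * wirtinger i f z + cnj (b i) * wirtinger_bar i f z)"
  proof (intro sum.cong refl)
    fix i
    show "Re (b i) *\<^sub>R partial_deriv i 1 f z + Im (b i) *\<^sub>R partial_deriv i \<i> f z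
        = b i * wirtinger i f z + cnj (b i) * wirtinger_bar i f z"
      by (simp add: wirtinger_def wirtinger_bar_def complex_eq_iff field_simps)
  qed
  also have "\<dots> = c * deriv_along \<phi> k x f z + cnj c * deriv_bar_along \<phi> k x f z"
    by (simp add: deriv_along_def deriv_bar_along_def b_def sum.distrib sum_distrib_left mult.assoc)
  finally have eq: "(\<Sum>i<k. Re (b i) *\<^sub>R partial_deriv i 1 f z + Im (b i) *\<^sub>R partial_deriv i \<i> f z)
      = c * deriv_along \<phi> k x f z + cnj c * deriv_bar_along \<phi> k x f z" .
  have "f (\<lambda>j. z j + of_real t * (if j \<in> {..<k} then b j else 0)) = f (\<lambda>i. z i + of_real t * (c * cinner (\<phi> i) x))" for t :: real
    by (rule smooth_dep[OF f]) (simp add: b_def)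
  then show "((\<lambda>t::real. f (\<lambda>i. z i + of_real t * (c * cinner (\<phi> i) x))) has_vector_derivative
      c * deriv_along \<phi> k x f z + cnj c * deriv_bar_along \<phi> k x f z) (at 0)"
    using smooth_line[OF f, of "{..<k}" z b] by (simp add: eq)
qed

end

section \<open>Hermite products\<close>

text \<open>The powers of 2 cancel: this is the complex Hermite polynomial with \<rho> = 1, adapted
  to a variable Z e with mean square modulus 1.\<close>

definition hermite :: "nat \<Rightarrow> nat \<Rightarrow> complex \<Rightarrow> complex"
  where "hermite m n z = of_real (2 powr (- real (m + n) / 2)) * complex_hermite m n (of_real (sqrt 2) * z) 2"

lemma hermite_eq:
  "hermite m n z = (\<Sum>r\<le>n. (- 1) ^ r * fact r * of_nat (m choose r) * of_nat (n choose r) * z ^ (m - r) * cnj z ^ (n - r))"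
proof -
  \<comment> \<open>The exponents of sqrt 2 add up to (m - r) + (n - r) + 2 r = m + n.\<close>
  have pw: "2 powr (- real (m + n) / 2) * sqrt 2 ^ (m - r) * sqrt 2 ^ (n - r) * 2 ^ r = 1" if "r \<le> m" "r \<le> n" for r
  proof -
    have "(2::real) ^ r = sqrt 2 ^ (2 * r)" by (simp add: power_mult)
    then have "sqrt 2 ^ (m - r) * sqrt 2 ^ (n - r) * 2 ^ r = sqrt 2 ^ (m + n)"
      using that by (simp add: power_add[symmetric])
    also have "\<dots> = 2 powr (real (m + n) / 2)"
      by (simp add: powr_half_sqrt[symmetric] powr_powr[symmetric] powr_realpow[symmetric] powr_powr)
    finally have "2 powr (- real (m + n) / 2) * (sqrt 2 ^ (m - r) * sqrt 2 ^ (n - r) * 2 ^ r)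
        = 2 powr (- real (m + n) / 2 + real (m + n) / 2)"
      by (simp only: powr_add)
    also have "- real (m + n) / 2 + real (m + n) / 2 = 0" by linarith
    finally have "2 powr (- real (m + n) / 2) * (sqrt 2 ^ (m - r) * sqrt 2 ^ (n - r) * 2 ^ r) = 1" by simp
    then show ?thesis by (simp only: mult.assoc)
  qed
  have "hermite m n z = (\<Sum>r\<le>min m n. (- 1) ^ r * fact r * of_nat (m choose r) * of_nat (n choose r) * z ^ (m - r) * cnj z ^ (n - r))"
    unfolding hermite_def complex_hermite_def sum_distrib_left
  proof (intro sum.cong refl)
    fix r assume "r \<in> {..min m n}"
    then have "complex_of_real (2 powr (- real (m + n) / 2) * sqrt 2 ^ (m - r) * sqrt 2 ^ (n - r) * 2 ^ r) = 1"
      using pw[of r] by simp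
    then have *: "complex_of_real (2 powr (- real (m + n) / 2)) * of_real (sqrt 2) ^ (m - r) * of_real (sqrt 2) ^ (n - r) * 2 ^ r = 1"
      by (simp only: of_real_mult of_real_power of_real_numeral)
    have "complex_of_real (2 powr (- real (m + n) / 2)) * ((- 1) ^ r * fact r * of_nat (m choose r) * of_nat (n choose r)
        * (of_real (sqrt 2) * z) ^ (m - r) * cnj (of_real (sqrt 2) * z) ^ (n - r) * of_real 2 ^ r)
      = (complex_of_real (2 powr (- real (m + n) / 2)) * of_real (sqrt 2) ^ (m - r) * of_real (sqrt 2) ^ (n - r) * 2 ^ r)
        * ((- 1) ^ r * fact r * of_nat (m choose r) * of_nat (n choose r) * z ^ (m - r) * cnj z ^ (n - r))"
      by (simp only: power_mult_distrib complex_cnj_mult complex_cnj_complex_of_real of_real_numeral mult_ac)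
    then show "complex_of_real (2 powr (- real (m + n) / 2)) * ((- 1) ^ r * fact r * of_nat (m choose r) * of_nat (n choose r)
        * (of_real (sqrt 2) * z) ^ (m - r) * cnj (of_real (sqrt 2) * z) ^ (n - r) * of_real 2 ^ r)
      = (- 1) ^ r * fact r * of_nat (m choose r) * of_nat (n choose r) * z ^ (m - r) * cnj z ^ (n - r)"
      by (simp only: * mult_1)
  qed
  \<comment> \<open>Terms with m < r vanish because the binomial coefficient does. A range that
    depends on n alone suits the recursion in m.\<close>
  also have "\<dots> = (\<Sum>r\<le>n. (- 1) ^ r * fact r * of_nat (m choose r) * of_nat (n choose r) * z ^ (m - r) * cnj z ^ (n - r))"
    by (intro sum.mono_neutral_left) (auto simp: not_le)
  finally show ?thesis .
qed

text \<open>Raising m applies the creation operator, multiplication by z minus the conjugate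
  derivative, which lowers n with factor n. For n = 0 the truncated index n - 1 is harmless since
  its coefficient is 0.\<close>

lemma hermite_Suc: "hermite (Suc m) n z = z * hermite m n z - of_nat n * hermite m (n - 1) z"
proof -
  define t where "t m n r = (- 1) ^ r * fact r * of_nat (m choose r) * of_nat (n choose r) * z ^ (m - r) * cnj z ^ (n - r)"
    for m n r
  have t: "hermite m n z = (\<Sum>r\<le>n. t m n r)" for m n by (simp add: hermite_eq t_def)
  have t0: "t (Suc m) n 0 = z * t m n 0" for n by (simp add: t_def)
  \<comment> \<open>Pascal's rule splits the coefficient in m; absorbing Suc r into the coefficient
    in n turns the second summand into a term of degree n.\<close>
  have tS: "t (Suc m) (Suc n) (Suc r) = z * t m (Suc n) (Suc r) - of_nat (Suc n) * t m n r" for n r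
  proof -
    \<comment> \<open>If Suc r exceeds m, the truncated exponents disagree but the binomial
      coefficient is 0.\<close>
    have 1: "of_nat (m choose Suc r) * z ^ (m - r) = z * (of_nat (m choose Suc r) * z ^ (m - Suc r))"
    proof (cases "Suc r \<le> m")
      case True
      then have "m - r = Suc (m - Suc r)" by simp
      then show ?thesis by (simp only: power_Suc mult_ac)
    qed simp
    have "Suc r * (Suc n choose Suc r) = Suc n * (n choose r)" by (subst mult.commute) (rule Suc_times_binomial_eq[symmetric])
    then have 2: "(of_nat (Suc r) :: complex) * of_nat (Suc n choose Suc r) = of_nat (Suc n) * of_nat (n choose r)"
      by (metis of_nat_mult)
    have "t (Suc m) (Suc n) (Suc r) = (- 1) ^ Suc r * fact (Suc r) * of_nat (Suc n choose Suc r) * cnj z ^ (n - r) *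
        (of_nat (m choose Suc r) * z ^ (m - r)) - (- 1) ^ r * fact r * of_nat (m choose r) * z ^ (m - r) * cnj z ^ (n - r) *
        (of_nat (Suc r) * of_nat (Suc n choose Suc r))"
      by (simp add: t_def algebra_simps del: binomial_Suc_Suc add: binomial_Suc_Suc[of m r])
    then show ?thesis unfolding 1 2 by (simp add: t_def algebra_simps del: binomial_Suc_Suc)
  qed
  show ?thesis
  proof (cases n)
    case 0
    then show ?thesis by (simp add: t t0)
  next
    case (Suc n')
    have "hermite (Suc m) n z = z * t m n 0 + (\<Sum>r\<le>n'. z * t m (Suc n') (Suc r) - of_nat (Suc n') * t m n' r)"
      unfolding t Suc sum.atMost_Suc_shift t0 tS ..
    also have "\<dots> = z * (\<Sum>r\<le>Suc n'. t m (Suc n') r) - of_nat (Suc n') * (\<Sum>r\<le>n'. t m n' r)"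
      unfolding sum.atMost_Suc_shift by (simp add: Suc sum_subtractf sum_distrib_left distrib_left)
    finally show ?thesis by (simp add: t Suc)
  qed
qed

lemma hermite_00 [simp]: "hermite 0 0 z = 1"
  by (simp add: hermite_eq)

lemma cnj_hermite: "cnj (hermite m n z) = hermite n m z"
  by (simp add: hermite_def complex_hermite_def min.commute add.commute mult_ac)

section \<open>Hermite products over lists of vectors\<close>

lemma count_list_mset: "count_list xs x = count (mset xs) x"
  by (induction xs) auto

lemma hermite_product_eq:
  assumes "finite E" "set xs \<union> set ys \<subseteq> E"
  shows "hermite_product Z xs ys \<omega> = (\<Prod>e\<in>E. hermite (count_list xs e) (count_list ys e) (Z e \<omega>))"
proof -
  have "hermite_product Z xs ys \<omega> = (\<Prod>e\<in>set xs \<union> set ys. hermite (count_list xs e) (count_list ys e) (Z e \<omega>))"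
    by (simp add: hermite_product_def hermite_def Let_def)
  also have "\<dots> = (\<Prod>e\<in>E. hermite (count_list xs e) (count_list ys e) (Z e \<omega>))"
    using assms by (intro prod.mono_neutral_left) (auto simp: count_list_0_iff)
  finally show ?thesis .
qed

lemma hermite_product_Nil [simp]: "hermite_product Z [] [] \<omega> = 1"
  by (simp add: hermite_product_def)

lemma hermite_product_cong:
  assumes "mset xs = mset xs'" "mset ys = mset ys'"
  shows "hermite_product Z xs ys = hermite_product Z xs' ys'"
proof -
  have "count_list xs = count_list xs'" "count_list ys = count_list ys'"
    by (rule ext, simp add: count_list_mset assms)+
  moreover have "set xs = set xs'" "set ys = set ys'" using assms by (auto dest: mset_eq_setD)
  ultimately show ?thesis by (intro ext) (simp only: hermite_product_def)
qed

lemma cnj_hermite_product: "cnj (hermite_product Z xs ys \<omega>) = hermite_product Z ys xs \<omega>"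
  by (subst (1 2) hermite_product_eq[of "set xs \<union> set ys"]) (auto simp: cnj_hermite)

text \<open>A further occurrence of x changes only the factor at x, to which the one-variable
  recursion applies. If x does not occur in \<open>ys\<close>, removal does nothing, but the
  coefficient is 0.\<close>

lemma hermite_product_Cons_left:
  "hermite_product Z (x # xs) ys \<omega> = Z x \<omega> * hermite_product Z xs ys \<omega>
    - of_nat (count_list ys x) * hermite_product Z xs (remove1 x ys) \<omega>"
proof -
  define E where "E = insert x (set xs \<union> set ys)"
  have E: "finite E" "x \<in> E" "set (x # xs) \<union> set ys \<subseteq> E" "set xs \<union> set ys \<subseteq> E" "set xs \<union> set (remove1 x ys) \<subseteq> E"
    using set_remove1_subset[of x ys] by (auto simp: E_def)
  define P where "P = (\<Prod>e\<in>E - {x}. hermite (count_list xs e) (count_list ys e) (Z e \<omega>))"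
  have "hermite_product Z (x # xs) ys \<omega> = hermite (Suc (count_list xs x)) (count_list ys x) (Z x \<omega>) * P"
    unfolding hermite_product_eq[OF E(1,3)] prod.remove[OF E(1,2)] P_def
    by (intro arg_cong2[of _ _ _ _ "(*)"] prod.cong) auto
  moreover have "hermite_product Z xs ys \<omega> = hermite (count_list xs x) (count_list ys x) (Z x \<omega>) * P"
    unfolding hermite_product_eq[OF E(1,4)] prod.remove[OF E(1,2)] P_def ..
  moreover have "hermite_product Z xs (remove1 x ys) \<omega> = hermite (count_list xs x) (count_list ys x - 1) (Z x \<omega>) * P"
    unfolding hermite_product_eq[OF E(1,5)] prod.remove[OF E(1,2)] P_def
    by (intro arg_cong2[of _ _ _ _ "(*)"] prod.cong) (auto simp: count_list_mset)
  ultimately show ?thesis by (simp add: hermite_Suc algebra_simps)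
qed

lemma hermite_product_Cons_right:
  "hermite_product Z xs (y # ys) \<omega> = cnj (Z y \<omega>) * hermite_product Z xs ys \<omega>
    - of_nat (count_list xs y) * hermite_product Z (remove1 y xs) ys \<omega>"
proof -
  have "cnj (hermite_product Z (y # ys) xs \<omega>) = cnj (Z y \<omega>) * cnj (hermite_product Z ys xs \<omega>)
    - of_nat (count_list xs y) * cnj (hermite_product Z ys (remove1 y xs) \<omega>)"
    by (simp add: hermite_product_Cons_left)
  then show ?thesis by (simp add: cnj_hermite_product)
qed

text \<open>The order of the stabilizer of the list under permutations of its positions.\<close>

definition mult_fact :: "'a list \<Rightarrow> nat" where "mult_fact xs = (\<Prod>x\<in>set xs. fact (count_list xs x))"

lemma mult_fact_Cons: "mult_fact (x # xs) = Suc (count_list xs x) * mult_fact xs"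
proof -
  define E where "E = insert x (set xs)"
  have E: "finite E" "x \<in> E" by (auto simp: E_def)
  define P where "P = (\<Prod>e\<in>E - {x}. fact (count_list xs e) :: nat)"
  have "mult_fact (x # xs) = fact (Suc (count_list xs x)) * P"
    unfolding mult_fact_def list.set E_def[symmetric] prod.remove[OF E] P_def
    by (intro arg_cong2[of _ _ _ _ "(*)"] prod.cong) auto
  moreover have "mult_fact xs = (\<Prod>e\<in>E. fact (count_list xs e))"
    unfolding mult_fact_def by (intro prod.mono_neutral_left) (auto simp: E_def count_list_0_iff)
  then have "mult_fact xs = fact (count_list xs x) * P"
    unfolding prod.remove[OF E] P_def .
  ultimately show ?thesis by (simp add: algebra_simps)
qed

lemma mult_fact_cong: "mset xs = mset ys \<Longrightarrow> mult_fact xs = mult_fact ys"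
  unfolding mult_fact_def count_list_mset using mset_eq_setD[of xs ys] by simp

text \<open>Orbit-stabilizer for permutations acting on the rearrangements of
  \<open>xs\<close>.\<close>

lemma mult_fact_card: "card {ys. mset ys = mset xs} * mult_fact xs = fact (length xs)"
proof -
  have "{ys. mset ys = mset xs} = permutations_of_multiset (mset xs)"
    by (auto simp: permutations_of_multiset_def)
  moreover have "mult_fact xs = (\<Prod>x\<in>set_mset (mset xs). fact (count (mset xs) x))"
    by (simp add: mult_fact_def count_list_mset)
  ultimately show ?thesis
    using card_permutations_of_multiset[of "mset xs"] by simp
qed

text \<open>Composition with one permutation \<rho> taking \<open>xs\<close> to \<open>ys\<close>
  maps the stabilizer of \<open>xs\<close> onto the permutations taking \<open>xs\<close> to
  \<open>ys\<close>. All these fibres have equal size and partition the n! permutations, so division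
  by the number of rearrangements gives the count.\<close>

lemma card_permute_list:
  "card {\<sigma>. \<sigma> permutes {..<length xs} \<and> permute_list \<sigma> xs = ys} = (if mset xs = mset ys then mult_fact ys else 0)"
proof -
  define n where "n = length xs"
  define S where "S ys = {\<sigma>. \<sigma> permutes {..<n} \<and> permute_list \<sigma> xs = ys}" for ys
  have fin: "finite (S ys)" for ys
    unfolding S_def using finite_permutations[of "{..<n}"] by (auto intro: finite_subset)
  have empty: "S ys = {}" if "mset xs \<noteq> mset ys" for ys
    using that mset_permute_list[of _ xs] by (fastforce simp: S_def n_def)
  have eq: "card (S ys) = card (S xs)" if ys: "mset ys = mset xs" for ys
  proof -
    obtain \<rho> where \<rho>: "\<rho> permutes {..<n}" "permute_list \<rho> xs = ys"
      by (rule mset_eq_permutation[OF ys, folded n_def])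
    have "bij_betw (\<lambda>\<tau>. \<tau> \<circ> \<rho>) (S xs) (S ys)"
    proof (rule bij_betwI[where g = "\<lambda>\<tau>. \<tau> \<circ> inv \<rho>"])
      show "(\<lambda>\<tau>. \<tau> \<circ> \<rho>) \<in> S xs \<rightarrow> S ys"
      proof
        fix \<tau> assume "\<tau> \<in> S xs"
        then have \<tau>: "\<tau> permutes {..<n}" "permute_list \<tau> xs = xs" by (auto simp: S_def)
        have "permute_list (\<tau> \<circ> \<rho>) xs = permute_list \<rho> (permute_list \<tau> xs)"
          using \<rho>(1) unfolding n_def by (rule permute_list_compose)
        then show "\<tau> \<circ> \<rho> \<in> S ys"
          unfolding S_def using permutes_compose[OF \<rho>(1) \<tau>(1)] \<tau>(2) \<rho>(2) by simp
      qed
      show "(\<lambda>\<tau>. \<tau> \<circ> inv \<rho>) \<in> S ys \<rightarrow> S xs"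
      proof
        fix \<tau> assume "\<tau> \<in> S ys"
        then have \<tau>: "\<tau> permutes {..<n}" "permute_list \<tau> xs = permute_list \<rho> xs" using \<rho> by (auto simp: S_def)
        have inv: "inv \<rho> permutes {..<length xs}" using permutes_inv[OF \<rho>(1)] by (simp add: n_def)
        have "permute_list (\<tau> \<circ> inv \<rho>) xs = permute_list (\<rho> \<circ> inv \<rho>) xs"
          unfolding permute_list_compose[OF inv] \<tau>(2) ..
        also have "\<dots> = xs" unfolding permutes_inv_o(1)[OF \<rho>(1)] by simp
        finally show "\<tau> \<circ> inv \<rho> \<in> S xs"
          unfolding S_def using permutes_compose[OF inv[folded n_def] \<tau>(1)] by simp
      qed
      show "\<tau> \<circ> \<rho> \<circ> inv \<rho> = \<tau>" for \<tau> unfolding comp_assoc permutes_inv_o(1)[OF \<rho>(1)] by simp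
      show "\<tau> \<circ> inv \<rho> \<circ> \<rho> = \<tau>" for \<tau> unfolding comp_assoc permutes_inv_o(2)[OF \<rho>(1)] by simp
    qed
    then show ?thesis by (simp add: bij_betw_same_card)
  qed
  have finP: "finite {ys. mset ys = mset xs}"
  proof -
    have "{ys. mset ys = mset xs} = permutations_of_multiset (mset xs)"
      by (auto simp: permutations_of_multiset_def)
    then show ?thesis by simp
  qed
  have "(\<Sum>ys | mset ys = mset xs. card (S ys)) = card (\<Union>ys\<in>{ys. mset ys = mset xs}. S ys)"
    using fin finP by (intro card_UN_disjoint[symmetric]) (auto simp: S_def)
  also have "(\<Union>ys\<in>{ys. mset ys = mset xs}. S ys) = {\<sigma>. \<sigma> permutes {..<n}}"
    using mset_permute_list[of _ xs] unfolding S_def n_def by blast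
  also have "card \<dots> = fact n" using card_permutations[of "{..<n}" n] by simp
  finally have "(\<Sum>ys | mset ys = mset xs. card (S ys)) = fact n" .
  moreover have "(\<Sum>ys | mset ys = mset xs. card (S ys)) = (\<Sum>ys | mset ys = mset xs. card (S xs))"
    by (rule sum.cong[OF refl]) (rule eq, simp)
  ultimately have "card {ys. mset ys = mset xs} * card (S xs) = fact n" by simp
  then have "card {ys. mset ys = mset xs} * card (S xs) = card {ys. mset ys = mset xs} * mult_fact xs"
    by (simp add: mult_fact_card n_def)
  moreover have "card {ys. mset ys = mset xs} \<noteq> 0" using finP by auto
  ultimately have "card (S xs) = mult_fact xs" by simp
  then have "card (S ys) = (if mset xs = mset ys then mult_fact ys else 0)"
    using empty[of ys] eq[of ys] mult_fact_cong[of xs ys] by (cases "mset xs = mset ys") auto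
  then show ?thesis unfolding S_def n_def .
qed

section \<open>Adjointness and orthogonality of Hermite products\<close>

context complex_isonormal
begin

abbreviation HP :: "'h cplx list \<Rightarrow> 'h cplx list \<Rightarrow> 'w \<Rightarrow> complex"
  where "HP \<equiv> hermite_product Z"

context
  fixes B :: "'h cplx set"
  assumes B: "corthonormal B"
begin

lemma norm_basis: "x \<in> B \<Longrightarrow> norm x = 1"
proof -
  assume "x \<in> B"
  then have "complex_of_real ((norm x)\<^sup>2) = 1" using corthonormalD(1)[OF B] unfolding cinner_self by blast
  then have "(norm x)\<^sup>2 = 1" unfolding of_real_eq_1_iff .
  then show ?thesis using norm_ge_zero[of x] unfolding power2_eq_1_iff by linarith
qed

text \<open>Without conjugate entries the Hermite product is a monomial in the variables, and this
  is its Leibniz rule. Its conjugate starts the induction in \<open>wdiff_HP\<close>.\<close>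

lemma wdiff_HP_left:
  assumes "x \<in> B" "set xs \<subseteq> B"
  shows "wdiff x (HP xs []) (\<lambda>\<omega>. of_nat (count_list xs x) * HP (remove1 x xs) [] \<omega>) (\<lambda>\<omega>. 0)"
  using assms(2)
proof (induction xs)
  case Nil
  then show ?case using wdiff_const[of x 1] by simp
next
  case (Cons a xs)
  have "HP (a # xs) [] = (\<lambda>\<omega>. Z a \<omega> * HP xs [] \<omega>)" by (rule ext) (simp add: hermite_product_Cons_left)
  moreover have "(\<lambda>\<omega>. cinner a x * HP xs [] \<omega> + Z a \<omega> * (of_nat (count_list xs x) * HP (remove1 x xs) [] \<omega>))
      = (\<lambda>\<omega>. of_nat (count_list (a # xs) x) * HP (remove1 x (a # xs)) [] \<omega>)"
  proof (cases "a = x")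
    case True
    \<comment> \<open>If x occurs in \<open>xs\<close>, moving it to the front leaves the product
      unchanged; otherwise both sides carry the factor 0.\<close>
    have *: "of_nat (count_list xs x) * HP xs [] \<omega> = of_nat (count_list xs x) * HP (x # remove1 x xs) [] \<omega>" for \<omega>
    proof (cases "x \<in> set xs")
      case True
      then have "HP xs [] = HP (x # remove1 x xs) []" by (intro hermite_product_cong) auto
      then show ?thesis by simp
    qed (simp add: count_list_0_iff)
    show ?thesis
    proof (rule ext)
      fix \<omega>
      show "cinner a x * HP xs [] \<omega> + Z a \<omega> * (of_nat (count_list xs x) * HP (remove1 x xs) [] \<omega>)
          = of_nat (count_list (a # xs) x) * HP (remove1 x (a # xs)) [] \<omega>"
        using True *[of \<omega>] corthonormalD(1)[OF B assms(1)]
        by (auto simp: hermite_product_Cons_left distrib_right)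
    qed
  next
    case False
    then show ?thesis
      using corthonormalD(2)[OF B, of a x] Cons.prems assms(1)
      by (simp add: hermite_product_Cons_left mult.left_commute)
  qed
  ultimately show ?case
    using wdiff_mult[OF wdiff_Z[of x a] Cons.IH] Cons.prems by simp
qed

text \<open>Differentiation lowers a multiplicity. In the induction the creation recursion is
  differentiated; the derivative of the factor Z a contributes exactly when a = x, which raises the
  count by one.\<close>

lemma wdiff_HP:
  assumes "x \<in> B" "set xs \<subseteq> B" "set ys \<subseteq> B"
  shows "wdiff x (HP xs ys) (\<lambda>\<omega>. of_nat (count_list xs x) * HP (remove1 x xs) ys \<omega>)
    (\<lambda>\<omega>. of_nat (count_list ys x) * HP xs (remove1 x ys) \<omega>)"
  using assms(2,3)
proof (induction xs arbitrary: ys)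
  case Nil
  then show ?case using wdiff_cnj[OF wdiff_HP_left[OF assms(1), of ys]] by (simp add: cnj_hermite_product)
next
  case (Cons a xs)
  have ys': "set (remove1 a ys) \<subseteq> B" using Cons.prems set_remove1_subset[of a ys] by auto
  define A where "A = (\<lambda>\<omega>. (cinner a x * HP xs ys \<omega> + Z a \<omega> * (of_nat (count_list xs x) * HP (remove1 x xs) ys \<omega>))
      - of_nat (count_list ys a) * (of_nat (count_list xs x) * HP (remove1 x xs) (remove1 a ys) \<omega>))"
  define D where "D = (\<lambda>\<omega>. (0 * HP xs ys \<omega> + Z a \<omega> * (of_nat (count_list ys x) * HP xs (remove1 x ys) \<omega>))
      - of_nat (count_list ys a) * (of_nat (count_list (remove1 a ys) x) * HP xs (remove1 x (remove1 a ys)) \<omega>))"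
  have wd: "wdiff x (HP (a # xs) ys) A D"
    unfolding hermite_product_Cons_left[abs_def] A_def D_def
    using Cons.prems ys' by (intro wdiff_diff wdiff_mult wdiff_cmult wdiff_Z Cons.IH) auto
  have "A = (\<lambda>\<omega>. of_nat (count_list (a # xs) x) * HP (remove1 x (a # xs)) ys \<omega>)"
  proof (cases "a = x")
    case True
    have *: "of_nat (count_list xs x) * HP xs ys \<omega> = of_nat (count_list xs x) * HP (x # remove1 x xs) ys \<omega>" for \<omega>
    proof (cases "x \<in> set xs")
      case True
      then have "HP xs ys = HP (x # remove1 x xs) ys" by (intro hermite_product_cong) auto
      then show ?thesis by simp
    qed (simp add: count_list_0_iff)
    show ?thesis
    proof (rule ext)
      fix \<omega>
      define c R R' d where "c = complex_of_nat (count_list xs x)" and "R = HP (remove1 x xs) ys \<omega>"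
        and "R' = HP (remove1 x xs) (remove1 x ys) \<omega>" and "d = complex_of_nat (count_list ys x)"
      have "A \<omega> = HP xs ys \<omega> + c * (Z x \<omega> * R - d * R')"
        using True corthonormalD(1)[OF B assms(1)]
        by (simp add: A_def c_def R_def R'_def d_def right_diff_distrib mult.left_commute)
      also have "Z x \<omega> * R - d * R' = HP (x # remove1 x xs) ys \<omega>"
        by (simp add: hermite_product_Cons_left R_def R'_def d_def)
      \<comment> \<open>The bracket was the creation recursion read backwards, so it restores the
        removed x.\<close>
      also have "c * \<dots> = c * HP xs ys \<omega>" using *[of \<omega>] by (simp only: c_def)
      also have "HP xs ys \<omega> + c * HP xs ys \<omega> = of_nat (count_list (a # xs) x) * HP (remove1 x (a # xs)) ys \<omega>"
        using True by (simp add: c_def distrib_right)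
      finally show "A \<omega> = of_nat (count_list (a # xs) x) * HP (remove1 x (a # xs)) ys \<omega>" .
    qed
  next
    case False
    then show ?thesis
      using corthonormalD(2)[OF B, of a x] Cons.prems assms(1)
      by (simp add: A_def hermite_product_Cons_left fun_eq_iff algebra_simps)
  qed
  moreover have "D = (\<lambda>\<omega>. of_nat (count_list ys x) * HP (a # xs) (remove1 x ys) \<omega>)"
  proof -
    \<comment> \<open>Both sides count the ordered choices of an a and an x from different positions
      of \<open>ys\<close>, so the order of the two removals does not matter.\<close>
    have "count_list ys a * count_list (remove1 a ys) x = count_list ys x * count_list (remove1 x ys) a"
      by (cases "a = x") (auto simp: count_list_mset)
    then have "(of_nat (count_list ys a) :: complex) * of_nat (count_list (remove1 a ys) x)
        = of_nat (count_list ys x) * of_nat (count_list (remove1 x ys) a)"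
      by (metis of_nat_mult)
    then have "of_nat (count_list ys a) * (of_nat (count_list (remove1 a ys) x) * h)
        = of_nat (count_list ys x) * (of_nat (count_list (remove1 x ys) a) * h)" for h :: complex
      by (simp only: mult.assoc[symmetric])
    then show ?thesis
      unfolding D_def hermite_product_Cons_left remove1_commute[of x a] by (simp add: algebra_simps)
  qed
  ultimately show ?case using wd by simp
qed

lemma HP_L2:
  assumes "set xs \<subseteq> B" "set ys \<subseteq> B"
  shows "HP xs ys \<in> L2_space M"
proof -
  \<comment> \<open>Differentiability in any direction includes moderate growth and hence square
    integrability; the direction 0 is a convenient choice.\<close>
  have "\<exists>A D. wdiff 0 (HP xs ys) A D"
    using assms(1)
  proof (induction xs arbitrary: ys)
    case Nil
    have "\<exists>A D. wdiff 0 (HP [] ys) A D"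
    proof (induction ys)
      case Nil
      then show ?case using wdiff_const[of 0 1] by auto
    next
      case (Cons y ys)
      then show ?case
        using wdiff_mult[OF wdiff_cnj[OF wdiff_Z[of 0 y]]] by (simp add: hermite_product_Cons_right[abs_def]) blast
    qed
    then show ?case .
  next
    case (Cons x xs)
    obtain A D A' D' where "wdiff 0 (HP xs ys) A D" "wdiff 0 (HP xs (remove1 x ys)) A' D'"
      using Cons by fastforce
    then show ?case
      using wdiff_diff[OF wdiff_mult[OF wdiff_Z[of 0 x]] wdiff_cmult[of 0 "HP xs (remove1 x ys)"]]
      unfolding hermite_product_Cons_left[abs_def] by blast
  qed
  then show ?thesis using wdiff_L2 by blast
qed

text \<open>Creation is adjoint to differentiation. Integration by parts of G \<open>cnj H\<close>
  against \<open>cnj (Z x)\<close> yields A \<open>cnj H\<close> and G times the conjugate of n H',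
  and the latter is exactly what the creation recursion subtracts.\<close>

lemma L2_inner_HP_Cons_left:
  assumes wd: "wdiff x G A D" and "x \<in> B" "set xs \<subseteq> B" "set ys \<subseteq> B"
  shows "L2_inner M G (HP (x # xs) ys) = L2_inner M A (HP xs ys)"
proof -
  define H where "H = HP xs ys"
  define H' where "H' = HP xs (remove1 x ys)"
  define n :: complex where "n = of_nat (count_list ys x)"
  have H: "H \<in> L2_space M" "H' \<in> L2_space M"
    unfolding H_def H'_def using assms set_remove1_subset[of x ys] by (auto intro!: HP_L2)
  have prod: "wdiff x (\<lambda>\<omega>. G \<omega> * cnj (H \<omega>)) (\<lambda>\<omega>. A \<omega> * cnj (H \<omega>) + G \<omega> * cnj (n * H' \<omega>))
      (\<lambda>\<omega>. D \<omega> * cnj (H \<omega>) + G \<omega> * cnj (of_nat (count_list xs x) * HP (remove1 x xs) ys \<omega>))"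
    unfolding H_def H'_def n_def by (intro wdiff_mult wd wdiff_cnj wdiff_HP assms)
  note L = wdiff_L2[OF wd]
  have int: "integrable M (\<lambda>\<omega>. G \<omega> * cnj (n * H' \<omega>))" "integrable M (\<lambda>\<omega>. A \<omega> * cnj (H \<omega>))"
    by (intro L2_integrable_mult_cnj L H L2_cmult)+
  have intp: "integrable M (\<lambda>\<omega>. G \<omega> * cnj (Z x \<omega> * H \<omega>))"
  proof -
    have "integrable M (\<lambda>\<omega>. (G \<omega> * cnj (H \<omega>)) * cnj (Z x \<omega>))"
      by (intro L2_integrable_mult_cnj wdiff_L2(1)[OF prod] wdiff_L2(1)[OF wdiff_Z])
    then show ?thesis by (simp add: mult_ac)
  qed
  have "L2_inner M G (HP (x # xs) ys) = expectation (\<lambda>\<omega>. G \<omega> * cnj (Z x \<omega> * H \<omega>) - G \<omega> * cnj (n * H' \<omega>))"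
    unfolding L2_inner_def hermite_product_Cons_left H_def H'_def n_def by (simp add: right_diff_distrib)
  also have "\<dots> = expectation (\<lambda>\<omega>. (G \<omega> * cnj (H \<omega>)) * cnj (Z x \<omega>)) - expectation (\<lambda>\<omega>. G \<omega> * cnj (n * H' \<omega>))"
    using intp int by (subst Bochner_Integration.integral_diff) (simp_all add: mult_ac)
  also have "\<dots> = expectation (\<lambda>\<omega>. A \<omega> * cnj (H \<omega>) + G \<omega> * cnj (n * H' \<omega>)) - expectation (\<lambda>\<omega>. G \<omega> * cnj (n * H' \<omega>))"
    by (subst wdiff_ibp(1)[OF norm_basis[OF assms(2)] prod]) simp
  also have "\<dots> = expectation (\<lambda>\<omega>. A \<omega> * cnj (H \<omega>))"
    using int by (subst Bochner_Integration.integral_add) auto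
  finally show ?thesis by (simp add: L2_inner_def H_def)
qed

text \<open>Conjugation swaps the two derivatives as well as the two lists, which reduces this to
  the left version.\<close>

lemma L2_inner_HP_Cons_right:
  assumes "wdiff x G A D" "x \<in> B" "set xs \<subseteq> B" "set ys \<subseteq> B"
  shows "L2_inner M G (HP xs (x # ys)) = L2_inner M D (HP xs ys)"
proof -
  have *: "cnj (L2_inner M U V) = L2_inner M (\<lambda>\<omega>. cnj (U \<omega>)) (\<lambda>\<omega>. cnj (V \<omega>))" for U V
    unfolding L2_inner_def Bochner_Integration.integral_cnj[symmetric] by simp
  have "cnj (L2_inner M G (HP xs (x # ys))) = cnj (L2_inner M D (HP xs ys))"
    unfolding * cnj_hermite_product by (intro L2_inner_HP_Cons_left[OF wdiff_cnj[OF assms(1)]] assms)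
  then show ?thesis by simp
qed

lemma L2_inner_one_HP:
  assumes "set xs \<subseteq> B" "set ys \<subseteq> B"
  shows "L2_inner M (HP [] []) (HP xs ys) = (if xs = [] \<and> ys = [] then 1 else 0)"
proof (cases xs)
  case (Cons x xs')
  then show ?thesis
    using L2_inner_HP_Cons_left[OF wdiff_HP[of x "[]" "[]"], of xs' ys] assms by simp
next
  case Nil
  show ?thesis
  proof (cases ys)
    case (Cons y ys')
    then show ?thesis
      using L2_inner_HP_Cons_right[OF wdiff_HP[of y "[]" "[]"], of "[]" ys'] assms Nil by simp
  qed (use Nil in \<open>simp add: L2_inner_def prob_space\<close>)
qed

text \<open>Each entry on the right is moved to the left, where it lowers a multiplicity and
  contributes that multiplicity as a factor. The factors multiply to the factorials if the multisets
  agree, and otherwise some count is 0.\<close>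

lemma L2_inner_HP:
  assumes "set xs \<subseteq> B" "set ys \<subseteq> B" "set us \<subseteq> B" "set vs \<subseteq> B"
  shows "L2_inner M (HP us vs) (HP xs ys) =
    (if mset us = mset xs \<and> mset vs = mset ys then of_nat (mult_fact xs * mult_fact ys) else 0)"
  using assms
proof (induction xs arbitrary: us)
  case (Cons x xs)
  have "L2_inner M (HP us vs) (HP (x # xs) ys) = of_nat (count_list us x) * L2_inner M (HP (remove1 x us) vs) (HP xs ys)"
    using L2_inner_HP_Cons_left[OF wdiff_HP[of x us vs]] Cons.prems by (simp add: L2_inner_cmult_left)
  also have "L2_inner M (HP (remove1 x us) vs) (HP xs ys) = (if mset (remove1 x us) = mset xs \<and> mset vs = mset ys then of_nat (mult_fact xs * mult_fact ys) else 0)"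
    using Cons.prems set_remove1_subset[of x us] by (intro Cons.IH) auto
  also have "of_nat (count_list us x) * (if mset (remove1 x us) = mset xs \<and> mset vs = mset ys then of_nat (mult_fact xs * mult_fact ys) else 0)
      = (if mset us = mset (x # xs) \<and> mset vs = mset ys then of_nat (mult_fact (x # xs) * mult_fact ys) else (0::complex))"
  proof (cases "x \<in> set us")
    case True
    then have "mset us = add_mset x (mset (remove1 x us))" by simp
    then have "mset (remove1 x us) = mset xs \<longleftrightarrow> mset us = mset (x # xs)"
      by (simp only: mset.simps(2) add_mset_add_mset_same_iff)
    moreover have "count_list us x = Suc (count_list xs x)" if "mset us = mset (x # xs)"
      using that by (simp add: count_list_mset)
    ultimately show ?thesis by (auto simp: mult_fact_Cons algebra_simps)
  next
    case False
    then have "mset us \<noteq> mset (x # xs)" by (metis list.set_intros(1) mset_eq_setD)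
    with False show ?thesis by (simp add: count_list_0_iff)
  qed
  finally show ?case .
next
  case Nil
  have "L2_inner M (HP us vs) (HP [] ys) = (if us = [] \<and> mset vs = mset ys then of_nat (mult_fact ys) else 0)"
    using Nil.prems
  proof (induction ys arbitrary: vs)
    case Nil
    have "L2_inner M (HP us vs) (HP [] []) = cnj (L2_inner M (HP [] []) (HP us vs))"
      by (rule L2_inner_commute)
    then show ?case using L2_inner_one_HP[OF Nil.prems(3,4)] Nil.prems(4)
      by (simp add: mult_fact_def del: hermite_product_Nil)
  next
    case (Cons y ys)
    have "L2_inner M (HP us vs) (HP [] (y # ys)) = of_nat (count_list vs y) * L2_inner M (HP us (remove1 y vs)) (HP [] ys)"
      using L2_inner_HP_Cons_right[OF wdiff_HP[of y us vs]] Cons.prems by (simp add: L2_inner_cmult_left)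
    also have "L2_inner M (HP us (remove1 y vs)) (HP [] ys) = (if us = [] \<and> mset (remove1 y vs) = mset ys then of_nat (mult_fact ys) else 0)"
      using Cons.prems set_remove1_subset[of y vs] by (intro Cons.IH) auto
    also have "of_nat (count_list vs y) * (if us = [] \<and> mset (remove1 y vs) = mset ys then of_nat (mult_fact ys) else 0)
        = (if us = [] \<and> mset vs = mset (y # ys) then of_nat (mult_fact (y # ys)) else (0::complex))"
    proof (cases "y \<in> set vs")
      case True
      then have "mset vs = add_mset y (mset (remove1 y vs))" by simp
      then have "mset (remove1 y vs) = mset ys \<longleftrightarrow> mset vs = mset (y # ys)"
        by (simp only: mset.simps(2) add_mset_add_mset_same_iff)
      moreover have "count_list vs y = Suc (count_list ys y)" if "mset vs = mset (y # ys)"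
        using that by (simp add: count_list_mset)
      ultimately show ?thesis by (auto simp: mult_fact_Cons algebra_simps)
    next
      case False
      then have "mset vs \<noteq> mset (y # ys)" by (metis list.set_intros(1) mset_eq_setD)
      with False show ?thesis by (simp add: count_list_0_iff)
    qed
    finally show ?case .
  qed
  then show ?case by (auto simp: mult_fact_def)
qed

text \<open>The outermost derivative is transferred first, so the entries arrive at the Hermite
  product in reverse order.\<close>

lemma L2_inner_deriv_along:
  assumes f: "smooth_poly_growth k f" and "set xs \<subseteq> B" "set us \<subseteq> B" "set vs \<subseteq> B"
  shows "L2_inner M (\<lambda>\<omega>. foldr (deriv_along \<phi> k) xs f (\<lambda>i. Z (\<phi> i) \<omega>)) (HP us vs)
    = L2_inner M (\<lambda>\<omega>. f (\<lambda>i. Z (\<phi> i) \<omega>)) (HP (rev xs @ us) vs)"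
  using assms(2-)
proof (induction xs arbitrary: us)
  case (Cons x xs)
  have "L2_inner M (\<lambda>\<omega>. foldr (deriv_along \<phi> k) (x # xs) f (\<lambda>i. Z (\<phi> i) \<omega>)) (HP us vs)
      = L2_inner M (\<lambda>\<omega>. foldr (deriv_along \<phi> k) xs f (\<lambda>i. Z (\<phi> i) \<omega>)) (HP (x # us) vs)"
    unfolding foldr_Cons comp_def
    by (rule L2_inner_HP_Cons_left[OF wdiff_smooth[OF smooth_foldr_deriv_along(1)[OF f]], symmetric]) (use Cons.prems in auto)
  then show ?case using Cons by simp
qed simp

lemma L2_inner_deriv_bar_along:
  assumes f: "smooth_poly_growth k f" and "set ys \<subseteq> B" "set us \<subseteq> B" "set vs \<subseteq> B"
  shows "L2_inner M (\<lambda>\<omega>. foldr (deriv_bar_along \<phi> k) ys f (\<lambda>i. Z (\<phi> i) \<omega>)) (HP us vs)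
    = L2_inner M (\<lambda>\<omega>. f (\<lambda>i. Z (\<phi> i) \<omega>)) (HP us (rev ys @ vs))"
  using assms(2-)
proof (induction ys arbitrary: vs)
  case (Cons x xs)
  have "L2_inner M (\<lambda>\<omega>. foldr (deriv_bar_along \<phi> k) (x # xs) f (\<lambda>i. Z (\<phi> i) \<omega>)) (HP us vs)
      = L2_inner M (\<lambda>\<omega>. foldr (deriv_bar_along \<phi> k) xs f (\<lambda>i. Z (\<phi> i) \<omega>)) (HP us (x # vs))"
    unfolding foldr_Cons comp_def
    by (rule L2_inner_HP_Cons_right[OF wdiff_smooth[OF smooth_foldr_deriv_along(2)[OF f]], symmetric]) (use Cons.prems in auto)
  then show ?case using Cons by simp
qed simp

text \<open>A mean is the inner product with the empty Hermite product 1, onto which all derivatives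
  are moved. Hermite products depend on multisets only, so the reversals disappear.\<close>

lemma expectation_cylinder_deriv:
  assumes f: "smooth_poly_growth k f" and "set xs \<subseteq> B" "set ys \<subseteq> B" "length xs = p" "length ys = q"
  shows "expectation (\<lambda>\<omega>. fock_eval (cylinder_deriv Z k \<phi> f p q \<omega>) (xs @ map cconj ys))
    = L2_inner M (\<lambda>\<omega>. f (\<lambda>i. Z (\<phi> i) \<omega>)) (HP xs ys)"
proof -
  have "expectation (\<lambda>\<omega>. fock_eval (cylinder_deriv Z k \<phi> f p q \<omega>) (xs @ map cconj ys))
      = L2_inner M (\<lambda>\<omega>. foldr (deriv_along \<phi> k) xs (foldr (deriv_bar_along \<phi> k) ys f) (\<lambda>i. Z (\<phi> i) \<omega>)) (HP [] [])"
    by (simp add: eval_cylinder_deriv[OF f assms(4,5)] L2_inner_def)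
  also have "\<dots> = L2_inner M (\<lambda>\<omega>. f (\<lambda>i. Z (\<phi> i) \<omega>)) (HP (rev xs) (rev ys))"
    using L2_inner_deriv_along[OF smooth_foldr_deriv_along(2)[OF f] assms(2), of "[]" "[]" \<phi> \<phi> ys]
      L2_inner_deriv_bar_along[OF f assms(3), of "rev xs" "[]" \<phi>] assms by simp
  also have "HP (rev xs) (rev ys) = HP xs ys" by (rule hermite_product_cong) auto
  finally show ?thesis .
qed

end

end

section \<open>Tensors over an orthonormal basis\<close>

lemma bounded_linear_slot: "bounded_linear (\<lambda>x. cnj (fock_eval T (pre @ x # post)))"
proof (rule bounded_linear_intro)
  note anti = fock_eval_antilinear[of T]
  show "cnj (fock_eval T (pre @ (x + y) # post)) = cnj (fock_eval T (pre @ x # post)) + cnj (fock_eval T (pre @ y # post))" for x y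
    by (simp add: slot_antilinear_add[OF anti])
  show "cnj (fock_eval T (pre @ (r *\<^sub>R x) # post)) = r *\<^sub>R cnj (fock_eval T (pre @ x # post))" for r x
    using slot_antilinear_scale[OF anti, of pre "of_real r" x post]
    by (simp add: cscale_of_real scaleR_conv_of_real)
  show "norm (cnj (fock_eval T (pre @ x # post))) \<le> norm x * ((\<Prod>z\<leftarrow>pre. norm z) * (\<Prod>z\<leftarrow>post. norm z) * norm T)" for x
    using fock_eval_bound[of T "pre @ x # post"] by (simp add: mult_ac)
qed

text \<open>The vectors at which the slot vanishes form a closed real subspace containing L and i
  L.\<close>

lemma fock_eval_dense_slot:
  fixes T :: "'h::real_inner fock"
  assumes "closure (span (L \<union> (\<lambda>b. \<i> *\<^sub>C b) ` L)) = UNIV" and L: "\<And>b. b \<in> L \<Longrightarrow> fock_eval T (pre @ b # post) = 0"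
  shows "fock_eval T (pre @ x # post) = 0"
proof -
  interpret bounded_linear "\<lambda>x. cnj (fock_eval T (pre @ x # post))" by (rule bounded_linear_slot)
  define N where "N = {x. cnj (fock_eval T (pre @ x # post)) = 0}"
  have "closed N"
    unfolding N_def by (intro closed_Collect_eq continuous_on_const) (rule linear_continuous_on[OF bounded_linear_slot])
  moreover have "subspace N"
  proof (rule subspaceI)
    show "0 \<in> N" unfolding N_def mem_Collect_eq by (rule zero)
    show "x + y \<in> N" if "x \<in> N" "y \<in> N" for x y
      using that unfolding N_def mem_Collect_eq add by simp
    show "c *\<^sub>R x \<in> N" if "x \<in> N" for c x
      using that unfolding N_def mem_Collect_eq scale by simp
  qed
  moreover have "L \<union> (\<lambda>b. \<i> *\<^sub>C b) ` L \<subseteq> N"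
    using L by (auto simp: N_def slot_antilinear_scale[OF fock_eval_antilinear])
  ultimately have "closure (span (L \<union> (\<lambda>b. \<i> *\<^sub>C b) ` L)) \<subseteq> N"
    by (intro closure_minimal span_minimal)
  then have "x \<in> N" using assms(1) by blast
  then show ?thesis by (simp add: N_def)
qed

text \<open>The slots are filled one at a time from the left. Each has its own dense system, since
  some slots use the basis and others its conjugate.\<close>

lemma fock_eval_dense:
  fixes T :: "'h::real_inner fock"
  assumes "\<And>L. L \<in> set Ls \<Longrightarrow> closure (span (L \<union> (\<lambda>b. \<i> *\<^sub>C b) ` L)) = UNIV"
    and "\<And>ws. list_all2 (\<in>) ws Ls \<Longrightarrow> fock_eval T (pre @ ws) = 0" and "length zs = length Ls"
  shows "fock_eval T (pre @ zs) = 0"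
  using assms
proof (induction Ls arbitrary: pre zs)
  case (Cons L Ls)
  obtain z zs' where zs: "zs = z # zs'" "length zs' = length Ls" using Cons.prems(3) by (cases zs) auto
  have "fock_eval T (pre @ b # zs') = 0" if "b \<in> L" for b
    using Cons.IH[of "pre @ [b]" zs'] Cons.prems(1,2) zs that by auto
  then show ?case unfolding zs by (rule fock_eval_dense_slot[rotated]) (use Cons.prems(1) in auto)
qed simp

lemma cconj_cscale: "cconj (c *\<^sub>C h) = cnj c *\<^sub>C cconj h"
  by (simp add: cconj_def cscale_def prod_eq_iff)

lemma cconj_cconj [simp]: "cconj (cconj h) = h"
  by (simp add: cconj_def)

lemma inj_cconj: "inj cconj"
  by (metis cconj_cconj injI)

lemma linear_cconj: "linear (cconj :: 'h::real_vector cplx \<Rightarrow> _)"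
  by (intro linearI) (auto simp: cconj_def prod_eq_iff)

lemma norm_cconj: "norm (cconj h) = norm (h :: 'h::real_inner cplx)"
  by (simp add: cconj_def norm_prod_def)

lemma corthonormal_cconj: "corthonormal B \<Longrightarrow> corthonormal (cconj ` B)"
  unfolding corthonormal_def by (simp add: cinner_cconj inj_eq[OF inj_cconj])

text \<open>Conjugation is an isometric real-linear bijection that sends i b to -i times the
  conjugate of b, so it carries the dense span into the required one.\<close>

lemma orthonormal_basis_cconj_dense:
  fixes B :: "'h::real_inner cplx set"
  assumes "orthonormal_basis B"
  shows "closure (span (cconj ` B \<union> (\<lambda>b. \<i> *\<^sub>C b) ` cconj ` B)) = UNIV"
proof -
  define S where "S = span (B \<union> (\<lambda>b. \<i> *\<^sub>C b) ` B)"
  have bl: "bounded_linear (cconj :: 'h cplx \<Rightarrow> _)"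
    using linear_cconj by (auto simp: bounded_linear_def bounded_linear_axioms_def norm_cconj intro!: exI[of _ 1])
  have "cconj ` (B \<union> (\<lambda>b. \<i> *\<^sub>C b) ` B) \<subseteq> span (cconj ` B \<union> (\<lambda>b. \<i> *\<^sub>C b) ` cconj ` B)"
  proof -
    have "- \<i> *\<^sub>C cconj b \<in> span (cconj ` B \<union> (\<lambda>b. \<i> *\<^sub>C b) ` cconj ` B)" if "b \<in> B" for b
    proof -
      have "\<i> *\<^sub>C cconj b \<in> span (cconj ` B \<union> (\<lambda>b. \<i> *\<^sub>C b) ` cconj ` B)"
        using that by (intro span_base) auto
      from span_neg[OF this] show ?thesis by (simp add: cscale_def prod_eq_iff)
    qed
    then show ?thesis by (auto simp: cconj_cscale intro: span_base)
  qed
  then have "cconj ` S \<subseteq> span (cconj ` B \<union> (\<lambda>b. \<i> *\<^sub>C b) ` cconj ` B)"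
    unfolding S_def linear_span_image[OF linear_cconj, symmetric] by (intro span_minimal) auto
  moreover have "cconj ` closure S \<subseteq> closure (cconj ` S)"
    by (rule closure_bounded_linear_image_subset[OF bl])
  moreover have "closure S = UNIV" using assms by (simp add: orthonormal_basis_def S_def)
  moreover have "range (cconj :: 'h cplx \<Rightarrow> _) = UNIV" by (metis cconj_cconj surjI)
  ultimately have "UNIV \<subseteq> closure (cconj ` S)" by simp
  also have "\<dots> \<subseteq> closure (span (cconj ` B \<union> (\<lambda>b. \<i> *\<^sub>C b) ` cconj ` B))"
    by (intro closure_mono) fact
  finally show ?thesis by blast
qed

lemma list_all2_mem_replicate: "list_all2 (\<in>) us (replicate p L) \<Longrightarrow> us \<in> words L p"
proof -
  assume *: "list_all2 (\<in>) us (replicate p L)"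
  have l: "length us = p" using list_all2_lengthD[OF *] by simp
  have "us ! i \<in> L" if "i < length us" for i
    using list_all2_nthD[OF * that] that l by simp
  then show ?thesis unfolding words_def using l by (auto simp: in_set_conv_nth)
qed

lemma map_cconj_words: "us \<in> words L p \<Longrightarrow> map cconj us \<in> words (cconj ` L) p"
  by (simp add: words_def image_mono)

lemma map_cconj_words': "us \<in> words (cconj ` L) p \<Longrightarrow> map cconj us \<in> words L p"
  using map_cconj_words[of us "cconj ` L" p] by (simp add: image_image)

lemma bisymmetricD:
  fixes f :: "'h::real_inner fock"
  assumes "f \<in> bisymmetric p q"
  shows "length zs \<noteq> p + q \<Longrightarrow> fock_eval f zs = 0"
    and "length us = p \<Longrightarrow> length vs = q \<Longrightarrow> \<sigma> permutes {..<p} \<Longrightarrow> \<tau> permutes {..<q} \<Longrightarrow>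
      fock_eval f (permute_list \<sigma> us @ permute_list \<tau> vs) = fock_eval f (us @ vs)"
  using assms unfolding bisymmetric_def by blast+

lemma fock_eq_on_basis:
  fixes S T :: "'h::real_inner fock"
  assumes B: "orthonormal_basis B"
    and len: "\<And>xs. length xs \<noteq> p + q \<Longrightarrow> fock_eval S xs = fock_eval T xs"
    and eq: "\<And>xs ys. xs \<in> words B p \<Longrightarrow> ys \<in> words B q \<Longrightarrow>
      fock_eval S (xs @ map cconj ys) = fock_eval T (xs @ map cconj ys)"
  shows "S = T"
proof (rule fock_eqI)
  fix zs
  show "fock_eval S zs = fock_eval T zs"
  proof (cases "length zs = p + q")
    case True
    define Ls where "Ls = replicate p B @ replicate q (cconj ` B)"
    have "fock_eval (S - T) ([] @ zs) = 0"
    proof (rule fock_eval_dense)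
      show "closure (span (L \<union> (\<lambda>b. \<i> *\<^sub>C b) ` L)) = UNIV" if "L \<in> set Ls" for L
        using that B orthonormal_basis_cconj_dense[OF B]
        by (auto simp: Ls_def orthonormal_basis_def split: if_splits)
      show "length zs = length Ls" using True by (simp add: Ls_def)
      fix ws assume "list_all2 (\<in>) ws Ls"
      then obtain us vs where ws: "ws = us @ vs" and "list_all2 (\<in>) us (replicate p B)"
        "list_all2 (\<in>) vs (replicate q (cconj ` B))"
        unfolding Ls_def list_all2_append2 by blast
      then have us: "us \<in> words B p" and vs: "vs \<in> words (cconj ` B) q"
        by (auto intro: list_all2_mem_replicate)
      have "map cconj (map cconj vs) = vs" by (simp add: comp_def)
      then show "fock_eval (S - T) ([] @ ws) = 0"
        using eq[OF us map_cconj_words'[OF vs]] by (simp only: ws append_Nil fock_eval_simps) simp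
    qed
    then show ?thesis by simp
  qed (rule len)
qed

section \<open>Norm estimates for sums of elementary tensors\<close>

lemma eltensor_parseval:
  assumes "finite C" "corthonormal C" "length g = length h" "\<And>z. z \<in> set g \<Longrightarrow> reproduced C z"
  shows "(\<Sum>u\<in>words C (length g). eltensor g u * cnj (eltensor h u)) = eltensor g h"
  using assms(3,4)
proof (induction g h rule: list_induct2)
  case (Cons x xs y ys)
  have "cinner x y = cinner (\<Sum>b\<in>C. cinner x b *\<^sub>C b) y"
    using Cons.prems[of x] unfolding reproduced_def by simp
  also have "\<dots> = (\<Sum>b\<in>C. cinner x b * cnj (cinner y b))"
    unfolding cinner_sum_left cinner_scale_left by (intro sum.cong refl) (subst cinner_commute, simp)
  finally have xy: "(\<Sum>b\<in>C. cinner x b * cnj (cinner y b)) = cinner x y" ..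
  have "(\<Sum>u\<in>words C (length (x # xs)). eltensor (x # xs) u * cnj (eltensor (y # ys) u))
      = (\<Sum>b\<in>C. \<Sum>u\<in>words C (length xs). (cinner x b * cnj (cinner y b)) * (eltensor xs u * cnj (eltensor ys u)))"
    by (simp add: sum_words_Suc mult_ac)
  also have "\<dots> = cinner x y * eltensor xs ys"
    using Cons unfolding sum_product[symmetric] xy by simp
  finally show ?case by simp
qed simp

text \<open>The norm is a supremum over finite orthonormal sets C. Enlarging C until it reproduces
  all vectors occurring in the tensors only increases the sum of squares, and Parseval then
  evaluates it exactly.\<close>

lemma norm_sum_pure_tensor_le:
  fixes g :: "'i \<Rightarrow> 'h::real_inner cplx list"
  assumes I: "finite I" and len: "\<And>i. i \<in> I \<Longrightarrow> length (g i) = n"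
    and orth: "\<And>i j. i \<in> I \<Longrightarrow> j \<in> I \<Longrightarrow> eltensor (g i) (g j) = (if i = j then 1 else 0)"
  shows "(norm (\<Sum>i\<in>I. c i *\<^sub>F pure_tensor (g i)))\<^sup>2 \<le> (\<Sum>i\<in>I. (cmod (c i))\<^sup>2)"
proof -
  define T where "T = (\<Sum>i\<in>I. c i *\<^sub>F pure_tensor (g i))"
  have T: "fock_eval T u = (\<Sum>i\<in>I. c i * eltensor (g i) u)" for u
    by (simp add: T_def pure_tensor.rep_eq)
  have "norm T \<le> sqrt (\<Sum>i\<in>I. (cmod (c i))\<^sup>2)"
  proof (rule fock_norm_leI)
    fix C :: "'h cplx set" and K assume C: "finite C" "corthonormal C"
    obtain C2 where C2: "finite C2" "corthonormal C2" "C \<subseteq> C2" "\<forall>x\<in>(\<Union>i\<in>I. set (g i)). reproduced C2 x"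
      using gram_schmidt[of "\<Union>i\<in>I. set (g i)" C] I C by auto
    have sub: "words C k \<subseteq> words C2 k" for k using C2(3) by (auto simp: words_def)
    have par: "(\<Sum>u\<in>words C2 n. eltensor (g i) u * cnj (eltensor (g j) u)) = (if i = j then 1 else 0)"
      if "i \<in> I" "j \<in> I" for i j
      using eltensor_parseval[OF C2(1,2), of "g i" "g j"] C2(4) that len orth by simp
    have "complex_of_real (\<Sum>u\<in>words C2 n. (cmod (fock_eval T u))\<^sup>2)
        = (\<Sum>u\<in>words C2 n. fock_eval T u * cnj (fock_eval T u))"
      by (simp add: complex_norm_square del: of_real_power)
    also have "\<dots> = (\<Sum>u\<in>words C2 n. \<Sum>i\<in>I. \<Sum>j\<in>I. (c i * cnj (c j)) * (eltensor (g i) u * cnj (eltensor (g j) u)))"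
      unfolding T cnj_sum sum_product by (simp add: mult_ac)
    also have "\<dots> = (\<Sum>i\<in>I. \<Sum>u\<in>words C2 n. \<Sum>j\<in>I. (c i * cnj (c j)) * (eltensor (g i) u * cnj (eltensor (g j) u)))"
      by (rule sum.swap)
    also have "\<dots> = (\<Sum>i\<in>I. \<Sum>j\<in>I. \<Sum>u\<in>words C2 n. (c i * cnj (c j)) * (eltensor (g i) u * cnj (eltensor (g j) u)))"
      by (intro sum.cong refl sum.swap)
    also have "\<dots> = (\<Sum>i\<in>I. \<Sum>j\<in>I. if i = j then c i * cnj (c j) else 0)"
    proof (intro sum.cong refl)
      fix i j assume "i \<in> I" "j \<in> I"
      then show "(\<Sum>u\<in>words C2 n. (c i * cnj (c j)) * (eltensor (g i) u * cnj (eltensor (g j) u)))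
          = (if i = j then c i * cnj (c j) else 0)"
        unfolding sum_distrib_left[symmetric] by (simp add: par)
    qed
    also have "\<dots> = (\<Sum>i\<in>I. c i * cnj (c i))" using I by simp
    also have "\<dots> = complex_of_real (\<Sum>i\<in>I. (cmod (c i))\<^sup>2)"
      by (simp add: complex_norm_square del: of_real_power)
    finally have eq: "(\<Sum>u\<in>words C2 n. (cmod (fock_eval T u))\<^sup>2) = (\<Sum>i\<in>I. (cmod (c i))\<^sup>2)"
      unfolding of_real_eq_iff .
    have zero: "(\<Sum>u\<in>words C k. (cmod (fock_eval T u))\<^sup>2) = 0" if "k \<noteq> n" for k
    proof (intro sum.neutral ballI)
      fix u assume "u \<in> words C k"
      then have "length (g i) \<noteq> length u" if "i \<in> I" for i
        using len[OF that] \<open>k \<noteq> n\<close> by (simp add: words_def)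
      then show "(cmod (fock_eval T u))\<^sup>2 = 0" unfolding T by (simp add: eltensor_length)
    qed
    have "(hs_norm (fock_eval T) C K)\<^sup>2 = (\<Sum>k\<le>K. if k = n then \<Sum>u\<in>words C n. (cmod (fock_eval T u))\<^sup>2 else 0)"
      unfolding hs_norm_power2[OF C(1)] using zero by (intro sum.cong) auto
    also have "\<dots> \<le> (\<Sum>u\<in>words C n. (cmod (fock_eval T u))\<^sup>2)" by (simp add: sum_nonneg)
    also have "\<dots> \<le> (\<Sum>u\<in>words C2 n. (cmod (fock_eval T u))\<^sup>2)"
      using C2(1) sub by (intro sum_mono2) auto
    finally show "hs_norm (fock_eval T) C K \<le> sqrt (\<Sum>i\<in>I. (cmod (c i))\<^sup>2)"
      unfolding eq by (rule real_le_rsqrt)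
  qed
  then have "(norm T)\<^sup>2 \<le> (sqrt (\<Sum>i\<in>I. (cmod (c i))\<^sup>2))\<^sup>2" by (intro power_mono) auto
  then show ?thesis by (simp add: T_def sum_nonneg)
qed

text \<open>The lists mix E with its conjugate, whose union need not be orthonormal. A larger
  orthonormal set C contains E and reproduces the conjugates, so the last q slots can be passed to C
  by \<open>words_mono\<close> and the first p by inclusion.\<close>

lemma bessel_mixed:
  fixes f :: "'h::real_inner fock"
  assumes E: "finite E" "corthonormal E"
  shows "(\<Sum>xs\<in>words E p. \<Sum>ys\<in>words E q. (cmod (fock_eval f (xs @ map cconj ys)))\<^sup>2) \<le> (norm f)\<^sup>2"
proof -
  have E': "finite (cconj ` E)" "corthonormal (cconj ` E)" using E by (auto intro: corthonormal_cconj)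
  obtain C where C: "finite C" "corthonormal C" "E \<subseteq> C" "\<forall>x\<in>cconj ` E. reproduced C x"
    using gram_schmidt[OF E'(1) E] by blast
  have bij: "bij_betw (map cconj) (words E q) (words (cconj ` E) q)"
    by (rule bij_betwI[where g = "map cconj"]) (simp_all add: map_cconj_words map_cconj_words' comp_def)
  have split: "(\<Sum>zs\<in>words C (p + q). h zs) = (\<Sum>xs\<in>words C p. \<Sum>ys\<in>words C q. h (xs @ ys))" for h :: "'h cplx list \<Rightarrow> real"
    by (induction p arbitrary: h) (simp_all add: sum_words_Suc)
  have "(\<Sum>xs\<in>words E p. \<Sum>ys\<in>words E q. (cmod (fock_eval f (xs @ map cconj ys)))\<^sup>2)
      = (\<Sum>xs\<in>words E p. \<Sum>ys\<in>words (cconj ` E) q. (cmod (fock_eval f (xs @ ys)))\<^sup>2)"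
    by (intro sum.cong refl sum.reindex_bij_betw[OF bij])
  also have "\<dots> \<le> (\<Sum>xs\<in>words E p. \<Sum>ys\<in>words C q. (cmod (fock_eval f (xs @ ys)))\<^sup>2)"
    using C(4) by (intro sum_mono words_mono[OF fock_eval_antilinear E' C(1,2)]) auto
  also have "\<dots> \<le> (\<Sum>xs\<in>words C p. \<Sum>ys\<in>words C q. (cmod (fock_eval f (xs @ ys)))\<^sup>2)"
    using C(1,3) by (intro sum_mono2) (auto simp: words_def sum_nonneg finite_lists_length_eq)
  also have "\<dots> = (\<Sum>zs\<in>words C (p + q). (cmod (fock_eval f zs))\<^sup>2)" by (rule split[symmetric])
  also have "\<dots> \<le> (\<Sum>k\<le>p + q. \<Sum>zs\<in>words C k. (cmod (fock_eval f zs))\<^sup>2)"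
    by (rule member_le_sum) (auto intro: sum_nonneg)
  also have "\<dots> = (hs_norm (fock_eval f) C (p + q))\<^sup>2" by (rule hs_norm_power2[OF C(1), symmetric])
  also have "\<dots> \<le> (norm f)\<^sup>2" by (intro power_mono hs_norm_le_norm C) auto
  finally show ?thesis .
qed

section \<open>Symmetrized tensors and their values on the basis\<close>

lemma eltensor_nth:
  "length gs = length xs \<Longrightarrow> eltensor gs xs = (\<Prod>i<length xs. cinner (gs ! i) (xs ! i))"
  by (induction gs xs rule: list_induct2) (simp_all add: prod.lessThan_Suc_shift del: prod.lessThan_Suc)

lemma sum_eltensor_permute:
  assumes "length gs = n" "length us = n" "\<sigma> permutes {..<n}"
  shows "(\<Sum>\<rho> | \<rho> permutes {..<n}. eltensor (permute_list \<rho> gs) (permute_list \<sigma> us))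
    = (\<Sum>\<rho> | \<rho> permutes {..<n}. eltensor (permute_list \<rho> gs) us)"
proof -
  have "(\<Sum>\<rho> | \<rho> permutes {..<n}. eltensor (permute_list \<rho> gs) (permute_list \<sigma> us))
      = (\<Sum>\<rho> | \<rho> permutes {..<n}. eltensor (permute_list (\<rho> \<circ> \<sigma>) gs) (permute_list \<sigma> us))"
    by (rule sum_permutations_compose_right[OF assms(3)])
  also have "\<dots> = (\<Sum>\<rho> | \<rho> permutes {..<n}. eltensor (permute_list \<rho> gs) us)"
  proof (intro sum.cong refl)
    fix \<rho> assume "\<rho> \<in> {\<rho>. \<rho> permutes {..<n}}"
    then have \<rho>: "\<rho> permutes {..<n}" by simp
    have "eltensor (permute_list (\<rho> \<circ> \<sigma>) gs) (permute_list \<sigma> us) = (\<Prod>i<n. cinner (gs ! \<rho> (\<sigma> i)) (us ! \<sigma> i))"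
      using permutes_compose[OF assms(3) \<rho>] assms
      by (subst eltensor_nth) (auto intro!: prod.cong simp: permute_list_nth)
    also have "\<dots> = (\<Prod>i<n. cinner (gs ! \<rho> i) (us ! i))"
      using prod.permute[OF assms(3), of "\<lambda>i. cinner (gs ! \<rho> i) (us ! i)"] by (simp add: comp_def)
    also have "\<dots> = eltensor (permute_list \<rho> gs) us"
      using \<rho> assms by (subst eltensor_nth) (auto intro!: prod.cong simp: permute_list_nth)
    finally show "eltensor (permute_list (\<rho> \<circ> \<sigma>) gs) (permute_list \<sigma> us) = eltensor (permute_list \<rho> gs) us" .
  qed
  finally show ?thesis .
qed

lemma eval_basis_tensor:
  assumes "length us = length xs"
  shows "fock_eval (basis_tensor xs ys) (us @ vs) = 1 / (fact (length xs) * fact (length ys)) *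
    ((\<Sum>\<sigma> | \<sigma> permutes {..<length xs}. eltensor (permute_list \<sigma> xs) us) *
     (\<Sum>\<tau> | \<tau> permutes {..<length ys}. eltensor (permute_list \<tau> (map cconj ys)) vs))"
proof -
  have "(\<Sum>\<sigma> | \<sigma> permutes {..<length xs}. \<Sum>\<tau> | \<tau> permutes {..<length ys}.
      eltensor (permute_list \<sigma> xs @ map cconj (permute_list \<tau> ys)) (us @ vs))
    = (\<Sum>\<sigma> | \<sigma> permutes {..<length xs}. \<Sum>\<tau> | \<tau> permutes {..<length ys}.
      eltensor (permute_list \<sigma> xs) us * eltensor (permute_list \<tau> (map cconj ys)) vs)"
    using assms by (intro sum.cong refl) (simp add: eltensor_append permute_list_map)
  then show ?thesis
    by (simp add: basis_tensor_def pure_tensor.rep_eq sum_product)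
qed

lemma eval_basis_tensor_length:
  "length zs \<noteq> length xs + length ys \<Longrightarrow> fock_eval (basis_tensor xs ys) zs = 0"
  by (simp add: basis_tensor_def pure_tensor.rep_eq eltensor_length)

lemma bisymmetric_basis_tensor:
  fixes xs ys :: "'h::real_inner cplx list"
  assumes "length xs = p" "length ys = q"
  shows "basis_tensor xs ys \<in> bisymmetric p q"
  unfolding bisymmetric_def
proof (intro CollectI conjI allI impI)
  show "fock_eval (basis_tensor xs ys) zs = 0" if "length zs \<noteq> p + q" for zs
    using that assms by (simp add: eval_basis_tensor_length)
  fix us vs :: "'h cplx list" and \<sigma> \<tau>
  assume *: "length us = p" "length vs = q" "\<sigma> permutes {..<p}" "\<tau> permutes {..<q}"
  show "fock_eval (basis_tensor xs ys) (permute_list \<sigma> us @ permute_list \<tau> vs) = fock_eval (basis_tensor xs ys) (us @ vs)"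
    using * assms sum_eltensor_permute[of xs p us \<sigma>] sum_eltensor_permute[of "map cconj ys" q vs \<tau>]
    by (simp add: eval_basis_tensor)
qed

lemma bisymmetric_scale: "f \<in> bisymmetric p q \<Longrightarrow> c *\<^sub>F f \<in> bisymmetric p q"
  by (simp add: bisymmetric_def)

lemma bisymmetric_sum: "(\<And>i. i \<in> I \<Longrightarrow> f i \<in> bisymmetric p q) \<Longrightarrow> (\<Sum>i\<in>I. f i) \<in> bisymmetric p q"
  by (induction I rule: infinite_finite_induct) (simp_all add: bisymmetric_def)

lemma tendsto_fock_eval:
  assumes "X \<longlonglongrightarrow> f"
  shows "(\<lambda>l. fock_eval (X l) zs) \<longlonglongrightarrow> fock_eval f zs"
proof -
  have "(\<lambda>l. norm (X l - f)) \<longlonglongrightarrow> 0" using assms by (simp add: tendsto_norm_zero_iff LIM_zero_iff)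
  then have "(\<lambda>l. (\<Prod>z\<leftarrow>zs. norm z) * norm (X l - f)) \<longlonglongrightarrow> 0" by (rule tendsto_mult_right_zero)
  then have "(\<lambda>l. fock_eval (X l) zs - fock_eval f zs) \<longlonglongrightarrow> 0"
  proof (rule Lim_null_comparison[rotated], intro always_eventually allI)
    show "norm (fock_eval (X l) zs - fock_eval f zs) \<le> (\<Prod>z\<leftarrow>zs. norm z) * norm (X l - f)" for l
      using fock_eval_bound[of "X l - f" zs] by simp
  qed
  then show ?thesis by (simp add: LIM_zero_iff)
qed

lemma bisymmetric_limit:
  assumes "\<And>l. X l \<in> bisymmetric p q" "X \<longlonglongrightarrow> f"
  shows "f \<in> bisymmetric p q"
  unfolding bisymmetric_def
proof (intro CollectI conjI allI impI)
  fix zs :: "'a cplx list" assume "length zs \<noteq> p + q"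
  then have "(\<lambda>l. fock_eval (X l) zs) = (\<lambda>l. 0)" using bisymmetricD(1)[OF assms(1)] by blast
  then show "fock_eval f zs = 0" using tendsto_fock_eval[OF assms(2), of zs] by (simp add: LIMSEQ_const_iff)
next
  fix us vs :: "'a cplx list" and \<sigma> \<tau>
  assume "length us = p" "length vs = q" "\<sigma> permutes {..<p}" "\<tau> permutes {..<q}"
  then have "(\<lambda>l. fock_eval (X l) (permute_list \<sigma> us @ permute_list \<tau> vs)) = (\<lambda>l. fock_eval (X l) (us @ vs))"
    using bisymmetricD(2)[OF assms(1)] by blast
  then show "fock_eval f (permute_list \<sigma> us @ permute_list \<tau> vs) = fock_eval f (us @ vs)"
    using tendsto_fock_eval[OF assms(2), of "permute_list \<sigma> us @ permute_list \<tau> vs"]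
      tendsto_fock_eval[OF assms(2), of "us @ vs"] by (simp add: LIMSEQ_unique)
qed

lemma bisymmetric_mset:
  assumes f: "f \<in> bisymmetric p q" and "length xs = p" "length ys = q" "mset xs = mset xs'" "mset ys = mset ys'"
  shows "fock_eval f (xs' @ map cconj ys') = fock_eval f (xs @ map cconj ys)"
proof -
  obtain \<sigma> where \<sigma>: "\<sigma> permutes {..<p}" "permute_list \<sigma> xs = xs'"
    using mset_eq_permutation[OF assms(4)[symmetric]] assms(2) by blast
  obtain \<tau> where \<tau>: "\<tau> permutes {..<q}" "permute_list \<tau> ys = ys'"
    using mset_eq_permutation[OF assms(5)[symmetric]] assms(3) by blast
  have "map cconj ys' = permute_list \<tau> (map cconj ys)"
    using \<tau> assms(3) by (simp add: permute_list_map)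
  then show ?thesis
    using bisymmetricD(2)[OF f, of xs "map cconj ys" \<sigma> \<tau>] \<sigma> \<tau> assms(2,3) by simp
qed

text \<open>By orthonormality each pair of permutations contributes 1 or 0, so the value counts
  pairs of matching permutations. This count is the inner product found in
  \<open>L2_inner_HP\<close>: the isometry of the integral on basis tensors.\<close>

lemma eval_basis_tensor_words:
  assumes B: "corthonormal B" and "us \<in> words B p" "vs \<in> words B q" "xs \<in> words B p" "ys \<in> words B q"
  shows "fact p * fact q * fock_eval (basis_tensor us vs) (xs @ map cconj ys) =
    (if mset us = mset xs \<and> mset vs = mset ys then of_nat (mult_fact xs * mult_fact ys) else 0)"
proof -
  have *: "(\<Sum>\<sigma> | \<sigma> permutes {..<length us}. eltensor (permute_list \<sigma> us) xs)
      = (if mset us = mset xs then of_nat (mult_fact xs) else 0)"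
    if "corthonormal B" "set us \<subseteq> B" "set xs \<subseteq> B" for B and us xs :: "'a cplx list"
  proof -
    have "(\<Sum>\<sigma> | \<sigma> permutes {..<length us}. eltensor (permute_list \<sigma> us) xs)
        = (\<Sum>\<sigma> | \<sigma> permutes {..<length us}. if permute_list \<sigma> us = xs then 1 else 0)"
      using that by (intro sum.cong refl eltensor_orthonormal) auto
    also have "\<dots> = of_nat (card {\<sigma>. \<sigma> permutes {..<length us} \<and> permute_list \<sigma> us = xs})"
      using finite_permutations[of "{..<length us}"] by (simp add: sum.If_cases Collect_conj_eq)
    finally show ?thesis by (simp add: card_permute_list)
  qed
  have "(\<Sum>\<tau> | \<tau> permutes {..<length vs}. eltensor (permute_list \<tau> (map cconj vs)) (map cconj ys))
      = cnj (\<Sum>\<tau> | \<tau> permutes {..<length vs}. eltensor (permute_list \<tau> vs) ys)"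
    unfolding cnj_sum by (intro sum.cong refl) (simp add: permute_list_map eltensor_map_cconj)
  also have "\<dots> = (if mset vs = mset ys then of_nat (mult_fact ys) else 0)"
    using assms by (subst *[OF B]) (auto simp: words_def)
  finally show ?thesis
    using assms *[OF B, of us xs] by (subst eval_basis_tensor) (auto simp: words_def)
qed

text \<open>Summing over words instead of over multiplicities makes all coefficients of a symmetric tensor equal to
  its values on the basis.\<close>

lemma eval_sum_basis_tensor:
  fixes c :: "'h::real_inner cplx list \<Rightarrow> 'h cplx list \<Rightarrow> complex"
  assumes B: "corthonormal B" and E: "finite E" "E \<subseteq> B"
    and sym: "\<And>xs ys xs' ys'. mset xs = mset xs' \<Longrightarrow> mset ys = mset ys' \<Longrightarrow> c xs ys = c xs' ys'"
    and xs: "xs \<in> words B p" "ys \<in> words B q"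
  shows "fock_eval (\<Sum>(us, vs)\<in>words E p \<times> words E q. c us vs *\<^sub>F basis_tensor us vs) (xs @ map cconj ys)
    = (if set xs \<subseteq> E \<and> set ys \<subseteq> E then c xs ys else 0)"
proof -
  \<comment> \<open>Each rearrangement of \<open>xs\<close> over E contributes the stabilizer order,
    and by orbit-stabilizer they contribute p! together.\<close>
  have perm: "(\<Sum>us\<in>words E p. if mset us = mset xs then of_nat (mult_fact xs) else 0)
      = (if set xs \<subseteq> E then fact p else (0::complex))" if "xs \<in> words B p" for xs p
  proof -
    have "(\<Sum>us\<in>words E p. if mset us = mset xs then complex_of_nat (mult_fact xs) else 0)
        = of_nat (card {us \<in> words E p. mset us = mset xs} * mult_fact xs)"
      using E by (simp add: sum.If_cases Collect_conj_eq Collect_mem_eq)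
    moreover have "{us \<in> words E p. mset us = mset xs} = (if set xs \<subseteq> E then {us. mset us = mset xs} else {})"
      using that by (auto simp: words_def dest: mset_eq_setD mset_eq_length)
    moreover have "length xs = p" using that by (simp add: words_def)
    ultimately have "(\<Sum>us\<in>words E p. if mset us = mset xs then complex_of_nat (mult_fact xs) else 0)
        = complex_of_nat (if set xs \<subseteq> E then fact p else 0)"
      using mult_fact_card[of xs] by (simp del: of_nat_mult)
    then show ?thesis by simp
  qed
  have "fact p * fact q * fock_eval (\<Sum>(us, vs)\<in>words E p \<times> words E q. c us vs *\<^sub>F basis_tensor us vs) (xs @ map cconj ys)
      = (\<Sum>us\<in>words E p. \<Sum>vs\<in>words E q. c us vs * (fact p * fact q * fock_eval (basis_tensor us vs) (xs @ map cconj ys)))"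
    by (simp add: case_prod_unfold sum.cartesian_product sum_distrib_left mult_ac)
  also have "\<dots> = (\<Sum>us\<in>words E p. \<Sum>vs\<in>words E q. c xs ys *
      ((if mset us = mset xs then of_nat (mult_fact xs) else 0) * (if mset vs = mset ys then of_nat (mult_fact ys) else 0)))"
  proof (intro sum.cong refl)
    fix us vs assume "us \<in> words E p" "vs \<in> words E q"
    then have "us \<in> words B p" "vs \<in> words B q" using E by (auto simp: words_def)
    note eval = eval_basis_tensor_words[OF B this xs]
    show "c us vs * (fact p * fact q * fock_eval (basis_tensor us vs) (xs @ map cconj ys)) = c xs ys *
      ((if mset us = mset xs then of_nat (mult_fact xs) else 0) * (if mset vs = mset ys then of_nat (mult_fact ys) else 0))"
      unfolding eval using sym[of us xs vs ys] by simp
  qed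
  also have "\<dots> = c xs ys * ((\<Sum>us\<in>words E p. if mset us = mset xs then of_nat (mult_fact xs) else 0) *
      (\<Sum>vs\<in>words E q. if mset vs = mset ys then of_nat (mult_fact ys) else 0))"
    unfolding sum_product by (simp add: sum_distrib_left)
  also have "\<dots> = fact p * fact q * (if set xs \<subseteq> E \<and> set ys \<subseteq> E then c xs ys else 0)"
    unfolding perm[OF xs(1)] perm[OF xs(2)] by simp
  finally show ?thesis by simp
qed

lemma sum_basis_tensor_bisymmetric:
  "(\<Sum>(us, vs)\<in>words E p \<times> words E q. c us vs *\<^sub>F basis_tensor us vs) \<in> bisymmetric p q"
  by (intro bisymmetric_sum) (auto simp: words_def intro: bisymmetric_scale bisymmetric_basis_tensor)

text \<open>For coefficients that depend on multisets only, symmetrizing each term leaves the whole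
  sum unchanged. The sum of plain elementary tensors over words has orthonormal terms and obeys the
  general bound.\<close>

lemma norm_sum_basis_tensor_le:
  fixes c :: "'h::real_inner cplx list \<Rightarrow> 'h cplx list \<Rightarrow> complex"
  assumes B: "orthonormal_basis B" and E: "finite E" "E \<subseteq> B"
    and sym: "\<And>xs ys xs' ys'. mset xs = mset xs' \<Longrightarrow> mset ys = mset ys' \<Longrightarrow> c xs ys = c xs' ys'"
  shows "(norm (\<Sum>(us, vs)\<in>words E p \<times> words E q. c us vs *\<^sub>F basis_tensor us vs))\<^sup>2
    \<le> (\<Sum>(us, vs)\<in>words E p \<times> words E q. (cmod (c us vs))\<^sup>2)"
proof -
  have B': "corthonormal B" using B by (simp add: orthonormal_basis_def)
  define I where "I = words E p \<times> words E q"
  define g where "g = (\<lambda>(us, vs). us @ map cconj vs :: 'h cplx list)"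
  have I: "finite I" using E by (simp add: I_def)
  have elt: "eltensor (us @ map cconj vs) (xs @ map cconj ys) = (if (us, vs) = (xs, ys) then 1 else 0)"
    if "us \<in> words B p" "vs \<in> words B q" "xs \<in> words B p" "ys \<in> words B q" for us vs xs ys
    using that eltensor_orthonormal[OF B', of us xs] eltensor_orthonormal[OF B', of vs ys]
    by (simp add: words_def eltensor_append eltensor_map_cconj)
  have sub: "I \<subseteq> words B p \<times> words B q" using E by (auto simp: I_def words_def)
  have "(\<Sum>(us, vs)\<in>I. c us vs *\<^sub>F basis_tensor us vs) = (\<Sum>i\<in>I. (case i of (us, vs) \<Rightarrow> c us vs) *\<^sub>F pure_tensor (g i))"
  proof (rule fock_eq_on_basis[OF B, of p q])
    fix zs :: "'h cplx list" assume "length zs \<noteq> p + q"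
    then have l: "length zs \<noteq> length (fst i) + length (snd i)" if "i \<in> I" for i
      using that by (auto simp: I_def words_def)
    show "fock_eval (\<Sum>(us, vs)\<in>I. c us vs *\<^sub>F basis_tensor us vs) zs
        = fock_eval (\<Sum>i\<in>I. (case i of (us, vs) \<Rightarrow> c us vs) *\<^sub>F pure_tensor (g i)) zs"
      unfolding fock_eval_sum case_prod_unfold fock_eval_simps pure_tensor.rep_eq g_def
    proof (intro sum.cong refl)
      fix i assume "i \<in> I"
      note l[OF this]
      then show "c (fst i) (snd i) * fock_eval (basis_tensor (fst i) (snd i)) zs
          = c (fst i) (snd i) * eltensor (fst i @ map cconj (snd i)) zs"
        by (simp add: eval_basis_tensor_length eltensor_length)
    qed
  next
    fix xs ys assume xs: "xs \<in> words B p" "ys \<in> words B q"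
    have "fock_eval (\<Sum>i\<in>I. (case i of (us, vs) \<Rightarrow> c us vs) *\<^sub>F pure_tensor (g i)) (xs @ map cconj ys)
        = (\<Sum>i\<in>I. if i = (xs, ys) then c xs ys else 0)"
      unfolding fock_eval_sum fock_eval_simps pure_tensor.rep_eq
    proof (intro sum.cong refl)
      fix i assume "i \<in> I"
      then obtain us vs where i: "i = (us, vs)" "us \<in> words B p" "vs \<in> words B q" using sub by blast
      show "(case i of (us, vs) \<Rightarrow> c us vs) * eltensor (g i) (xs @ map cconj ys) = (if i = (xs, ys) then c xs ys else 0)"
        unfolding i(1) g_def prod.case elt[OF i(2,3) xs] by simp
    qed
    also have "\<dots> = (if (xs, ys) \<in> I then c xs ys else 0)" using I by simp
    also have "\<dots> = (if set xs \<subseteq> E \<and> set ys \<subseteq> E then c xs ys else 0)"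
      using xs by (simp add: I_def words_def)
    also have "\<dots> = fock_eval (\<Sum>(us, vs)\<in>I. c us vs *\<^sub>F basis_tensor us vs) (xs @ map cconj ys)"
      unfolding I_def by (rule eval_sum_basis_tensor[OF B' E _ xs, symmetric]) (rule sym)
    finally show "fock_eval (\<Sum>(us, vs)\<in>I. c us vs *\<^sub>F basis_tensor us vs) (xs @ map cconj ys)
        = fock_eval (\<Sum>i\<in>I. (case i of (us, vs) \<Rightarrow> c us vs) *\<^sub>F pure_tensor (g i)) (xs @ map cconj ys)"
      by (rule HOL.sym)
  qed
  moreover have "(norm (\<Sum>i\<in>I. (case i of (us, vs) \<Rightarrow> c us vs) *\<^sub>F pure_tensor (g i)))\<^sup>2
      \<le> (\<Sum>i\<in>I. (cmod (case i of (us, vs) \<Rightarrow> c us vs))\<^sup>2)"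
  proof (rule norm_sum_pure_tensor_le[OF I, of _ "p + q"])
    show "length (g i) = p + q" if "i \<in> I" for i using that by (auto simp: g_def I_def words_def)
    show "eltensor (g i) (g j) = (if i = j then 1 else 0)" if "i \<in> I" "j \<in> I" for i j
    proof -
      obtain us vs xs ys where "i = (us, vs)" "j = (xs, ys)" by force
      moreover from this have "us \<in> words B p" "vs \<in> words B q" "xs \<in> words B p" "ys \<in> words B q"
        using that sub by blast+
      ultimately show ?thesis using elt[of us vs xs ys] by (simp only: g_def prod.case)
    qed
  qed
  ultimately show ?thesis by (simp add: I_def case_prod_unfold)
qed

text \<open>Distinct members are at distance sqrt 2, so balls of radius 1/2 around them are disjoint
  open sets, of which a second countable space has only countably many.\<close>

lemma countable_corthonormal:
  fixes B :: "'h::{real_inner, second_countable_topology} cplx set"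
  assumes "corthonormal B"
  shows "countable B"
proof -
  have dist: "dist x y > 1" if "x \<in> B" "y \<in> B" "x \<noteq> y" for x y
  proof -
    have "cinner (x - y) (x - y) = 2"
      using corthonormalD(2)[OF assms, of x y] corthonormalD(2)[OF assms, of y x]
        corthonormalD(1)[OF assms, of x] corthonormalD(1)[OF assms, of y] that
      by (simp add: cinner_diff_left cinner_diff_right)
    then have "complex_of_real ((norm (x - y))\<^sup>2) = of_real 2" unfolding cinner_self by simp
    then have n: "(norm (x - y))\<^sup>2 = 2" unfolding of_real_eq_iff .
    have "1\<^sup>2 < (norm (x - y))\<^sup>2" unfolding n by simp
    then show ?thesis unfolding dist_norm by (rule power_less_imp_less_base) simp
  qed
  have "pairwise disjnt ((\<lambda>b. ball b (1/2)) ` B)"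
  proof (rule pairwiseI)
    fix S T assume "S \<in> (\<lambda>b. ball b (1/2)) ` B" "T \<in> (\<lambda>b. ball b (1/2)) ` B" "S \<noteq> T"
    then obtain x y where xy: "x \<in> B" "y \<in> B" "x \<noteq> y" "S = ball x (1/2)" "T = ball y (1/2)" by auto
    have False if "z \<in> S" "z \<in> T" for z
      using that dist[OF xy(1-3)] dist_triangle_half_r[of z x 1 y] xy(4,5) by (simp add: dist_commute)
    then show "disjnt S T" by (auto simp: disjnt_iff)
  qed
  then have "countable ((\<lambda>b. ball b (1/2)) ` B)"
    by (intro countable_disjoint_open_subsets) auto
  moreover have "inj_on (\<lambda>b. ball b (1/2)) B"
  proof (rule inj_onI, rule ccontr)
    fix x y assume xy: "x \<in> B" "y \<in> B" "ball x (1/2) = ball y (1/2)" "x \<noteq> y"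
    have "x \<in> ball y (1/2)" unfolding xy(3)[symmetric] by simp
    then show False using dist[OF xy(1,2,4)] by (simp add: dist_commute)
  qed
  ultimately show ?thesis by (rule countable_image_inj_on)
qed

text \<open>The graph of the integral asks for approximating sequences; these finite subsets of the
  basis index them.\<close>

lemma countable_exhaustion:
  assumes "countable B"
  obtains E :: "nat \<Rightarrow> 'a set" where "incseq E" "\<And>l. finite (E l)" "\<And>l. E l \<subseteq> B"
    "\<And>X. finite X \<Longrightarrow> X \<subseteq> B \<Longrightarrow> \<forall>\<^sub>F l in sequentially. X \<subseteq> E l"
proof
  define E where "E l = {b \<in> B. to_nat_on B b \<le> l}" for l
  show "incseq E" by (auto simp: incseq_def E_def)
  show "finite (E l)" for l
  proof (rule finite_imageD)
    show "finite (to_nat_on B ` E l)" by (rule finite_subset[of _ "{..l}"]) (auto simp: E_def)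
    show "inj_on (to_nat_on B) (E l)"
      using inj_on_to_nat_on[OF assms] by (rule inj_on_subset) (auto simp: E_def)
  qed
  show "E l \<subseteq> B" for l by (auto simp: E_def)
  show "\<forall>\<^sub>F l in sequentially. X \<subseteq> E l" if "finite X" "X \<subseteq> B" for X
    using eventually_ge_at_top[of "Max (to_nat_on B ` X)"]
  proof eventually_elim
    case (elim l)
    show ?case
    proof
      fix x assume "x \<in> X"
      then have "to_nat_on B x \<le> Max (to_nat_on B ` X)" using that(1) by (intro Max_ge) auto
      then show "x \<in> E l" using elim that(2) \<open>x \<in> X\<close> by (auto simp: E_def)
    qed
  qed
qed

section \<open>The multiple integrals\<close>

lemma bounded_linear_fock_scale: "bounded_linear (\<lambda>c. c *\<^sub>F T)"
  by (rule bounded_linear_intro[of _ "norm T"])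
    (simp_all add: fock_eqI fock_norm_scale distrib_left distrib_right scaleR_conv_of_real mult_ac)

lemma bounded_linear_fock_eval: "bounded_linear (\<lambda>T. fock_eval T zs)"
proof (rule bounded_linear_intro)
  show "norm (fock_eval T zs) \<le> norm T * (\<Prod>z\<leftarrow>zs. norm z)" for T
    using fock_eval_bound[of T zs] by (simp add: mult.commute)
qed (simp_all add: scaleR_conv_of_real)

locale isonormal_basis = complex_isonormal M Z
  for M :: "'w measure" and Z :: "'h::{real_inner, second_countable_topology} cplx \<Rightarrow> 'w \<Rightarrow> complex" +
  fixes B :: "'h cplx set"
  assumes basis: "orthonormal_basis B"
begin

lemma orthonormal: "corthonormal B"
  using basis by (simp add: orthonormal_basis_def)

lemma HP_words_L2: "xs \<in> words B p \<Longrightarrow> ys \<in> words B q \<Longrightarrow> HP xs ys \<in> L2_space M"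
  by (rule HP_L2[OF orthonormal]) (auto simp: words_def)

lemma L2_inner_HP_words:
  assumes "us \<in> words B p" "vs \<in> words B q" "xs \<in> words B p" "ys \<in> words B q"
  shows "L2_inner M (HP us vs) (HP xs ys) = fact p * fact q * fock_eval (basis_tensor us vs) (xs @ map cconj ys)"
  unfolding eval_basis_tensor_words[OF orthonormal assms]
  using assms by (intro L2_inner_HP[OF orthonormal]) (auto simp: words_def)

lemma L2_inner_HP_words_neq:
  assumes "us \<in> words B p" "vs \<in> words B q" "xs \<in> words B p'" "ys \<in> words B q'" "(p, q) \<noteq> (p', q')"
  shows "L2_inner M (HP us vs) (HP xs ys) = 0"
proof -
  have n: "\<not> (mset us = mset xs \<and> mset vs = mset ys)"
    using assms by (auto simp: words_def dest: mset_eq_length)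
  have "L2_inner M (HP us vs) (HP xs ys) =
    (if mset us = mset xs \<and> mset vs = mset ys then of_nat (mult_fact xs * mult_fact ys) else 0)"
    using assms by (intro L2_inner_HP[OF orthonormal]) (auto simp: words_def)
  then show ?thesis unfolding if_not_P[OF n] .
qed

lemma sum_HP_L2:
  assumes "A \<subseteq> words B p \<times> words B q"
  shows "(\<lambda>\<omega>. \<Sum>(us, vs)\<in>A. c us vs * HP us vs \<omega>) \<in> L2_space M"
  unfolding case_prod_unfold using assms by (intro L2_sum L2_cmult HP_words_L2) auto

lemma L2_inner_sum_HP:
  assumes "A \<subseteq> words B p \<times> words B q" "xs \<in> words B p" "ys \<in> words B q"
  shows "L2_inner M (\<lambda>\<omega>. \<Sum>(us, vs)\<in>A. c us vs * HP us vs \<omega>) (HP xs ys)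
    = fact p * fact q * fock_eval (\<Sum>(us, vs)\<in>A. c us vs *\<^sub>F basis_tensor us vs) (xs @ map cconj ys)"
proof -
  have "L2_inner M (\<lambda>\<omega>. \<Sum>i\<in>A. c (fst i) (snd i) * HP (fst i) (snd i) \<omega>) (HP xs ys)
      = (\<Sum>i\<in>A. L2_inner M (\<lambda>\<omega>. c (fst i) (snd i) * HP (fst i) (snd i) \<omega>) (HP xs ys))"
    using assms by (intro L2_inner_sum_left L2_cmult HP_words_L2[of _ p _ q]) auto
  also have "\<dots> = (\<Sum>i\<in>A. fact p * fact q * fock_eval (c (fst i) (snd i) *\<^sub>F basis_tensor (fst i) (snd i)) (xs @ map cconj ys))"
  proof (intro sum.cong refl)
    fix i assume "i \<in> A"
    then have i: "fst i \<in> words B p" "snd i \<in> words B q" using assms by auto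
    show "L2_inner M (\<lambda>\<omega>. c (fst i) (snd i) * HP (fst i) (snd i) \<omega>) (HP xs ys)
        = fact p * fact q * fock_eval (c (fst i) (snd i) *\<^sub>F basis_tensor (fst i) (snd i)) (xs @ map cconj ys)"
      unfolding L2_inner_cmult_left L2_inner_HP_words[OF i assms(2,3)] by simp
  qed
  finally show ?thesis by (simp add: case_prod_unfold sum_distrib_left)
qed

context
  fixes p q :: nat and f :: "'h fock" and X :: "'w \<Rightarrow> complex"
  assumes graph: "wiener_ito_graph M Z B p q f X"
begin

lemma graph_L2: "X \<in> L2_space M"
  using graph by (simp add: wiener_ito_graph_def)

lemma graph_approx:
  obtains A c where "\<And>l::nat. A l \<subseteq> words B p \<times> words B q"
    "(\<lambda>l. \<Sum>(xs, ys)\<in>A l. c l xs ys *\<^sub>F basis_tensor xs ys) \<longlonglongrightarrow> f"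
    "L2_tendsto M (\<lambda>l \<omega>. \<Sum>(xs, ys)\<in>A l. c l xs ys * HP xs ys \<omega>) X sequentially"
proof -
  have "\<exists>(A :: nat \<Rightarrow> ('h cplx list \<times> 'h cplx list) set) c. (\<forall>l. finite (A l) \<and> A l \<subseteq> words B p \<times> words B q) \<and>
      (\<lambda>l. \<Sum>(xs, ys)\<in>A l. c l xs ys *\<^sub>F basis_tensor xs ys) \<longlonglongrightarrow> f \<and>
      L2_tendsto M (\<lambda>l \<omega>. \<Sum>(xs, ys)\<in>A l. c l xs ys * HP xs ys \<omega>) X sequentially"
    using graph unfolding wiener_ito_graph_def by (rule conjunct2)
  then show ?thesis by (elim exE conjE) (rule that, simp_all)
qed

text \<open>For finite sums the isometry equates both sides, and both are continuous under the
  convergence in the graph. The pairing thus depends on f alone, whichever version of the integral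
  is chosen.\<close>

lemma graph_inner:
  assumes "xs \<in> words B p" "ys \<in> words B q"
  shows "L2_inner M X (HP xs ys) = fact p * fact q * fock_eval f (xs @ map cconj ys)"
proof -
  obtain A c where A: "\<And>l::nat. A l \<subseteq> words B p \<times> words B q"
    and f: "(\<lambda>l. \<Sum>(xs, ys)\<in>A l. c l xs ys *\<^sub>F basis_tensor xs ys) \<longlonglongrightarrow> f"
    and X: "L2_tendsto M (\<lambda>l \<omega>. \<Sum>(xs, ys)\<in>A l. c l xs ys * HP xs ys \<omega>) X sequentially"
    by (rule graph_approx) (rule that)
  have "(\<lambda>l. L2_inner M (\<lambda>\<omega>. \<Sum>(xs, ys)\<in>A l. c l xs ys * HP xs ys \<omega>) (HP xs ys)) \<longlonglongrightarrow> L2_inner M X (HP xs ys)"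
    using A by (intro L2_inner_tendsto[OF _ graph_L2 HP_words_L2[OF assms] X] always_eventually allI sum_HP_L2)
  moreover have "(\<lambda>l. fact p * fact q * fock_eval (\<Sum>(xs, ys)\<in>A l. c l xs ys *\<^sub>F basis_tensor xs ys) (xs @ map cconj ys))
      \<longlonglongrightarrow> fact p * fact q * fock_eval f (xs @ map cconj ys)"
    by (intro tendsto_mult tendsto_const tendsto_fock_eval f)
  ultimately show ?thesis unfolding L2_inner_sum_HP[OF A assms] by (rule LIMSEQ_unique)
qed

text \<open>X is a mean square limit of combinations of Hermite products of degree (p, q), so
  orthogonality passes to it.\<close>

lemma graph_orth:
  assumes R: "R \<in> L2_space M" and orth: "\<And>us vs. us \<in> words B p \<Longrightarrow> vs \<in> words B q \<Longrightarrow> L2_inner M (HP us vs) R = 0"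
  shows "L2_inner M X R = 0"
proof -
  obtain A c where A: "\<And>l::nat. A l \<subseteq> words B p \<times> words B q"
    and X: "L2_tendsto M (\<lambda>l \<omega>. \<Sum>(xs, ys)\<in>A l. c l xs ys * HP xs ys \<omega>) X sequentially"
    by (rule graph_approx) (rule that, simp_all)
  have "(\<lambda>l. L2_inner M (\<lambda>\<omega>. \<Sum>(xs, ys)\<in>A l. c l xs ys * HP xs ys \<omega>) R) \<longlonglongrightarrow> L2_inner M X R"
    using A by (intro L2_inner_tendsto[OF _ graph_L2 R X] always_eventually allI sum_HP_L2)
  moreover have "L2_inner M (\<lambda>\<omega>. \<Sum>(xs, ys)\<in>A l. c l xs ys * HP xs ys \<omega>) R = 0" for l
  proof -
    have "L2_inner M (\<lambda>\<omega>. \<Sum>i\<in>A l. c l (fst i) (snd i) * HP (fst i) (snd i) \<omega>) R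
        = (\<Sum>i\<in>A l. L2_inner M (\<lambda>\<omega>. c l (fst i) (snd i) * HP (fst i) (snd i) \<omega>) R)"
      using A[of l] R by (intro L2_inner_sum_left L2_cmult HP_words_L2[of _ p _ q]) auto
    also have "\<dots> = 0"
      using A[of l] by (intro sum.neutral ballI) (auto simp: L2_inner_cmult_left orth)
    finally show ?thesis by (simp add: case_prod_unfold)
  qed
  ultimately show ?thesis by (simp add: LIMSEQ_const_iff)
qed

end

lemma graph_inner_neq:
  assumes "wiener_ito_graph M Z B p q f X" "xs \<in> words B p'" "ys \<in> words B q'" "(p, q) \<noteq> (p', q')"
  shows "L2_inner M X (HP xs ys) = 0"
proof (rule graph_orth[OF assms(1) HP_words_L2[OF assms(2,3)]])
  show "L2_inner M (HP us vs) (HP xs ys) = 0" if "us \<in> words B p" "vs \<in> words B q" for us vs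
    by (rule L2_inner_HP_words_neq[OF that assms(2-4)])
qed

section \<open>Symmetric coefficients, existence of integrals and projections\<close>

context
  fixes c :: "'h cplx list \<Rightarrow> 'h cplx list \<Rightarrow> complex"
  assumes sym: "\<And>xs ys xs' ys'. mset xs = mset xs' \<Longrightarrow> mset ys = mset ys' \<Longrightarrow> c xs ys = c xs' ys'"
begin

lemma L2_inner_sym_sum_HP:
  assumes "finite E" "E \<subseteq> B" "xs \<in> words E p" "ys \<in> words E q"
  shows "L2_inner M (\<lambda>\<omega>. \<Sum>(us, vs)\<in>words E p \<times> words E q. c us vs * HP us vs \<omega>) (HP xs ys)
    = fact p * fact q * c xs ys"
proof -
  have sub: "words E p \<times> words E q \<subseteq> words B p \<times> words B q" and xs: "xs \<in> words B p" "ys \<in> words B q"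
    using assms by (auto simp: words_def)
  have "fock_eval (\<Sum>(us, vs)\<in>words E p \<times> words E q. c us vs *\<^sub>F basis_tensor us vs) (xs @ map cconj ys)
      = (if set xs \<subseteq> E \<and> set ys \<subseteq> E then c xs ys else 0)"
    by (rule eval_sum_basis_tensor[OF orthonormal assms(1,2) _ xs]) (rule sym)
  then show ?thesis using L2_inner_sum_HP[OF sub xs] assms by (simp add: words_def)
qed

text \<open>Pairing the sum with one of its own Hermite products returns p! q! times the
  corresponding coefficient, so the square norm is a weighted sum of squares although the words
  repeat the same product.\<close>

lemma L2_sq_sym_sum_HP:
  assumes E: "finite E" "E \<subseteq> B"
  shows "L2_sq M (\<lambda>\<omega>. \<Sum>(us, vs)\<in>words E p \<times> words E q. c us vs * HP us vs \<omega>)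
    = fact p * fact q * (\<Sum>(us, vs)\<in>words E p \<times> words E q. (cmod (c us vs))\<^sup>2)"
proof -
  define I where "I = words E p \<times> words E q"
  have sub: "I \<subseteq> words B p \<times> words B q" using E by (auto simp: words_def I_def)
  define X where "X = (\<lambda>\<omega>. \<Sum>(us, vs)\<in>I. c us vs * HP us vs \<omega>)"
  have X: "X \<in> L2_space M" unfolding X_def by (rule sum_HP_L2[OF sub])
  have "complex_of_real (L2_sq M X) = L2_inner M X (\<lambda>\<omega>. \<Sum>i\<in>I. c (fst i) (snd i) * HP (fst i) (snd i) \<omega>)"
    unfolding L2_inner_self[symmetric] by (simp add: X_def case_prod_unfold)
  also have "\<dots> = (\<Sum>i\<in>I. L2_inner M X (\<lambda>\<omega>. c (fst i) (snd i) * HP (fst i) (snd i) \<omega>))"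
    using sub X by (intro L2_inner_sum_right L2_cmult HP_words_L2[of _ p _ q]) auto
  also have "\<dots> = (\<Sum>i\<in>I. complex_of_real (fact p * fact q * (cmod (c (fst i) (snd i)))\<^sup>2))"
  proof (intro sum.cong refl)
    fix i assume "i \<in> I"
    then have i: "fst i \<in> words E p" "snd i \<in> words E q" by (auto simp: I_def)
    have "L2_inner M X (HP (fst i) (snd i)) = fact p * fact q * c (fst i) (snd i)"
      unfolding X_def I_def by (rule L2_inner_sym_sum_HP[OF E i])
    then show "L2_inner M X (\<lambda>\<omega>. c (fst i) (snd i) * HP (fst i) (snd i) \<omega>)
        = complex_of_real (fact p * fact q * (cmod (c (fst i) (snd i)))\<^sup>2)"
      by (simp add: L2_inner_cmult_right complex_norm_square mult_ac del: of_real_power)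
  qed
  also have "\<dots> = complex_of_real (fact p * fact q * (\<Sum>i\<in>I. (cmod (c (fst i) (snd i)))\<^sup>2))"
    by (simp add: sum_distrib_left)
  finally show ?thesis unfolding of_real_eq_iff X_def I_def by (simp add: case_prod_unfold)
qed

end

text \<open>Partial sums over the exhaustion are Cauchy both as tensors and in mean square, because
  both distances are controlled by increments of the bounded increasing sequence s. This one
  construction serves both the integral of a given kernel and the projection of F.\<close>

lemma graph_exists:
  fixes c :: "'h cplx list \<Rightarrow> 'h cplx list \<Rightarrow> complex"
  assumes sym: "\<And>xs ys xs' ys'. mset xs = mset xs' \<Longrightarrow> mset ys = mset ys' \<Longrightarrow> c xs ys = c xs' ys'"
    and bound: "\<And>E. finite E \<Longrightarrow> E \<subseteq> B \<Longrightarrow> (\<Sum>(us, vs)\<in>words E p \<times> words E q. (cmod (c us vs))\<^sup>2) \<le> K"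
  obtains f X where "f \<in> bisymmetric p q" "wiener_ito_graph M Z B p q f X"
    "\<And>xs ys. xs \<in> words B p \<Longrightarrow> ys \<in> words B q \<Longrightarrow> fock_eval f (xs @ map cconj ys) = c xs ys"
proof -
  obtain E :: "nat \<Rightarrow> 'h cplx set" where E: "incseq E" "\<And>l. finite (E l)" "\<And>l. E l \<subseteq> B"
    "\<And>X. finite X \<Longrightarrow> X \<subseteq> B \<Longrightarrow> \<forall>\<^sub>F l in sequentially. X \<subseteq> E l"
    by (rule countable_exhaustion[OF countable_corthonormal[OF orthonormal]]) (rule that)
  define I where "I l = words (E l) p \<times> words (E l) q" for l
  have finI: "finite (I l)" for l using E(2) by (simp add: I_def)
  have words_sub: "words C r \<subseteq> words D r" if "C \<subseteq> D" for C D :: "'h cplx set" and r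
    using that unfolding words_def by blast
  have subI: "I l \<subseteq> words B p \<times> words B q" for l
    unfolding I_def by (intro Sigma_mono words_sub E(3))
  have monoI: "I k \<subseteq> I l" if "k \<le> l" for k l
    unfolding I_def using incseqD[OF E(1) that] by (intro Sigma_mono words_sub)
  define s where "s l = (\<Sum>(us, vs)\<in>I l. (cmod (c us vs))\<^sup>2)" for l
  define f where "f l = (\<Sum>(us, vs)\<in>I l. c us vs *\<^sub>F basis_tensor us vs)" for l
  define X where "X l = (\<lambda>\<omega>. \<Sum>(us, vs)\<in>I l. c us vs * HP us vs \<omega>)" for l
  have X_L2: "X l \<in> L2_space M" for l unfolding X_def by (rule sum_HP_L2[OF subI])
  have "incseq s"
    unfolding incseq_def s_def using finI monoI by (auto intro!: sum_mono2)
  moreover have "s l \<le> K" for l unfolding s_def I_def by (rule bound[OF E(2,3)])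
  ultimately have "Cauchy s"
    by (intro convergent_Cauchy) (rule incseq_convergent[of s K], auto simp: convergent_def)
  have split: "(\<Sum>i\<in>I l. \<phi> i) - (\<Sum>i\<in>I k. \<phi> i) = (\<Sum>i\<in>I l. if i \<in> I k then 0 else \<phi> i)"
    if "k \<le> l" for k l and \<phi> :: "_ \<Rightarrow> 'z::ab_group_add"
  proof -
    have "(\<Sum>i\<in>I l. if i \<in> I k then 0 else \<phi> i) = (\<Sum>i\<in>I l - I k. \<phi> i)"
      using finI by (intro sum.mono_neutral_cong_right) auto
    then show ?thesis using sum_diff[OF finI monoI[OF that], of \<phi>] by simp
  qed
  have diff: "(norm (f l - f k))\<^sup>2 \<le> s l - s k \<and> L2_sq M (\<lambda>\<omega>. X l \<omega> - X k \<omega>) = fact p * fact q * (s l - s k)"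
    if kl: "k \<le> l" for k l
  proof -
    \<comment> \<open>Discarding the words already used depends on multisets only, so c' is again
      symmetric and the norm statements apply to differences of partial sums.\<close>
    define c' where "c' us vs = (if set us \<subseteq> E k \<and> set vs \<subseteq> E k then 0 else c us vs)" for us vs
    have sym': "c' xs ys = c' xs' ys'" if "mset xs = mset xs'" "mset ys = mset ys'" for xs ys xs' ys'
      using sym[OF that] mset_eq_setD[OF that(1)] mset_eq_setD[OF that(2)] by (simp add: c'_def)
    have c': "c' (fst i) (snd i) = (if i \<in> I k then 0 else c (fst i) (snd i))" if "i \<in> I l" for i
      using that by (auto simp: c'_def I_def words_def)
    have 1: "s l - s k = (\<Sum>(us, vs)\<in>I l. (cmod (c' us vs))\<^sup>2)"
      unfolding s_def case_prod_unfold split[OF kl] by (intro sum.cong refl) (simp add: c')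
    have 2: "f l - f k = (\<Sum>(us, vs)\<in>I l. c' us vs *\<^sub>F basis_tensor us vs)"
      unfolding f_def case_prod_unfold split[OF kl] by (intro sum.cong refl) (simp add: c' fock_eqI)
    have 3: "(\<lambda>\<omega>. X l \<omega> - X k \<omega>) = (\<lambda>\<omega>. \<Sum>(us, vs)\<in>I l. c' us vs * HP us vs \<omega>)"
      unfolding X_def case_prod_unfold split[OF kl] by (intro ext sum.cong refl) (simp add: c')
    show ?thesis
      unfolding 1 2 3 I_def
    proof
      show "(norm (\<Sum>(us, vs)\<in>words (E l) p \<times> words (E l) q. c' us vs *\<^sub>F basis_tensor us vs))\<^sup>2
          \<le> (\<Sum>(us, vs)\<in>words (E l) p \<times> words (E l) q. (cmod (c' us vs))\<^sup>2)"
        by (rule norm_sum_basis_tensor_le[OF basis E(2,3)]) (rule sym')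
      show "L2_sq M (\<lambda>\<omega>. \<Sum>(us, vs)\<in>words (E l) p \<times> words (E l) q. c' us vs * HP us vs \<omega>)
          = fact p * fact q * (\<Sum>(us, vs)\<in>words (E l) p \<times> words (E l) q. (cmod (c' us vs))\<^sup>2)"
        by (rule L2_sq_sym_sum_HP[OF _ E(2,3)]) (rule sym')
    qed
  qed
  have "Cauchy f"
  proof (rule CauchyI)
    fix e :: real assume e: "e > 0"
    obtain N where N: "\<And>m n. m \<ge> N \<Longrightarrow> n \<ge> N \<Longrightarrow> norm (s m - s n) < e\<^sup>2"
      using CauchyD[OF \<open>Cauchy s\<close> zero_less_power[OF e, of 2]] by blast
    have lt: "norm (f l - f k) < e" if "N \<le> k" "k \<le> l" for k l
    proof (rule power2_less_imp_less)
      show "(norm (f l - f k))\<^sup>2 < e\<^sup>2"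
        using diff[OF that(2)] N[of l k] that unfolding real_norm_def by linarith
    qed (use e in simp)
    have "norm (f m - f n) < e" if "N \<le> m" "N \<le> n" for m n
      using lt[of n m] lt[of m n] that by (cases "n \<le> m") (auto simp: norm_minus_commute)
    then show "\<exists>N. \<forall>m\<ge>N. \<forall>n\<ge>N. norm (f m - f n) < e" by blast
  qed
  then obtain f' where f': "f \<longlonglongrightarrow> f'" using Cauchy_convergent convergent_def by blast
  have "\<exists>Y\<in>L2_space M. L2_tendsto M X Y sequentially"
  proof (rule L2_complete[OF X_L2])
    fix e :: real assume e: "e > 0"
    define e' where "e' = e / (fact p * fact q)"
    have e': "e' > 0" using e by (simp add: e'_def)
    obtain N where N: "\<And>m n. m \<ge> N \<Longrightarrow> n \<ge> N \<Longrightarrow> norm (s m - s n) < e'"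
      using CauchyD[OF \<open>Cauchy s\<close> e'] by blast
    have lt: "L2_sq M (\<lambda>\<omega>. X l \<omega> - X k \<omega>) < e" if "N \<le> k" "k \<le> l" for k l
    proof -
      have "s l - s k < e'" using N[of l k] that by simp
      then have "(s l - s k) * (fact p * fact q) < e" unfolding e'_def by (simp add: pos_less_divide_eq)
      then show ?thesis using diff[OF that(2)] by (simp add: mult_ac)
    qed
    have "L2_sq M (\<lambda>\<omega>. X m \<omega> - X n \<omega>) < e" if "N \<le> m" "N \<le> n" for m n
      using lt[of n m] lt[of m n] that L2_sq_commute[of M "X m" "X n"] by (cases "n \<le> m") auto
    then show "\<exists>N. \<forall>m\<ge>N. \<forall>n\<ge>N. L2_sq M (\<lambda>\<omega>. X m \<omega> - X n \<omega>) < e" by blast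
  qed
  then obtain Y where Y: "Y \<in> L2_space M" "L2_tendsto M X Y sequentially" by blast
  show ?thesis
  proof (rule that)
    show "f' \<in> bisymmetric p q"
      by (rule bisymmetric_limit[OF _ f']) (simp add: f_def I_def sum_basis_tensor_bisymmetric)
    show "wiener_ito_graph M Z B p q f' Y"
      unfolding wiener_ito_graph_def
      using Y f' finI subI unfolding f_def[abs_def] X_def[abs_def]
      by (intro conjI exI[of _ I] exI[of _ "\<lambda>_. c"] allI) auto
    fix xs ys assume xs: "xs \<in> words B p" "ys \<in> words B q"
    have ev: "fock_eval (f l) (xs @ map cconj ys) = (if set xs \<subseteq> E l \<and> set ys \<subseteq> E l then c xs ys else 0)" for l
      unfolding f_def I_def by (rule eval_sum_basis_tensor[OF orthonormal E(2,3) _ xs]) (rule sym)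
    have "\<forall>\<^sub>F l in sequentially. set xs \<union> set ys \<subseteq> E l"
      using xs by (intro E(4)) (auto simp: words_def)
    then have "\<forall>\<^sub>F l in sequentially. fock_eval (f l) (xs @ map cconj ys) = c xs ys"
      by eventually_elim (simp add: ev)
    then have "(\<lambda>l. fock_eval (f l) (xs @ map cconj ys)) \<longlonglongrightarrow> c xs ys" by (rule tendsto_eventually)
    then show "fock_eval f' (xs @ map cconj ys) = c xs ys"
      using tendsto_fock_eval[OF f'] LIMSEQ_unique by blast
  qed
qed

text \<open>The choice has a witness: the values of f on the basis are symmetric and, by Bessel,
  square summable. They produce a kernel with an integral, and this kernel is f by comparison on the
  basis.\<close>

lemma wiener_ito_graph_wiener_ito:
  assumes f: "f \<in> bisymmetric p q"
  shows "wiener_ito_graph M Z B p q f (wiener_ito M Z B p q f)"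
proof -
  define c where "c xs ys = (if length xs = p \<and> length ys = q then fock_eval f (xs @ map cconj ys) else 0)" for xs ys
  have sym: "c xs ys = c xs' ys'" if "mset xs = mset xs'" "mset ys = mset ys'" for xs ys xs' ys'
    using bisymmetric_mset[OF f _ _ that] mset_eq_length[OF that(1)] mset_eq_length[OF that(2)] by (simp add: c_def)
  have bound: "(\<Sum>(us, vs)\<in>words E p \<times> words E q. (cmod (c us vs))\<^sup>2) \<le> (norm f)\<^sup>2"
    if E: "finite E" "E \<subseteq> B" for E
  proof -
    have "(\<Sum>(us, vs)\<in>words E p \<times> words E q. (cmod (c us vs))\<^sup>2)
        = (\<Sum>us\<in>words E p. \<Sum>vs\<in>words E q. (cmod (fock_eval f (us @ map cconj vs)))\<^sup>2)"
      unfolding sum.cartesian_product[symmetric] by (intro sum.cong refl) (simp add: c_def words_def)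
    also have "\<dots> \<le> (norm f)\<^sup>2"
      by (rule bessel_mixed[OF E(1) corthonormal_subset[OF orthonormal E(2)]])
    finally show ?thesis .
  qed
  obtain f' X where f': "f' \<in> bisymmetric p q" "wiener_ito_graph M Z B p q f' X"
    "\<And>xs ys. xs \<in> words B p \<Longrightarrow> ys \<in> words B q \<Longrightarrow> fock_eval f' (xs @ map cconj ys) = c xs ys"
    using graph_exists[OF sym bound] by blast
  have "f' = f"
  proof (rule fock_eq_on_basis[OF basis])
    show "fock_eval f' zs = fock_eval f zs" if "length zs \<noteq> p + q" for zs
      using bisymmetricD(1)[OF f that] bisymmetricD(1)[OF f'(1) that] by simp
    show "fock_eval f' (xs @ map cconj ys) = fock_eval f (xs @ map cconj ys)" if "xs \<in> words B p" "ys \<in> words B q" for xs ys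
      using f'(3)[OF that] that by (simp add: c_def words_def)
  qed
  then have "wiener_ito_graph M Z B p q f X" using f' by simp
  then show ?thesis unfolding wiener_ito_def by (rule someI[where P = "wiener_ito_graph M Z B p q f"])
qed

text \<open>Bessel's inequality makes the coefficients square summable.\<close>

lemma projection_exists:
  assumes F: "F \<in> L2_space M"
  obtains f where "f \<in> bisymmetric p q"
    "\<And>xs ys. xs \<in> words B p \<Longrightarrow> ys \<in> words B q \<Longrightarrow>
      fact p * fact q * fock_eval f (xs @ map cconj ys) = L2_inner M F (HP xs ys)"
proof -
  define d :: real where "d = fact p * fact q"
  have d: "d > 0" by (simp add: d_def)
  define c where "c xs ys = L2_inner M F (HP xs ys) / of_real d" for xs ys
  have sym: "c xs ys = c xs' ys'" if "mset xs = mset xs'" "mset ys = mset ys'" for xs ys xs' ys'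
    using hermite_product_cong[OF that, of Z] by (simp add: c_def)
  have bound: "(\<Sum>(us, vs)\<in>words E p \<times> words E q. (cmod (c us vs))\<^sup>2) \<le> L2_sq M F / d"
    if E: "finite E" "E \<subseteq> B" for E
  proof -
    define I where "I = words E p \<times> words E q"
    have sub: "I \<subseteq> words B p \<times> words B q" using E by (auto simp: words_def I_def)
    define X where "X = (\<lambda>\<omega>. \<Sum>i\<in>I. c (fst i) (snd i) * HP (fst i) (snd i) \<omega>)"
    define S where "S = (\<Sum>i\<in>I. (cmod (c (fst i) (snd i)))\<^sup>2)"
    have X: "X \<in> L2_space M" unfolding X_def using sum_HP_L2[OF sub, of c] by (simp add: case_prod_unfold)
    have sq: "L2_sq M X = d * S"
      using L2_sq_sym_sum_HP[OF sym E, where p = p and q = q] by (simp add: X_def I_def S_def d_def case_prod_unfold)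
    have "L2_inner M F X = (\<Sum>i\<in>I. L2_inner M F (\<lambda>\<omega>. c (fst i) (snd i) * HP (fst i) (snd i) \<omega>))"
      unfolding X_def using sub F by (intro L2_inner_sum_right L2_cmult HP_words_L2[of _ p _ q]) auto
    also have "\<dots> = (\<Sum>i\<in>I. complex_of_real (d * (cmod (c (fst i) (snd i)))\<^sup>2))"
    proof (intro sum.cong refl)
      fix i
      have "L2_inner M F (HP (fst i) (snd i)) = of_real d * c (fst i) (snd i)" using d by (simp add: c_def)
      then show "L2_inner M F (\<lambda>\<omega>. c (fst i) (snd i) * HP (fst i) (snd i) \<omega>) = complex_of_real (d * (cmod (c (fst i) (snd i)))\<^sup>2)"
        by (simp add: L2_inner_cmult_right complex_norm_square mult_ac del: of_real_power)
    qed
    also have "\<dots> = complex_of_real (d * S)" by (simp add: S_def sum_distrib_left)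
    finally have "L2_inner M F X = complex_of_real (d * S)" .
    \<comment> \<open>X is the orthogonal projection of F on the span of finitely many Hermite
      products: its pairing with F is its own squared norm d S.\<close>
    then have "L2_sq M (\<lambda>\<omega>. F \<omega> - X \<omega>) = L2_sq M F - d * S"
      unfolding L2_sq_diff[OF F X] sq by simp
    then have "d * S \<le> L2_sq M F" using L2_sq_nonneg[of M "\<lambda>\<omega>. F \<omega> - X \<omega>"] by linarith
    then have "S \<le> L2_sq M F / d" using d by (simp add: field_simps)
    then show ?thesis by (simp add: S_def I_def case_prod_unfold)
  qed
  obtain f X where "f \<in> bisymmetric p q"
    "\<And>xs ys. xs \<in> words B p \<Longrightarrow> ys \<in> words B q \<Longrightarrow> fock_eval f (xs @ map cconj ys) = c xs ys"
    using graph_exists[OF sym bound] by blast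
  moreover have "fact p * fact q * c xs ys = L2_inner M F (HP xs ys)" for xs ys
    by (simp add: c_def d_def)
  ultimately show ?thesis using that[of f] by simp
qed

section \<open>Means of Malliavin derivatives\<close>

lemma cylinder_deriv_L2:
  assumes f: "smooth_poly_growth k f"
  shows "cylinder_deriv Z k \<phi> f p q \<in> L2_space M"
  unfolding cylinder_deriv_def[abs_def]
proof (intro L2_sum)
  fix "is" js assume "is \<in> words {..<k} p" "js \<in> words {..<k} q"
  then have "smooth_poly_growth k (foldr wirtinger is (foldr wirtinger_bar js f))"
    by (intro smooth_foldr_wirtinger f) (auto simp: words_def)
  then have "(\<lambda>\<omega>. foldr wirtinger is (foldr wirtinger_bar js f) (\<lambda>i. Z (\<phi> i) \<omega>)) \<in> L2_space M"
    using smooth_moderate by (intro cylinder_functional_L2[of _ k]) (auto simp: moderate_def)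
  then show "(\<lambda>\<omega>. foldr wirtinger is (foldr wirtinger_bar js f) (\<lambda>i. Z (\<phi> i) \<omega>) *\<^sub>F
      pure_tensor (map \<phi> is @ map (\<lambda>j. cconj (\<phi> j)) js)) \<in> L2_space M"
    by (rule L2_bounded_linear[OF bounded_linear_fock_scale])
qed

lemma smooth_functional_L2:
  assumes "smooth_functional Z S T"
  shows "S \<in> L2_space M" "T p q \<in> L2_space M"
  using assms cylinder_deriv_L2 cylinder_functional_L2 smooth_moderate
  unfolding smooth_functional_def moderate_def by blast+

lemma smooth_functional_mean:
  assumes "smooth_functional Z S T"
  shows "xs \<in> words B p \<Longrightarrow> ys \<in> words B q \<Longrightarrow>
      expectation (\<lambda>\<omega>. fock_eval (T p q \<omega>) (xs @ map cconj ys)) = L2_inner M S (HP xs ys)"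
    and "length zs \<noteq> p + q \<Longrightarrow> fock_eval (T p q \<omega>) zs = 0"
proof -
  obtain k \<phi> f where f: "smooth_poly_growth k f" and S: "S = (\<lambda>\<omega>. f (\<lambda>i. Z (\<phi> i) \<omega>))" and T: "T = cylinder_deriv Z k \<phi> f"
    using assms unfolding smooth_functional_def by blast
  show "expectation (\<lambda>\<omega>. fock_eval (T p q \<omega>) (xs @ map cconj ys)) = L2_inner M S (HP xs ys)"
    if "xs \<in> words B p" "ys \<in> words B q"
    unfolding S T using that by (intro expectation_cylinder_deriv[OF orthonormal f]) (auto simp: words_def)
  show "fock_eval (T p q \<omega>) zs = 0" if "length zs \<noteq> p + q"
    using that unfolding T cylinder_deriv_def
    by (auto simp: pure_tensor.rep_eq words_def intro!: sum.neutral eltensor_length)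
qed

lemma expectation_fock_eval:
  assumes "G \<in> L2_space M"
  shows "expectation (\<lambda>\<omega>. fock_eval (G \<omega>) zs) = fock_eval (expectation G) zs"
  by (rule integral_bounded_linear[OF bounded_linear_fock_eval L2_integrable[OF assms]])

text \<open>Expectation is a contraction from L1, and on a probability space the L2 distance bounds
  the L1 distance.\<close>

lemma expectation_fock_tendsto:
  fixes T :: "nat \<Rightarrow> 'w \<Rightarrow> 'h fock"
  assumes T: "\<And>l. T l \<in> L2_space M" and G: "G \<in> L2_space M" and lim: "L2_tendsto M T G sequentially"
  shows "(\<lambda>l. expectation (T l)) \<longlonglongrightarrow> expectation G"
proof -
  have "(\<lambda>l. L2_sq M (\<lambda>\<omega>. T l \<omega> - G \<omega>)) \<longlonglongrightarrow> 0"
    using lim L2_tendsto_iff[of T M sequentially G] T G by simp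
  then have "(\<lambda>l. sqrt (L2_sq M (\<lambda>\<omega>. T l \<omega> - G \<omega>))) \<longlonglongrightarrow> sqrt 0" by (rule tendsto_real_sqrt)
  then have 1: "(\<lambda>l. sqrt (L2_sq M (\<lambda>\<omega>. T l \<omega> - G \<omega>))) \<longlonglongrightarrow> 0" by simp
  have 2: "norm (expectation (T l) - expectation G) \<le> sqrt (L2_sq M (\<lambda>\<omega>. T l \<omega> - G \<omega>))" for l
  proof -
    have "expectation (T l) - expectation G = expectation (\<lambda>\<omega>. T l \<omega> - G \<omega>)"
      using L2_integrable[OF T] L2_integrable[OF G] by simp
    then have "norm (expectation (T l) - expectation G) \<le> expectation (\<lambda>\<omega>. norm (T l \<omega> - G \<omega>))"
      by simp
    also have "\<dots> \<le> sqrt (L2_sq M (\<lambda>\<omega>. T l \<omega> - G \<omega>))" by (rule integral_power2_le[OF L2_diff[OF T G]])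
    finally show ?thesis .
  qed
  show ?thesis
    by (rule LIM_zero_cancel[OF Lim_null_comparison[OF always_eventually[OF allI[OF 2]] 1]])
qed

text \<open>Only the mean of the derivative enters, and it is a continuous functional of F: closability of
  the derivatives is not needed.\<close>

lemma malliavin_graph_mean:
  assumes "malliavin_graph M Z p q F G"
  shows "xs \<in> words B p \<Longrightarrow> ys \<in> words B q \<Longrightarrow> fock_eval (expectation G) (xs @ map cconj ys) = L2_inner M F (HP xs ys)"
    and "length zs \<noteq> p + q \<Longrightarrow> fock_eval (expectation G) zs = 0"
proof -
  obtain S T where F: "F \<in> L2_space M" and G: "G \<in> L2_space M" and ST: "\<And>l::nat. smooth_functional Z (S l) (T l)"
    and S: "L2_tendsto M S F sequentially" and T: "L2_tendsto M (\<lambda>l. T l p q) G sequentially"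
    using assms unfolding malliavin_graph_def by blast
  note L = smooth_functional_L2[OF ST]
  have lim: "(\<lambda>l. fock_eval (expectation (T l p q)) zs) \<longlonglongrightarrow> fock_eval (expectation G) zs" for zs
    by (intro tendsto_fock_eval expectation_fock_tendsto[OF L(2) G T])
  show "fock_eval (expectation G) (xs @ map cconj ys) = L2_inner M F (HP xs ys)"
    if xs: "xs \<in> words B p" "ys \<in> words B q"
  proof (rule LIMSEQ_unique[OF lim])
    have "(\<lambda>l. L2_inner M (S l) (HP xs ys)) \<longlonglongrightarrow> L2_inner M F (HP xs ys)"
      using L(1) by (intro L2_inner_tendsto[OF _ F HP_words_L2[OF xs] S]) simp
    then show "(\<lambda>l. fock_eval (expectation (T l p q)) (xs @ map cconj ys)) \<longlonglongrightarrow> L2_inner M F (HP xs ys)"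
      by (simp add: expectation_fock_eval[OF L(2), symmetric] smooth_functional_mean(1)[OF ST xs])
  qed
  show "fock_eval (expectation G) zs = 0" if "length zs \<noteq> p + q"
  proof (rule LIMSEQ_unique[OF lim])
    show "(\<lambda>l. fock_eval (expectation (T l p q)) zs) \<longlonglongrightarrow> 0"
      by (simp add: expectation_fock_eval[OF L(2), symmetric] smooth_functional_mean(2)[OF ST that])
  qed
qed

text \<open>Each square distance is one summand of the Sobolev norm, so the sequence approximating F
  in that norm also witnesses the graph of the single derivative of order (p, q), and the choice is
  justified.\<close>

lemma sobolev_malliavin_graph:
  assumes F: "F \<in> sobolev_space M Z m n" and "p \<le> m" "q \<le> n"
  shows "malliavin_graph M Z p q F (malliavin M Z p q F)"
proof -
  obtain S T G where FL: "F \<in> L2_space M" and ST: "\<And>l::nat. smooth_functional Z (S l) (T l)"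
    and G: "\<And>i j. i \<le> m \<Longrightarrow> j \<le> n \<Longrightarrow> G i j \<in> L2_space M" and S: "L2_tendsto M S F sequentially"
    and sob: "(\<lambda>l. sobolev_norm M m n (\<lambda>i j \<omega>. T l i j \<omega> - G i j \<omega>)) \<longlonglongrightarrow> 0"
    using F unfolding sobolev_space_def by blast
  note L = smooth_functional_L2[OF ST]
  have G': "G p q \<in> L2_space M" using G assms by blast
  have le: "sqrt (L2_sq M (\<lambda>\<omega>. T l p q \<omega> - G p q \<omega>)) \<le> sobolev_norm M m n (\<lambda>i j \<omega>. T l i j \<omega> - G i j \<omega>)" for l
  proof -
    have "L2_sq M (\<lambda>\<omega>. T l p q \<omega> - G p q \<omega>) \<le> (\<Sum>j\<le>n. L2_sq M (\<lambda>\<omega>. T l p j \<omega> - G p j \<omega>))"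
      using assms(3) by (intro member_le_sum[of q "{..n}" "\<lambda>j. L2_sq M (\<lambda>\<omega>. T l p j \<omega> - G p j \<omega>)"]) auto
    also have "\<dots> \<le> (\<Sum>i\<le>m. \<Sum>j\<le>n. L2_sq M (\<lambda>\<omega>. T l i j \<omega> - G i j \<omega>))"
      using assms(2) by (intro member_le_sum[of p "{..m}" "\<lambda>i. \<Sum>j\<le>n. L2_sq M (\<lambda>\<omega>. T l i j \<omega> - G i j \<omega>)"]) (auto intro: sum_nonneg)
    finally show ?thesis unfolding sobolev_norm_def L2_sq_def by (rule real_sqrt_le_mono)
  qed
  have "(\<lambda>l. sqrt (L2_sq M (\<lambda>\<omega>. T l p q \<omega> - G p q \<omega>))) \<longlonglongrightarrow> 0"
    by (rule tendsto_sandwich[OF _ _ tendsto_const sob]) (use le in auto)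
  then have "(\<lambda>l. (sqrt (L2_sq M (\<lambda>\<omega>. T l p q \<omega> - G p q \<omega>)))\<^sup>2) \<longlonglongrightarrow> 0\<^sup>2" by (rule tendsto_power)
  then have "(\<lambda>l. L2_sq M (\<lambda>\<omega>. T l p q \<omega> - G p q \<omega>)) \<longlonglongrightarrow> 0" by simp
  then have "L2_tendsto M (\<lambda>l. T l p q) (G p q) sequentially"
    using L2_tendsto_iff[of "\<lambda>l. T l p q" M sequentially "G p q"] L(2) G' by simp
  then have "malliavin_graph M Z p q F (G p q)"
    unfolding malliavin_graph_def using FL G' ST S by blast
  then show ?thesis unfolding malliavin_def by (rule someI[where P = "malliavin_graph M Z p q F"])
qed

end

section \<open>Totality of the Hermite products\<close>

lemma L2_cong_AE:
  assumes "X \<in> L2_space M" "AE \<omega> in M. X \<omega> = Y \<omega>" "Y \<in> borel_measurable M"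
  shows "Y \<in> L2_space M"
proof (rule L2_spaceI[OF assms(3)])
  note [measurable] = L2_spaceD(1)[OF assms(1)] assms(3)
  have "AE \<omega> in M. (norm (X \<omega>))\<^sup>2 = (norm (Y \<omega>))\<^sup>2" using assms(2) by eventually_elim simp
  from integrable_cong_AE_imp[OF L2_spaceD(2)[OF assms(1)] _ this]
  show "integrable M (\<lambda>\<omega>. (norm (Y \<omega>))\<^sup>2)" by simp
qed

lemma L2_inner_cong_AE_right:
  assumes "R \<in> L2_space M" "X \<in> L2_space M" "AE \<omega> in M. X \<omega> = Y \<omega>" "Y \<in> borel_measurable M"
  shows "L2_inner M R X = L2_inner M R Y"
proof -
  note [measurable] = L2_spaceD(1)[OF assms(1)] L2_spaceD(1)[OF assms(2)] assms(4)
  have "AE \<omega> in M. R \<omega> * cnj (X \<omega>) = R \<omega> * cnj (Y \<omega>)" using assms(3) by eventually_elim simp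
  then show ?thesis unfolding L2_inner_def by (intro integral_cong_AE) simp_all
qed

text \<open>Vanishing integrals over all sets of N mean that the conditional expectations of the
  real and imaginary parts of R given N are 0; the N-measurable factor F passes through
  them.\<close>

lemma (in prob_space) orthogonal_subalgebra:
  fixes R F :: "'a \<Rightarrow> complex"
  assumes N: "subalgebra M N" and R: "R \<in> L2_space M" and F: "F \<in> L2_space M" "F \<in> borel_measurable N"
    and zero: "\<And>E. E \<in> sets N \<Longrightarrow> (\<integral>\<omega>. R \<omega> * indicator E \<omega> \<partial>M) = 0"
  shows "(\<integral>\<omega>. R \<omega> * F \<omega> \<partial>M) = 0"
proof -
  interpret finite_measure_subalgebra M N by unfold_locales (rule N)
  have sets: "E \<in> sets N \<Longrightarrow> E \<in> sets M" for E using N by (auto simp: subalgebra_def)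
  have intR: "integrable M R" by (rule L2_integrable[OF R])
  have intE: "integrable M (\<lambda>\<omega>. R \<omega> * indicator E \<omega>)" if "E \<in> sets M" for E
    by (rule Bochner_Integration.integrable_bound[OF intR])
      (use intR that in \<open>auto simp: norm_mult split: split_indicator\<close>)
  have L2r: "(\<lambda>\<omega>. complex_of_real (\<phi> (X \<omega>))) \<in> L2_space M" if "X \<in> L2_space M" "\<phi> \<in> {Re, Im}" for X \<phi>
  proof (rule L2_spaceI)
    note [measurable] = L2_spaceD(1)[OF that(1)]
    show "(\<lambda>\<omega>. complex_of_real (\<phi> (X \<omega>))) \<in> borel_measurable M" using that(2) by auto
    show "integrable M (\<lambda>\<omega>. (norm (complex_of_real (\<phi> (X \<omega>))))\<^sup>2)"
      by (rule Bochner_Integration.integrable_bound[OF L2_spaceD(2)[OF that(1)]])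
        (use that(2) in \<open>auto simp: cmod_power2\<close>)
  qed
  have intp: "integrable M (\<lambda>\<omega>. \<psi> (F \<omega>) * \<phi> (R \<omega>))" if "\<phi> \<in> {Re, Im}" "\<psi> \<in> {Re, Im}" for \<phi> \<psi>
    using integrable_Re[OF L2_integrable_mult[OF L2r[OF F(1) that(2)] L2r[OF R that(1)]]] by simp
  \<comment> \<open>Conditional expectation is real valued, so the complex product is treated as
    four products of real and imaginary parts.\<close>
  have key: "(\<integral>\<omega>. \<psi> (F \<omega>) * \<phi> (R \<omega>) \<partial>M) = 0" if \<phi>: "\<phi> \<in> {Re, Im}" and \<psi>: "\<psi> \<in> {Re, Im}" for \<phi> \<psi>
  proof -
    have int\<phi>: "integrable M (\<lambda>\<omega>. \<phi> (R \<omega>))" using intR \<phi> by auto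
    have "AE \<omega> in M. real_cond_exp M N (\<lambda>\<omega>. \<phi> (R \<omega>)) \<omega> = 0"
    proof (rule real_cond_exp_charact)
      fix E assume E: "E \<in> sets N"
      have "(LINT \<omega>:E|M. \<phi> (R \<omega>)) = (\<integral>\<omega>. \<phi> (R \<omega> * indicator E \<omega>) \<partial>M)"
        unfolding set_lebesgue_integral_def
        by (intro Bochner_Integration.integral_cong refl) (use \<phi> in \<open>auto split: split_indicator\<close>)
      also have "\<dots> = \<phi> (\<integral>\<omega>. R \<omega> * indicator E \<omega> \<partial>M)"
        using \<phi> integral_Re[OF intE[OF sets[OF E]]] integral_Im[OF intE[OF sets[OF E]]] by blast
      also have "\<dots> = 0" using zero[OF E] \<phi> by auto
      finally show "(LINT \<omega>:E|M. \<phi> (R \<omega>)) = (LINT \<omega>:E|M. 0)" by simp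
    qed (use int\<phi> in auto)
    moreover have [measurable]: "(\<lambda>\<omega>. \<psi> (F \<omega>)) \<in> borel_measurable N" using F(2) \<psi> by auto
    then have "(\<integral>\<omega>. \<psi> (F \<omega>) * real_cond_exp M N (\<lambda>\<omega>. \<phi> (R \<omega>)) \<omega> \<partial>M) = (\<integral>\<omega>. \<psi> (F \<omega>) * \<phi> (R \<omega>) \<partial>M)"
      using intp[OF \<phi> \<psi>] int\<phi> by (intro real_cond_exp_intg(2)) auto
    moreover have "(\<integral>\<omega>. \<psi> (F \<omega>) * real_cond_exp M N (\<lambda>\<omega>. \<phi> (R \<omega>)) \<omega> \<partial>M) = 0"
      by (rule integral_eq_zero_AE) (use calculation(1) in \<open>auto elim: eventually_mono\<close>)
    ultimately show ?thesis by simp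
  qed
  have int: "integrable M (\<lambda>\<omega>. R \<omega> * F \<omega>)" by (rule L2_integrable_mult[OF R F(1)])
  have "Re (\<integral>\<omega>. R \<omega> * F \<omega> \<partial>M) = (\<integral>\<omega>. Re (F \<omega>) * Re (R \<omega>) - Im (F \<omega>) * Im (R \<omega>) \<partial>M)"
    unfolding integral_Re[OF int, symmetric] by (simp add: mult.commute)
  also have "\<dots> = 0" using intp key by (subst Bochner_Integration.integral_diff) auto
  finally have 1: "Re (\<integral>\<omega>. R \<omega> * F \<omega> \<partial>M) = 0" .
  have "Im (\<integral>\<omega>. R \<omega> * F \<omega> \<partial>M) = (\<integral>\<omega>. Im (F \<omega>) * Re (R \<omega>) + Re (F \<omega>) * Im (R \<omega>) \<partial>M)"
    unfolding integral_Im[OF int, symmetric] by (simp add: mult.commute add.commute)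
  also have "\<dots> = 0" using intp key by (subst Bochner_Integration.integral_add) auto
  finally show ?thesis using 1 by (simp add: complex_eq_iff)
qed

lemma iexp_partial_sum_bound: "cmod (\<Sum>n<N. (\<i> * complex_of_real x) ^ n / fact n) \<le> exp \<bar>x\<bar>"
proof -
  have "cmod (\<Sum>n<N. (\<i> * complex_of_real x) ^ n / fact n) \<le> (\<Sum>n<N. \<bar>x\<bar> ^ n /\<^sub>R fact n)"
    by (rule order_trans[OF norm_sum], intro sum_mono)
      (simp add: norm_mult norm_divide norm_power power_mult_distrib divide_inverse norm_inverse norm_fact mult.commute)
  also have "\<dots> \<le> exp \<bar>x\<bar>"
    unfolding exp_def by (intro sum_le_suminf summable_exp_generic) auto
  finally show ?thesis .
qed

lemma iexp_diff_bound: "cmod (iexp a - iexp b) \<le> \<bar>a - b\<bar>"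
proof -
  have "iexp a - iexp b = iexp b * (iexp (a - b) - 1)"
    by (simp add: right_diff_distrib exp_add[symmetric])
  moreover have "cmod (iexp (a - b) - 1) \<le> \<bar>a - b\<bar>" using iexp_approx1[of "a - b" 0] by simp
  ultimately show ?thesis by (simp add: norm_mult)
qed

section \<open>From orthogonality to Hermite products to orthogonality to the sigma algebra\<close>

context isonormal_basis
begin

text \<open>Multiplication by W h, for h in the span of the basis, preserves the span of the Hermite products.
  The predicate below is a form of orthogonality to R that is inherited under such multiplications.\<close>

context
  fixes R :: "'w \<Rightarrow> complex"
  assumes R: "R \<in> L2_space M"
    and orth: "\<And>xs ys. set xs \<subseteq> B \<Longrightarrow> set ys \<subseteq> B \<Longrightarrow> L2_inner M R (HP xs ys) = 0"
begin

definition orth_multiples :: "('w \<Rightarrow> complex) \<Rightarrow> bool"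
  where "orth_multiples G \<longleftrightarrow> G \<in> borel_measurable M \<and> (\<forall>xs ys. set xs \<subseteq> B \<longrightarrow> set ys \<subseteq> B \<longrightarrow>
    (\<lambda>\<omega>. G \<omega> * HP xs ys \<omega>) \<in> L2_space M \<and> L2_inner M R (\<lambda>\<omega>. G \<omega> * HP xs ys \<omega>) = 0)"

lemma orth_multiplesD:
  assumes "orth_multiples G" "set xs \<subseteq> B" "set ys \<subseteq> B"
  shows "(\<lambda>\<omega>. G \<omega> * HP xs ys \<omega>) \<in> L2_space M" "L2_inner M R (\<lambda>\<omega>. G \<omega> * HP xs ys \<omega>) = 0"
  using assms unfolding orth_multiples_def by blast+

lemma orth_multiples_measurable: "orth_multiples G \<Longrightarrow> G \<in> borel_measurable M"
  by (simp add: orth_multiples_def)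

lemma orth_multiples_one: "orth_multiples (\<lambda>\<omega>. 1)"
  using orth HP_L2[OF orthonormal] by (simp add: orth_multiples_def)

text \<open>Linearity of W holds almost surely, so the class must be stable under change of
  version.\<close>

lemma orth_multiples_cong:
  assumes G: "orth_multiples G" and ae: "AE \<omega> in M. G \<omega> = G' \<omega>" and G': "G' \<in> borel_measurable M"
  shows "orth_multiples G'"
  unfolding orth_multiples_def
proof (intro conjI allI impI G')
  fix xs ys assume xs: "set xs \<subseteq> B" "set ys \<subseteq> B"
  note [measurable] = G' L2_spaceD(1)[OF HP_L2[OF orthonormal xs]]
  have ae': "AE \<omega> in M. G \<omega> * HP xs ys \<omega> = G' \<omega> * HP xs ys \<omega>" using ae by eventually_elim simp
  have m: "(\<lambda>\<omega>. G' \<omega> * HP xs ys \<omega>) \<in> borel_measurable M" by measurable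
  show "(\<lambda>\<omega>. G' \<omega> * HP xs ys \<omega>) \<in> L2_space M"
    by (rule L2_cong_AE[OF orth_multiplesD(1)[OF G xs] ae' m])
  show "L2_inner M R (\<lambda>\<omega>. G' \<omega> * HP xs ys \<omega>) = 0"
    using L2_inner_cong_AE_right[OF R orth_multiplesD(1)[OF G xs] ae' m] orth_multiplesD(2)[OF G xs] by simp
qed

lemma orth_multiples_add:
  assumes "orth_multiples G" "orth_multiples G'"
  shows "orth_multiples (\<lambda>\<omega>. G \<omega> + G' \<omega>)"
  unfolding orth_multiples_def
proof (intro conjI allI impI)
  show "(\<lambda>\<omega>. G \<omega> + G' \<omega>) \<in> borel_measurable M"
    using assms[THEN orth_multiples_measurable] by measurable
  fix xs ys assume xs: "set xs \<subseteq> B" "set ys \<subseteq> B"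
  note D = orth_multiplesD[OF assms(1) xs] orth_multiplesD[OF assms(2) xs]
  show "(\<lambda>\<omega>. (G \<omega> + G' \<omega>) * HP xs ys \<omega>) \<in> L2_space M"
    unfolding distrib_right by (rule L2_add[OF D(1,3)])
  show "L2_inner M R (\<lambda>\<omega>. (G \<omega> + G' \<omega>) * HP xs ys \<omega>) = 0"
    unfolding distrib_right L2_inner_add_right[OF D(1,3) R] D by simp
qed

lemma orth_multiples_cmult:
  assumes "orth_multiples G"
  shows "orth_multiples (\<lambda>\<omega>. c * G \<omega>)"
  unfolding orth_multiples_def
proof (intro conjI allI impI)
  show "(\<lambda>\<omega>. c * G \<omega>) \<in> borel_measurable M"
    using assms[THEN orth_multiples_measurable] by measurable
  fix xs ys assume xs: "set xs \<subseteq> B" "set ys \<subseteq> B"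
  note D = orth_multiplesD[OF assms(1) xs]
  show "(\<lambda>\<omega>. c * G \<omega> * HP xs ys \<omega>) \<in> L2_space M"
    unfolding mult.assoc by (rule L2_cmult[OF D(1)])
  show "L2_inner M R (\<lambda>\<omega>. c * G \<omega> * HP xs ys \<omega>) = 0"
    unfolding mult.assoc L2_inner_cmult_right D by simp
qed

text \<open>The creation recursion, solved for the product with Z b, expresses it by two further
  Hermite products.\<close>

lemma orth_multiples_Z:
  assumes G: "orth_multiples G" and b: "b \<in> B"
  shows "orth_multiples (\<lambda>\<omega>. Z b \<omega> * G \<omega>)"
  unfolding orth_multiples_def
proof (intro conjI allI impI)
  show "(\<lambda>\<omega>. Z b \<omega> * G \<omega>) \<in> borel_measurable M"
    using G[THEN orth_multiples_measurable] by measurable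
  fix xs ys assume xs: "set xs \<subseteq> B" "set ys \<subseteq> B"
  have xs': "set (b # xs) \<subseteq> B" "set (remove1 b ys) \<subseteq> B" using xs b set_remove1_subset[of b ys] by auto
  note D = orth_multiplesD[OF G xs'(1) xs(2)] orth_multiplesD[OF G xs(1) xs'(2)]
  have eq: "(\<lambda>\<omega>. Z b \<omega> * G \<omega> * HP xs ys \<omega>)
      = (\<lambda>\<omega>. G \<omega> * HP (b # xs) ys \<omega> + of_nat (count_list ys b) * (G \<omega> * HP xs (remove1 b ys) \<omega>))"
    by (rule ext) (simp add: hermite_product_Cons_left algebra_simps)
  show "(\<lambda>\<omega>. Z b \<omega> * G \<omega> * HP xs ys \<omega>) \<in> L2_space M"
    unfolding eq by (rule L2_add[OF D(1) L2_cmult[OF D(3)]])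
  show "L2_inner M R (\<lambda>\<omega>. Z b \<omega> * G \<omega> * HP xs ys \<omega>) = 0"
    unfolding eq L2_inner_add_right[OF D(1) L2_cmult[OF D(3)] R] L2_inner_cmult_right D by simp
qed

lemma orth_multiples_cnj_Z:
  assumes G: "orth_multiples G" and b: "b \<in> B"
  shows "orth_multiples (\<lambda>\<omega>. cnj (Z b \<omega>) * G \<omega>)"
  unfolding orth_multiples_def
proof (intro conjI allI impI)
  show "(\<lambda>\<omega>. cnj (Z b \<omega>) * G \<omega>) \<in> borel_measurable M"
    using G[THEN orth_multiples_measurable] by measurable
  fix xs ys assume xs: "set xs \<subseteq> B" "set ys \<subseteq> B"
  have xs': "set (remove1 b xs) \<subseteq> B" "set (b # ys) \<subseteq> B" using xs b set_remove1_subset[of b xs] by auto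
  note D = orth_multiplesD[OF G xs(1) xs'(2)] orth_multiplesD[OF G xs'(1) xs(2)]
  have eq: "(\<lambda>\<omega>. cnj (Z b \<omega>) * G \<omega> * HP xs ys \<omega>)
      = (\<lambda>\<omega>. G \<omega> * HP xs (b # ys) \<omega> + of_nat (count_list xs b) * (G \<omega> * HP (remove1 b xs) ys \<omega>))"
    by (rule ext) (simp add: hermite_product_Cons_right algebra_simps)
  show "(\<lambda>\<omega>. cnj (Z b \<omega>) * G \<omega> * HP xs ys \<omega>) \<in> L2_space M"
    unfolding eq by (rule L2_add[OF D(1) L2_cmult[OF D(3)]])
  show "L2_inner M R (\<lambda>\<omega>. cnj (Z b \<omega>) * G \<omega> * HP xs ys \<omega>) = 0"
    unfolding eq L2_inner_add_right[OF D(1) L2_cmult[OF D(3)] R] L2_inner_cmult_right D by simp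
qed

lemma orth_multiples_W:
  assumes h: "h \<in> span (B \<union> (\<lambda>b. \<i> *\<^sub>C b) ` B)" and G: "orth_multiples G"
  shows "orth_multiples (\<lambda>\<omega>. of_real (W h \<omega>) * G \<omega>)"
proof -
  have [measurable]: "G \<in> borel_measurable M" by (rule orth_multiples_measurable[OF G])
  \<comment> \<open>W of a multiple of b is half the sum of c Z b and its conjugate, so both
    multiplication rules are used.\<close>
  have Re_Z: "orth_multiples (\<lambda>\<omega>. of_real (W (c *\<^sub>C b) \<omega>) * G \<omega>)" if b: "b \<in> B" for b c
  proof (rule orth_multiples_cong)
    show "orth_multiples (\<lambda>\<omega>. (c / 2) * (Z b \<omega> * G \<omega>) + (cnj c / 2) * (cnj (Z b \<omega>) * G \<omega>))"
      by (intro orth_multiples_add orth_multiples_cmult orth_multiples_Z orth_multiples_cnj_Z G b)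
    show "AE \<omega> in M. (c / 2) * (Z b \<omega> * G \<omega>) + (cnj c / 2) * (cnj (Z b \<omega>) * G \<omega>) = of_real (W (c *\<^sub>C b) \<omega>) * G \<omega>"
      using Z_scale[of c b]
    proof eventually_elim
      case (elim \<omega>)
      have "complex_of_real (W (c *\<^sub>C b) \<omega>) = (c * Z b \<omega> + cnj (c * Z b \<omega>)) / 2"
        unfolding W_def elim complex_add_cnj by simp
      then show ?case by (simp add: field_simps)
    qed
  qed measurable
  show ?thesis
    using h
  proof (induction h rule: span_induct_alt)
    case base
    show ?case
    proof (rule orth_multiples_cong)
      show "orth_multiples (\<lambda>\<omega>. 0 * G \<omega>)" by (rule orth_multiples_cmult[OF G])
      show "AE \<omega> in M. 0 * G \<omega> = of_real (W 0 \<omega>) * G \<omega>" using W_zero by eventually_elim simp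
    qed measurable
  next
    case (step r x y)
    have "orth_multiples (\<lambda>\<omega>. of_real (W x \<omega>) * G \<omega>)"
      using step(1) Re_Z[of x 1] Re_Z[of _ \<i>] by (elim UnE imageE) (simp_all add: cscale_simps)
    then have *: "orth_multiples (\<lambda>\<omega>. of_real (W y \<omega>) * G \<omega> + of_real r * (of_real (W x \<omega>) * G \<omega>))"
      by (intro orth_multiples_add orth_multiples_cmult step(2))
    show ?case
    proof (rule orth_multiples_cong[OF *])
      show "AE \<omega> in M. of_real (W y \<omega>) * G \<omega> + of_real r * (of_real (W x \<omega>) * G \<omega>) = of_real (W (r *\<^sub>R x + y) \<omega>) * G \<omega>"
        using W_linear[of y r x] by eventually_elim (simp add: algebra_simps)
    qed measurable
  qed
qed

lemma orth_W_power:
  assumes h: "h \<in> span (B \<union> (\<lambda>b. \<i> *\<^sub>C b) ` B)"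
  shows "(\<integral>\<omega>. R \<omega> * of_real (W h \<omega>) ^ n \<partial>M) = 0"
proof -
  have "orth_multiples (\<lambda>\<omega>. of_real (W h \<omega>) ^ n)"
    by (induction n) (use orth_multiples_one orth_multiples_W[OF h] in simp_all)
  from orth_multiplesD(2)[OF this, of "[]" "[]"] show ?thesis by (simp add: L2_inner_def)
qed

text \<open>All powers of W h are orthogonal to R. The exponential series may be integrated term by
  term because its partial sums are dominated by exp of the absolute value of W h, which is square
  integrable like R.\<close>

lemma orth_iexp_span:
  assumes h: "h \<in> span (B \<union> (\<lambda>b. \<i> *\<^sub>C b) ` B)"
  shows "(\<integral>\<omega>. R \<omega> * iexp (W h \<omega>) \<partial>M) = 0"
proof -
  note [measurable] = L2_spaceD(1)[OF R]
  define s where "s N \<omega> = R \<omega> * (\<Sum>n<N. (\<i> * complex_of_real (W h \<omega>)) ^ n / fact n)" for N :: nat and \<omega>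
  have exp_L2: "(\<lambda>\<omega>. complex_of_real (exp \<bar>W h \<omega>\<bar>)) \<in> L2_space M"
  proof (rule L2_spaceI)
    show "integrable M (\<lambda>\<omega>. (norm (complex_of_real (exp \<bar>W h \<omega>\<bar>)))\<^sup>2)"
      using W_exp_abs_integrable[of 2 h] by (simp add: power2_eq_square exp_add[symmetric])
  qed measurable
  have pow_L2: "(\<lambda>\<omega>. complex_of_real (W h \<omega>) ^ n) \<in> L2_space M" for n
  proof (rule L2_spaceI)
    show "integrable M (\<lambda>\<omega>. (norm (complex_of_real (W h \<omega>) ^ n))\<^sup>2)"
      using W_power_integrable[of h "n * 2"] by (simp add: norm_power power_mult)
  qed measurable
  have "(\<lambda>N. \<integral>\<omega>. s N \<omega> \<partial>M) \<longlonglongrightarrow> (\<integral>\<omega>. R \<omega> * iexp (W h \<omega>) \<partial>M)"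
  proof (rule integral_dominated_convergence)
    show "(\<lambda>\<omega>. R \<omega> * iexp (W h \<omega>)) \<in> borel_measurable M" by measurable
    show "s N \<in> borel_measurable M" for N unfolding s_def[abs_def] by measurable
    show "integrable M (\<lambda>\<omega>. cmod (R \<omega> * complex_of_real (exp \<bar>W h \<omega>\<bar>)))"
      by (intro integrable_norm L2_integrable_mult R exp_L2)
    show "AE \<omega> in M. (\<lambda>N. s N \<omega>) \<longlonglongrightarrow> R \<omega> * iexp (W h \<omega>)"
    proof (intro AE_I2 allI)
      fix \<omega>
      have "(\<lambda>n. (\<i> * complex_of_real (W h \<omega>)) ^ n / fact n) sums iexp (W h \<omega>)"
        using exp_converges[of "\<i> * complex_of_real (W h \<omega>)"] by (simp add: scaleR_conv_of_real divide_inverse mult.commute)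
      then show "(\<lambda>N. s N \<omega>) \<longlonglongrightarrow> R \<omega> * iexp (W h \<omega>)"
        unfolding s_def sums_def by (intro tendsto_mult tendsto_const)
    qed
    show "AE \<omega> in M. norm (s N \<omega>) \<le> cmod (R \<omega> * complex_of_real (exp \<bar>W h \<omega>\<bar>))" for N
      unfolding s_def norm_mult using iexp_partial_sum_bound by (intro AE_I2 mult_left_mono) auto
  qed
  moreover have "(\<integral>\<omega>. s N \<omega> \<partial>M) = 0" for N
  proof -
    have int: "integrable M (\<lambda>\<omega>. (\<i> ^ n / fact n) * (R \<omega> * complex_of_real (W h \<omega>) ^ n))" for n
      by (intro integrable_mult_right L2_integrable_mult R pow_L2)
    have "(\<integral>\<omega>. s N \<omega> \<partial>M) = (\<integral>\<omega>. (\<Sum>n<N. (\<i> ^ n / fact n) * (R \<omega> * complex_of_real (W h \<omega>) ^ n)) \<partial>M)"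
      unfolding s_def by (intro Bochner_Integration.integral_cong refl)
        (simp add: sum_distrib_left power_mult_distrib mult_ac)
    also have "\<dots> = (\<Sum>n<N. \<integral>\<omega>. (\<i> ^ n / fact n) * (R \<omega> * complex_of_real (W h \<omega>) ^ n) \<partial>M)"
      by (rule Bochner_Integration.integral_sum) (rule int)
    also have "\<dots> = 0" by (simp add: orth_W_power[OF h])
    finally show ?thesis .
  qed
  ultimately show ?thesis by (simp add: LIMSEQ_const_iff)
qed

text \<open>The span is dense and the character depends continuously on h in mean square: exp (i t)
  is 1-Lipschitz, and W (u - h) has norm |u - h| / sqrt 2 in L2.\<close>

lemma orth_iexp: "(\<integral>\<omega>. R \<omega> * iexp (W h \<omega>) \<partial>M) = 0"
proof -
  note [measurable] = L2_spaceD(1)[OF R]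
  have "h \<in> closure (span (B \<union> (\<lambda>b. \<i> *\<^sub>C b) ` B))" using basis by (simp add: orthonormal_basis_def)
  then obtain u where u: "\<And>l. u l \<in> span (B \<union> (\<lambda>b. \<i> *\<^sub>C b) ` B)" "u \<longlonglongrightarrow> h"
    unfolding closure_sequential by blast
  have int: "integrable M (\<lambda>\<omega>. R \<omega> * iexp (W g \<omega>))" for g
    by (rule Bochner_Integration.integrable_bound[OF L2_integrable[OF R]]) (auto simp: norm_mult)
  have WL2: "(\<lambda>\<omega>. complex_of_real (W g \<omega>)) \<in> L2_space M" for g
    using W_power_integrable[of g 2] by (intro L2_spaceI) auto
  have le: "cmod (\<integral>\<omega>. R \<omega> * iexp (W h \<omega>) \<partial>M) \<le> sqrt (L2_sq M R) * sqrt ((norm (u l - h))\<^sup>2 / 2)" for l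
  proof -
    have "(\<integral>\<omega>. R \<omega> * iexp (W h \<omega>) \<partial>M) = (\<integral>\<omega>. R \<omega> * iexp (W h \<omega>) \<partial>M) - (\<integral>\<omega>. R \<omega> * iexp (W (u l) \<omega>) \<partial>M)"
      by (simp add: orth_iexp_span[OF u(1)])
    also have "\<dots> = (\<integral>\<omega>. R \<omega> * (iexp (W h \<omega>) - iexp (W (u l) \<omega>)) \<partial>M)"
      using int by (simp add: right_diff_distrib)
    finally have "cmod (\<integral>\<omega>. R \<omega> * iexp (W h \<omega>) \<partial>M) \<le> (\<integral>\<omega>. cmod (R \<omega> * (iexp (W h \<omega>) - iexp (W (u l) \<omega>))) \<partial>M)"
      by simp
    also have "\<dots> \<le> (\<integral>\<omega>. cmod (R \<omega> * of_real (W (u l - h) \<omega>)) \<partial>M)"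
    proof (rule integral_mono_AE)
      show "integrable M (\<lambda>\<omega>. cmod (R \<omega> * (iexp (W h \<omega>) - iexp (W (u l) \<omega>))))"
        using int unfolding right_diff_distrib by (intro integrable_norm Bochner_Integration.integrable_diff)
      show "integrable M (\<lambda>\<omega>. cmod (R \<omega> * of_real (W (u l - h) \<omega>)))"
        by (intro integrable_norm L2_integrable_mult R WL2)
      show "AE \<omega> in M. cmod (R \<omega> * (iexp (W h \<omega>) - iexp (W (u l) \<omega>))) \<le> cmod (R \<omega> * of_real (W (u l - h) \<omega>))"
        using W_linear[of "u l" "-1" h]
      proof eventually_elim
        case (elim \<omega>)
        have "cmod (iexp (W h \<omega>) - iexp (W (u l) \<omega>)) \<le> \<bar>W h \<omega> - W (u l) \<omega>\<bar>" by (rule iexp_diff_bound)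
        also have "\<dots> = \<bar>W (u l - h) \<omega>\<bar>" using elim by simp
        finally show ?case unfolding norm_mult by (intro mult_left_mono) auto
      qed
    qed
    also have "\<dots> = Re (L2_inner M (\<lambda>\<omega>. of_real (cmod (R \<omega>))) (\<lambda>\<omega>. of_real \<bar>W (u l - h) \<omega>\<bar>))"
      by (simp add: L2_inner_def norm_mult flip: of_real_mult)
    also have "\<dots> \<le> sqrt (L2_sq M (\<lambda>\<omega>. complex_of_real (cmod (R \<omega>)))) * sqrt (L2_sq M (\<lambda>\<omega>. complex_of_real \<bar>W (u l - h) \<omega>\<bar>))"
    proof (rule order_trans[OF complex_Re_le_cmod L2_inner_bound_sqrt])
      show "(\<lambda>\<omega>. complex_of_real (cmod (R \<omega>))) \<in> L2_space M"
        using L2_spaceD(2)[OF R] by (intro L2_spaceI) auto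
      show "(\<lambda>\<omega>. complex_of_real \<bar>W (u l - h) \<omega>\<bar>) \<in> L2_space M"
        using L2_spaceD(2)[OF WL2[of "u l - h"]] by (intro L2_spaceI) auto
    qed
    also have "\<dots> = sqrt (L2_sq M R) * sqrt ((norm (u l - h))\<^sup>2 / 2)"
      using W_square[of "u l - h"] by (simp add: L2_sq_def)
    finally show ?thesis .
  qed
  have "(\<lambda>l. sqrt (L2_sq M R) * sqrt ((norm (u l - h))\<^sup>2 / 2)) \<longlonglongrightarrow> sqrt (L2_sq M R) * sqrt ((norm (h - h))\<^sup>2 / 2)"
    using u(2) by (intro tendsto_mult tendsto_const tendsto_real_sqrt tendsto_divide tendsto_power tendsto_norm tendsto_diff) auto
  then have "(\<lambda>l. sqrt (L2_sq M R) * sqrt ((norm (u l - h))\<^sup>2 / 2)) \<longlonglongrightarrow> 0" by simp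
  then have "cmod (\<integral>\<omega>. R \<omega> * iexp (W h \<omega>) \<partial>M) \<le> 0"
    by (rule LIMSEQ_le_const) (use le in blast)
  then show ?thesis by simp
qed

text \<open>The imaginary parts of Z agree with real parts only almost surely, hence they are listed separately among
  the variables generating the sigma algebra.\<close>

lemma orth_process_sigma:
  assumes F: "F \<in> L2_space M" "F \<in> borel_measurable (process_sigma M Z)"
  shows "(\<integral>\<omega>. R \<omega> * F \<omega> \<partial>M) = 0"
proof -
  define Y where "Y j \<omega> = (if snd j then Re (Z (fst j) \<omega>) else Im (Z (fst j) \<omega>))" for j :: "'h cplx \<times> bool" and \<omega>
  define N where "N = sigma (space M) (cylinders M Y UNIV)"
  have Y: "Y j \<in> borel_measurable M" for j unfolding Y_def[abs_def] by (cases "snd j") simp_all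
  have sub: "cylinders M Y UNIV \<subseteq> sets M" by (rule cylinders_measurable) (rule Y)
  have subP: "cylinders M Y UNIV \<subseteq> Pow (space M)" using sub sets.sets_into_space by blast
  have N: "space N = space M" "sets N = sigma_sets (space M) (cylinders M Y UNIV)"
    using subP by (simp_all add: N_def)
  have NM: "subalgebra M N"
    unfolding subalgebra_def N using sets.sigma_sets_subset[OF sub] by simp
  have YN: "Y j \<in> borel_measurable N" for j unfolding N_def by (rule cylinders_generator_measurable) simp
  have ZN: "Z h \<in> borel_measurable N" for h
  proof -
    have [measurable]: "Y (h, True) \<in> borel_measurable N" "Y (h, False) \<in> borel_measurable N" by (rule YN)+
    have "(\<lambda>\<omega>. complex_of_real (Y (h, True) \<omega>) + \<i> * complex_of_real (Y (h, False) \<omega>)) \<in> borel_measurable N"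
      by measurable
    moreover have "complex_of_real (Y (h, True) \<omega>) + \<i> * complex_of_real (Y (h, False) \<omega>) = Z h \<omega>" for \<omega>
      by (simp add: Y_def complex_eq_iff)
    ultimately show ?thesis by simp
  qed
  have gen: "(\<Union>h. {Z h -` A \<inter> space M |A. A \<in> sets borel}) \<subseteq> sets N"
    using measurable_sets[OF ZN] N(1) by auto
  have P: "space (process_sigma M Z) = space M"
    "sets (process_sigma M Z) = sigma_sets (space M) (\<Union>h. {Z h -` A \<inter> space M |A. A \<in> sets borel})"
    unfolding process_sigma_def by (intro space_measure_of sets_measure_of; blast)+
  have PN: "sets (process_sigma M Z) \<subseteq> sets N"
    unfolding P using sets.sigma_sets_subset[OF gen] N(1) by simp
  have FN: "F \<in> borel_measurable N"
    using F(2) PN unfolding measurable_def P(1) N(1) by blast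
  show ?thesis
  proof (rule orthogonal_subalgebra[OF NM R F(1) FN])
    fix E assume "E \<in> sets N"
    then have E: "E \<in> sigma_sets (space M) (cylinders M Y UNIV)" unfolding N .
    show "(\<integral>\<omega>. R \<omega> * indicator E \<omega> \<partial>M) = 0"
    proof (rule fourier_unique_sigma[OF L2_integrable[OF R] W_measurable W_linear subspace_UNIV orth_iexp Y _ E])
      fix j :: "'h cplx \<times> bool"
      show "\<exists>h\<in>UNIV. AE \<omega> in M. Y j \<omega> = W h \<omega>"
      proof (cases "snd j")
        case True
        then show ?thesis by (intro bexI[of _ "fst j"]) (simp_all add: Y_def W_def)
      next
        case False
        then show ?thesis using Im_Z[of "fst j"] by (intro bexI[of _ "(- \<i>) *\<^sub>C fst j"]) (simp_all add: Y_def)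
      qed
    qed
  qed
qed

end

section \<open>The chaos expansion\<close>

context
  fixes F :: "'w \<Rightarrow> complex" and f :: "nat \<Rightarrow> nat \<Rightarrow> 'h fock"
  assumes F: "F \<in> L2_space M"
    and f: "\<And>p q. f p q \<in> bisymmetric p q"
begin

definition chaos_sum :: "(nat \<times> nat) set \<Rightarrow> 'w \<Rightarrow> complex"
  where "chaos_sum A \<omega> = (\<Sum>(p, q)\<in>A. wiener_ito M Z B p q (f p q) \<omega>)"

lemmas integral_graph = wiener_ito_graph_wiener_ito[OF f]

lemma chaos_sum_L2: "chaos_sum A \<in> L2_space M"
  unfolding chaos_sum_def[abs_def] case_prod_unfold by (intro L2_sum graph_L2[OF integral_graph])

lemma L2_inner_chaos_sum:
  assumes "finite A" "U \<in> L2_space M"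
  shows "L2_inner M (chaos_sum A) U = (\<Sum>(p, q)\<in>A. L2_inner M (wiener_ito M Z B p q (f p q)) U)"
  unfolding chaos_sum_def[abs_def] case_prod_unfold
  by (intro L2_inner_sum_left graph_L2[OF integral_graph] assms)

lemma L2_inner_chaos_sum_HP:
  assumes "finite A" "xs \<in> words B p" "ys \<in> words B q"
  shows "L2_inner M (chaos_sum A) (HP xs ys)
    = (if (p, q) \<in> A then fact p * fact q * fock_eval (f p q) (xs @ map cconj ys) else 0)"
proof -
  have "L2_inner M (chaos_sum A) (HP xs ys) = (\<Sum>i\<in>A. if i = (p, q) then fact p * fact q * fock_eval (f p q) (xs @ map cconj ys) else 0)"
    unfolding L2_inner_chaos_sum[OF assms(1) HP_words_L2[OF assms(2,3)]]
  proof (intro sum.cong refl)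
    fix i :: "nat \<times> nat"
    obtain r s where i: "i = (r, s)" by force
    show "(case i of (p, q) \<Rightarrow> L2_inner M (wiener_ito M Z B p q (f p q)) (HP xs ys))
        = (if i = (p, q) then fact p * fact q * fock_eval (f p q) (xs @ map cconj ys) else 0)"
    proof (cases "(r, s) = (p, q)")
      case True
      then show ?thesis using graph_inner[OF integral_graph assms(2,3)] by (simp add: i)
    next
      case False
      then show ?thesis using graph_inner_neq[OF integral_graph assms(2,3) False] by (auto simp: i)
    qed
  qed
  then show ?thesis using assms(1) by simp
qed

text \<open>Once a finite set of indices contains (p, q), the pairing of its partial sum no longer
  changes, so the limit is read off directly.\<close>

lemma L2_inner_of_expansion:
  assumes "chaos_expansion M Z B F f" "xs \<in> words B p" "ys \<in> words B q"
  shows "L2_inner M F (HP xs ys) = fact p * fact q * fock_eval (f p q) (xs @ map cconj ys)"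
proof -
  have "L2_tendsto M chaos_sum F (finite_subsets_at_top UNIV)"
    using assms(1) by (simp add: chaos_expansion_def chaos_sum_def[abs_def])
  then have lim: "((\<lambda>A. L2_inner M (chaos_sum A) (HP xs ys)) \<longlongrightarrow> L2_inner M F (HP xs ys)) (finite_subsets_at_top UNIV)"
    by (intro L2_inner_tendsto F HP_words_L2[OF assms(2,3)] always_eventually allI chaos_sum_L2)
  have "\<forall>\<^sub>F A in finite_subsets_at_top UNIV. finite A \<and> {(p, q)} \<subseteq> A \<and> A \<subseteq> UNIV"
    unfolding eventually_finite_subsets_at_top by (intro exI[of _ "{(p, q)}"]) auto
  then have "\<forall>\<^sub>F A in finite_subsets_at_top UNIV. L2_inner M (chaos_sum A) (HP xs ys) = fact p * fact q * fock_eval (f p q) (xs @ map cconj ys)"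
    by eventually_elim (simp add: L2_inner_chaos_sum_HP[OF _ assms(2,3)])
  then have "((\<lambda>A. L2_inner M (chaos_sum A) (HP xs ys)) \<longlongrightarrow> fact p * fact q * fock_eval (f p q) (xs @ map cconj ys)) (finite_subsets_at_top UNIV)"
    by (rule tendsto_eventually)
  with lim show ?thesis by (rule tendsto_unique[rotated]) simp
qed

context
  assumes coeff: "\<And>p q xs ys. xs \<in> words B p \<Longrightarrow> ys \<in> words B q \<Longrightarrow>
    fact p * fact q * fock_eval (f p q) (xs @ map cconj ys) = L2_inner M F (HP xs ys)"
begin

definition remainder :: "(nat \<times> nat) set \<Rightarrow> 'w \<Rightarrow> complex"
  where "remainder A \<omega> = F \<omega> - chaos_sum A \<omega>"

lemma remainder_L2: "remainder A \<in> L2_space M"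
  unfolding remainder_def[abs_def] by (rule L2_diff[OF F chaos_sum_L2])

lemma L2_inner_remainder_HP:
  assumes "finite A" "(p, q) \<in> A" "xs \<in> words B p" "ys \<in> words B q"
  shows "L2_inner M (remainder A) (HP xs ys) = 0"
  unfolding remainder_def[abs_def] L2_inner_diff_left[OF F chaos_sum_L2 HP_words_L2[OF assms(3,4)]]
    L2_inner_chaos_sum_HP[OF assms(1,3,4)] using assms(2) coeff[OF assms(3,4)] by simp

lemma chaos_sum_orth_remainder:
  assumes A: "finite A" and "C \<subseteq> A"
  shows "L2_inner M (chaos_sum C) (remainder A) = 0"
  unfolding L2_inner_chaos_sum[OF finite_subset[OF assms(2,1)] remainder_L2]
proof (intro sum.neutral ballI, clarify)
  fix p q assume "(p, q) \<in> C"
  then have pq: "(p, q) \<in> A" using assms(2) by blast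
  show "L2_inner M (wiener_ito M Z B p q (f p q)) (remainder A) = 0"
  proof (rule graph_orth[OF integral_graph remainder_L2])
    fix us vs assume "us \<in> words B p" "vs \<in> words B q"
    from L2_inner_remainder_HP[OF A pq this] show "L2_inner M (HP us vs) (remainder A) = 0"
      using L2_inner_commute[of M "HP us vs" "remainder A"] by simp
  qed
qed

text \<open>Pythagoras: the remainder over A is orthogonal to all partial sums over subsets of A.
  Enlarging the index set therefore never increases the remainder, which later controls arbitrary
  finite sets.\<close>

lemma L2_sq_remainder:
  assumes A: "finite A" and CA: "C \<subseteq> A"
  shows "L2_sq M (remainder C) = L2_sq M (remainder A) + L2_sq M (\<lambda>\<omega>. chaos_sum A \<omega> - chaos_sum C \<omega>)"
proof -
  define D where "D = (\<lambda>\<omega>. chaos_sum C \<omega> - chaos_sum A \<omega>)"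
  have D: "D \<in> L2_space M" unfolding D_def by (rule L2_diff[OF chaos_sum_L2 chaos_sum_L2])
  have "L2_inner M D (remainder A) = 0"
    unfolding D_def L2_inner_diff_left[OF chaos_sum_L2 chaos_sum_L2 remainder_L2]
    using chaos_sum_orth_remainder[OF A CA] chaos_sum_orth_remainder[OF A subset_refl] by simp
  then have o: "L2_inner M (remainder A) D = 0" using L2_inner_commute[of M "remainder A" D] by simp
  have eq: "remainder C = (\<lambda>\<omega>. remainder A \<omega> - D \<omega>)"
    by (rule ext) (simp add: remainder_def D_def)
  show ?thesis
    unfolding eq L2_sq_diff[OF remainder_L2 D] o unfolding D_def L2_sq_commute[of M "chaos_sum C" "chaos_sum A"] by simp
qed

text \<open>The partial sums over squares converge to some Y. The difference R = F - Y is orthogonal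
  to every Hermite product, hence to Y as a limit of integrals and to F by totality, so it is
  orthogonal to itself.\<close>

lemma chaos_expansion_of_coefficients:
  assumes FP: "F \<in> borel_measurable (process_sigma M Z)"
  shows "chaos_expansion M Z B F f"
proof -
  \<comment> \<open>Completeness is available for sequences, so the net of finite sets is first
    replaced by a cofinal sequence of squares.\<close>
  define A where "A N = {..N} \<times> {..N}" for N :: nat
  have fin: "finite (A N)" for N by (simp add: A_def)
  have mono: "A k \<subseteq> A l" if "k \<le> l" for k l using that by (auto simp: A_def)
  define d where "d N = L2_sq M (remainder (A N))" for N
  have dd: "L2_sq M (\<lambda>\<omega>. chaos_sum (A l) \<omega> - chaos_sum (A k) \<omega>) = d k - d l" if "k \<le> l" for k l
    using L2_sq_remainder[OF fin mono[OF that]] by (simp add: d_def)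
  have "decseq d"
    unfolding decseq_def using dd L2_sq_nonneg by (metis diff_ge_0_iff_ge)
  then have "convergent d"
    by (rule decseq_convergent[of d 0]) (auto simp: d_def convergent_def)
  then have Cd: "Cauchy d" by (rule convergent_Cauchy)
  have "\<exists>Y\<in>L2_space M. L2_tendsto M (\<lambda>N. chaos_sum (A N)) Y sequentially"
  proof (rule L2_complete[OF chaos_sum_L2])
    fix e :: real assume e: "e > 0"
    obtain N where N: "\<And>m n. m \<ge> N \<Longrightarrow> n \<ge> N \<Longrightarrow> norm (d m - d n) < e"
      using CauchyD[OF Cd e] by blast
    have lt: "L2_sq M (\<lambda>\<omega>. chaos_sum (A l) \<omega> - chaos_sum (A k) \<omega>) < e" if "N \<le> k" "k \<le> l" for k l
      unfolding dd[OF that(2)] using N[of k l] that unfolding real_norm_def by linarith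
    have "L2_sq M (\<lambda>\<omega>. chaos_sum (A m) \<omega> - chaos_sum (A n) \<omega>) < e" if "N \<le> m" "N \<le> n" for m n
      using lt[of n m] lt[of m n] that L2_sq_commute[of M "chaos_sum (A m)" "chaos_sum (A n)"] by (cases "n \<le> m") auto
    then show "\<exists>N. \<forall>m\<ge>N. \<forall>n\<ge>N. L2_sq M (\<lambda>\<omega>. chaos_sum (A m) \<omega> - chaos_sum (A n) \<omega>) < e" by blast
  qed
  then obtain Y where Y: "Y \<in> L2_space M" and lim: "L2_tendsto M (\<lambda>N. chaos_sum (A N)) Y sequentially" by blast
  define R where "R = (\<lambda>\<omega>. F \<omega> - Y \<omega>)"
  have R: "R \<in> L2_space M" unfolding R_def by (rule L2_diff[OF F Y])
  have limY: "(\<lambda>N. L2_inner M (chaos_sum (A N)) U) \<longlonglongrightarrow> L2_inner M Y U" if "U \<in> L2_space M" for U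
    by (intro L2_inner_tendsto[OF _ Y that lim] always_eventually allI chaos_sum_L2)
  have R_HP: "L2_inner M R (HP xs ys) = 0" if xs: "xs \<in> words B p" "ys \<in> words B q" for xs ys p q
  proof -
    have "\<forall>\<^sub>F N in sequentially. (p, q) \<in> A N"
      using eventually_ge_at_top[of "max p q"] by eventually_elim (auto simp: A_def)
    then have "\<forall>\<^sub>F N in sequentially. L2_inner M (chaos_sum (A N)) (HP xs ys) = L2_inner M F (HP xs ys)"
      by eventually_elim (simp add: L2_inner_chaos_sum_HP[OF fin xs] coeff[OF xs])
    then have "(\<lambda>N. L2_inner M (chaos_sum (A N)) (HP xs ys)) \<longlonglongrightarrow> L2_inner M F (HP xs ys)"
      by (rule tendsto_eventually)
    then have "L2_inner M Y (HP xs ys) = L2_inner M F (HP xs ys)"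
      using limY[OF HP_words_L2[OF xs]] LIMSEQ_unique by blast
    then show ?thesis unfolding R_def L2_inner_diff_left[OF F Y HP_words_L2[OF xs]] by simp
  qed
  have "L2_inner M Y R = 0"
  proof (rule LIMSEQ_unique[OF limY[OF R]])
    have "L2_inner M (chaos_sum (A N)) R = 0" for N
      unfolding L2_inner_chaos_sum[OF fin R]
    proof (intro sum.neutral ballI, clarify)
      fix p q
      show "L2_inner M (wiener_ito M Z B p q (f p q)) R = 0"
        using R_HP L2_inner_commute[of M _ R] by (intro graph_orth[OF integral_graph R]) simp
    qed
    then show "(\<lambda>N. L2_inner M (chaos_sum (A N)) R) \<longlonglongrightarrow> 0" by simp
  qed
  moreover have "L2_inner M F R = 0"
  proof -
    \<comment> \<open>\<open>orth_process_sigma\<close> concerns the product without conjugation and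
      is therefore applied to \<open>cnj F\<close>.\<close>
    have "(\<integral>\<omega>. R \<omega> * cnj (F \<omega>) \<partial>M) = 0"
    proof (rule orth_process_sigma[OF R])
      show "L2_inner M R (HP xs ys) = 0" if "set xs \<subseteq> B" "set ys \<subseteq> B" for xs ys
        using that by (intro R_HP[of xs "length xs" ys "length ys"]) (simp_all add: words_def)
      show "(\<lambda>\<omega>. cnj (F \<omega>)) \<in> L2_space M" by (rule L2_cnj[OF F])
      show "(\<lambda>\<omega>. cnj (F \<omega>)) \<in> borel_measurable (process_sigma M Z)" using FP by measurable
    qed
    then show ?thesis using L2_inner_commute[of M F R] by (simp add: L2_inner_def)
  qed
  ultimately have "L2_inner M R R = 0"
    using L2_inner_diff_left[OF F Y R] by (simp add: R_def)
  then have R0: "L2_sq M R = 0" by (simp add: L2_inner_self)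
  have "L2_tendsto M (\<lambda>N. remainder (A N)) R sequentially"
    using lim unfolding L2_tendsto_def remainder_def R_def by (simp add: norm_minus_commute)
  then have d0: "d \<longlonglongrightarrow> 0"
    using L2_sq_tendsto[OF remainder_L2 R] unfolding R0 d_def[abs_def] by blast
  \<comment> \<open>Any finite set containing the square A N has a remainder at most d N, which
    lifts convergence from the sequence to the net.\<close>
  have "((\<lambda>A. L2_sq M (\<lambda>\<omega>. chaos_sum A \<omega> - F \<omega>)) \<longlongrightarrow> 0) (finite_subsets_at_top UNIV)"
  proof (rule tendstoI)
    fix e :: real assume e: "e > 0"
    obtain N where N: "d N < e" using order_tendstoD(2)[OF d0 e] eventually_happens'[OF sequentially_bot] by blast
    have "\<forall>\<^sub>F C in finite_subsets_at_top UNIV. finite C \<and> A N \<subseteq> C \<and> C \<subseteq> UNIV"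
      using fin unfolding eventually_finite_subsets_at_top by (intro exI[of _ "A N"]) auto
    then show "\<forall>\<^sub>F C in finite_subsets_at_top UNIV. dist (L2_sq M (\<lambda>\<omega>. chaos_sum C \<omega> - F \<omega>)) 0 < e"
    proof eventually_elim
      case (elim C)
      have "L2_sq M (remainder C) \<le> d N"
        using L2_sq_remainder[of C "A N"] elim by (simp add: d_def)
      moreover have "L2_sq M (\<lambda>\<omega>. chaos_sum C \<omega> - F \<omega>) = L2_sq M (remainder C)"
        unfolding remainder_def[abs_def] by (rule L2_sq_commute)
      ultimately show ?case using N by simp
    qed
  qed
  then have "L2_tendsto M chaos_sum F (finite_subsets_at_top UNIV)"
    using L2_tendsto_iff[of chaos_sum M "finite_subsets_at_top UNIV" F] chaos_sum_L2 F by simp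
  then show ?thesis using f by (simp add: chaos_expansion_def chaos_sum_def[abs_def])
qed

end

end

lemma chaos_expansion_exists:
  assumes F: "F \<in> L2_space M" "F \<in> borel_measurable (process_sigma M Z)"
  shows "\<exists>f. chaos_expansion M Z B F f"
proof -
  have "\<exists>f. f \<in> bisymmetric p q \<and> (\<forall>xs\<in>words B p. \<forall>ys\<in>words B q.
      fact p * fact q * fock_eval f (xs @ map cconj ys) = L2_inner M F (HP xs ys))" for p q
    by (rule projection_exists[OF F(1), of p q]) blast
  then obtain f where f: "\<And>p q. f p q \<in> bisymmetric p q"
    "\<And>p q xs ys. xs \<in> words B p \<Longrightarrow> ys \<in> words B q \<Longrightarrow>
      fact p * fact q * fock_eval (f p q) (xs @ map cconj ys) = L2_inner M F (HP xs ys)"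
    by metis
  show ?thesis using chaos_expansion_of_coefficients[OF F(1) f F(2)] by blast
qed

lemma stroock_formula:
  assumes F: "F \<in> L2_space M" and exp: "chaos_expansion M Z B F f"
    and sob: "F \<in> sobolev_space M Z m n" and "p \<le> m" "q \<le> n"
  shows "f p q = (1 / (fact p * fact q)) *\<^sub>R expectation (malliavin M Z p q F)"
proof (rule fock_eq_on_basis[OF basis])
  have f: "f p q \<in> bisymmetric p q" for p q using exp by (simp add: chaos_expansion_def)
  note graph = sobolev_malliavin_graph[OF sob assms(4,5)]
  show "fock_eval (f p q) zs = fock_eval ((1 / (fact p * fact q)) *\<^sub>R expectation (malliavin M Z p q F)) zs"
    if "length zs \<noteq> p + q" for zs
    using bisymmetricD(1)[OF f that] malliavin_graph_mean(2)[OF graph that] by simp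
  show "fock_eval (f p q) (xs @ map cconj ys)
      = fock_eval ((1 / (fact p * fact q)) *\<^sub>R expectation (malliavin M Z p q F)) (xs @ map cconj ys)"
    if "xs \<in> words B p" "ys \<in> words B q" for xs ys
    using L2_inner_of_expansion[OF F f exp that] malliavin_graph_mean(1)[OF graph that] by simp
qed

end

theorem theorem2p8:
  fixes M :: "'w measure"
    and Z :: "'h::{real_inner, complete_space, second_countable_topology} cplx \<Rightarrow> 'w \<Rightarrow> complex"
    and B :: "'h cplx set"
    and F :: "'w \<Rightarrow> complex"
  assumes "complex_isonormal M Z"
    and "orthonormal_basis B"
    and "F \<in> L2_space M" and "F \<in> borel_measurable (process_sigma M Z)"
  shows "(\<exists>f. chaos_expansion M Z B F f) \<and>
    (\<forall>f m n. chaos_expansion M Z B F f \<and> F \<in> sobolev_space M Z m n \<longrightarrow>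
      (\<forall>p\<le>m. \<forall>q\<le>n. f p q = (1 / (fact p * fact q)) *\<^sub>R (\<integral>\<omega>. malliavin M Z p q F \<omega> \<partial>M)))"
proof -
  interpret isonormal_basis M Z B
    using assms(1,2) by (simp add: isonormal_basis_def isonormal_basis_axioms_def)
  show ?thesis using chaos_expansion_exists[OF assms(3,4)] stroock_formula[OF assms(3)] by blast
qed

end
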